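(* Let $n,k\in\mathbb{N}$, let $(n_1,\dots,n_k)\in\mathbb{N}^k$ with $n=n_1+\cdots+n_k$, and let $G=U_{n_1}\times\cdots\times U_{n_k}$, viewed as the group of block diagonal matrices in $U_n$. Then the set of all $k$-quasi-radial Toeplitz operators on the Bergman space $\mathcal{A}^2(\mathbb{B}^n)$ is (norm) dense in the quasi-radial Toeplitz algebra $\mathfrak{T}^{qrad}(L^\infty)$; moreover $$\mathfrak{T}^{qrad}(L^\infty)=\mathfrak{T}(L^\infty)\cap \mathfrak{L}(\mathcal{A}^2(\mathbb{B}^n))^{qrad}=\overline{\{T_a\mid a\in L^\infty(\mathbb{B}^n),\ T_a\in \mathfrak{L}(\mathcal{A}^2(\mathbb{B}^n))^{qrad}\}},$$ where the closure is in operator norm.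
   Context: $\mathbb{B}^n$ is the open unit ball in $\mathbb{C}^n$ with normalized volume measure $dV$; the Bergman space $\mathcal{A}^2(\mathbb{B}^n)$ is the closed subspace of holomorphic functions in $L^2(\mathbb{B}^n,dV)$, and $\mathfrak{L}(\mathcal{A}^2(\mathbb{B}^n))$ is the algebra of bounded operators on it. For $a\in L^\infty(\mathbb{B}^n)$, $T_af=P(af)$, where $P$ is the orthogonal projection $L^2(\mathbb{B}^n,dV)\to\mathcal{A}^2(\mathbb{B}^n)$. $\mathfrak{T}(L^\infty)$ is the norm closed subalgebra of $\mathfrak{L}(\mathcal{A}^2(\mathbb{B}^n))$ generated by all $T_a$, $a\in L^\infty(\mathbb{B}^n)$. $U_m$ denotes the group of $m\times m$ unitary matrices. $G$ acts unitarily on $\mathcal{A}^2(\mathbb{B}^n)$ by $(\pi_G(A)f)(z)=f(A^{-1}z)$. $\mathfrak{L}(\mathcal{A}^2(\mathbb{B}^n))^{qrad}$ is the algebra of ($k$-)quasi-radial operators, i.e. of all bounded $S$ with $\pi_G(A)S\pi_G(A)^*=S$ for all $A\in G$. A $k$-quasi-radial Toeplitz operator is a Toeplitz operator $T_a$, $a\in L^\infty(\mathbb{B}^n)$, which is a quasi-radial operator. $\mathfrak{T}^{qrad}(L^\infty)$ is the norm closed subalgebra of $\mathfrak{L}(\mathcal{A}^2(\mathbb{B}^n))$ generated by all $k$-quasi-radial Toeplitz operators. *)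

theory Defs
  imports "HOL-Analysis.Analysis"
begin

definition dV :: "(complex^'n::finite) measure" where
  "dV = uniform_measure lborel (ball 0 1)"

text \<open>Holomorphic functions of several variables on an open set: the real Frechet derivative
  exists at each point and is complex linear.\<close>

definition holomorphic_Cn_on :: "(complex^'n::finite \<Rightarrow> complex) \<Rightarrow> (complex^'n) set \<Rightarrow> bool"
    (infixl \<open>holomorphic'_Cn'_on\<close> 50) where
  "f holomorphic_Cn_on S \<longleftrightarrow>
     (\<forall>z\<in>S. \<exists>D. (f has_derivative D) (at z) \<and> (\<forall>c v. D (c *s v) = c * D v))"

definition L2 :: "(complex^'n::finite \<Rightarrow> complex) set" where
  "L2 = {f. f \<in> borel_measurable dV \<and> integrable dV (\<lambda>z. (norm (f z))\<^sup>2)}"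

definition Linf :: "(complex^'n::finite \<Rightarrow> complex) set" where
  "Linf = {a. a \<in> borel_measurable dV \<and> (\<exists>C. AE z in dV. norm (a z) \<le> C)}"

lemma L2_zero: "(\<lambda>z. 0) \<in> L2"
  by (simp add: L2_def)

lemma L2_scale: "f \<in> L2 \<Longrightarrow> (\<lambda>z. c * f z) \<in> L2"
  by (auto simp: L2_def norm_mult power_mult_distrib)

lemma L2_add:
  assumes "f \<in> L2" "g \<in> L2"
  shows "(\<lambda>z. f z + g z) \<in> L2"
proof -
  have [measurable]: "f \<in> borel_measurable dV" "g \<in> borel_measurable dV"
    using assms by (auto simp: L2_def)
  have bd: "(norm (x + y))\<^sup>2 \<le> 2 * (norm x)\<^sup>2 + 2 * (norm y)\<^sup>2" for x y :: complex
  proof -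
    have "(norm (x + y))\<^sup>2 \<le> (norm x + norm y)\<^sup>2"
      by (intro power_mono norm_triangle_ineq) auto
    also have "\<dots> \<le> 2 * (norm x)\<^sup>2 + 2 * (norm y)\<^sup>2"
      using sum_squares_bound[of "norm x" "norm y"] by (simp add: power2_sum)
    finally show ?thesis .
  qed
  have "integrable dV (\<lambda>z. 2 * (norm (f z))\<^sup>2 + 2 * (norm (g z))\<^sup>2)"
    using assms by (auto simp: L2_def)
  then have "integrable dV (\<lambda>z. (norm (f z + g z))\<^sup>2)"
    by (rule Bochner_Integration.integrable_bound) (use bd in auto)
  then show ?thesis by (simp add: L2_def)
qed

lemma L2_integrable:
  assumes "f \<in> L2" "g \<in> L2"
  shows "integrable dV (\<lambda>z. f z * cnj (g z))"
proof -
  have [measurable]: "f \<in> borel_measurable dV" "g \<in> borel_measurable dV"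
    using assms by (auto simp: L2_def)
  have [measurable]: "(\<lambda>z. cnj (g z)) \<in> borel_measurable dV"
    by (rule borel_measurable_continuous_on[where f = cnj]) (auto intro: continuous_intros)
  have bd: "norm (x * cnj y) \<le> (norm x)\<^sup>2 + (norm y)\<^sup>2" for x y :: complex
  proof -
    have "0 \<le> norm x * norm y" by simp
    then show ?thesis
      using sum_squares_bound[of "norm x" "norm y"]
      unfolding norm_mult complex_mod_cnj by linarith
  qed
  have "integrable dV (\<lambda>z. (norm (f z))\<^sup>2 + (norm (g z))\<^sup>2)"
    using assms by (auto simp: L2_def)
  then show ?thesis
    by (rule Bochner_Integration.integrable_bound) (use bd in auto)
qed

lemma holomorphic_Cn_on_add:
  assumes "f holomorphic_Cn_on S" "g holomorphic_Cn_on S"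
  shows "(\<lambda>z. f z + g z) holomorphic_Cn_on S"
  unfolding holomorphic_Cn_on_def
proof
  fix z assume "z \<in> S"
  then obtain D E where "(f has_derivative D) (at z)" "\<forall>c v. D (c *s v) = c * D v"
    "(g has_derivative E) (at z)" "\<forall>c v. E (c *s v) = c * E v"
    using assms unfolding holomorphic_Cn_on_def by blast
  then show "\<exists>D. ((\<lambda>z. f z + g z) has_derivative D) (at z) \<and> (\<forall>c v. D (c *s v) = c * D v)"
    by (intro exI[of _ "\<lambda>v. D v + E v"]) (auto intro!: derivative_intros simp: algebra_simps)
qed

lemma holomorphic_Cn_on_scale:
  assumes "f holomorphic_Cn_on S"
  shows "(\<lambda>z. a * f z) holomorphic_Cn_on S"
  unfolding holomorphic_Cn_on_def
proof
  fix z assume "z \<in> S"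
  then obtain D where "(f has_derivative D) (at z)" "\<forall>c v. D (c *s v) = c * D v"
    using assms unfolding holomorphic_Cn_on_def by blast
  then show "\<exists>D. ((\<lambda>z. a * f z) has_derivative D) (at z) \<and> (\<forall>c v. D (c *s v) = c * D v)"
    by (intro exI[of _ "\<lambda>v. a * D v"]) (auto intro!: derivative_intros simp: algebra_simps)
qed

lemma holomorphic_Cn_on_imp_continuous_on:
  assumes "f holomorphic_Cn_on S"
  shows "continuous_on S f"
  using assms unfolding holomorphic_Cn_on_def
  by (meson continuous_at_imp_continuous_on has_derivative_continuous)

text \<open>Members of the Bergman space are functions on the ball; they are represented by their
  extension by zero to the whole of \<open>\<complex>\<^sup>n\<close>, so that equality is equality on the ball.\<close>

typedef (overloaded) ('n::finite) bergman =
    "{f :: complex^'n \<Rightarrow> complex. f holomorphic_Cn_on ball 0 1 \<and> f \<in> L2 \<and> (\<forall>z. z \<notin> ball 0 1 \<longrightarrow> f z = 0)}"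
  morphisms bergman_fun Bergman
proof
  show "(\<lambda>z. 0) \<in> {f :: complex^'n \<Rightarrow> complex. f holomorphic_Cn_on ball 0 1 \<and> f \<in> L2 \<and> (\<forall>z. z \<notin> ball 0 1 \<longrightarrow> f z = 0)}"
    by (auto simp: L2_zero holomorphic_Cn_on_def intro!: exI[of _ "\<lambda>v. 0"])
qed

setup_lifting type_definition_bergman

lift_definition cscale :: "complex \<Rightarrow> 'n::finite bergman \<Rightarrow> 'n bergman" is "\<lambda>c f z. c * f z"
  by (auto intro: holomorphic_Cn_on_scale L2_scale)

definition cinner :: "'n::finite bergman \<Rightarrow> 'n bergman \<Rightarrow> complex" where
  "cinner f g = (\<integral>z. bergman_fun f z * cnj (bergman_fun g z) \<partial>dV)"

lemma bergman_L2: "bergman_fun f \<in> L2"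
  using bergman_fun[of f] by simp

lemma bergman_integrable:
  "integrable dV (\<lambda>z. bergman_fun f z * cnj (bergman_fun g z))"
  by (intro L2_integrable bergman_L2)

lemma cinner_self: "cinner f f = of_real (\<integral>z. (norm (bergman_fun f z))\<^sup>2 \<partial>dV)"
  unfolding cinner_def integral_complex_of_real[symmetric]
  by (intro Bochner_Integration.integral_cong refl) (simp add: complex_norm_square[symmetric])

instantiation bergman :: (finite) real_inner
begin

lift_definition zero_bergman :: "'a bergman" is "\<lambda>z. 0"
  by (auto simp: L2_zero holomorphic_Cn_on_def intro!: exI[of _ "\<lambda>v. 0"])

lift_definition plus_bergman :: "'a bergman \<Rightarrow> 'a bergman \<Rightarrow> 'a bergman" is "\<lambda>f g z. f z + g z"
  by (auto intro: holomorphic_Cn_on_add L2_add)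

lift_definition uminus_bergman :: "'a bergman \<Rightarrow> 'a bergman" is "\<lambda>f z. - f z"
  using holomorphic_Cn_on_scale[where a = "-1"] L2_scale[where c = "-1"] by auto

definition minus_bergman :: "'a bergman \<Rightarrow> 'a bergman \<Rightarrow> 'a bergman" where
  "minus_bergman f g = f + - g"

definition scaleR_bergman :: "real \<Rightarrow> 'a bergman \<Rightarrow> 'a bergman" where
  "scaleR_bergman r f = cscale (of_real r) f"

definition inner_bergman :: "'a bergman \<Rightarrow> 'a bergman \<Rightarrow> real" where
  "inner_bergman f g = Re (cinner f g)"

definition norm_bergman :: "'a bergman \<Rightarrow> real" where
  "norm_bergman f = sqrt (inner f f)"

definition sgn_bergman :: "'a bergman \<Rightarrow> 'a bergman" where
  "sgn_bergman f = scaleR (inverse (norm f)) f"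

definition dist_bergman :: "'a bergman \<Rightarrow> 'a bergman \<Rightarrow> real" where
  "dist_bergman f g = norm (f - g)"

definition uniformity_bergman :: "('a bergman \<times> 'a bergman) filter" where
  "uniformity_bergman = (INF e\<in>{0<..}. principal {(x, y). dist x y < e})"

definition open_bergman :: "'a bergman set \<Rightarrow> bool" where
  "open_bergman U \<longleftrightarrow> (\<forall>x\<in>U. eventually (\<lambda>(x', y). x' = x \<longrightarrow> y \<in> U) uniformity)"

instance
proof
  fix f g h :: "'a bergman" and r s :: real and U :: "'a bergman set"
  show "f + g + h = f + (g + h)" by transfer (simp add: add.assoc)
  show "f + g = g + f" by transfer (simp add: add.commute)
  show "0 + f = f" by transfer simp
  show "- f + f = 0" by transfer simp
  show "f - g = f + - g" by (rule minus_bergman_def)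
  show "r *\<^sub>R (f + g) = r *\<^sub>R f + r *\<^sub>R g"
    unfolding scaleR_bergman_def by transfer (simp add: algebra_simps)
  show "(r + s) *\<^sub>R f = r *\<^sub>R f + s *\<^sub>R f"
    unfolding scaleR_bergman_def by transfer (simp add: algebra_simps)
  show "r *\<^sub>R s *\<^sub>R f = (r * s) *\<^sub>R f"
    unfolding scaleR_bergman_def by transfer (simp add: algebra_simps)
  show "1 *\<^sub>R f = f" unfolding scaleR_bergman_def by transfer simp
  show "sgn f = scaleR (inverse (norm f)) f" by (rule sgn_bergman_def)
  show "dist f g = norm (f - g)" by (rule dist_bergman_def)
  show "uniformity = (INF e\<in>{0<..}. principal {(x :: 'a bergman, y). dist x y < e})"
    by (rule uniformity_bergman_def)
  show "open U \<longleftrightarrow> (\<forall>x\<in>U. eventually (\<lambda>(x', y). x' = x \<longrightarrow> y \<in> U) uniformity)"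
    by (rule open_bergman_def)
  show "norm f = sqrt (inner f f)" by (rule norm_bergman_def)
  have "cinner f g = cnj (cinner g f)"
    unfolding cinner_def Bochner_Integration.integral_cnj[symmetric] by (simp add: mult.commute)
  then show "inner f g = inner g f" by (simp add: inner_bergman_def)
  have "cinner (f + g) h = cinner f h + cinner g h"
    unfolding cinner_def plus_bergman.rep_eq distrib_right
    by (intro Bochner_Integration.integral_add bergman_integrable)
  then show "inner (f + g) h = inner f h + inner g h" by (simp add: inner_bergman_def)
  have "cinner (r *\<^sub>R f) g = of_real r * cinner f g"
    unfolding cinner_def scaleR_bergman_def cscale.rep_eq mult.assoc by simp
  then show "inner (r *\<^sub>R f) g = r * inner f g" by (simp add: inner_bergman_def)
  have ff: "inner f f = (\<integral>z. (norm (bergman_fun f z))\<^sup>2 \<partial>dV)"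
    by (simp add: inner_bergman_def cinner_self)
  then show "0 \<le> inner f f" by simp
  show "inner f f = 0 \<longleftrightarrow> f = 0"
  proof
    assume "f = 0"
    then show "inner f f = 0" unfolding ff by (simp add: zero_bergman.rep_eq)
  next
    assume "inner f f = 0"
    moreover have "integrable dV (\<lambda>z. (norm (bergman_fun f z))\<^sup>2)"
      using bergman_L2[of f] by (simp add: L2_def)
    ultimately have "AE z in dV. (norm (bergman_fun f z))\<^sup>2 = 0"
      unfolding ff by (subst (asm) integral_nonneg_eq_0_iff_AE) auto
    moreover have "emeasure lborel (ball 0 1 :: (complex^'a) set) \<noteq> 0"
      using content_ball_pos[of 1 "0 :: complex^'a"] by (auto simp: measure_def)
    moreover have "emeasure lborel (ball 0 1 :: (complex^'a) set) < \<infinity>"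
      by (rule emeasure_lborel_ball_finite)
    ultimately have ae: "AE z in lborel. z \<in> ball 0 1 \<longrightarrow> bergman_fun f z = 0"
      unfolding dV_def by (subst (asm) AE_uniform_measure) auto
    let ?U = "{z \<in> ball 0 1. bergman_fun f z \<noteq> 0}"
    have "continuous_on (ball 0 1) (bergman_fun f)"
      using bergman_fun[of f] by (auto intro: holomorphic_Cn_on_imp_continuous_on)
    then have "open (ball 0 1 \<inter> bergman_fun f -` (- {0}))"
      by (intro continuous_open_preimage) auto
    moreover have "ball 0 1 \<inter> bergman_fun f -` (- {0}) = ?U" by auto
    ultimately have op: "open ?U" by simp
    have "?U \<in> null_sets lborel"
      using ae op by (subst AE_iff_null_sets) (auto elim: eventually_mono)
    then have "negligible ?U"
      using negligible_iff_null_sets null_sets_completionI by blast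
    then have "?U = {}" using open_not_negligible[OF op] by blast
    then have "bergman_fun f z = 0" for z
      using bergman_fun[of f] by (cases "z \<in> ball 0 1") auto
    then show "f = 0" by transfer auto
  qed
qed

end

text \<open>The orthogonal projection of \<open>g \<in> L2\<close>; as members of \<open>L2\<close> are functions rather than classes
  modulo null sets, it is specified by orthogonality of \<open>g - P g\<close> to the Bergman space.\<close>

definition bergman_proj :: "(complex^'n::finite \<Rightarrow> complex) \<Rightarrow> 'n bergman" where
  "bergman_proj g = (THE f. \<forall>h. (\<integral>z. (g z - bergman_fun f z) * cnj (bergman_fun h z) \<partial>dV) = 0)"

text \<open>The type \<open>\<Rightarrow>\<^sub>L\<close> consists of real-linear maps, hence the restriction to complex-linear ones.\<close>

definition bounded_ops :: "('n::finite bergman \<Rightarrow>\<^sub>L 'n bergman) set" where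
  "bounded_ops = {S. \<forall>c f. blinfun_apply S (cscale c f) = cscale c (blinfun_apply S f)}"

lemma norm_cscale: "norm (cscale c f) = norm c * norm f"
proof -
  have "inner (cscale c f) (cscale c f) = (norm c)\<^sup>2 * inner f f"
    by (simp add: inner_bergman_def cinner_self cscale.rep_eq norm_mult power_mult_distrib)
  then show ?thesis
    by (simp add: norm_bergman_def real_sqrt_mult)
qed

lemma bounded_linear_cscale: "bounded_linear (cscale c :: _ \<Rightarrow> 'n::finite bergman)"
proof (rule bounded_linear_intro[where K = "norm c"])
  fix f g :: "'n bergman" and r :: real
  show "cscale c (f + g) = cscale c f + cscale c g" by transfer (simp add: algebra_simps)
  show "cscale c (r *\<^sub>R f) = r *\<^sub>R cscale c f"
    unfolding scaleR_bergman_def by transfer (simp add: algebra_simps)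
  show "norm (cscale c f) \<le> norm f * norm c" by (simp add: norm_cscale)
qed

definition cscale_op ::
    "complex \<Rightarrow> ('n::finite bergman \<Rightarrow>\<^sub>L 'n bergman) \<Rightarrow> ('n bergman \<Rightarrow>\<^sub>L 'n bergman)" where
  "cscale_op c S = Blinfun (\<lambda>f. cscale c (blinfun_apply S f))"

lemma cscale_op_apply: "blinfun_apply (cscale_op c S) f = cscale c (blinfun_apply S f)"
  unfolding cscale_op_def
  by (simp add: bounded_linear_Blinfun_apply
      bounded_linear_compose[OF bounded_linear_cscale blinfun.bounded_linear_right])

text \<open>The descriptions \<open>THE\<close> in \<open>bergman_proj\<close> and \<open>adj\<close>, and the use of \<open>Blinfun\<close> in \<open>toeplitz\<close>,
  are meaningful because the Bergman space is complete; \<open>rep_pi\<close> is meaningful for unitary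
  matrices, as these preserve the ball and its volume.\<close>

definition adj :: "('n::finite bergman \<Rightarrow>\<^sub>L 'n bergman) \<Rightarrow> ('n bergman \<Rightarrow>\<^sub>L 'n bergman)" where
  "adj S = (THE R. \<forall>f g. cinner (blinfun_apply S f) g = cinner f (blinfun_apply R g))"

definition closed_subalgebra :: "('n::finite bergman \<Rightarrow>\<^sub>L 'n bergman) set \<Rightarrow> bool" where
  "closed_subalgebra A \<longleftrightarrow> A \<subseteq> bounded_ops \<and> closed A \<and> 0 \<in> A \<and>
     (\<forall>S\<in>A. \<forall>T\<in>A. S + T \<in> A \<and> S o\<^sub>L T \<in> A) \<and> (\<forall>c. \<forall>S\<in>A. cscale_op c S \<in> A)"

definition toeplitz :: "(complex^'n::finite \<Rightarrow> complex) \<Rightarrow> ('n bergman \<Rightarrow>\<^sub>L 'n bergman)" where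
  "toeplitz a = Blinfun (\<lambda>f. bergman_proj (\<lambda>z. a z * bergman_fun f z))"

definition toeplitz_algebra :: "('n::finite bergman \<Rightarrow>\<^sub>L 'n bergman) set" where
  "toeplitz_algebra = closed_subalgebra hull (toeplitz ` Linf)"

definition unitary :: "complex^'n^'n::finite \<Rightarrow> bool" where
  "unitary A \<longleftrightarrow> map_matrix cnj (transpose A) ** A = mat 1 \<and>
     A ** map_matrix cnj (transpose A) = mat 1"

text \<open>Positions \<open>0, \<dots>, n - 1\<close> are cut into consecutive blocks of lengths \<open>ns ! 0, ns ! 1, \<dots>\<close>.\<close>

definition same_block :: "nat list \<Rightarrow> nat \<Rightarrow> nat \<Rightarrow> bool" where
  "same_block ns p q \<longleftrightarrow> (\<exists>j<length ns.
     {p, q} \<subseteq> {sum_list (take j ns)..<sum_list (take (Suc j) ns)})"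

text \<open>The coordinates of \<open>\<complex>\<^sup>n\<close> are indexed by a type \<open>'n\<close>; \<open>e\<close> numbers them from \<open>0\<close>.\<close>

definition block_unitaries :: "('n::finite \<Rightarrow> nat) \<Rightarrow> nat list \<Rightarrow> (complex^'n^'n) set" where
  "block_unitaries e ns =
     {A. unitary A \<and> (\<forall>i j. \<not> same_block ns (e i) (e j) \<longrightarrow> A $ i $ j = 0)}"

definition rep_pi :: "complex^'n^'n \<Rightarrow> ('n::finite bergman \<Rightarrow>\<^sub>L 'n bergman)" where
  "rep_pi A = Blinfun (\<lambda>f. Bergman (\<lambda>z. bergman_fun f (matrix_inv A *v z)))"

definition qrad_ops :: "('n::finite \<Rightarrow> nat) \<Rightarrow> nat list \<Rightarrow> ('n bergman \<Rightarrow>\<^sub>L 'n bergman) set" where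
  "qrad_ops e ns =
     {S \<in> bounded_ops. \<forall>A\<in>block_unitaries e ns. rep_pi A o\<^sub>L S o\<^sub>L adj (rep_pi A) = S}"

definition qrad_toeplitz_ops ::
    "('n::finite \<Rightarrow> nat) \<Rightarrow> nat list \<Rightarrow> ('n bergman \<Rightarrow>\<^sub>L 'n bergman) set" where
  "qrad_toeplitz_ops e ns = {toeplitz a | a. a \<in> Linf \<and> toeplitz a \<in> qrad_ops e ns}"

definition qrad_toeplitz_algebra ::
    "('n::finite \<Rightarrow> nat) \<Rightarrow> nat list \<Rightarrow> ('n bergman \<Rightarrow>\<^sub>L 'n bergman) set" where
  "qrad_toeplitz_algebra e ns = closed_subalgebra hull qrad_toeplitz_ops e ns"

end

theory Submission
  imports Defs "HOL-Complex_Analysis.Cauchy_Integral_Formula"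
begin

text \<open>The heart of the matter is a theorem of Xia: the closure of the set of Toeplitz operators is
  already an algebra. In \<open>T\<^sub>a T\<^sub>b = P a P b P\<close> the kernel of the middle projection may be cut off,
  with small error in norm, to the pairs \<open>(z,w)\<close> with
  \<open>|1 - \<langle>z,w\<rangle>|\<^sup>2 < M (1 - |z|\<^sup>2) (1 - |w|\<^sup>2)\<close> (Schur test with Forelli-Rudin integrals). For such pairs
  \<open>f(w) cnj g(z)\<close> is approximated by a fixed linear combination of values of \<open>f cnj g\<close> on a circle in
  the complex geodesic through \<open>z\<close> and \<open>w\<close>, and these values by means over small neighbourhoods;
  exchanging integrals turns the truncated form into \<open>\<integral> s f cnj g\<close> with a bounded symbol \<open>s\<close>.
  Hence an operator \<open>S\<close> in the Toeplitz algebra is a norm limit of Toeplitz operators, and if \<open>S\<close>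
  commutes with the group, the approximating symbols can be made invariant.\<close>

section \<open>Isometries and unitary matrices\<close>

text \<open>One inclusion, of the quasi-radial algebra in the intersection, is formal. For the
  converse, an approximating sum of products of Toeplitz operators cannot be made invariant factor
  by factor, since invariance of a product does not pass to its factors. A single Toeplitz operator
  depends linearly on its symbol, and conjugation by a unitary merely composes the symbol with the
  inverse matrix. This is why the analysis goes into replacing products by single Toeplitz
  operators. The obstacle there is that a kernel supported near the diagonal still pairs values of
  \<open>f\<close> and \<open>g\<close> at different points, whereas a symbol pairs them at the same
  point. As \<open>f\<close> is holomorphic and \<open>cnj g\<close> antiholomorphic, the diagonal
  values determine the others, and on a region of bounded invariant size they do so with uniform
  estimates. Point evaluations are not integrals against functions; the means over neighbourhoods
  make them so. The cut-off is fixed before the accuracy of this approximation, whose constants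
  depend on it.\<close>

lemma nn_integral_lborel_translate:
  fixes f :: "'a::euclidean_space \<Rightarrow> ennreal"
  assumes [measurable]: "f \<in> borel_measurable borel"
  shows "(\<integral>\<^sup>+x. f (x + c) \<partial>lborel) = (\<integral>\<^sup>+x. f x \<partial>lborel)"
proof -
  have "(\<integral>\<^sup>+x. f x \<partial>lborel) = (\<integral>\<^sup>+x. f x \<partial>distr lborel borel ((+) c))"
    by (simp only: lborel_distr_plus)
  also have "\<dots> = (\<integral>\<^sup>+x. f (c + x) \<partial>lborel)"
    by (subst nn_integral_distr) auto
  finally show ?thesis by (simp add: add.commute)
qed

lemma nn_integral_lborel_reflect:
  fixes f :: "'a::euclidean_space \<Rightarrow> ennreal"
  assumes [measurable]: "f \<in> borel_measurable borel"
  shows "(\<integral>\<^sup>+x. f (c - x) \<partial>lborel) = (\<integral>\<^sup>+x. f x \<partial>lborel)"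
proof -
  have "(\<integral>\<^sup>+x. f x \<partial>lborel) =
      (\<integral>\<^sup>+x. f x \<partial>density (distr lborel borel (\<lambda>x. c + (-1) *\<^sub>R x)) (\<lambda>_. ennreal (\<bar>- 1\<bar> ^ DIM('a))))"
    by (subst lborel_affine[of "-1" c]) auto
  then show ?thesis
    by (simp add: nn_integral_density nn_integral_distr)
qed

text \<open>The classical uniqueness argument for Haar measure: both sides of the identity
  \<open>\<lambda>(T\<inverse> A) \<lambda>(B) = \<lambda>(A) \<lambda>(T\<inverse> B)\<close> are the same double integral; take for \<open>B\<close> the unit ball.\<close>

lemma lborel_distr_linear_isometry:
  fixes T :: "'a::euclidean_space \<Rightarrow> 'a"
  assumes lin: "linear T" and iso: "\<And>x. norm (T x) = norm x"
  shows "distr lborel borel T = lborel"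
proof -
  have inj: "inj T"
    using iso linear_injective_0[OF lin] by (metis norm_eq_zero)
  then obtain T' where T': "linear T'" "\<And>x. T (T' x) = x"
    using linear_injective_isomorphism[OF lin] by blast
  have [measurable]: "T \<in> borel_measurable borel" "T' \<in> borel_measurable borel"
    using lin T' by (auto intro!: borel_measurable_continuous_onI linear_continuous_on
        simp: linear_conv_bounded_linear[symmetric])
  let ?B = "ball 0 1 :: 'a set"
  have [measurable]: "?B \<in> sets borel" by simp
  have TB: "indicator ?B (T x) = (indicator ?B x :: ennreal)" for x
    using iso[of x] by (auto simp: indicator_def)
  have *: "emeasure lborel (T -` A) * emeasure lborel ?B = emeasure lborel A * emeasure lborel ?B"
    if A[measurable]: "A \<in> sets borel" for A
  proof -
    have [measurable]: "T -` A \<in> sets borel"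
      using measurable_sets[of T borel borel A] by simp
    have "emeasure lborel (T -` A) * emeasure lborel ?B =
        (\<integral>\<^sup>+x. indicator A (T x) * (\<integral>\<^sup>+y. indicator ?B y \<partial>lborel) \<partial>lborel)"
    proof -
      have "(\<lambda>x. indicator A (T x) :: ennreal) = indicator (T -` A)"
        by (auto simp: indicator_def fun_eq_iff)
      then show ?thesis by (subst nn_integral_multc) measurable
    qed
    also have "\<dots> = (\<integral>\<^sup>+x. indicator A (T x) * (\<integral>\<^sup>+y. indicator ?B (y + T x) \<partial>lborel) \<partial>lborel)"
      by (subst nn_integral_lborel_translate) auto
    also have "\<dots> = (\<integral>\<^sup>+x. (\<integral>\<^sup>+y. indicator A (T x) * indicator ?B (y + T x) \<partial>lborel) \<partial>lborel)"
      by (subst nn_integral_cmult) auto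
    also have "\<dots> = (\<integral>\<^sup>+y. (\<integral>\<^sup>+x. indicator A (T x) * indicator ?B (y + T x) \<partial>lborel) \<partial>lborel)"
      by (rule lborel_pair.Fubini') measurable
    \<comment> \<open>Translating \<open>x\<close> by a preimage of \<open>- y\<close> under
      \<open>T\<close> moves \<open>y\<close> from the indicator of the ball to that of
      \<open>A\<close>.\<close>
    also have "\<dots> = (\<integral>\<^sup>+y. (\<integral>\<^sup>+x. indicator A (T (x + T' (- y))) * indicator ?B (y + T (x + T' (- y))) \<partial>lborel) \<partial>lborel)"
      by (intro nn_integral_cong nn_integral_lborel_translate[symmetric]) measurable
    also have "\<dots> = (\<integral>\<^sup>+y. (\<integral>\<^sup>+x. indicator A (T x - y) * indicator ?B (T x) \<partial>lborel) \<partial>lborel)"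
      by (simp add: linear_add[OF lin] T')
    also have "\<dots> = (\<integral>\<^sup>+x. (\<integral>\<^sup>+y. indicator A (T x - y) * indicator ?B (T x) \<partial>lborel) \<partial>lborel)"
      by (rule lborel_pair.Fubini') measurable
    also have "\<dots> = (\<integral>\<^sup>+x. emeasure lborel A * indicator ?B x \<partial>lborel)"
      by (simp add: nn_integral_multc nn_integral_lborel_reflect TB)
    also have "\<dots> = emeasure lborel A * emeasure lborel ?B"
      by (subst nn_integral_cmult) auto
    finally show ?thesis .
  qed
  have B: "emeasure lborel ?B \<noteq> 0" "emeasure lborel ?B \<noteq> \<infinity>"
    using content_ball_pos[of 1 "0::'a"] emeasure_lborel_ball_finite[of "0::'a" 1]
    by (auto simp: measure_def)
  show ?thesis
  proof (rule measure_eqI)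
    fix A assume "A \<in> sets (distr lborel borel T)"
    then have A: "A \<in> sets borel" by simp
    show "emeasure (distr lborel borel T) A = emeasure lborel A"
      using arg_cong[OF *[OF A], of "\<lambda>x. x / emeasure lborel ?B"] B A
      by (simp add: emeasure_distr ennreal_mult_divide_eq)
  qed simp
qed

lemma cnj_measurable [measurable]: "cnj \<in> borel_measurable borel"
  by (intro borel_measurable_continuous_onI continuous_intros)

text \<open>The Hermitian inner product, linear in the first argument. The class operation
  \<open>inner\<close> on \<open>complex^'n\<close> is only its real part and does not see the
  complex structure.\<close>

definition hip :: "complex^'n::finite \<Rightarrow> complex^'n \<Rightarrow> complex" where
  "hip z w = (\<Sum>i\<in>UNIV. z $ i * cnj (w $ i))"

lemma hip_add_left: "hip (x + y) z = hip x z + hip y z"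
  and hip_add_right: "hip z (x + y) = hip z x + hip z y"
  and hip_diff_left: "hip (x - y) z = hip x z - hip y z"
  and hip_diff_right: "hip z (x - y) = hip z x - hip z y"
  and hip_scale_left: "hip (c *s x) z = c * hip x z"
  and hip_scale_right: "hip z (c *s x) = cnj c * hip z x"
  and hip_minus_left: "hip (- x) z = - hip x z"
  and hip_minus_right: "hip z (- x) = - hip z x"
  and hip_zero_left [simp]: "hip 0 z = 0"
  and hip_zero_right [simp]: "hip z 0 = 0"
  by (simp_all add: hip_def algebra_simps sum.distrib sum_subtractf sum_distrib_left sum_negf)

lemma hip_commute: "hip z w = cnj (hip w z)"
  by (simp add: hip_def mult.commute)

lemma hip_self: "hip z z = of_real ((norm z)\<^sup>2)"
  by (simp add: hip_def norm_vec_def L2_set_def sum_nonneg complex_norm_square[symmetric] of_real_sum)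

lemma norm_scale_vec: "norm (c *s (x::complex^'n::finite)) = norm c * norm x"
  by (simp add: norm_vec_def norm_mult L2_set_right_distrib)

text \<open>Obtained by expanding \<open>hip\<close> of the difference with itself. This computation
  underlies Cauchy-Schwarz, Pythagoras and the formula for \<open>pw\<close> on complex
  lines.\<close>

lemma norm_diff_scale_sq:
  "(norm (z - c *s w))\<^sup>2 = (norm z)\<^sup>2 - 2 * Re (cnj c * hip z w) + (norm c)\<^sup>2 * (norm w)\<^sup>2"
proof -
  have "complex_of_real ((norm (z - c *s w))\<^sup>2) =
      of_real ((norm z)\<^sup>2) - (cnj c * hip z w + cnj (cnj c * hip z w)) + (c * cnj c) * of_real ((norm w)\<^sup>2)"
    unfolding hip_self[symmetric]
    by (simp add: hip_diff_left hip_diff_right hip_scale_left hip_scale_right algebra_simps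
        hip_commute[of w z])
  also have "\<dots> = of_real ((norm z)\<^sup>2 - 2 * Re (cnj c * hip z w) + (norm c)\<^sup>2 * (norm w)\<^sup>2)"
    unfolding complex_norm_square[symmetric] complex_add_cnj by simp
  finally show ?thesis by (simp only: of_real_eq_iff)
qed

lemma norm_hip_le: "norm (hip z w) \<le> norm z * norm w"
proof (cases "w = 0")
  case False
  \<comment> \<open>The coefficient of the orthogonal projection of \<open>z\<close> onto the
    complex line of \<open>w\<close>, for which the expanded square is smallest.\<close>
  let ?c = "hip z w / of_real ((norm w)\<^sup>2)"
  have "0 \<le> (norm (z - ?c *s w))\<^sup>2" by simp
  also have "\<dots> = (norm z)\<^sup>2 - (norm (hip z w))\<^sup>2 / (norm w)\<^sup>2"
  proof -
    have "cnj ?c * hip z w = of_real ((norm (hip z w))\<^sup>2 / (norm w)\<^sup>2)"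
      by (simp add: complex_norm_square[symmetric] mult.commute)
    then have "Re (cnj ?c * hip z w) = (norm (hip z w))\<^sup>2 / (norm w)\<^sup>2"
      by (simp only: Re_complex_of_real)
    moreover have "(norm ?c)\<^sup>2 * (norm w)\<^sup>2 = (norm (hip z w))\<^sup>2 / (norm w)\<^sup>2"
      using False by (simp add: norm_divide norm_mult power2_eq_square)
    ultimately show ?thesis unfolding norm_diff_scale_sq by linarith
  qed
  finally have "(norm (hip z w))\<^sup>2 \<le> (norm z * norm w)\<^sup>2"
    using False by (simp add: field_simps power_mult_distrib)
  then show ?thesis by (rule power2_le_imp_le) simp
qed simp

lemma hip_measurable [measurable]:
  assumes "f \<in> borel_measurable M" "g \<in> borel_measurable M"
  shows "(\<lambda>x. hip (f x) (g x :: complex^'n::finite)) \<in> borel_measurable M"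
proof -
  have "(\<lambda>x. hip (fst x) (snd x :: complex^'n)) \<in> borel_measurable borel"
    unfolding hip_def by (intro borel_measurable_continuous_onI continuous_intros)
  from measurable_compose[OF borel_measurable_Pair[OF assms] this] show ?thesis by simp
qed

lemma continuous_on_hip [continuous_intros]:
  "continuous_on S f \<Longrightarrow> continuous_on S g \<Longrightarrow> continuous_on S (\<lambda>x. hip (f x) (g x :: complex^'n::finite))"
  unfolding hip_def by (intro continuous_intros)

lemma continuous_on_scale_vec [continuous_intros]:
  "continuous_on S f \<Longrightarrow> continuous_on S g \<Longrightarrow> continuous_on S (\<lambda>x. f x *s (g x :: complex^'n::finite))"
  unfolding vector_scalar_mult_def by (intro continuous_intros)

lemma scale_vec_measurable [measurable]:
  assumes "f \<in> borel_measurable M" "g \<in> borel_measurable M"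
  shows "(\<lambda>x. f x *s (g x :: complex^'n::finite)) \<in> borel_measurable M"
proof -
  have "(\<lambda>x. fst x *s (snd x :: complex^'n)) \<in> borel_measurable borel"
    by (intro borel_measurable_continuous_onI continuous_intros)
  from measurable_compose[OF borel_measurable_Pair[OF assms] this] show ?thesis by simp
qed

lemma matrix_vector_mult_measurable [measurable]:
  "(*v) (A :: complex^'n^'m) \<in> borel_measurable borel"
  by (intro borel_measurable_continuous_onI) (intro continuous_intros)

definition mstar :: "complex^'n^'n \<Rightarrow> complex^'n^'n::finite" where
  "mstar A = map_matrix cnj (transpose A)"

lemma hip_mstar: "hip (A *v z) w = hip z (mstar A *v w)"
proof -
  have "hip (A *v z) w = (\<Sum>i\<in>UNIV. \<Sum>j\<in>UNIV. A $ i $ j * z $ j * cnj (w $ i))"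
    by (simp add: hip_def matrix_vector_mult_def sum_distrib_right)
  also have "\<dots> = (\<Sum>j\<in>UNIV. \<Sum>i\<in>UNIV. A $ i $ j * z $ j * cnj (w $ i))"
    by (rule sum.swap)
  also have "\<dots> = hip z (mstar A *v w)"
    by (simp add: hip_def matrix_vector_mult_def sum_distrib_left mstar_def map_matrix_def transpose_def
        mult_ac)
  finally show ?thesis .
qed

lemma mstar_mstar [simp]: "mstar (mstar A) = A"
  by (simp add: mstar_def map_matrix_def transpose_def vec_eq_iff)

lemma unitary_alt: "unitary A \<longleftrightarrow> mstar A ** A = mat 1 \<and> A ** mstar A = mat 1"
  by (simp add: unitary_def mstar_def)

lemma unitary_mstar: "unitary A \<Longrightarrow> unitary (mstar A)"
  by (simp add: unitary_alt)

lemma unitary_inv: "unitary A \<Longrightarrow> matrix_inv A = mstar A"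
proof -
  assume A: "unitary A"
  then have "\<exists>A'. A ** A' = mat 1 \<and> A' ** A = mat 1"
    unfolding unitary_alt by blast
  then have "A ** matrix_inv A = mat 1"
    unfolding matrix_inv_def by (metis (mono_tags, lifting) someI_ex)
  then have "mstar A ** (A ** matrix_inv A) = mstar A" by simp
  with A show ?thesis by (simp add: matrix_mul_assoc unitary_alt)
qed

lemma unitary_apply: 
  assumes "unitary A"
  shows "mstar A *v (A *v z) = z" "A *v (mstar A *v z) = z"
  using assms by (auto simp: unitary_alt matrix_vector_mul_assoc)

lemma hip_unitary: "unitary A \<Longrightarrow> hip (A *v z) (A *v w) = hip z w"
  by (simp add: hip_mstar unitary_apply)

lemma norm_unitary: assumes "unitary A" shows "norm (A *v z) = norm z"
proof -
  have "(norm (A *v z))\<^sup>2 = (norm z)\<^sup>2"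
    using hip_unitary[OF assms, of z z] unfolding hip_self of_real_eq_iff .
  then show ?thesis by simp
qed

section \<open>The normalised volume and its isometries\<close>

lemma dV_space [simp]: "space dV = UNIV" and sets_dV [measurable_cong, simp]: "sets dV = sets borel"
  by (auto simp: dV_def uniform_measure_def)

lemma emeasure_unit_ball: "emeasure lborel (ball 0 1 :: (complex^'n::finite) set) \<noteq> 0"
    "emeasure lborel (ball 0 1 :: (complex^'n::finite) set) \<noteq> \<infinity>"
  using content_ball_pos[of 1 "0::complex^'n"] emeasure_lborel_ball_finite[of "0::complex^'n" 1]
  by (auto simp: measure_def)

lemma emeasure_dV_UNIV: "emeasure (dV :: (complex^'n::finite) measure) UNIV = 1"
  using emeasure_unit_ball[where 'n='n] by (simp add: dV_def ennreal_divide_self less_top)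

lemma finite_measure_dV: "finite_measure (dV :: (complex^'n::finite) measure)"
  by (rule finite_measureI) (simp add: emeasure_dV_UNIV)

text \<open>The space of \<open>dV\<close> is all of \<open>complex^'n\<close>, so estimates valid
  only inside the ball enter the integrals through this almost-everywhere statement.\<close>

lemma AE_dV_ball: "AE z in dV. z \<in> ball 0 1"
  unfolding dV_def using emeasure_unit_ball by (subst AE_uniform_measure) (auto simp: less_top[symmetric])

lemma dV_distr_isometry:
  fixes T :: "complex^'n::finite \<Rightarrow> complex^'n"
  assumes "linear T" and iso: "\<And>x. norm (T x) = norm x"
  shows "distr dV dV T = dV"
proof (rule measure_eqI)
  have [measurable]: "T \<in> borel_measurable borel"
    using assms by (auto intro!: borel_measurable_continuous_onI linear_continuous_on
        simp: linear_conv_bounded_linear[symmetric])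
  fix A assume "A \<in> sets (distr dV dV T)"
  then have A [measurable]: "A \<in> sets borel" by simp
  have vA: "T -` A \<in> sets borel" using measurable_sets[of T borel borel A] by simp
  have "emeasure lborel (ball 0 1 \<inter> A) = emeasure (distr lborel borel T) (ball 0 1 \<inter> A)"
    by (simp only: lborel_distr_linear_isometry[OF assms])
  also have "\<dots> = emeasure lborel (T -` (ball 0 1 \<inter> A))"
    by (subst emeasure_distr) auto
  also have "T -` (ball 0 1 \<inter> A) = ball 0 1 \<inter> T -` A"
    using iso by auto
  finally have "emeasure lborel (ball 0 1 \<inter> A) = emeasure lborel (ball 0 1 \<inter> T -` A)" .
  then show "emeasure (distr dV dV T) A = emeasure dV A"
    using vA by (subst emeasure_distr) (auto simp: dV_def emeasure_uniform_measure)
qed auto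

lemma linear_matrix_complex: "linear ((*v) (A :: complex^'n^'m))"
  by (auto intro!: linearI simp: matrix_vector_mult_def vec_eq_iff sum.distrib algebra_simps scaleR_sum_right)

lemma dV_distr_unitary: "unitary A \<Longrightarrow> distr dV dV ((*v) A) = dV"
  by (intro dV_distr_isometry linear_matrix_complex norm_unitary)

section \<open>Averages over circles\<close>

text \<open>A probability measure on the parameter interval of the unit circle: means over circles
  become Bochner integrals, to which Fubini with \<open>dV\<close> applies.\<close>

definition circle01 :: "real measure" where
  "circle01 = uniform_measure lborel {0..1}"

lemma space_circle01 [simp]: "space circle01 = UNIV"
  and sets_circle01 [measurable_cong, simp]: "sets circle01 = sets borel"
  by (auto simp: circle01_def)

lemma emeasure_circle01_UNIV: "emeasure circle01 UNIV = 1"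
  by (simp add: circle01_def ennreal_divide_self)

lemma finite_measure_circle01: "finite_measure circle01"
  by (rule finite_measureI) (simp add: emeasure_circle01_UNIV)

lemma measure_circle01_UNIV [simp]: "measure circle01 UNIV = 1"
  by (simp add: measure_def emeasure_circle01_UNIV)

lemma circle01_eq_density: "circle01 = density lborel (indicator {0..1})"
  unfolding circle01_def uniform_measure_def by (simp add: divide_ennreal_def)

lemma integral_circle01:
  fixes f :: "real \<Rightarrow> 'a::euclidean_space"
  assumes "continuous_on UNIV f"
  shows "integrable circle01 f" "(\<integral>x. f x \<partial>circle01) = integral {0..1} f"
proof -
  have [measurable]: "f \<in> borel_measurable borel"
    using assms by (rule borel_measurable_continuous_onI)
  have si: "set_integrable lborel {0..1} f"
    by (rule borel_integrable_atLeastAtMost') (rule continuous_on_subset[OF assms], simp)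
  have eq: "circle01 = density lborel (\<lambda>x. ennreal (indicator {0..1} x))"
    unfolding circle01_eq_density by (intro arg_cong2[where f = density]) (auto simp: indicator_def)
  show "integrable circle01 f"
    using si unfolding eq by (subst integrable_density) (auto simp: set_integrable_def)
  have "(\<integral>x. f x \<partial>circle01) = set_lebesgue_integral lborel {0..1} f"
    unfolding eq by (subst integral_density) (auto simp: set_lebesgue_integral_def)
  also have "\<dots> = integral {0..1} f"
    using si by (rule set_borel_integral_eq_integral)
  finally show "(\<integral>x. f x \<partial>circle01) = integral {0..1} f" .
qed

definition unit_exp :: "real \<Rightarrow> complex" where
  "unit_exp x = exp (2 * of_real pi * \<i> * of_real x)"

lemma norm_unit_exp [simp]: "norm (unit_exp x) = 1"
  by (simp add: unit_exp_def)

lemma unit_exp_nonzero [simp]: "unit_exp x \<noteq> 0"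
  by (simp add: unit_exp_def)

lemma continuous_on_unit_exp [continuous_intros]:
  "continuous_on S f \<Longrightarrow> continuous_on S (\<lambda>x. unit_exp (f x))"
  unfolding unit_exp_def by (intro continuous_intros)

lemma unit_exp_measurable [measurable]: "unit_exp \<in> borel_measurable borel"
  by (intro borel_measurable_continuous_onI continuous_intros)

definition taylor_coeff :: "(complex \<Rightarrow> complex) \<Rightarrow> nat \<Rightarrow> complex" where
  "taylor_coeff F k = (deriv ^^ k) F 0 / fact k"

lemma taylor_coeff_0 [simp]: "taylor_coeff F 0 = F 0"
  by (simp add: taylor_coeff_def)

lemma taylor_sums:
  assumes "F holomorphic_on ball 0 r" "norm z < r"
  shows "(\<lambda>k. taylor_coeff F k * z ^ k) sums F z"
  using holomorphic_power_series[OF assms(1), of z] assms(2) by (simp add: taylor_coeff_def)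

text \<open>Cauchy's formula for the \<open>k\<close>-th derivative, pulled back to the parameter
  interval, where \<open>cnj (unit_exp x)\<close> is the inverse of \<open>unit_exp x\<close>. For
  \<open>k = 0\<close> it is the mean value property.\<close>

lemma circle_integral_coeff:
  assumes holo: "F holomorphic_on S" "cball 0 r \<subseteq> S" and r: "r > 0"
  shows "(\<integral>x. F (of_real r * unit_exp x) * cnj (unit_exp x) ^ k \<partial>circle01) = taylor_coeff F k * of_real r ^ k"
proof -
  have holc: "F holomorphic_on cball 0 r"
    by (rule holomorphic_on_subset[OF holo(1) holo(2)])
  then have hol: "F holomorphic_on ball 0 r"
    by (rule holomorphic_on_subset) (rule ball_subset_cball)
  have cont: "continuous_on (cball 0 r) F"
    using holc by (rule holomorphic_on_imp_continuous_on)
  have "((\<lambda>u. F u / (u-0) ^ (Suc k)) has_contour_integral ((2 * pi * \<i>) / (fact k) * (deriv ^^ k) F 0))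
           (circlepath 0 r)"
    by (rule Cauchy_has_contour_integral_higher_derivative_circlepath[OF cont hol]) (use r in auto)
  then have "((\<lambda>x. F (circlepath 0 r x) / (circlepath 0 r x) ^ (Suc k) *
      vector_derivative (circlepath 0 r) (at x within {0..1})) has_integral
      ((2 * pi * \<i>) / (fact k) * (deriv ^^ k) F 0)) {0..1}"
    by (simp add: has_contour_integral_def)
  then have "((\<lambda>x. (2 * pi * \<i>) / of_real r ^ k * (F (of_real r * unit_exp x) * cnj (unit_exp x) ^ k)) has_integral
      ((2 * pi * \<i>) / (fact k) * (deriv ^^ k) F 0)) {0..1}"
  proof (rule has_integral_eq[rotated])
    fix x :: real assume x: "x \<in> {0..1}"
    have inv: "cnj (unit_exp x) = 1 / unit_exp x"
      by (simp add: unit_exp_def exp_cnj exp_minus[symmetric] divide_inverse)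
    have c: "circlepath 0 r x = of_real r * unit_exp x"
      by (simp add: circlepath unit_exp_def)
    have "vector_derivative (circlepath 0 r) (at x within {0..1}) = 2 * pi * \<i> * (of_real r * unit_exp x)"
      using x by (simp add: vector_derivative_circlepath01 unit_exp_def mult_ac)
    then show "F (circlepath 0 r x) / (circlepath 0 r x) ^ (Suc k) *
      vector_derivative (circlepath 0 r) (at x within {0..1}) =
      (2 * pi * \<i>) / of_real r ^ k * (F (of_real r * unit_exp x) * cnj (unit_exp x) ^ k)"
      using r by (simp add: c inv power_divide power_mult_distrib)
  qed
  then have "((\<lambda>x. F (of_real r * unit_exp x) * cnj (unit_exp x) ^ k) has_integral
      ((2 * pi * \<i>) / (fact k) * (deriv ^^ k) F 0) / ((2 * pi * \<i>) / of_real r ^ k)) {0..1}"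
  proof -
    define C where "C = (2 * pi * \<i>) / complex_of_real r ^ k"
    have C: "C \<noteq> 0" using r by (simp add: C_def)
    assume "((\<lambda>x. (2 * pi * \<i>) / of_real r ^ k * (F (of_real r * unit_exp x) * cnj (unit_exp x) ^ k)) has_integral
      ((2 * pi * \<i>) / (fact k) * (deriv ^^ k) F 0)) {0..1}"
    from has_integral_mult_right[OF this[folded C_def], of "1 / C"] show ?thesis
      unfolding C_def[symmetric] using C by (simp add: mult.assoc[symmetric] mult.commute[of C "fact k"])
  qed
  moreover have "((2 * pi * \<i>) / (fact k) * (deriv ^^ k) F 0) / ((2 * pi * \<i>) / of_real r ^ k) =
      taylor_coeff F k * of_real r ^ k"
    by (simp add: taylor_coeff_def field_simps)
  ultimately have "integral {0..1} (\<lambda>x. F (of_real r * unit_exp x) * cnj (unit_exp x) ^ k) = taylor_coeff F k * of_real r ^ k"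
    using integral_unique by metis
  moreover have "continuous_on UNIV (\<lambda>x. F (of_real r * unit_exp x) * cnj (unit_exp x) ^ k)"
    using r by (intro continuous_intros continuous_on_compose2[OF cont]) (auto simp: norm_mult)
  ultimately show ?thesis by (simp add: integral_circle01)
qed

text \<open>Each \<open>T x\<close> preserves \<open>M\<close>, so the integral of \<open>f\<close>
  composed with \<open>T x\<close> does not depend on \<open>x\<close>, and Fubini moves the mean
  over \<open>x\<close> inside. In this way an identity for circle means at each point becomes an
  identity of integrals.\<close>

lemma average_over_isometries:
  fixes f :: "'a \<Rightarrow> complex"
  assumes sf: "sigma_finite_measure M"
    and T[measurable]: "(\<lambda>(x, w). T x w) \<in> measurable (circle01 \<Otimes>\<^sub>M M) M"
    and inv: "\<And>x. distr M M (T x) = M" and f: "integrable M f"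
  shows "integrable M (\<lambda>w. \<integral>x. f (T x w) \<partial>circle01)"
    "(\<integral>w. (\<integral>x. f (T x w) \<partial>circle01) \<partial>M) = (\<integral>w. f w \<partial>M)"
proof -
  interpret C: finite_measure circle01 by (rule finite_measure_circle01)
  interpret M: sigma_finite_measure M by fact
  interpret pair_sigma_finite circle01 M ..
  have [measurable]: "f \<in> borel_measurable M" using f by auto
  have Tx [measurable]: "T x \<in> measurable M M" for x
    using measurable_compose[OF measurable_Pair1' T, of x] by simp
  have 1: "integrable M (\<lambda>w. g (T x w))" "(\<integral>w. g (T x w) \<partial>M) = (\<integral>w. g w \<partial>M)"
    if "integrable M g" for x and g :: "'a \<Rightarrow> 'b::{banach, second_countable_topology}"
  proof -
    have [measurable]: "g \<in> borel_measurable M" using that by auto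
    show "integrable M (\<lambda>w. g (T x w))"
      using that by (subst (asm) inv[of x, symmetric]) (simp add: integrable_distr_eq)
    have "(\<integral>w. g w \<partial>M) = (\<integral>w. g w \<partial>distr M M (T x))" by (simp add: inv)
    then show "(\<integral>w. g (T x w) \<partial>M) = (\<integral>w. g w \<partial>M)" by (simp add: integral_distr)
  qed
  have int: "integrable (circle01 \<Otimes>\<^sub>M M) (\<lambda>(x, w). f (T x w))"
  proof (rule Fubini_integrable)
    show "(\<lambda>(x, w). f (T x w)) \<in> borel_measurable (circle01 \<Otimes>\<^sub>M M)"
      using measurable_compose[OF T \<open>f \<in> borel_measurable M\<close>] by (simp add: case_prod_beta)
    have "(\<integral>w. norm (f (T x w)) \<partial>M) = (\<integral>w. norm (f w) \<partial>M)" for x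
      using 1(2)[of "\<lambda>w. norm (f w)"] f by simp
    then show "integrable circle01 (\<lambda>x. \<integral>w. norm (case (x, w) of (x, w) \<Rightarrow> f (T x w)) \<partial>M)"
      by simp
    show "AE x in circle01. integrable M (\<lambda>w. case (x, w) of (x, w) \<Rightarrow> f (T x w))"
      using 1(1)[OF f] by simp
  qed
  show "integrable M (\<lambda>w. \<integral>x. f (T x w) \<partial>circle01)"
    using integrable_snd[OF int] .
  have "(\<integral>w. (\<integral>x. f (T x w) \<partial>circle01) \<partial>M) = (\<integral>x. (\<integral>w. f (T x w) \<partial>M) \<partial>circle01)"
    using Fubini_integral[OF int] .
  also have "\<dots> = (\<integral>w. f w \<partial>M)"
    by (simp add: 1(2)[OF f])
  finally show "(\<integral>w. (\<integral>x. f (T x w) \<partial>circle01) \<partial>M) = (\<integral>w. f w \<partial>M)" .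
qed

lemma isometry_measurable:
  assumes "linear (T :: 'a::euclidean_space \<Rightarrow> 'a)"
  shows "T \<in> borel_measurable borel"
  using assms by (auto intro!: borel_measurable_continuous_onI linear_continuous_on
        simp: linear_conv_bounded_linear[symmetric])

lemma dV_integral_isometry:
  fixes T :: "complex^'n::finite \<Rightarrow> complex^'n" and f :: "complex^'n \<Rightarrow> 'b::{banach, second_countable_topology}"
  assumes T: "linear T" "\<And>x. norm (T x) = norm x" and [measurable]: "f \<in> borel_measurable borel"
  shows "integrable dV (\<lambda>w. f (T w)) \<longleftrightarrow> integrable dV f" "(\<integral>w. f (T w) \<partial>dV) = (\<integral>w. f w \<partial>dV)"
proof -
  have [measurable]: "T \<in> measurable dV dV"
    using isometry_measurable[OF T(1)] by (simp cong: measurable_cong_sets)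
  show "integrable dV (\<lambda>w. f (T w)) \<longleftrightarrow> integrable dV f"
    using integrable_distr_eq[of T dV dV f] dV_distr_isometry[OF T] by simp
  show "(\<integral>w. f (T w) \<partial>dV) = (\<integral>w. f w \<partial>dV)"
    using integral_distr[of T dV dV f] dV_distr_isometry[OF T] by simp
qed

text \<open>The complex Householder reflection, which negates \<open>u\<close> and fixes its
  orthogonal complement; for \<open>u = 0\<close> it is the identity.\<close>

definition reflect :: "complex^'n::finite \<Rightarrow> complex^'n \<Rightarrow> complex^'n" where
  "reflect u w = w - (2 * hip w u / hip u u) *s u"

lemma scaleR_eq_scale_vec: "r *\<^sub>R (x :: complex^'n::finite) = complex_of_real r *s x"
  by (simp add: vec_eq_iff) (simp add: scaleR_conv_of_real)

lemma hip_eq_0_iff [simp]: "hip u u = 0 \<longleftrightarrow> u = 0"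
  by (simp add: hip_self)

lemma reflect_hip: "hip (reflect u w) x = hip w (reflect u x)"
proof -
  have "cnj (hip x u) = hip u x" "cnj (hip u u) = hip u u"
    by (simp_all add: hip_commute[symmetric])
  then show ?thesis
    by (simp add: reflect_def hip_diff_left hip_diff_right hip_scale_left hip_scale_right)
qed

lemma reflect_reflect: "reflect u (reflect u w) = w"
proof (cases "u = 0")
  case False
  then have "hip (reflect u w) u = - hip w u"
    by (simp add: reflect_def hip_diff_left hip_scale_left)
  then show ?thesis
    by (simp add: reflect_def[of u "reflect u w"]) (simp add: reflect_def vector_sadd_rdistrib)
qed (simp add: reflect_def)

lemma norm_reflect: "norm (reflect u w) = norm w"
proof -
  have "complex_of_real ((norm (reflect u w))\<^sup>2) = of_real ((norm w)\<^sup>2)"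
    unfolding hip_self[symmetric] reflect_hip reflect_reflect ..
  then show ?thesis by (simp only: of_real_eq_iff) simp
qed

lemma linear_reflect: "linear (reflect u)"
proof (rule linearI)
  show "reflect u (x + y) = reflect u x + reflect u y" for x y
    by (simp add: reflect_def hip_add_left distrib_left add_divide_distrib vector_sadd_rdistrib)
  show "reflect u (r *\<^sub>R x) = r *\<^sub>R reflect u x" for r x
    by (simp add: reflect_def scaleR_eq_scale_vec hip_scale_left vector_smult_assoc vector_ssub_ldistrib)
qed

text \<open>The complex Householder reflection exchanging two unit vectors requires their product to be
  real, whence the unimodular factor \<open>c\<close>.\<close>

lemma isometry_to_axis:
  fixes z :: "complex^'n::finite" and i :: 'n
  obtains T c where "linear T" "\<And>x. norm (T x) = norm x" "norm c = 1"
    "\<And>w. hip (T w) z = c * of_real (norm z) * w $ i"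
proof (cases "z = 0")
  case True
  show ?thesis
    by (rule that[of id 1]) (simp_all add: True linear_id)
next
  case False
  define a :: "complex^'n" where "a = axis i 1"
  obtain c :: complex where c: "norm c = 1" "c * of_real (norm (hip z a)) = hip z a"
  proof (cases "hip z a = 0")
    case True then show ?thesis by (intro that[of 1]) auto
  next
    case False then show ?thesis
      by (intro that[of "hip z a / of_real (norm (hip z a))"]) (auto simp: norm_divide)
  qed
  \<comment> \<open>The unit multiple of \<open>z\<close> whose product with \<open>a\<close> is
    real and nonnegative; reality of this product is what makes the reflection along
    \<open>a - b\<close> take \<open>b\<close> to \<open>a\<close>.\<close>
  define b where "b = (cnj c / of_real (norm z)) *s z"
  have nz: "complex_of_real (norm z) \<noteq> 0" using False by simp
  have cc: "cnj c * c = 1" using c(1)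
    by (simp add: complex_norm_square[symmetric] mult.commute)
  have haa: "hip a a = 1"
    by (simp add: a_def hip_def axis_def if_distrib cong: if_cong)
  have hzz: "hip z z = of_real (norm z) * of_real (norm z)"
    by (simp add: hip_self power2_eq_square)
  have hbb: "hip b b = 1"
    using cc nz by (simp add: b_def hip_scale_left hip_scale_right hzz mult_ac)
  have hba: "hip b a = of_real (norm (hip z a) / norm z)"
  proof -
    have "hip b a = cnj c * hip z a / of_real (norm z)" by (simp add: b_def hip_scale_left)
    also have "\<dots> = (cnj c * c) * of_real (norm (hip z a)) / of_real (norm z)"
      by (subst c(2)[symmetric]) simp
    finally show ?thesis by (simp add: cc)
  qed
  have hab: "hip a b = hip b a"
    by (subst hip_commute) (simp add: hba)
  let ?T = "reflect (a - b)"
  have Tb: "?T b = a"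
  proof (cases "a = b")
    case True then show ?thesis by (simp add: reflect_def)
  next
    case False
    have u: "hip (a - b) (a - b) = 2 - 2 * hip b a"
      by (simp add: hip_diff_left hip_diff_right haa hbb hab)
    moreover have "hip b (a - b) = hip b a - 1"
      by (simp add: hip_diff_right hbb)
    ultimately have "2 * hip b (a - b) = - hip (a - b) (a - b)"
      by simp
    then have "2 * hip b (a - b) / hip (a - b) (a - b) = -1"
      using False hip_eq_0_iff[of "a - b"] by (simp del: hip_eq_0_iff)
    then have "?T b = b - (-1) *s (a - b)" unfolding reflect_def by simp
    then show ?thesis by (simp add: vec_eq_iff)
  qed
  have zb: "z = (c * of_real (norm z)) *s b"
    using cc nz by (simp add: b_def vector_smult_assoc mult_ac)
  show ?thesis
  proof (rule that[of ?T "cnj c"])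
    fix w
    have "hip (?T w) z = hip (?T w) ((c * of_real (norm z)) *s b)" using zb by simp
    also have "\<dots> = cnj c * of_real (norm z) * hip (?T w) b" by (simp add: hip_scale_right)
    also have "hip (?T w) b = hip w a" by (simp add: reflect_hip Tb)
    also have "hip w a = w $ i"
      by (simp add: a_def hip_def axis_def if_distrib cong: if_cong)
    finally show "hip (?T w) z = cnj c * of_real (norm z) * w $ i" .
  qed (use c in \<open>auto simp: linear_reflect norm_reflect\<close>)
qed

section \<open>Moments of the ball and Forelli-Rudin integrals\<close>

text \<open>A ball of radius \<open>sqrt x\<close> has real dimension \<open>2 * CARD('n)\<close>,
  so for \<open>x\<close> between 0 and 1 it carries the fraction \<open>x ^ CARD('n)\<close> of the
  volume; the density is the derivative.\<close>

lemma norm_squared_distribution: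
  "distr (dV :: (complex^'n::finite) measure) borel (\<lambda>w. (norm w)\<^sup>2) =
    density lborel (\<lambda>r. ennreal (real CARD('n) * r ^ (CARD('n) - 1)) * indicator {0..1} r)"
    (is "?M = ?D")
proof (rule measure_eqI_lessThan)
  interpret finite_measure "dV :: (complex^'n) measure" by (rule finite_measure_dV)
  show "sets ?M = sets borel" "sets ?D = sets borel" by simp_all
  have M: "emeasure ?M {x<..} = emeasure (dV :: (complex^'n) measure) {w. x < (norm w)\<^sup>2}" for x
    by (subst emeasure_distr) (auto intro!: arg_cong2[where f = emeasure])
  show "emeasure ?M {x<..} < \<infinity>" for x
    unfolding M by (simp add: emeasure_eq_measure)
  have U: "emeasure (dV :: (complex^'n) measure) UNIV = 1" by (rule emeasure_dV_UNIV)
  show "emeasure ?M {x<..} = emeasure ?D {x<..}" for x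
  proof -
    \<comment> \<open>Clamping to the unit interval lets one formula for the tail cover
      \<open>x < 0\<close> and \<open>x > 1\<close>.\<close>
    define y where "y = max 0 (min x 1)"
    have y: "0 \<le> y" "y \<le> 1" by (auto simp: y_def)
    have "emeasure (dV :: (complex^'n) measure) {w. x < (norm w)\<^sup>2} = ennreal (1 - y ^ CARD('n))"
    proof (cases "x < 0")
      case True
      then have "{w::complex^'n. x < (norm w)\<^sup>2} = UNIV"
        by (auto intro: less_le_trans[OF _ zero_le_power2])
      then show ?thesis using True by (simp add: U y_def)
    next
      case False
      have c: "emeasure (dV :: (complex^'n) measure) (cball 0 (sqrt x)) = ennreal (y ^ CARD('n))"
      proof (cases "x < 1")
        case True
        then have sub: "ball 0 1 \<inter> cball 0 (sqrt x) = (cball 0 (sqrt x) :: (complex^'n) set)"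
        proof -
          have "sqrt x < 1" using True by simp
          then show ?thesis by (auto intro: le_less_trans simp del: real_sqrt_lt_1_iff)
        qed
        have "sqrt x ^ (CARD('n) * 2) = y ^ CARD('n)"
          unfolding mult.commute[of "CARD('n)" 2] power_mult using True False by (simp add: y_def)
        then show ?thesis
          using False y
          by (simp add: dV_def sub emeasure_cball emeasure_ball divide_ennreal mult.commute
              less_imp_neq[OF unit_ball_vol_pos[of "real CARD('n) * 2"], symmetric])
      next
        case False
        then have s: "1 \<le> sqrt x" by simp
        have "norm w \<le> sqrt x" if "norm w < 1" for w :: "complex^'n"
          using s that by linarith
        then have "ball 0 1 \<inter> cball 0 (sqrt x) = (ball 0 1 :: (complex^'n) set)" by auto
        then show ?thesis using False emeasure_unit_ball[where 'n='n]
          by (simp add: dV_def y_def ennreal_divide_self less_top)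
      qed
      have "norm w \<le> sqrt x \<longleftrightarrow> (norm w)\<^sup>2 \<le> x" for w :: "complex^'n"
        using real_sqrt_le_iff[of "(norm w)\<^sup>2" x] by simp
      then have "{w::complex^'n. x < (norm w)\<^sup>2} = UNIV - cball 0 (sqrt x)"
        by (auto simp: not_less)
      then have "emeasure (dV :: (complex^'n) measure) {w. x < (norm w)\<^sup>2} = 1 - ennreal (y ^ CARD('n))"
        using Measure_Space.emeasure_compl[of "cball 0 (sqrt x)" "dV :: (complex^'n) measure"] by (simp add: c U)
      then show ?thesis using y
        by (simp add: ennreal_1[symmetric] ennreal_minus del: ennreal_1)
    qed
    moreover have "emeasure ?D {x<..} = ennreal (1 - y ^ CARD('n))"
    proof -
      have "((\<lambda>r. real CARD('n) * r ^ (CARD('n) - 1)) has_integral (1 ^ CARD('n) - y ^ CARD('n))) {y..1}"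
        using y by (intro fundamental_theorem_of_calculus)
          (auto simp flip: has_real_derivative_iff_has_vector_derivative intro!: derivative_eq_intros)
      then have *: "(\<integral>\<^sup>+r. ennreal (real CARD('n) * r ^ (CARD('n) - 1)) * indicator {y..1} r \<partial>lborel)
          = ennreal (1 - y ^ CARD('n))"
        using y by (intro nn_integral_has_integral_lebesgue') auto
      have "emeasure ?D {x<..} =
          (\<integral>\<^sup>+r. ennreal (real CARD('n) * r ^ (CARD('n) - 1)) * indicator {0..1} r * indicator {x<..} r \<partial>lborel)"
        by (subst emeasure_density) auto
      also have "\<dots> = (\<integral>\<^sup>+r. ennreal (real CARD('n) * r ^ (CARD('n) - 1)) * indicator {y..1} r \<partial>lborel)"
      proof (rule nn_integral_cong_AE)
        show "AE r in lborel. ennreal (real CARD('n) * r ^ (CARD('n) - 1)) * indicator {0..1} r * indicator {x<..} r =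
          ennreal (real CARD('n) * r ^ (CARD('n) - 1)) * indicator {y..1} r"
          \<comment> \<open>The two sets differ at most in \<open>x\<close> and, for
            \<open>x \<ge> 1\<close>, in the point 1.\<close>
          using AE_lborel_singleton[of x] AE_lborel_singleton[of 1]
          by eventually_elim (auto simp: y_def indicator_def)
      qed
      finally show ?thesis using * by simp
    qed
    ultimately show ?thesis by (simp add: M)
  qed
qed

text \<open>The defining function of the ball, of the order of the distance to the sphere. Its power
  \<open>CARD('n) + 1\<close> recurs throughout, as \<open>dV\<close> divided by it is the volume
  invariant under automorphisms of the ball.\<close>

definition pw :: "complex^'n::finite \<Rightarrow> real" where
  "pw w = 1 - (norm w)\<^sup>2"

lemma pw_pos_iff: "0 < pw w \<longleftrightarrow> norm w < 1"
  by (simp add: pw_def power_less_one_iff abs_square_less_1)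

lemma pw_pos: "w \<in> ball 0 1 \<Longrightarrow> 0 < pw w"
  by (simp add: pw_pos_iff)

lemma pw_le_1: "pw w \<le> 1"
  by (simp add: pw_def)

lemma pw_measurable [measurable]: "pw \<in> borel_measurable borel"
  unfolding pw_def by measurable

lemma nth_measurable [measurable]: "(\<lambda>w. w $ i) \<in> borel_measurable (borel :: (complex^'n::finite) measure)"
  by (intro borel_measurable_continuous_onI continuous_intros)

text \<open>In the variable \<open>r = (norm w)\<^sup>2\<close> this is \<open>CARD('n)\<close>
  times the Beta integral with parameters \<open>CARD('n)\<close> and \<open>b\<close>.\<close>

lemma pw_powr_integral:
  assumes b: "0 < b"
  shows "integrable (dV :: (complex^'n::finite) measure) (\<lambda>w. pw w powr (b - 1))"
    "(\<integral>w. pw w powr (b - 1) \<partial>(dV :: (complex^'n) measure)) = fact CARD('n) * Gamma b / Gamma (real CARD('n) + b)"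
proof -
  let ?N = "CARD('n)"
  have N: "0 < ?N" by simp
  have "(\<integral>\<^sup>+w. ennreal (pw w powr (b - 1)) \<partial>(dV :: (complex^'n) measure)) =
      (\<integral>\<^sup>+r. ennreal ((1 - r) powr (b - 1)) \<partial>distr (dV :: (complex^'n) measure) borel (\<lambda>w. (norm w)\<^sup>2))"
    by (subst nn_integral_distr) (auto simp: pw_def)
  also have "\<dots> = (\<integral>\<^sup>+r. ennreal (real ?N * r ^ (?N - 1)) * indicator {0..1} r * ennreal ((1 - r) powr (b - 1)) \<partial>lborel)"
    unfolding norm_squared_distribution by (subst nn_integral_density) auto
  also have "\<dots> = (\<integral>\<^sup>+r. ennreal (real ?N * (r powr (real ?N - 1) * (1 - r) powr (b - 1))) * indicator {0..1} r \<partial>lborel)"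
  proof (rule nn_integral_cong_AE)
    show "AE r in lborel. ennreal (real ?N * r ^ (?N - 1)) * indicator {0..1} r * ennreal ((1 - r) powr (b - 1)) =
      ennreal (real ?N * (r powr (real ?N - 1) * (1 - r) powr (b - 1))) * indicator {0..1} r"
      using AE_lborel_singleton[of 0]
    proof eventually_elim
      fix r :: real assume "r \<noteq> 0"
      show "ennreal (real ?N * r ^ (?N - 1)) * indicator {0..1} r * ennreal ((1 - r) powr (b - 1)) =
        ennreal (real ?N * (r powr (real ?N - 1) * (1 - r) powr (b - 1))) * indicator {0..1} r"
      proof (cases "r \<in> {0..1}")
        case True
        then have "0 < r" using \<open>r \<noteq> 0\<close> by simp
        then have "r ^ (?N - 1) = r powr (real ?N - 1)"
          using N by (subst powr_realpow[symmetric]) (auto simp: of_nat_diff)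
        then show ?thesis using True \<open>0 < r\<close>
          by (simp add: ennreal_mult[symmetric] mult.assoc)
      qed simp
    qed
  qed
  also have "\<dots> = ennreal (real ?N * Beta (real ?N) b)"
    using has_integral_mult_right[OF has_integral_Beta_real[of "real ?N" b], of "real ?N"] b
    by (intro nn_integral_has_integral_lebesgue') auto
  finally have *: "(\<integral>\<^sup>+w. ennreal (pw w powr (b - 1)) \<partial>(dV :: (complex^'n) measure)) =
      ennreal (real ?N * Beta (real ?N) b)" .
  have "real ?N * Gamma (real ?N) = fact ?N"
    using Gamma_fact[of "?N - 1", where ?'a = real] N
    by (simp add: of_nat_diff fact_reduce[of ?N])
  then have eq: "real ?N * Beta (real ?N) b = fact ?N * Gamma b / Gamma (real ?N + b)"
    by (simp add: Beta_def mult.assoc[symmetric])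
  have pos: "0 \<le> real ?N * Beta (real ?N) b"
    using b unfolding eq by (intro divide_nonneg_nonneg mult_nonneg_nonneg Gamma_real_nonneg) auto
  show "integrable (dV :: (complex^'n) measure) (\<lambda>w. pw w powr (b - 1))"
    using * by (intro integrableI_bounded) auto
  show "(\<integral>w. pw w powr (b - 1) \<partial>(dV :: (complex^'n) measure)) = fact CARD('n) * Gamma b / Gamma (real CARD('n) + b)"
    using * pos by (subst integral_eq_nn_integral) (auto simp: eq)
qed

lemma phase_distinct:
  assumes "m \<noteq> m'" obtains c :: complex where "norm c = 1" "c ^ m * cnj (c ^ m') = -1"
proof -
  define a where "a = pi / (real m - real m')"
  have "real m * a - real m' * a = pi"
  proof -
    have "real m - real m' \<noteq> 0" using assms by simp
    then show ?thesis unfolding left_diff_distrib[symmetric] a_def by simp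
  qed
  then have "cis a ^ m * cnj (cis a ^ m') = -1"
    by (simp add: Complex.DeMoivre cis_cnj cis_mult)
  then show ?thesis by (intro that[of "cis a"]) auto
qed

definition phase :: "'n \<Rightarrow> complex \<Rightarrow> complex^'n::finite \<Rightarrow> complex^'n" where
  "phase j c w = (\<chi> i. if i = j then c * w $ i else w $ i)"

lemma linear_phase: "linear (phase j c)"
  by (rule linearI) (auto simp: phase_def vec_eq_iff algebra_simps)

lemma norm_phase: "norm c = 1 \<Longrightarrow> norm (phase j c w) = norm w"
  unfolding norm_vec_def phase_def by (intro arg_cong2[where f = L2_set]) (auto simp: fun_eq_iff norm_mult)

lemma linear_scale_vec: "linear (\<lambda>w::complex^'n::finite. c *s w)"
  by (rule linearI) (auto simp: vec_eq_iff algebra_simps)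

lemma integral_dV_eq_0:
  fixes F :: "complex^'n::finite \<Rightarrow> complex"
  assumes T: "linear T" "\<And>x. norm (T x) = norm x" and [measurable]: "F \<in> borel_measurable borel"
    and eq: "\<And>w. F (T w) = d * F w" and d: "d \<noteq> 1"
  shows "(\<integral>w. F w \<partial>dV) = 0"
proof -
  have "(\<integral>w. F w \<partial>dV) = (\<integral>w. F (T w) \<partial>dV)"
    by (rule dV_integral_isometry[OF T, symmetric]) simp
  also have "\<dots> = d * (\<integral>w. F w \<partial>dV)" by (simp add: eq)
  finally show ?thesis using d by (simp add: mult_eq_self_implies_10 algebra_simps)
qed

text \<open>As a polynomial in \<open>t\<^sup>2\<close> the difference of the two sides has all
  nonnegative reals as zeros.\<close>

lemma even_polynomial_eq:
  fixes a b :: "nat \<Rightarrow> real"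
  assumes "\<And>t::real. (\<Sum>m\<le>k. a m * t ^ (2 * m)) = (\<Sum>m\<le>k. b m * t ^ (2 * m))" "m \<le> k"
  shows "a m = b m"
proof -
  define p where "p = (\<Sum>m\<le>k. monom (a m - b m) m)"
  have "poly p (t\<^sup>2) = 0" for t
    using assms(1)[of t] by (simp add: p_def poly_sum poly_monom left_diff_distrib sum_subtractf power_mult)
  then have "poly p x = 0" if "0 \<le> x" for x
    using that by (metis real_sqrt_pow2)
  then have "{0..} \<subseteq> {x. poly p x = 0}" by auto
  moreover have "infinite {0::real..}" by (rule infinite_Ici)
  ultimately have "p = 0" using poly_roots_finite finite_subset by blast
  then have "coeff p m = 0" by simp
  also have "coeff p m = a m - b m"
    using assms(2) by (simp add: p_def coeff_sum if_distrib cong: if_cong)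
  finally show ?thesis by simp
qed

section \<open>Moments of the ball against a radial weight\<close>

context
  fixes \<psi> :: "complex^'n::finite \<Rightarrow> real" and \<phi> :: "real \<Rightarrow> real"
  assumes radial: "\<And>w. \<psi> w = \<phi> (norm w)" and pos: "\<And>w. 0 \<le> \<psi> w"
    and meas [measurable]: "\<psi> \<in> borel_measurable borel" and int: "integrable dV \<psi>"
begin

lemma radial_inv: "norm x = norm y \<Longrightarrow> \<psi> x = \<psi> y"
  by (simp add: radial)

lemma radial_integrable_mult:
  fixes F :: "complex^'n \<Rightarrow> complex"
  assumes [measurable]: "F \<in> borel_measurable borel" and bd: "\<And>w. norm w < 1 \<Longrightarrow> norm (F w) \<le> C"
  shows "integrable dV (\<lambda>w. F w * of_real (\<psi> w))"
proof (rule Bochner_Integration.integrable_bound)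
  show "integrable dV (\<lambda>w. C * \<psi> w)" using int by simp
  show "(\<lambda>w. F w * of_real (\<psi> w)) \<in> borel_measurable dV" by measurable
  show "AE w in dV. norm (F w * of_real (\<psi> w)) \<le> norm (C * \<psi> w)"
    using AE_dV_ball
  proof eventually_elim
    fix w :: "complex^'n" assume "w \<in> ball 0 1"
    then have "norm (F w) \<le> C" using bd by simp
    moreover from this have "0 \<le> C" using norm_ge_zero order_trans by blast
    ultimately show "norm (F w * of_real (\<psi> w)) \<le> norm (C * \<psi> w)"
      using pos[of w] by (simp add: norm_mult mult_right_mono)
  qed
qed

lemma radial_integrable_mult_real:
  fixes F :: "complex^'n \<Rightarrow> real"
  assumes [measurable]: "F \<in> borel_measurable borel" and bd: "\<And>w. norm w < 1 \<Longrightarrow> \<bar>F w\<bar> \<le> C"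
  shows "integrable dV (\<lambda>w. F w * \<psi> w)"
  using radial_integrable_mult[of "\<lambda>w. of_real (F w)" C] bd
  by (simp flip: of_real_mult add: complex_of_real_integrable_eq)

text \<open>An isometry turns the functional defined by \<open>z\<close> into \<open>norm z\<close>
  times a coordinate, up to a phase, and leaves the radial weight unchanged.\<close>

lemma moment_hip:
  "(\<integral>w. norm (hip w z) ^ (2 * k) * \<psi> w \<partial>dV) = norm z ^ (2 * k) * (\<integral>w. norm (w $ i) ^ (2 * k) * \<psi> w \<partial>dV)"
proof -
  obtain T c where T: "linear T" "\<And>x. norm (T x) = norm x" and c: "norm c = 1"
    "\<And>w. hip (T w) z = c * of_real (norm z) * w $ i"
    using isometry_to_axis[of z i] by metis
  have "(\<integral>w. norm (hip w z) ^ (2 * k) * \<psi> w \<partial>dV) = (\<integral>w. norm (hip (T w) z) ^ (2 * k) * \<psi> (T w) \<partial>dV)"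
    by (rule dV_integral_isometry[OF T, symmetric]) measurable
  also have "\<dots> = (\<integral>w. norm z ^ (2 * k) * (norm (w $ i) ^ (2 * k) * \<psi> w) \<partial>dV)"
    using radial_inv[OF T(2)] by (simp add: c norm_mult power_mult_distrib mult.assoc)
  finally show ?thesis by simp
qed

text \<open>Multiplying \<open>w\<close> by a suitable unimodular constant preserves
  \<open>dV\<close> and \<open>\<psi>\<close> but reverses the sign of the integrand.\<close>

lemma moment_hip_orth:
  assumes "m \<noteq> m'"
  shows "(\<integral>w. hip w z ^ m * cnj (hip w z ^ m') * of_real (\<psi> w) \<partial>dV) = 0"
proof -
  obtain c :: complex where c: "norm c = 1" "c ^ m * cnj (c ^ m') = -1"
    using phase_distinct[OF assms] .
  have cm: "(\<lambda>w. cnj (hip w z)) \<in> borel_measurable borel"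
    by (intro borel_measurable_continuous_onI continuous_intros)
  show ?thesis
  proof (rule integral_dV_eq_0[where T = "\<lambda>w. c *s w" and d = "-1"])
    show "norm (c *s x) = norm x" for x :: "complex^'n" using c by (simp add: norm_scale_vec)
    show "(\<lambda>w. hip w z ^ m * cnj (hip w z ^ m') * of_real (\<psi> w)) \<in> borel_measurable borel"
      using cm by simp measurable
    show "hip (c *s w) z ^ m * cnj (hip (c *s w) z ^ m') * of_real (\<psi> (c *s w)) =
         -1 * (hip w z ^ m * cnj (hip w z ^ m') * of_real (\<psi> w))" for w
    proof -
      have e: "\<psi> (c *s w) = \<psi> w" using c by (intro radial_inv) (simp add: norm_scale_vec)
      have "hip (c *s w) z ^ m * cnj (hip (c *s w) z ^ m') * of_real (\<psi> (c *s w)) =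
         (c ^ m * cnj (c ^ m')) * (hip w z ^ m * cnj (hip w z ^ m') * of_real (\<psi> w))"
        unfolding e hip_scale_left power_mult_distrib complex_cnj_mult by (simp only: mult_ac)
      then show ?thesis by (simp only: c)
    qed
  qed (use linear_scale_vec in auto)
qed

text \<open>Unitary invariance makes the \<open>2 * k\<close>-th moment of
  \<open>w $ i + t * w $ j\<close> equal to \<open>(1 + t\<^sup>2) ^ k\<close> times that of
  \<open>w $ i\<close>. When the same moment is expanded by the binomial theorem, rotation of the
  \<open>j\<close>-th coordinate kills all mixed products of monomials, and comparing the
  coefficients of \<open>t\<^sup>2\<close> gives the claim.\<close>

lemma moment_mixed:
  assumes ij: "i \<noteq> j" and k: "k \<ge> 1"
  shows "k * (\<integral>w. (norm (w $ j))\<^sup>2 * norm (w $ i) ^ (2 * (k - 1)) * \<psi> w \<partial>dV) = (\<integral>w. norm (w $ i) ^ (2 * k) * \<psi> w \<partial>dV)"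
proof -
  define J where "J = (\<integral>w. norm (w $ i) ^ (2 * k) * \<psi> w \<partial>dV)"
  define A where "A m = (\<integral>w. norm (w $ j) ^ (2 * m) * norm (w $ i) ^ (2 * (k - m)) * \<psi> w \<partial>dV)" for m
  define u where "u m w = (w $ j) ^ m * (w $ i) ^ (k - m)" for m and w :: "complex^'n"
  have cm [measurable]: "(\<lambda>w. cnj (w $ l)) \<in> borel_measurable (borel :: (complex^'n) measure)" for l
    by (intro borel_measurable_continuous_onI continuous_intros)
  have [measurable]: "u m \<in> borel_measurable borel" for m unfolding u_def by measurable
  have [measurable]: "(\<lambda>w. cnj (u m w)) \<in> borel_measurable borel" for m unfolding u_def by simp
  have u1: "norm (u m w) \<le> 1" if "norm w < 1" for m w
  proof -
    have "norm (w $ l) \<le> 1" for l using Finite_Cartesian_Product.norm_nth_le[of w l] that by linarith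
    then show ?thesis unfolding u_def norm_mult norm_power by (intro mult_le_one power_le_one) auto
  qed
  have int_u: "integrable dV (\<lambda>w. u m w * cnj (u m' w) * of_real (\<psi> w))" for m m'
    using u1 by (intro radial_integrable_mult[of _ 1]) (auto simp: norm_mult intro!: mult_le_one)
  have orth: "(\<integral>w. u m w * cnj (u m' w) * of_real (\<psi> w) \<partial>dV) = (if m = m' then of_real (A m) else 0)" for m m'
  proof (cases "m = m'")
    case True
    have "u m w * cnj (u m w) = of_real (norm (w $ j) ^ (2 * m) * norm (w $ i) ^ (2 * (k - m)))" for w
      unfolding complex_norm_square[symmetric]
      by (simp add: u_def norm_mult norm_power power_mult_distrib power_mult[symmetric] mult.commute)
    then have "(\<integral>w. u m w * cnj (u m w) * of_real (\<psi> w) \<partial>dV) =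
        (\<integral>w. of_real (norm (w $ j) ^ (2 * m) * norm (w $ i) ^ (2 * (k - m)) * \<psi> w) \<partial>dV)"
      by simp
    then show ?thesis using True unfolding A_def integral_complex_of_real by simp
  next
    case False
    then obtain c :: complex where c: "norm c = 1" "c ^ m * cnj (c ^ m') = -1"
      by (rule phase_distinct)
    have u_ph: "u m (phase j c w) = c ^ m * u m w" for m w
      using ij by (simp add: u_def phase_def power_mult_distrib)
    have "(\<integral>w. u m w * cnj (u m' w) * of_real (\<psi> w) \<partial>dV) = 0"
    proof (rule integral_dV_eq_0[where T = "phase j c" and d = "-1"])
      fix w
      have e: "\<psi> (phase j c w) = \<psi> w" using c by (intro radial_inv norm_phase)
      have "u m (phase j c w) * cnj (u m' (phase j c w)) * of_real (\<psi> (phase j c w)) =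
         (c ^ m * cnj (c ^ m')) * (u m w * cnj (u m' w) * of_real (\<psi> w))"
        unfolding e u_ph complex_cnj_mult by (simp only: mult_ac)
      then show "u m (phase j c w) * cnj (u m' (phase j c w)) * of_real (\<psi> (phase j c w)) =
         -1 * (u m w * cnj (u m' w) * of_real (\<psi> w))" by (simp only: c)
    qed (use c in \<open>auto simp: linear_phase norm_phase\<close>)
    then show ?thesis using False by simp
  qed
  have main: "(1 + t\<^sup>2) ^ k * J = (\<Sum>m\<le>k. (real (k choose m))\<^sup>2 * t ^ (2 * m) * A m)" for t :: real
  proof -
    define z :: "complex^'n" where "z = axis i 1 + of_real t *s axis j 1"
    have hz: "hip w z = w $ i + of_real t * w $ j" for w
      by (simp add: z_def hip_add_right hip_scale_right)
        (simp add: hip_def axis_def if_distrib cong: if_cong)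
    have "complex_of_real ((norm z)\<^sup>2) = hip z z" by (simp add: hip_self)
    also have "\<dots> = of_real (1 + t\<^sup>2)"
      unfolding hz using ij by (simp add: z_def axis_def power2_eq_square)
    finally have nz: "(norm z)\<^sup>2 = 1 + t\<^sup>2" by (simp only: of_real_eq_iff)
    have "complex_of_real ((1 + t\<^sup>2) ^ k * J) = of_real (\<integral>w. norm (hip w z) ^ (2 * k) * \<psi> w \<partial>dV)"
      unfolding moment_hip[of z k i] J_def by (simp add: power_mult nz)
    also have "\<dots> = (\<integral>w. hip w z ^ k * cnj (hip w z ^ k) * of_real (\<psi> w) \<partial>dV)"
      unfolding integral_complex_of_real[symmetric] complex_norm_square[symmetric]
      by (simp add: norm_power power_mult[symmetric] mult.commute)
    also have "\<dots> = (\<integral>w. (\<Sum>m\<le>k. \<Sum>m'\<le>k. of_real (real (k choose m) * real (k choose m') * t ^ m * t ^ m') *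
        (u m w * cnj (u m' w) * of_real (\<psi> w))) \<partial>dV)"
    proof (intro Bochner_Integration.integral_cong refl)
      fix w :: "complex^'n"
      have e: "hip w z ^ k = (\<Sum>m\<le>k. of_real (real (k choose m) * t ^ m) * u m w)"
        unfolding hz add.commute[of "w $ i"] binomial_ring
        by (intro sum.cong refl) (simp add: u_def power_mult_distrib)
      show "hip w z ^ k * cnj (hip w z ^ k) * of_real (\<psi> w) =
        (\<Sum>m\<le>k. \<Sum>m'\<le>k. of_real (real (k choose m) * real (k choose m') * t ^ m * t ^ m') *
        (u m w * cnj (u m' w) * of_real (\<psi> w)))"
        unfolding e cnj_sum unfolding sum_product unfolding sum_distrib_right
        by (intro sum.cong refl) (simp add: mult_ac)
    qed
    also have "\<dots> = (\<Sum>m\<le>k. \<Sum>m'\<le>k. of_real (real (k choose m) * real (k choose m') * t ^ m * t ^ m') *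
        (if m = m' then of_real (A m) else 0))"
      by (simp add: Bochner_Integration.integral_sum int_u orth integral_mult_right_zero)
    also have "\<dots> = (\<Sum>m\<le>k. of_real ((real (k choose m))\<^sup>2 * t ^ (2 * m) * A m))"
      by (intro sum.cong refl)
        (simp add: if_distrib sum.delta power2_eq_square mult_2 power_add mult.assoc mult.left_commute cong: if_cong)
    also have "\<dots> = of_real (\<Sum>m\<le>k. (real (k choose m))\<^sup>2 * t ^ (2 * m) * A m)" by simp
    finally show ?thesis by (simp only: of_real_eq_iff)
  qed
  have "(\<Sum>m\<le>k. ((real (k choose m))\<^sup>2 * A m) * t ^ (2 * m)) = (\<Sum>m\<le>k. (real (k choose m) * J) * t ^ (2 * m))" for t
  proof -
    have "(1 + t\<^sup>2) ^ k * J = (\<Sum>m\<le>k. real (k choose m) * J * t ^ (2 * m))"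
      unfolding add.commute[of 1] binomial_ring sum_distrib_right
      by (intro sum.cong refl) (simp add: power_mult)
    then show ?thesis using main[of t] by (simp add: mult_ac)
  qed
  \<comment> \<open>The coefficient of \<open>t\<^sup>2\<close> has index \<open>m = 1\<close> and
    reads \<open>k\<^sup>2 * A 1 = k * J\<close>.\<close>
  from even_polynomial_eq[where k = k and a = "\<lambda>m. (real (k choose m))\<^sup>2 * A m" and b = "\<lambda>m. real (k choose m) * J", OF this k]
  have "k * A 1 = J" using k by (simp add: power2_eq_square)
  then show ?thesis by (simp add: A_def J_def)
qed

text \<open>When \<open>(norm w)\<^sup>2\<close> is split into coordinates, the summand with index
  \<open>i\<close> is the moment itself, and each of the other \<open>CARD('n) - 1\<close> summands
  is the moment divided by \<open>k\<close>, by \<open>moment_mixed\<close>.\<close>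

lemma moment_recursion:
  assumes k: "k \<ge> 1"
  shows "(real k + real CARD('n) - 1) * (\<integral>w. norm (w $ i) ^ (2 * k) * \<psi> w \<partial>dV) =
    k * (\<integral>w. (norm w)\<^sup>2 * norm (w $ i) ^ (2 * (k - 1)) * \<psi> w \<partial>dV)"
proof -
  define J where "J = (\<integral>w. norm (w $ i) ^ (2 * k) * \<psi> w \<partial>dV)"
  have c1: "norm (w $ l) \<le> 1" if "norm w < 1" for w :: "complex^'n" and l
    using Finite_Cartesian_Product.norm_nth_le[of w l] that by linarith
  have int1: "integrable dV (\<lambda>w. (norm (w $ j))\<^sup>2 * norm (w $ i) ^ (2 * (k - 1)) * \<psi> w)" for j
    using c1 by (intro radial_integrable_mult_real[of _ 1]) (auto simp: abs_mult intro!: mult_le_one power_le_one)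
  have "(\<integral>w. (norm w)\<^sup>2 * norm (w $ i) ^ (2 * (k - 1)) * \<psi> w \<partial>dV) =
      (\<integral>w. (\<Sum>j\<in>UNIV. (norm (w $ j))\<^sup>2 * norm (w $ i) ^ (2 * (k - 1)) * \<psi> w) \<partial>dV)"
    by (simp add: norm_vec_def L2_set_def sum_nonneg sum_distrib_right)
  also have "\<dots> = (\<Sum>j\<in>UNIV. \<integral>w. (norm (w $ j))\<^sup>2 * norm (w $ i) ^ (2 * (k - 1)) * \<psi> w \<partial>dV)"
    by (rule Bochner_Integration.integral_sum) (rule int1)
  also have "\<dots> = J + (\<Sum>j\<in>UNIV - {i}. J / k)"
  proof -
    have "(norm (w $ i))\<^sup>2 * norm (w $ i) ^ (2 * (k - 1)) = norm (w $ i) ^ (2 * k)" for w :: "complex^'n"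
      using k by (cases k) (simp_all add: power2_eq_square mult.assoc)
    then have "(\<integral>w. (norm (w $ i))\<^sup>2 * norm (w $ i) ^ (2 * (k - 1)) * \<psi> w \<partial>dV) = J"
      by (simp add: J_def)
    moreover have "(\<integral>w. (norm (w $ j))\<^sup>2 * norm (w $ i) ^ (2 * (k - 1)) * \<psi> w \<partial>dV) = J / k" if "j \<in> UNIV - {i}" for j
      using moment_mixed[of i j k] that k by (simp add: J_def field_simps)
    ultimately show ?thesis by (subst sum.remove[of UNIV i]) auto
  qed
  also have "(\<Sum>j\<in>UNIV - {i}. J / k) = (real CARD('n) - 1) * (J / k)"
    by (simp add: card_Diff_singleton of_nat_diff Suc_le_eq)
  finally show ?thesis using k unfolding J_def[symmetric] by (simp add: field_simps)
qed

end

text \<open>Induction on \<open>k\<close> for all \<open>b\<close> at once: the recursion leads to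
  the preceding moment with an additional factor \<open>(norm w)\<^sup>2 = 1 - pw w\<close>, and the
  factor \<open>pw w\<close> raises \<open>b\<close> by one.\<close>

lemma moment_formula:
  assumes b: "0 < b"
  shows "(\<integral>w. norm (w $ i) ^ (2 * k) * pw w powr (b - 1) \<partial>(dV :: (complex^'n::finite) measure)) =
    fact CARD('n) * fact k * Gamma b / Gamma (real CARD('n) + real k + b)"
  using b
proof (induction k arbitrary: b)
  case 0
  then show ?case using pw_powr_integral(2)[of b, where 'n='n] by simp
next
  case (Suc k)
  let ?N = "real CARD('n)" and ?I = "\<lambda>F. integral\<^sup>L (dV :: (complex^'n) measure) F"
  have rad: "pw w powr (b - 1) = (\<lambda>r. (1 - r\<^sup>2) powr (b - 1)) (norm w)" for w :: "complex^'n" and b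
    by (simp add: pw_def)
  note recursion = moment_recursion[of "\<lambda>w. pw w powr (b - 1)", OF rad _ _ pw_powr_integral(1)]
  have c1: "norm (w $ l) \<le> 1" if "norm w < 1" for w :: "complex^'n" and l
    using Finite_Cartesian_Product.norm_nth_le[of w l] that by linarith
  have int: "integrable (dV :: (complex^'n) measure) (\<lambda>w. norm (w $ i) ^ (2 * k) * pw w powr (b - 1))" if "0 < b" for b
    using c1 that by (intro radial_integrable_mult_real[where C = 1, OF rad _ _ pw_powr_integral(1)])
       (auto intro!: power_le_one)
  have "?I (\<lambda>w. (norm w)\<^sup>2 * norm (w $ i) ^ (2 * k) * pw w powr (b - 1)) =
      ?I (\<lambda>w. norm (w $ i) ^ (2 * k) * pw w powr (b - 1) - norm (w $ i) ^ (2 * k) * pw w powr ((b + 1) - 1))"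
  proof (rule integral_cong_AE)
    show "AE w in (dV :: (complex^'n) measure). (norm w)\<^sup>2 * norm (w $ i) ^ (2 * k) * pw w powr (b - 1) =
       norm (w $ i) ^ (2 * k) * pw w powr (b - 1) - norm (w $ i) ^ (2 * k) * pw w powr ((b + 1) - 1)"
      using AE_dV_ball
    proof eventually_elim
      fix w :: "complex^'n" assume "w \<in> ball 0 1"
      then have p: "0 < pw w" by (rule pw_pos)
      have e1: "pw w powr ((b + 1) - 1) = pw w * pw w powr (b - 1)"
        using p by (simp add: powr_mult_base)
      have e2: "(norm w)\<^sup>2 = 1 - pw w" by (simp add: pw_def)
      show "(norm w)\<^sup>2 * norm (w $ i) ^ (2 * k) * pw w powr (b - 1) =
       norm (w $ i) ^ (2 * k) * pw w powr (b - 1) - norm (w $ i) ^ (2 * k) * pw w powr ((b + 1) - 1)"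
        unfolding e1 e2 by (simp add: algebra_simps)
    qed
  qed measurable
  also have "\<dots> = ?I (\<lambda>w. norm (w $ i) ^ (2 * k) * pw w powr (b - 1)) - ?I (\<lambda>w. norm (w $ i) ^ (2 * k) * pw w powr ((b + 1) - 1))"
    using Suc.prems by (intro Bochner_Integration.integral_diff int) auto
  also have "\<dots> = fact CARD('n) * fact k * Gamma b / Gamma (?N + k + b) -
      fact CARD('n) * fact k * Gamma (b + 1) / Gamma (?N + k + (b + 1))"
    using Suc.IH[of b] Suc.IH[of "b + 1"] Suc.prems by simp
  also have "\<dots> = fact CARD('n) * fact k * Gamma b * (?N + k) / Gamma (?N + k + b + 1)"
  proof -
    have "Gamma (b + 1) = b * Gamma b" using Suc.prems by (intro Gamma_plus1) (auto dest: nonpos_Ints_nonpos)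
    moreover have "Gamma (?N + k + b + 1) = (?N + k + b) * Gamma (?N + k + b)"
      using Suc.prems by (intro Gamma_plus1) (auto dest!: nonpos_Ints_nonpos)
    moreover have "Gamma (?N + k + b) > 0" "?N + k + b > 0" using Suc.prems by (auto intro!: Gamma_real_pos add_nonneg_pos)
    moreover have "F * X / G - F * (b * X) / ((?N + k + b) * G) = F * X * (?N + k) / ((?N + k + b) * G)"
      if "0 < G" "0 < ?N + k + b" for F X G :: real
    proof -
      have "F * X / G = F * X * (?N + k + b) / ((?N + k + b) * G)" using that by simp
      then show ?thesis by (simp only: diff_divide_distrib[symmetric]) (simp add: algebra_simps)
    qed
    ultimately show ?thesis by (simp only: add.assoc[symmetric])
  qed
  finally have eq: "?I (\<lambda>w. (norm w)\<^sup>2 * norm (w $ i) ^ (2 * k) * pw w powr (b - 1)) =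
     fact CARD('n) * fact k * Gamma b * (?N + k) / Gamma (?N + k + b + 1)" .
  have "(?N + k) * ?I (\<lambda>w. norm (w $ i) ^ (2 * Suc k) * pw w powr (b - 1)) =
      Suc k * ?I (\<lambda>w. (norm w)\<^sup>2 * norm (w $ i) ^ (2 * k) * pw w powr (b - 1))"
    using recursion[of "Suc k" i] Suc.prems by (simp add: add_ac)
  also have "\<dots> = (?N + k) * (fact CARD('n) * fact (Suc k) * Gamma b / Gamma (?N + Suc k + b))"
    unfolding eq by (simp add: add_ac mult_ac)
  finally have "(?N + k) * ?I (\<lambda>w. norm (w $ i) ^ (2 * Suc k) * pw w powr (b - 1)) =
      (?N + k) * (fact CARD('n) * fact (Suc k) * Gamma b / Gamma (?N + Suc k + b))" .
  moreover have "?N + k \<noteq> 0" by (simp add: add_nonneg_eq_0_iff)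
  ultimately show ?case by (simp only: mult_cancel_left) simp
qed

section \<open>The binomial series with negative exponent\<close>

definition nbinom :: "real \<Rightarrow> nat \<Rightarrow> real" where
  "nbinom s k = pochhammer s k / fact k"

text \<open>Because of this sign the real series at \<open>norm z\<close> dominates the complex
  series at \<open>hip w z\<close> for all \<open>w\<close> in the ball.\<close>

lemma nbinom_nonneg: "0 < s \<Longrightarrow> 0 \<le> nbinom s k"
  by (simp add: nbinom_def pochhammer_nonneg)

lemma nbinom_sums_real:
  assumes "\<bar>x\<bar> < 1"
  shows "(\<lambda>k. nbinom s k * x ^ k) sums (1 - x) powr (- s)"
proof -
  have "(\<lambda>k. (- s gchoose k) * (- x) ^ k) sums (1 + (- x)) powr (- s)"
    using assms by (intro gen_binomial_real) simp
  also have "(\<lambda>k. (- s gchoose k) * (- x) ^ k) = (\<lambda>k. nbinom s k * x ^ k)"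
  proof
    fix k
    have "(- 1 :: real) ^ k * (- 1) ^ k = 1" by (simp flip: power_mult_distrib)
    then have "((- 1) ^ k * (pochhammer s k / fact k)) * ((- 1) ^ k * x ^ k) = pochhammer s k / fact k * x ^ k"
      by (simp only: mult_ac) simp
    then show "(- s gchoose k) * (- x) ^ k = nbinom s k * x ^ k"
      by (simp add: gbinomial_pochhammer nbinom_def power_minus[of x])
  qed
  finally show ?thesis by simp
qed

lemma nbinom_sums_complex:
  fixes x :: complex
  assumes "norm x < 1"
  shows "(\<lambda>k. of_real (nbinom s k) * x ^ k) sums (1 - x) powr (- of_real s)"
proof -
  have "(\<lambda>k. (- of_real s gchoose k) * (- x) ^ k) sums (1 + (- x)) powr (- of_real s)"
    using assms by (intro gen_binomial_complex) simp
  also have "(\<lambda>k. (- of_real s gchoose k) * (- x) ^ k) = (\<lambda>k. of_real (nbinom s k) * x ^ k)"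
  proof
    fix k
    have "(- 1 :: complex) ^ k * (- 1) ^ k = 1" by (simp flip: power_mult_distrib)
    then have "((- 1) ^ k * (of_real (pochhammer s k) / fact k)) * ((- 1) ^ k * x ^ k) = of_real (pochhammer s k) / fact k * x ^ k"
      by (simp only: mult_ac) simp
    then show "(- of_real s gchoose k) * (- x) ^ k = of_real (nbinom s k) * x ^ k"
      by (simp add: gbinomial_pochhammer nbinom_def power_minus[of x] pochhammer_of_real)
  qed
  finally show ?thesis by simp
qed

lemma Gamma_log_convex_mid:
  assumes "0 < x" "0 < (y::real)"
  shows "(Gamma ((x + y) / 2))\<^sup>2 \<le> Gamma x * Gamma y"
proof -
  have "(ln \<circ> Gamma) ((1 - 1/2) *\<^sub>R x + (1/2) *\<^sub>R y) \<le> (1 - 1/2) * (ln \<circ> Gamma) x + (1/2) * (ln \<circ> Gamma) y"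
    by (rule convex_onD[OF log_convex_Gamma_real]) (use assms in auto)
  then have "2 * ln (Gamma ((x + y) / 2)) \<le> ln (Gamma x) + ln (Gamma y)"
    by (simp add: field_simps)
  moreover have pos: "0 < Gamma x" "0 < Gamma y" "0 < Gamma ((x + y) / 2)"
    using assms by (auto intro!: Gamma_real_pos)
  ultimately have "ln ((Gamma ((x + y) / 2))\<^sup>2) \<le> ln (Gamma x * Gamma y)"
    by (simp add: ln_mult ln_realpow)
  then show ?thesis using pos by (subst (asm) ln_le_cancel_iff) auto
qed

lemma one_minus_hip_ge:
  assumes "norm w \<le> 1"
  shows "1 - norm z \<le> norm (1 - hip w z)"
proof -
  have "norm (hip w z) \<le> norm w * norm z" by (rule norm_hip_le)
  also have "\<dots> \<le> norm z" using assms by (simp add: mult_left_le_one_le)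
  finally show ?thesis using norm_triangle_ineq2[of 1 "hip w z"] by simp
qed

lemma norm_hip_ball:
  assumes "norm w < 1" shows "norm (hip w z) \<le> norm z"
  using norm_hip_le[of w z] assms mult_left_le_one_le[of "norm z" "norm w"] by simp

lemma hip_eq_cnj_norm: "norm (hip z w) = norm (hip w z)" "norm (1 - hip z w) = norm (1 - hip w z)"
proof -
  show "norm (hip z w) = norm (hip w z)" by (subst hip_commute) simp
  have "1 - hip z w = cnj (1 - hip w z)" by (simp add: hip_commute[of z w])
  then show "norm (1 - hip z w) = norm (1 - hip w z)" by (simp only: complex_mod_cnj)
qed

text \<open>The exponents are such that \<open>2\<sigma> = N + 1/2\<close>, so that \<open>k + \<sigma>\<close> is the midpoint of
  \<open>k + 1/4\<close> and \<open>k + N + 1/4\<close>: log-convexity of the Gamma function bounds the coefficients of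
  the series exactly.\<close>

lemma Forelli_Rudin:
  defines "\<sigma> \<equiv> (real CARD('n::finite) + 1 / 2) / 2"
  shows "\<exists>C>0. \<forall>z :: complex^'n. z \<in> ball 0 1 \<longrightarrow>
    integrable dV (\<lambda>w. norm (1 - hip w z) powr (- 2 * \<sigma>) * pw w powr (- 3 / 4)) \<and>
    (\<integral>w. norm (1 - hip w z) powr (- 2 * \<sigma>) * pw w powr (- 3 / 4) \<partial>dV) \<le> C * pw z powr (- 1 / 4)"
proof -
  define N where "N = real CARD('n)"
  define C where "C = fact CARD('n) * (Gamma (1/4))\<^sup>2 / (Gamma \<sigma>)\<^sup>2"
  define \<psi> :: "complex^'n \<Rightarrow> real" where "\<psi> w = pw w powr (1 / 4 - 1)" for w
  have \<sigma>: "0 < \<sigma>" by (simp add: \<sigma>_def add_nonneg_pos)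
  have G: "0 < Gamma (1/4::real)" "0 < Gamma \<sigma>" using \<sigma> by (auto intro!: Gamma_real_pos)
  have C: "0 < C" using G unfolding C_def by (intro divide_pos_pos mult_pos_pos zero_less_power) auto
  have rad: "\<psi> w = (\<lambda>r. (1 - r\<^sup>2) powr (1/4 - 1)) (norm w)" for w
    by (simp add: \<psi>_def pw_def)
  have pos: "0 \<le> \<psi> w" for w by (simp add: \<psi>_def)
  have meas [measurable]: "\<psi> \<in> borel_measurable borel" unfolding \<psi>_def by measurable
  have int\<psi>: "integrable dV \<psi>" unfolding \<psi>_def by (rule pw_powr_integral) simp
  note ctx = rad pos meas int\<psi>
  define i :: 'n where "i = (SOME i. True)"
  define J where "J k = (\<integral>w. norm (w $ i) ^ (2 * k) * \<psi> w \<partial>dV)" for k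
  \<comment> \<open>Compares the terms of the squared series with those of
    \<open>C * (1 - x) powr (- 1 / 4)\<close> at \<open>x = (norm z)\<^sup>2\<close>, which sum to
    the claimed bound.\<close>
  have coeff: "(nbinom \<sigma> k)\<^sup>2 * J k \<le> C * nbinom (1/4) k" for k
  proof -
    have J: "J k = fact CARD('n) * fact k * Gamma (1/4) / Gamma (N + k + 1/4)"
      unfolding J_def \<psi>_def N_def by (rule moment_formula) simp
    have b: "nbinom \<sigma> k = Gamma (\<sigma> + k) / (Gamma \<sigma> * fact k)"
      using \<sigma> by (subst nbinom_def, subst pochhammer_Gamma) (auto dest: nonpos_Ints_nonpos)
    have q: "nbinom (1/4) k = Gamma (1/4 + k) / (Gamma (1/4) * fact k)"
      by (subst nbinom_def, subst pochhammer_Gamma) (auto dest: nonpos_Ints_nonpos)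
    have "(Gamma (((1/4 + k) + (N + k + 1/4)) / 2))\<^sup>2 \<le> Gamma (1/4 + k) * Gamma (N + k + 1/4)"
      by (rule Gamma_log_convex_mid) (auto simp: N_def intro: add_pos_nonneg add_nonneg_pos)
    also have "((1/4 + k) + (N + k + 1/4)) / 2 = \<sigma> + k"
      by (simp add: \<sigma>_def N_def field_simps)
    finally have mid: "(Gamma (\<sigma> + k))\<^sup>2 \<le> Gamma (1/4 + k) * Gamma (N + k + 1/4)" .
    have GN: "0 < Gamma (N + k + 1/4)"
      by (intro Gamma_real_pos) (auto simp: N_def intro: add_nonneg_pos)
    have "(nbinom \<sigma> k)\<^sup>2 * J k = (Gamma (\<sigma> + k))\<^sup>2 * (fact CARD('n) * Gamma (1/4) / ((Gamma \<sigma>)\<^sup>2 * fact k * Gamma (N + k + 1/4)))"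
      using G by (simp add: b J power_divide power_mult_distrib) (simp add: power2_eq_square)
    also have "\<dots> \<le> (Gamma (1/4 + k) * Gamma (N + k + 1/4)) * (fact CARD('n) * Gamma (1/4) / ((Gamma \<sigma>)\<^sup>2 * fact k * Gamma (N + k + 1/4)))"
      using G GN by (intro mult_right_mono mid) auto
    also have "\<dots> = C * nbinom (1/4) k"
      using G GN by (simp add: C_def q power2_eq_square)
    finally show ?thesis .
  qed
  show ?thesis
  proof (intro exI[of _ C] conjI[OF C] allI impI)
    fix z :: "complex^'n" assume "z \<in> ball 0 1"
    then have z: "norm z < 1" by simp
    define h where "h w = hip w z" for w
    have [measurable]: "h \<in> borel_measurable borel" unfolding h_def by measurable
    have cm [measurable]: "(\<lambda>w. cnj (h w)) \<in> borel_measurable borel"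
      unfolding h_def by (intro borel_measurable_continuous_onI continuous_intros)
    have h1: "norm (h w) \<le> norm z" if "norm w < 1" for w
      unfolding h_def using that by (rule norm_hip_ball)
    define S where "S n w = (\<Sum>k<n. of_real (nbinom \<sigma> k) * h w ^ k)" for n w
    have [measurable]: "S n \<in> borel_measurable borel" for n unfolding S_def by measurable
    \<comment> \<open>A bound for all partial sums on the ball. It depends on \<open>z\<close>, but
      serves only as a majorant for dominated convergence with \<open>z\<close> fixed.\<close>
    define B where "B = (1 - norm z) powr (- \<sigma>)"
    have Bs: "(\<lambda>k. nbinom \<sigma> k * norm z ^ k) sums B"
      unfolding B_def using z by (intro nbinom_sums_real) simp
    have SB: "norm (S n w) \<le> B" if "norm w < 1" for n w
    proof -
      have "norm (S n w) \<le> (\<Sum>k<n. nbinom \<sigma> k * norm z ^ k)"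
        unfolding S_def
        by (intro sum_norm_le) (auto simp: norm_mult norm_power nbinom_nonneg[OF \<sigma>] intro!: mult_left_mono power_mono h1 that)
      also have "\<dots> \<le> B"
        using Bs nbinom_nonneg[OF \<sigma>] by (intro sum_le_suminf[OF sums_summable, OF Bs, unfolded sums_unique[OF Bs, symmetric]]) auto
      finally show ?thesis .
    qed
    have Bpos: "0 \<le> B" by (simp add: B_def)
    have lim: "(\<lambda>n. (norm (S n w))\<^sup>2 * \<psi> w) \<longlonglongrightarrow> norm (1 - h w) powr (- 2 * \<sigma>) * \<psi> w" if w: "norm w < 1" for w
    proof -
      have "(\<lambda>n. S n w) \<longlonglongrightarrow> (1 - h w) powr (- of_real \<sigma>)"
        unfolding S_def using nbinom_sums_complex[of "h w" \<sigma>] h1[OF w] z by (simp add: sums_def)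
      then have "(\<lambda>n. (norm (S n w))\<^sup>2 * \<psi> w) \<longlonglongrightarrow> (norm ((1 - h w) powr (- of_real \<sigma>)))\<^sup>2 * \<psi> w"
        by (intro tendsto_intros)
      also have "norm ((1 - h w) powr (- of_real \<sigma>)) = norm (1 - h w) powr (- \<sigma>)"
        by (subst norm_powr_real_powr') auto
      also have "(norm (1 - h w) powr (- \<sigma>))\<^sup>2 = norm (1 - h w) powr (- 2 * \<sigma>)"
        by (simp add: power2_eq_square powr_add[symmetric])
      finally show ?thesis .
    qed
    have dom: "integrable dV (\<lambda>w. B\<^sup>2 * \<psi> w)" using int\<psi> by simp
    have bd: "AE w in dV. norm ((norm (S n w))\<^sup>2 * \<psi> w) \<le> B\<^sup>2 * \<psi> w" for n
      using AE_dV_ball by eventually_elim (auto simp: pos intro!: mult_right_mono power_mono SB)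
    have limAE: "AE w in dV. (\<lambda>n. (norm (S n w))\<^sup>2 * \<psi> w) \<longlonglongrightarrow> norm (1 - h w) powr (- 2 * \<sigma>) * \<psi> w"
      using AE_dV_ball by eventually_elim (use lim in auto)
    have I: "integrable dV (\<lambda>w. norm (1 - h w) powr (- 2 * \<sigma>) * \<psi> w)"
      by (rule integrable_dominated_convergence[OF _ _ dom limAE bd]) measurable
    have L: "(\<lambda>n. \<integral>w. (norm (S n w))\<^sup>2 * \<psi> w \<partial>dV) \<longlonglongrightarrow> (\<integral>w. norm (1 - h w) powr (- 2 * \<sigma>) * \<psi> w \<partial>dV)"
      by (rule integral_dominated_convergence[OF _ _ dom limAE bd]) measurable
    have val: "(\<integral>w. (norm (S n w))\<^sup>2 * \<psi> w \<partial>dV) = (\<Sum>k<n. (nbinom \<sigma> k)\<^sup>2 * J k * ((norm z)\<^sup>2) ^ k)" for n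
    proof -
      have int_h: "integrable dV (\<lambda>w. h w ^ k * cnj (h w ^ l) * of_real (\<psi> w))" for k l
      proof (rule radial_integrable_mult[OF ctx])
        show "(\<lambda>w. h w ^ k * cnj (h w ^ l)) \<in> borel_measurable borel" by simp
        show "norm (h w ^ k * cnj (h w ^ l)) \<le> 1" if "norm w < 1" for w
          using h1[OF that] z by (auto simp: norm_mult norm_power intro!: mult_le_one power_le_one)
      qed
      have "complex_of_real (\<integral>w. (norm (S n w))\<^sup>2 * \<psi> w \<partial>dV) = (\<integral>w. S n w * cnj (S n w) * of_real (\<psi> w) \<partial>dV)"
        unfolding integral_complex_of_real[symmetric] complex_norm_square[symmetric] by simp
      also have "\<dots> = (\<integral>w. (\<Sum>k<n. \<Sum>l<n. of_real (nbinom \<sigma> k * nbinom \<sigma> l) * (h w ^ k * cnj (h w ^ l) * of_real (\<psi> w))) \<partial>dV)"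
        unfolding S_def cnj_sum unfolding sum_product unfolding sum_distrib_right
        by (intro Bochner_Integration.integral_cong refl sum.cong) (simp add: mult_ac)
      also have "\<dots> = (\<Sum>k<n. \<Sum>l<n. of_real (nbinom \<sigma> k * nbinom \<sigma> l) * (if k = l then of_real (norm z ^ (2 * k) * J k) else 0))"
      proof -
        have "(\<integral>w. h w ^ k * cnj (h w ^ l) * of_real (\<psi> w) \<partial>dV) = (if k = l then of_real (norm z ^ (2 * k) * J k) else 0)" for k l
        proof (cases "k = l")
          case True
          have "(\<integral>w. h w ^ k * cnj (h w ^ k) * of_real (\<psi> w) \<partial>dV) = of_real (\<integral>w. norm (h w) ^ (2 * k) * \<psi> w \<partial>dV)"
            unfolding integral_complex_of_real[symmetric] complex_norm_square[symmetric]
            by (simp add: norm_power power_mult[symmetric] mult.commute)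
          also have "\<dots> = of_real (norm z ^ (2 * k) * J k)"
            unfolding h_def J_def by (subst moment_hip[OF ctx, where i = i]) simp
          finally show ?thesis using True by simp
        next
          case False
          then show ?thesis unfolding h_def using moment_hip_orth[OF ctx False, of z] by simp
        qed
        then show ?thesis
          by (simp add: Bochner_Integration.integral_sum int_h[simplified] integral_mult_right_zero)
      qed
      also have "\<dots> = (\<Sum>k<n. of_real ((nbinom \<sigma> k)\<^sup>2 * J k * ((norm z)\<^sup>2) ^ k))"
        by (intro sum.cong refl) (simp add: if_distrib sum.delta power2_eq_square power_mult power_mult_distrib mult_ac cong: if_cong)
      finally show ?thesis by (simp only: of_real_sum[symmetric] of_real_eq_iff)
    qed
    have zz: "\<bar>(norm z)\<^sup>2\<bar> < 1" using z by (simp add: abs_square_less_1)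
    have "(\<integral>w. (norm (S n w))\<^sup>2 * \<psi> w \<partial>dV) \<le> C * pw z powr (- 1 / 4)" for n
    proof -
      have "(\<integral>w. (norm (S n w))\<^sup>2 * \<psi> w \<partial>dV) \<le> (\<Sum>k<n. C * (nbinom (1/4) k * ((norm z)\<^sup>2) ^ k))"
        unfolding val by (intro sum_mono) (auto simp: mult.assoc[symmetric] intro!: mult_right_mono coeff)
      also have "\<dots> = C * (\<Sum>k<n. nbinom (1/4) k * ((norm z)\<^sup>2) ^ k)" by (simp add: sum_distrib_left)
      also have "(\<Sum>k<n. nbinom (1/4) k * ((norm z)\<^sup>2) ^ k) \<le> (1 - (norm z)\<^sup>2) powr (- (1 / 4))"
        using nbinom_sums_real[OF zz, of "1/4"]
        by (simp only: sums_iff, intro sum_le_suminf[THEN order_trans]) (auto intro!: mult_nonneg_nonneg nbinom_nonneg)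
      finally show ?thesis using C by (simp add: pw_def)
    qed
    then have "(\<integral>w. norm (1 - h w) powr (- 2 * \<sigma>) * \<psi> w \<partial>dV) \<le> C * pw z powr (- 1 / 4)"
      by (intro LIMSEQ_le_const2[OF L]) auto
    with I show "integrable dV (\<lambda>w. norm (1 - hip w z) powr (- 2 * \<sigma>) * pw w powr (- 3 / 4)) \<and>
      (\<integral>w. norm (1 - hip w z) powr (- 2 * \<sigma>) * pw w powr (- 3 / 4) \<partial>dV) \<le> C * pw z powr (- 1 / 4)"
      by (simp add: h_def \<psi>_def)
  qed
qed

section \<open>The Bergman kernel\<close>

lemma holomorphic_Cn_on_compose_line:
  assumes f: "f holomorphic_Cn_on S" and b: "\<beta> holomorphic_on T" and T: "open T"
    and sub: "\<And>\<zeta>. \<zeta> \<in> T \<Longrightarrow> a + \<beta> \<zeta> *s b \<in> S"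
  shows "(\<lambda>\<zeta>. f (a + \<beta> \<zeta> *s b)) holomorphic_on T"
proof (rule holomorphic_onI)
  fix x assume x: "x \<in> T"
  obtain D where D: "(f has_derivative D) (at (a + \<beta> x *s b))" "\<And>c v. D (c *s v) = c * D v"
    using f sub[OF x] unfolding holomorphic_Cn_on_def by blast
  have "(\<beta> has_field_derivative deriv \<beta> x) (at x)"
    using holomorphic_derivI[OF b T x] .
  then have "(\<beta> has_derivative (*) (deriv \<beta> x)) (at x)"
    by (simp add: has_field_derivative_def)
  then have "((\<lambda>\<zeta>. \<beta> \<zeta> *s b) has_derivative (\<lambda>h. (deriv \<beta> x * h) *s b)) (at x)"
    by (rule bounded_linear.has_derivative[rotated])
       (auto intro!: linear_conv_bounded_linear[THEN iffD1] linearI simp: vec_eq_iff algebra_simps)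
  then have "((\<lambda>\<zeta>. a + \<beta> \<zeta> *s b) has_derivative (\<lambda>h. (deriv \<beta> x * h) *s b)) (at x)"
    by (auto intro!: derivative_eq_intros)
  from has_derivative_compose[OF this D(1)]
  have "((\<lambda>\<zeta>. f (a + \<beta> \<zeta> *s b)) has_derivative (\<lambda>h. D b * deriv \<beta> x * h)) (at x)"
    by (simp add: D(2) mult_ac)
  then show "(\<lambda>\<zeta>. f (a + \<beta> \<zeta> *s b)) field_differentiable at x within T"
    by (auto simp: field_differentiable_def has_field_derivative_def intro: has_derivative_at_withinI)
qed

lemma open_line_preimage: "open {\<zeta>. a + \<zeta> *s b \<in> ball (0::complex^'n::finite) 1}"
proof -
  have "open ((\<lambda>\<zeta>. a + \<zeta> *s b) -` ball 0 1)"
    by (intro open_vimage continuous_intros open_ball)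
  then show ?thesis by (simp add: vimage_def)
qed

lemma holomorphic_on_line:
  assumes "f holomorphic_Cn_on ball 0 1"
  shows "(\<lambda>\<zeta>. f (a + \<zeta> *s b)) holomorphic_on {\<zeta>. a + \<zeta> *s b \<in> ball 0 1}"
  using holomorphic_Cn_on_compose_line[OF assms, of "\<lambda>x. x" _ a b] open_line_preimage[of a b] by auto

section \<open>Projection onto complex lines and the reproducing formula\<close>

definition proj_line :: "complex^'n::finite \<Rightarrow> complex^'n \<Rightarrow> complex^'n" where
  "proj_line z w = (hip w z / hip z z) *s z"

lemma proj_line_measurable [measurable]: "proj_line z \<in> borel_measurable borel"
  unfolding proj_line_def by measurable

lemma hip_proj_line: "hip (proj_line z w) z = hip w z"
  by (cases "z = 0") (simp_all add: proj_line_def hip_scale_left)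

text \<open>The two components are orthogonal. The factor \<open>c\<close> is free because the
  formula is used both to rotate and to shrink the part orthogonal to \<open>z\<close>.\<close>

lemma norm_proj_decomp: "(norm (proj_line z w + c *s (w - proj_line z w)))\<^sup>2 =
  (norm (proj_line z w))\<^sup>2 + (norm c)\<^sup>2 * (norm (w - proj_line z w))\<^sup>2"
proof -
  let ?P = "proj_line z w" and ?Q = "w - proj_line z w"
  have PQ: "hip ?P ?Q = 0"
  proof -
    have "hip ?Q z = 0" by (simp add: hip_diff_left hip_proj_line)
    then have "hip z ?Q = 0" by (subst hip_commute) simp
    then show ?thesis unfolding proj_line_def[of z w] hip_scale_left by simp
  qed
  have "(norm (?P - (- c) *s ?Q))\<^sup>2 = (norm ?P)\<^sup>2 + (norm c)\<^sup>2 * (norm ?Q)\<^sup>2"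
    unfolding norm_diff_scale_sq PQ by simp
  moreover have "?P - (- c) *s ?Q = ?P + c *s ?Q" by (simp add: vec_eq_iff)
  ultimately show ?thesis by (simp only:)
qed

lemma linear_proj_line: "linear (proj_line z)"
  by (rule linearI) (auto simp: proj_line_def hip_add_left add_divide_distrib vector_sadd_rdistrib
      scaleR_eq_scale_vec hip_scale_left vector_smult_assoc)

lemma norm_proj_rotate:
  assumes "norm c = 1"
  shows "norm (proj_line z w + c *s (w - proj_line z w)) = norm w"
proof -
  have "(norm (proj_line z w + c *s (w - proj_line z w)))\<^sup>2 = (norm (proj_line z w + 1 *s (w - proj_line z w)))\<^sup>2"
    unfolding norm_proj_decomp using assms by simp
  then show ?thesis by simp
qed

lemma linear_proj_rotate: "linear (\<lambda>w. proj_line z w + c *s (w - proj_line z w))"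
  by (intro linear_compose_add linear_compose[OF _ linear_scale_vec, unfolded o_def]
      linear_compose_sub linear_proj_line linear_id[unfolded id_def])

text \<open>The Bergman kernel of the ball, without a constant factor because \<open>dV\<close> has
  total mass one.\<close>

definition bker :: "complex^'n::finite \<Rightarrow> complex^'n \<Rightarrow> complex" where
  "bker z w = 1 / (1 - hip z w) ^ (CARD('n) + 1)"

lemma one_minus_hip_nonzero: "norm z < 1 \<Longrightarrow> norm w < 1 \<Longrightarrow> 1 - hip z w \<noteq> 0"
  using norm_hip_ball[of z w] by auto

lemma bker_measurable [measurable]:
  assumes "f \<in> borel_measurable M" "g \<in> borel_measurable M"
  shows "(\<lambda>x. bker (f x) (g x :: complex^'n::finite)) \<in> borel_measurable M"
  unfolding bker_def using assms by measurable

lemma bker_sums: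
  fixes z w :: "complex^'n::finite"
  assumes "norm z < 1" "norm w < 1"
  shows "(\<lambda>k. of_real (nbinom (real (CARD('n) + 1)) k) * hip z w ^ k) sums bker z w"
proof -
  have "norm (hip z w) < 1" using norm_hip_ball[OF assms(1), of w] assms by simp
  from nbinom_sums_complex[OF this, of "real (CARD('n) + 1)"]
  have "(\<lambda>k. of_real (nbinom (real (CARD('n) + 1)) k) * hip z w ^ k) sums (1 - hip z w) powr (- of_nat (CARD('n) + 1))"
    by simp
  also have "(1 - hip z w) powr (- of_nat (CARD('n) + 1)) = bker z w"
    unfolding bker_def powr_minus using one_minus_hip_nonzero[OF assms]
    by (subst powr_nat') (auto simp: divide_inverse)
  finally show ?thesis .
qed

lemma sigma_finite_dV: "sigma_finite_measure (dV :: (complex^'n::finite) measure)"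
proof -
  interpret finite_measure "dV :: (complex^'n) measure" by (rule finite_measure_dV)
  show ?thesis ..
qed

lemma dV_isometry_circle_average:
  fixes f :: "complex^'n::finite \<Rightarrow> complex" and T :: "real \<Rightarrow> complex^'n \<Rightarrow> complex^'n"
  assumes T: "(\<lambda>(x, w). T x w) \<in> borel_measurable (circle01 \<Otimes>\<^sub>M borel)"
    and iso: "\<And>x. linear (T x)" "\<And>x w. norm (T x w) = norm w"
    and f: "integrable dV f"
    and g: "\<And>w. norm w < 1 \<Longrightarrow> (\<integral>x. f (T x w) \<partial>circle01) = g w" and gm: "g \<in> borel_measurable borel"
  shows "integrable dV g" "(\<integral>w. g w \<partial>dV) = (\<integral>w. f w \<partial>dV)"
proof -
  have T': "(\<lambda>(x, w). T x w) \<in> measurable (circle01 \<Otimes>\<^sub>M dV) dV"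
    using T by (simp cong: measurable_cong_sets)
  have inv: "distr dV dV (T x) = dV" for x
    by (rule dV_distr_isometry) (auto intro: iso)
  note av = average_over_isometries[OF sigma_finite_dV T' inv f]
  have ae: "AE w in dV. (\<integral>x. f (T x w) \<partial>circle01) = g w"
    using AE_dV_ball by eventually_elim (use g in auto)
  have gm': "g \<in> borel_measurable dV" using gm by (simp cong: measurable_cong_sets)
  show "integrable dV g"
    using av(1) gm' ae by (rule integrable_cong_AE_imp)
  have "(\<integral>w. g w \<partial>dV) = (\<integral>w. (\<integral>x. f (T x w) \<partial>circle01) \<partial>dV)"
    by (rule integral_cong_AE[OF gm' borel_measurable_integrable[OF av(1)]]) (use ae in auto)
  also have "\<dots> = (\<integral>w. f w \<partial>dV)" by (rule av(2))
  finally show "(\<integral>w. g w \<partial>dV) = (\<integral>w. f w \<partial>dV)" .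
qed

text \<open>The case \<open>b = 1\<close> of the moment formula, where the quotient of Gamma values
  is the inverse of a coefficient in the expansion of the kernel; this match makes the kernel
  reproducing.\<close>

lemma power_moment:
  fixes z :: "complex^'n::finite"
  shows "(\<integral>w. norm (hip w z) ^ (2 * k) \<partial>dV) = norm z ^ (2 * k) / nbinom (real (CARD('n) + 1)) k"
proof -
  define i :: 'n where "i = (SOME i. True)"
  have rad: "pw w powr (1 - 1) = (\<lambda>r. (1 - r\<^sup>2) powr (1 - 1)) (norm w)" for w :: "complex^'n"
    by (simp add: pw_def)
  \<comment> \<open>\<open>x powr 0\<close> vanishes at \<open>x = 0\<close>, so the weight is 1
    only off the sphere, hence almost everywhere.\<close>
  have p1: "AE w in (dV :: (complex^'n) measure). F w * pw w powr (1 - 1) = F w" for F :: "complex^'n \<Rightarrow> real"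
    using AE_dV_ball
  proof eventually_elim
    fix w :: "complex^'n" assume "w \<in> ball 0 1"
    then have "0 < pw w" by (rule pw_pos)
    then show "F w * pw w powr (1 - 1) = F w" by simp
  qed
  have e: "(\<integral>w. norm (hip w z) ^ (2 * k) * pw w powr (1 - 1) \<partial>dV) = (\<integral>w. norm (hip w z) ^ (2 * k) \<partial>dV)"
    by (rule integral_cong_AE[OF _ _ p1]) measurable
  have "(\<integral>w. norm (hip w z) ^ (2 * k) * pw w powr (1 - 1) \<partial>dV) =
      norm z ^ (2 * k) * (\<integral>w. norm (w $ i) ^ (2 * k) * pw w powr (1 - 1) \<partial>dV)"
    by (rule moment_hip[where \<phi> = "\<lambda>r. (1 - r\<^sup>2) powr (1 - 1)"], rule rad, simp, measurable, rule pw_powr_integral, simp)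
  also have "(\<integral>w. norm (w $ i) ^ (2 * k) * pw w powr (1 - 1) \<partial>(dV :: (complex^'n) measure)) =
      fact CARD('n) * fact k * Gamma 1 / Gamma (real CARD('n) + real k + 1)"
    by (rule moment_formula) simp
  also have "Gamma (real CARD('n) + real k + 1) = Gamma (real (CARD('n) + 1) + real k)"
    by (simp add: add_ac)
  also have "\<dots> = pochhammer (real (CARD('n) + 1)) k * Gamma (real (CARD('n) + 1))"
    by (subst pochhammer_Gamma) (auto dest!: nonpos_Ints_nonpos simp: Gamma_eq_zero_iff)
  also have "Gamma (real (CARD('n) + 1)) = fact CARD('n)"
    using Gamma_fact[of "CARD('n)", where ?'a = real] by (simp add: add_ac)
  finally show ?thesis unfolding e by (simp add: nbinom_def)
qed

text \<open>Two circle means reduce the integral to a single Taylor coefficient. Rotating the part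
  of \<open>w\<close> orthogonal to \<open>z\<close> replaces \<open>f\<close> by its values on the
  complex line of \<open>z\<close>; rotating \<open>w\<close> as a whole then picks out the power
  \<open>k\<close>, and \<open>power_moment\<close> evaluates what is left.\<close>

lemma power_coefficient_integral:
  fixes f :: "complex^'n::finite \<Rightarrow> complex"
  assumes f: "f holomorphic_Cn_on ball 0 1" "integrable dV f" and z: "norm z < 1"
  shows "integrable dV (\<lambda>w. f w * cnj (hip w z ^ k))"
    "of_real (nbinom (real (CARD('n) + 1)) k) * (\<integral>w. f w * cnj (hip w z ^ k) \<partial>dV) = taylor_coeff (\<lambda>\<zeta>. f (\<zeta> *s z)) k"
proof -
  define h where "h w = cnj (hip w z ^ k)" for w
  have [measurable]: "f \<in> borel_measurable borel"
    using borel_measurable_integrable[OF f(2)] by (simp cong: measurable_cong_sets)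
  have [measurable]: "h \<in> borel_measurable borel"
    unfolding h_def by (intro borel_measurable_continuous_onI continuous_intros)
  have h1: "norm (h w) \<le> 1" if "norm w < 1" for w
    using norm_hip_ball[OF that, of z] z by (auto simp: h_def norm_power intro!: power_le_one)
  show intf: "integrable dV (\<lambda>w. f w * cnj (hip w z ^ k))"
    unfolding h_def[symmetric]
  proof (rule Bochner_Integration.integrable_bound[OF f(2)])
    show "AE w in dV. norm (f w * h w) \<le> norm (f w)"
      using AE_dV_ball by eventually_elim (auto simp: norm_mult intro: mult_right_le_one_le h1)
  qed measurable
  have pball: "norm (proj_line z w) < 1" if "norm w < 1" for w
  proof -
    have "(norm (proj_line z w))\<^sup>2 \<le> (norm w)\<^sup>2"
      using norm_proj_decomp[of z w 1] by simp
    then show ?thesis using that by (simp add: power2_le_iff_abs_le)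
  qed
  have 1: "integrable dV (\<lambda>w. f (proj_line z w) * h w)"
    "(\<integral>w. f (proj_line z w) * h w \<partial>dV) = (\<integral>w. f w * h w \<partial>dV)"
  proof -
    let ?T = "\<lambda>x w. proj_line z w + unit_exp x *s (w - proj_line z w)"
    have T: "(\<lambda>(x, w). ?T x w) \<in> borel_measurable (circle01 \<Otimes>\<^sub>M borel)" by measurable
    have iso: "linear (?T x)" "norm (?T x w) = norm w" for x w
      by (rule linear_proj_rotate, rule norm_proj_rotate[OF norm_unit_exp])
    have hT: "h (?T x w) = h w" for x w
      by (simp add: h_def hip_add_left hip_scale_left hip_diff_left hip_proj_line)
    have inner: "(\<integral>x. f (?T x w) * h (?T x w) \<partial>circle01) = f (proj_line z w) * h w" if w: "norm w < 1" for w
    proof -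
      let ?P = "proj_line z w" and ?Q = "w - proj_line z w"
      have "cball 0 1 \<subseteq> {\<zeta>. ?P + \<zeta> *s ?Q \<in> ball 0 1}"
      proof
        fix \<zeta> :: complex assume "\<zeta> \<in> cball 0 1"
        then have "(norm \<zeta>)\<^sup>2 \<le> 1" by (simp add: power_le_one)
        then have "(norm (?P + \<zeta> *s ?Q))\<^sup>2 \<le> (norm (?P + 1 *s ?Q))\<^sup>2"
          unfolding norm_proj_decomp using mult_right_mono[of "(norm \<zeta>)\<^sup>2" 1 "(norm ?Q)\<^sup>2"] by simp
        then have "(norm (?P + \<zeta> *s ?Q))\<^sup>2 \<le> (norm w)\<^sup>2" by simp
        then have "norm (?P + \<zeta> *s ?Q) < 1" using w by (simp add: power2_le_iff_abs_le)
        then show "\<zeta> \<in> {\<zeta>. ?P + \<zeta> *s ?Q \<in> ball 0 1}" by simp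
      qed
      from circle_integral_coeff[OF holomorphic_on_line[OF f(1)] this, of 0]
      have "(\<integral>x. f (?T x w) \<partial>circle01) = f ?P" by simp
      then show ?thesis by (simp only: hT integral_mult_left_zero)
    qed
    show "integrable dV (\<lambda>w. f (proj_line z w) * h w)"
      "(\<integral>w. f (proj_line z w) * h w \<partial>dV) = (\<integral>w. f w * h w \<partial>dV)"
      using dV_isometry_circle_average[OF T iso intf[folded h_def] inner] by simp_all
  qed
  let ?c = "taylor_coeff (\<lambda>\<zeta>. f (\<zeta> *s z)) k"
  show "of_real (nbinom (real (CARD('n) + 1)) k) * (\<integral>w. f w * cnj (hip w z ^ k) \<partial>dV) = ?c"
  proof (cases "z = 0")
    case True
    show ?thesis
    proof (cases "k = 0")
      case True
      then show ?thesis using 1(2) \<open>z = 0\<close>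
        by (simp add: h_def proj_line_def nbinom_def measure_def emeasure_dV_UNIV)
    next
      case False
      then obtain l where "k = Suc l" by (cases k) auto
      then show ?thesis using \<open>z = 0\<close>
        by (simp add: taylor_coeff_def)
    qed
  next
    case False
    \<comment> \<open>The coordinate of the projection of \<open>w\<close> on the line of
      \<open>z\<close>: the slice of \<open>f\<close> through the projection is the slice through
      \<open>z\<close> with its parameter multiplied by \<open>\<alpha> w\<close>.\<close>
    define \<alpha> where "\<alpha> w = hip w z / hip z z" for w
    have inner: "(\<integral>x. f (proj_line z (unit_exp x *s w)) * h (unit_exp x *s w) \<partial>circle01) =
        ?c * of_real (norm (hip w z) ^ (2 * k) / norm z ^ (2 * k))" if w: "norm w < 1" for w
    proof -
      let ?T = "{\<zeta>. 0 + \<zeta> *s z \<in> ball 0 1}" and ?S = "{\<zeta>. 0 + \<zeta> *s proj_line z w \<in> ball 0 1}"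
      have S: "cball 0 1 \<subseteq> ?S"
      proof
        fix \<zeta> :: complex assume "\<zeta> \<in> cball 0 1"
        then have "norm (\<zeta> *s proj_line z w) \<le> norm (proj_line z w)"
          by (simp add: norm_scale_vec mult_left_le_one_le)
        then show "\<zeta> \<in> ?S" using pball[OF w] by simp
      qed
      have pl: "proj_line z w = \<alpha> w *s z" by (simp add: proj_line_def \<alpha>_def)
      have "(\<integral>x. f (of_real 1 * unit_exp x *s proj_line z w) * cnj (unit_exp x) ^ k \<partial>circle01) =
          taylor_coeff (\<lambda>\<zeta>. f (\<zeta> *s proj_line z w)) k * of_real 1 ^ k"
        using circle_integral_coeff[OF holomorphic_on_line[OF f(1)] S, of k] by simp
      moreover have "taylor_coeff (\<lambda>\<zeta>. f (\<zeta> *s proj_line z w)) k = \<alpha> w ^ k * ?c"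
      proof -
        have "(deriv ^^ k) (\<lambda>\<zeta>. (\<lambda>\<zeta>. f (\<zeta> *s z)) (\<alpha> w * \<zeta>)) 0 = \<alpha> w ^ k * (deriv ^^ k) (\<lambda>\<zeta>. f (\<zeta> *s z)) (\<alpha> w * 0)"
        proof (rule higher_deriv_compose_linear)
          show "(\<lambda>\<zeta>. f (\<zeta> *s z)) holomorphic_on ?T"
            using holomorphic_on_line[OF f(1), of 0 z] by simp
          show "open ?S" "open ?T" by (rule open_line_preimage)+
          show "0 \<in> ?S" by simp
          show "\<alpha> w * \<zeta> \<in> ?T" if "\<zeta> \<in> ?S" for \<zeta>
            using that by (simp add: pl vector_smult_assoc mult.commute)
        qed
        then show ?thesis by (simp add: taylor_coeff_def pl vector_smult_assoc mult.commute)
      qed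
      moreover have "f (proj_line z (unit_exp x *s w)) * h (unit_exp x *s w) =
          (f (of_real 1 * unit_exp x *s proj_line z w) * cnj (unit_exp x) ^ k) * h w" for x
        by (simp add: h_def proj_line_def hip_scale_left vector_smult_assoc power_mult_distrib)
      ultimately have "(\<integral>x. f (proj_line z (unit_exp x *s w)) * h (unit_exp x *s w) \<partial>circle01) =
          \<alpha> w ^ k * ?c * h w" by simp
      also have "\<dots> = ?c * (\<alpha> w ^ k * h w)" by (simp only: mult_ac)
      also have "\<alpha> w ^ k * h w = of_real (norm (hip w z) ^ (2 * k) / norm z ^ (2 * k))"
      proof -
        have "\<alpha> w ^ k * h w = (hip w z * cnj (hip w z)) ^ k / hip z z ^ k"
          by (simp add: \<alpha>_def h_def power_mult_distrib power_divide)
        then show ?thesis unfolding complex_norm_square[symmetric] hip_self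
          by (simp add: power_mult)
      qed
      finally show ?thesis .
    qed
    have T: "(\<lambda>(x, w). unit_exp x *s w) \<in> borel_measurable (circle01 \<Otimes>\<^sub>M borel)" by measurable
    have iso: "linear (\<lambda>w. unit_exp x *s w :: complex^'n)" "norm (unit_exp x *s w) = norm w" for x and w :: "complex^'n"
      by (auto intro: linear_scale_vec simp: norm_scale_vec)
    have "(\<integral>w. ?c * of_real (norm (hip w z) ^ (2 * k) / norm z ^ (2 * k)) \<partial>dV) = (\<integral>w. f (proj_line z w) * h w \<partial>dV)"
      by (rule dV_isometry_circle_average(2)[OF T iso 1(1) inner]) simp_all
    moreover have "(\<integral>w. ?c * of_real (norm (hip w z) ^ (2 * k) / norm z ^ (2 * k)) \<partial>dV) =
        ?c * of_real ((\<integral>w. norm (hip w z) ^ (2 * k) \<partial>dV) / norm z ^ (2 * k))"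
      unfolding integral_mult_right_zero integral_complex_of_real by simp
    moreover have "(\<integral>w. norm (hip w z) ^ (2 * k) \<partial>dV) / norm z ^ (2 * k) = 1 / nbinom (real (CARD('n) + 1)) k"
      unfolding power_moment using False by simp
    ultimately have I: "(\<integral>w. f w * cnj (hip w z ^ k) \<partial>dV) = ?c * of_real (1 / nbinom (real (CARD('n) + 1)) k)"
      using 1(2) by (simp only: h_def)
    have "nbinom (real (CARD('n) + 1)) k \<noteq> 0"
      by (simp add: nbinom_def pochhammer_eq_0_iff)
    then show ?thesis unfolding I by simp
  qed
qed

text \<open>Expanding the kernel in powers of \<open>hip z w\<close>, each term yields a Taylor
  coefficient of the slice of \<open>f\<close> through \<open>z\<close>, and these sum to the slice
  at parameter 1. The partial sums are dominated by a multiple of \<open>norm (f w)\<close>.\<close>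

lemma bergman_reproducing:
  fixes f :: "complex^'n::finite \<Rightarrow> complex"
  assumes f: "f holomorphic_Cn_on ball 0 1" "integrable dV f" and z: "norm z < 1"
  shows "integrable dV (\<lambda>w. f w * bker z w)" "(\<integral>w. f w * bker z w \<partial>dV) = f z"
proof -
  let ?b = "nbinom (real (CARD('n) + 1))"
  have b0: "0 \<le> ?b k" for k by (rule nbinom_nonneg) simp
  define B where "B = (1 - norm z) powr (- real (CARD('n) + 1))"
  have Bs: "(\<lambda>k. ?b k * norm z ^ k) sums B"
    unfolding B_def using z by (intro nbinom_sums_real) simp
  define s where "s n w = (\<Sum>k<n. of_real (?b k) * (f w * cnj (hip w z ^ k)))" for n w
  have [measurable]: "f \<in> borel_measurable borel"
    using borel_measurable_integrable[OF f(2)] by (simp cong: measurable_cong_sets)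
  have [measurable]: "(\<lambda>w. cnj (hip w z ^ k)) \<in> borel_measurable borel" for k
    by (intro borel_measurable_continuous_onI continuous_intros)
  have meas: "(\<lambda>w. f w * bker z w) \<in> borel_measurable dV" "\<And>n. s n \<in> borel_measurable dV"
    unfolding s_def by measurable
  have cnj_hip: "cnj (hip w z) = hip z w" for w by (rule hip_commute[symmetric])
  have lim: "AE w in dV. (\<lambda>n. s n w) \<longlonglongrightarrow> f w * bker z w"
    using AE_dV_ball
  proof eventually_elim
    fix w :: "complex^'n" assume "w \<in> ball 0 1"
    then have "(\<lambda>k. of_real (?b k) * hip z w ^ k) sums bker z w" using z by (intro bker_sums) auto
    from sums_mult[OF this, of "f w"] show "(\<lambda>n. s n w) \<longlonglongrightarrow> f w * bker z w"
      by (simp add: sums_def s_def cnj_hip mult_ac)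
  qed
  have bd: "AE w in dV. norm (s n w) \<le> B * norm (f w)" for n
    using AE_dV_ball
  proof eventually_elim
    fix w :: "complex^'n" assume "w \<in> ball 0 1"
    then have w: "norm w < 1" by simp
    have "norm (s n w) \<le> (\<Sum>k<n. ?b k * norm z ^ k * norm (f w))"
      unfolding s_def
    proof (rule sum_norm_le)
      fix k
      have "norm (of_real (?b k) * (f w * cnj (hip w z ^ k))) = ?b k * norm (hip w z) ^ k * norm (f w)"
        using b0[of k] by (simp add: norm_mult norm_power)
      also have "\<dots> \<le> ?b k * norm z ^ k * norm (f w)"
        by (intro mult_right_mono mult_left_mono power_mono norm_hip_ball[OF w] b0) auto
      finally show "norm (of_real (?b k) * (f w * cnj (hip w z ^ k))) \<le> ?b k * norm z ^ k * norm (f w)" .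
    qed
    also have "\<dots> = (\<Sum>k<n. ?b k * norm z ^ k) * norm (f w)" by (simp add: sum_distrib_right)
    also have "\<dots> \<le> B * norm (f w)"
    proof (rule mult_right_mono)
      show "(\<Sum>k<n. ?b k * norm z ^ k) \<le> B"
        using Bs b0 by (simp only: sums_iff, intro sum_le_suminf[THEN order_trans]) auto
    qed simp
    finally show "norm (s n w) \<le> B * norm (f w)" .
  qed
  have dom: "integrable dV (\<lambda>w. B * norm (f w))" using f(2) by simp
  show "integrable dV (\<lambda>w. f w * bker z w)"
    by (rule integrable_dominated_convergence[OF meas dom lim bd])
  have L: "(\<lambda>n. \<integral>w. s n w \<partial>dV) \<longlonglongrightarrow> (\<integral>w. f w * bker z w \<partial>dV)"
    by (rule integral_dominated_convergence[OF meas dom lim bd])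
  have "(\<integral>w. s n w \<partial>dV) = (\<Sum>k<n. taylor_coeff (\<lambda>\<zeta>. f (\<zeta> *s z)) k)" for n
    unfolding s_def power_coefficient_integral(2)[OF f z, symmetric]
    by (subst Bochner_Integration.integral_sum)
       (auto intro!: integrable_mult_right power_coefficient_integral(1)[OF f z] simp del: complex_cnj_power)
  moreover have "(\<lambda>n. \<Sum>k<n. taylor_coeff (\<lambda>\<zeta>. f (\<zeta> *s z)) k) \<longlonglongrightarrow> f z"
  proof -
    \<comment> \<open>The slice is holomorphic on the disc of radius \<open>1 / norm z\<close>,
      which exceeds 1; for \<open>z = 0\<close> it is constant, and 2 is an arbitrary radius above
      1.\<close>
    define r where "r = (if z = 0 then 2 else 1 / norm z)"
    have r: "1 < r" "norm z * r \<le> 1" using z by (auto simp: r_def)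
    have "ball 0 r \<subseteq> {\<zeta>. 0 + \<zeta> *s z \<in> ball 0 1}"
    proof
      fix \<zeta> :: complex assume "\<zeta> \<in> ball 0 r"
      then have "norm \<zeta> * norm z < 1"
      proof (cases "z = 0")
        case False
        then have "norm \<zeta> * norm z < r * norm z" using \<open>\<zeta> \<in> ball 0 r\<close> by simp
        then show ?thesis using r by (simp add: mult.commute)
      qed simp
      then show "\<zeta> \<in> {\<zeta>. 0 + \<zeta> *s z \<in> ball 0 1}" by (simp add: norm_scale_vec)
    qed
    then have "(\<lambda>\<zeta>. f (\<zeta> *s z)) holomorphic_on ball 0 r"
      using holomorphic_on_subset[OF holomorphic_on_line[OF f(1), of 0 z]] by simp
    from taylor_sums[OF this, of 1] r show ?thesis by (simp add: sums_def)
  qed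
  ultimately show "(\<integral>w. f w * bker z w \<partial>dV) = f z"
    using LIMSEQ_unique[OF L] by simp
qed

section \<open>The Schur test and the near-diagonal region\<close>

text \<open>Cauchy-Schwarz with the splitting of \<open>k * f\<close> into
  \<open>sqrt (k * h)\<close> and \<open>sqrt (k / h) * f\<close>. The hypothesis bounds the first
  factor directly, and, after Fubini and by symmetry of \<open>k\<close>, also the second.\<close>

lemma schur_test:
  fixes k :: "'a \<Rightarrow> 'a \<Rightarrow> real" and h f :: "'a \<Rightarrow> real"
  assumes sf: "sigma_finite_measure M"
    and k [measurable]: "(\<lambda>(x, y). k x y) \<in> borel_measurable (M \<Otimes>\<^sub>M M)"
    and h [measurable]: "h \<in> borel_measurable M" and f [measurable]: "f \<in> borel_measurable M"
    and k0: "\<And>x y. 0 \<le> k x y" and sym: "\<And>x y. k x y = k y x"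
    and f0: "\<And>x. 0 \<le> f x" and h0: "AE x in M. 0 < h x" and C: "0 \<le> C"
    and schur: "AE x in M. (\<integral>\<^sup>+y. ennreal (k x y * h y) \<partial>M) \<le> ennreal (C * h x)"
  shows "(\<integral>\<^sup>+x. (\<integral>\<^sup>+y. ennreal (k x y * f y) \<partial>M)\<^sup>2 \<partial>M) \<le> ennreal (C\<^sup>2) * (\<integral>\<^sup>+x. ennreal ((f x)\<^sup>2) \<partial>M)"
proof -
  interpret sigma_finite_measure M by fact
  interpret pair_sigma_finite M M ..
  have [measurable]: "(\<lambda>y. k x y) \<in> borel_measurable M" if "x \<in> space M" for x
    using measurable_compose[OF measurable_Pair1'[OF that] k] by simp
  have [measurable (raw)]: "(\<lambda>z. k (u z) (v z)) \<in> borel_measurable N"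
    if "u \<in> measurable N M" "v \<in> measurable N M" for u v and N :: "'b measure"
    using measurable_compose[OF measurable_Pair[OF that] k] by simp
  have [measurable (raw)]: "(\<lambda>z. k (u z) (v z)) \<in> borel_measurable N"
    if "u \<in> measurable N M" "v \<in> measurable N M" for u v and N :: "('a \<times> 'a) measure"
    using measurable_compose[OF measurable_Pair[OF that] k] by simp
  have [measurable (raw)]: "(\<lambda>z. k (u z) (v z)) \<in> borel_measurable N"
    if "u \<in> measurable N M" "v \<in> measurable N M" for u v and N :: "'a measure"
    using measurable_compose[OF measurable_Pair[OF that] k] by simp
  have step: "(\<integral>\<^sup>+y. ennreal (k x y * f y) \<partial>M)\<^sup>2 \<le>
      (\<integral>\<^sup>+y. ennreal (k x y * h y) \<partial>M) * (\<integral>\<^sup>+y. ennreal (k x y * ((f y)\<^sup>2 / h y)) \<partial>M)"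
    if x: "x \<in> space M" for x
  proof -
    have [measurable]: "(\<lambda>y. k x y) \<in> borel_measurable M"
      using measurable_compose[OF measurable_Pair1'[OF x] k] by simp
    have "(\<integral>\<^sup>+y. ennreal (k x y * f y) \<partial>M) =
        (\<integral>\<^sup>+y. ennreal (sqrt (k x y * h y)) * ennreal (sqrt (k x y / h y) * f y) \<partial>M)"
    proof (rule nn_integral_cong_AE)
      show "AE y in M. ennreal (k x y * f y) = ennreal (sqrt (k x y * h y)) * ennreal (sqrt (k x y / h y) * f y)"
        using h0
      proof eventually_elim
        fix y assume h: "0 < h y"
        have "sqrt (k x y * h y) * sqrt (k x y / h y) = k x y"
          using h k0[of x y] by (simp flip: real_sqrt_mult)
        then have e: "sqrt (k x y * h y) * (sqrt (k x y / h y) * f y) = k x y * f y"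
          by (simp only: mult.assoc[symmetric])
        show "ennreal (k x y * f y) = ennreal (sqrt (k x y * h y)) * ennreal (sqrt (k x y / h y) * f y)"
          unfolding e[symmetric] using h k0[of x y] f0[of y] by (intro ennreal_mult) auto
      qed
    qed
    also have "\<dots>\<^sup>2 \<le> (\<integral>\<^sup>+y. (ennreal (sqrt (k x y * h y)))\<^sup>2 \<partial>M) * (\<integral>\<^sup>+y. (ennreal (sqrt (k x y / h y) * f y))\<^sup>2 \<partial>M)"
      by (rule Cauchy_Schwarz_nn_integral) measurable
    also have "(\<integral>\<^sup>+y. (ennreal (sqrt (k x y * h y)))\<^sup>2 \<partial>M) = (\<integral>\<^sup>+y. ennreal (k x y * h y) \<partial>M)"
      using h0 k0 by (intro nn_integral_cong_AE, elim eventually_mono) (simp add: ennreal_power)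
    also have "(\<integral>\<^sup>+y. (ennreal (sqrt (k x y / h y) * f y))\<^sup>2 \<partial>M) = (\<integral>\<^sup>+y. ennreal (k x y * ((f y)\<^sup>2 / h y)) \<partial>M)"
      using h0 k0 f0 by (intro nn_integral_cong_AE, elim eventually_mono) (simp add: ennreal_power power_mult_distrib)
    finally show ?thesis .
  qed
  have "(\<integral>\<^sup>+x. (\<integral>\<^sup>+y. ennreal (k x y * f y) \<partial>M)\<^sup>2 \<partial>M) \<le>
      (\<integral>\<^sup>+x. ennreal (C * h x) * (\<integral>\<^sup>+y. ennreal (k x y * ((f y)\<^sup>2 / h y)) \<partial>M) \<partial>M)"
  proof (rule nn_integral_mono_AE)
    show "AE x in M. (\<integral>\<^sup>+y. ennreal (k x y * f y) \<partial>M)\<^sup>2 \<le> ennreal (C * h x) * (\<integral>\<^sup>+y. ennreal (k x y * ((f y)\<^sup>2 / h y)) \<partial>M)"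
      using schur AE_space by eventually_elim (rule order_trans[OF step mult_right_mono], auto)
  qed
  also have "\<dots> = (\<integral>\<^sup>+x. (\<integral>\<^sup>+y. ennreal (C * h x) * ennreal (k x y * ((f y)\<^sup>2 / h y)) \<partial>M) \<partial>M)"
    by (intro nn_integral_cong nn_integral_cmult[symmetric]) measurable
  also have "\<dots> = (\<integral>\<^sup>+y. (\<integral>\<^sup>+x. ennreal (C * h x) * ennreal (k x y * ((f y)\<^sup>2 / h y)) \<partial>M) \<partial>M)"
    by (rule Fubini') measurable
  also have "\<dots> \<le> (\<integral>\<^sup>+y. ennreal (C\<^sup>2) * ennreal ((f y)\<^sup>2) \<partial>M)"
  proof (rule nn_integral_mono_AE)
    show "AE y in M. (\<integral>\<^sup>+x. ennreal (C * h x) * ennreal (k x y * ((f y)\<^sup>2 / h y)) \<partial>M) \<le> ennreal (C\<^sup>2) * ennreal ((f y)\<^sup>2)"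
      using schur h0 AE_space
    proof eventually_elim
      fix y assume 1: "(\<integral>\<^sup>+x. ennreal (k y x * h x) \<partial>M) \<le> ennreal (C * h y)" and hy: "0 < h y" and y: "y \<in> space M"
      have [measurable]: "(\<lambda>x. k y x) \<in> borel_measurable M"
        using measurable_compose[OF measurable_Pair1'[OF y] k] by simp
      have "(\<integral>\<^sup>+x. ennreal (C * h x) * ennreal (k x y * ((f y)\<^sup>2 / h y)) \<partial>M) =
          (\<integral>\<^sup>+x. ennreal (C * (f y)\<^sup>2 / h y) * ennreal (k y x * h x) \<partial>M)"
      proof (rule nn_integral_cong_AE)
        show "AE x in M. ennreal (C * h x) * ennreal (k x y * ((f y)\<^sup>2 / h y)) = ennreal (C * (f y)\<^sup>2 / h y) * ennreal (k y x * h x)"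
          using h0 by eventually_elim (use hy C k0 sym[of y] in \<open>simp flip: ennreal_mult add: mult_ac\<close>)
      qed
      also have "\<dots> = ennreal (C * (f y)\<^sup>2 / h y) * (\<integral>\<^sup>+x. ennreal (k y x * h x) \<partial>M)"
        by (rule nn_integral_cmult) measurable
      also have "\<dots> \<le> ennreal (C * (f y)\<^sup>2 / h y) * ennreal (C * h y)"
        by (rule mult_left_mono[OF 1]) simp
      also have "\<dots> = ennreal (C\<^sup>2) * ennreal ((f y)\<^sup>2)"
        using hy C by (simp flip: ennreal_mult add: power2_eq_square mult_ac)
      finally show "(\<integral>\<^sup>+x. ennreal (C * h x) * ennreal (k x y * ((f y)\<^sup>2 / h y)) \<partial>M) \<le> ennreal (C\<^sup>2) * ennreal ((f y)\<^sup>2)" .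
    qed
  qed
  also have "\<dots> = ennreal (C\<^sup>2) * (\<integral>\<^sup>+x. ennreal ((f x)\<^sup>2) \<partial>M)"
    by (rule nn_integral_cmult) measurable
  finally show ?thesis .
qed

text \<open>Rudin's quasi-triangle inequality. The form \<open>\<langle>z,v\<rangle> - \<langle>z,w\<rangle>\<langle>w,v\<rangle>\<close> is nonnegative; it equals
  \<open>\<langle>R z, R v\<rangle>\<close> for the square root \<open>R = 1 - \<kappa> w w\<^sup>*\<close> of \<open>1 - w w\<^sup>*\<close>.\<close>

lemma one_minus_hip_triangle:
  assumes "norm z < 1" "norm w < 1" "norm v < 1"
  shows "norm (1 - hip z v) \<le> 2 * (norm (1 - hip z w) + norm (1 - hip w v))"
proof -
  define s where "s = sqrt (1 - (norm w)\<^sup>2)"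
  have s: "0 \<le> s" "s\<^sup>2 = 1 - (norm w)\<^sup>2"
    using assms(2) by (auto simp: s_def abs_square_le_1)
  \<comment> \<open>With this choice \<open>1 - \<kappa> * (norm w)\<^sup>2 = s\<close>, the
    eigenvalue of \<open>R\<close> on \<open>w\<close>.\<close>
  define \<kappa> where "\<kappa> = 1 / (1 + s)"
  have \<kappa>: "\<kappa>\<^sup>2 * (norm w)\<^sup>2 = 2 * \<kappa> - 1"
  proof -
    have "(norm w)\<^sup>2 = (1 + s) * (1 - s)" using s(2) by (simp add: algebra_simps power2_eq_square)
    then have "\<kappa>\<^sup>2 * (norm w)\<^sup>2 = (1 + s) * (1 - s) / (1 + s)\<^sup>2" by (simp add: \<kappa>_def power_divide)
    also have "\<dots> = (1 - s) / (1 + s)" using s(1) by (simp add: power2_eq_square)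
    also have "\<dots> = 2 * \<kappa> - 1" using s(1) by (simp add: \<kappa>_def field_simps)
    finally show ?thesis .
  qed
  define R where "R x = x - (of_real \<kappa> * hip x w) *s w" for x
  have RR: "hip (R x) (R y) = hip x y - hip x w * hip w y" for x y
  proof -
    have "hip (R x) (R y) = hip x y - 2 * of_real \<kappa> * (hip x w * hip w y) + of_real (\<kappa>\<^sup>2 * (norm w)\<^sup>2) * (hip x w * hip w y)"
      by (simp add: R_def hip_diff_left hip_diff_right hip_scale_left hip_scale_right hip_self
          hip_commute[of w y] algebra_simps power2_eq_square)
    then show ?thesis unfolding \<kappa> by (simp add: algebra_simps)
  qed
  \<comment> \<open>The squared norm of \<open>R x\<close> is at most
    \<open>1 - (norm (hip x w))\<^sup>2\<close>, a product whose one factor is at most 2 and the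
    other at most \<open>norm (1 - hip x w)\<close>.\<close>
  have Rn: "(norm (R x))\<^sup>2 \<le> 2 * norm (1 - hip x w)" if "norm x < 1" for x
  proof -
    have "hip w x = cnj (hip x w)" by (rule hip_commute)
    then have "hip x w * hip w x = of_real ((norm (hip x w))\<^sup>2)"
      by (simp add: complex_norm_square[symmetric])
    then have "complex_of_real ((norm (R x))\<^sup>2) = of_real ((norm x)\<^sup>2 - (norm (hip x w))\<^sup>2)"
      using RR[of x x] by (simp add: hip_self)
    then have "(norm (R x))\<^sup>2 = (norm x)\<^sup>2 - (norm (hip x w))\<^sup>2" by (simp only: of_real_eq_iff)
    also have "\<dots> \<le> 1 - (norm (hip x w))\<^sup>2" using that by (simp add: power_le_one)
    also have "\<dots> = (1 + norm (hip x w)) * (1 - norm (hip x w))" by (simp add: power2_eq_square algebra_simps)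
    also have "\<dots> \<le> 2 * norm (1 - hip x w)"
    proof (rule mult_mono)
      show "1 + norm (hip x w) \<le> 2" using norm_hip_ball[of x w] that assms by simp
      show "1 - norm (hip x w) \<le> norm (1 - hip x w)" using norm_triangle_ineq2[of 1 "hip x w"] by simp
      show "0 \<le> 1 - norm (hip x w)" using norm_hip_ball[of x w] that assms by simp
    qed simp
    finally show ?thesis .
  qed
  let ?a = "norm (1 - hip z w)" and ?b = "norm (1 - hip w v)"
  have b: "norm (1 - hip v w) = ?b" by (rule hip_eq_cnj_norm)
  have "norm (hip (R z) (R v)) \<le> norm (R z) * norm (R v)" by (rule norm_hip_le)
  also have "\<dots> \<le> ((norm (R z))\<^sup>2 + (norm (R v))\<^sup>2) / 2"
    using sum_squares_bound[of "norm (R z)" "norm (R v)"] by simp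
  also have "\<dots> \<le> ?a + ?b" using Rn[OF assms(1)] Rn[OF assms(3)] b by simp
  finally have 1: "norm (hip z v - hip z w * hip w v) \<le> ?a + ?b" unfolding RR .
  have e: "1 - hip z w * hip w v = (1 - hip z w) + hip z w * (1 - hip w v)" by (simp add: algebra_simps)
  have "norm (1 - hip z w * hip w v) \<le> ?a + norm (hip z w) * ?b"
    unfolding e using norm_triangle_ineq[of "1 - hip z w" "hip z w * (1 - hip w v)"] by (simp only: norm_mult)
  also have "norm (hip z w) * ?b \<le> 1 * ?b"
    using norm_hip_ball[of z w] assms by (intro mult_right_mono) auto
  finally have 2: "norm (1 - hip z w * hip w v) \<le> ?a + ?b" by simp
  have "1 - hip z v = (1 - hip z w * hip w v) - (hip z v - hip z w * hip w v)" by simp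
  then have "norm (1 - hip z v) \<le> norm (1 - hip z w * hip w v) + norm (hip z v - hip z w * hip w v)"
    using norm_triangle_ineq4 by metis
  with 1 2 show ?thesis by simp
qed

section \<open>The region near the diagonal\<close>

lemma pw_le_one_minus_hip:
  assumes "norm z < 1" "norm w < 1"
  shows "pw z \<le> 2 * norm (1 - hip z w)" "pw w \<le> 2 * norm (1 - hip z w)"
proof -
  have pw2: "pw x \<le> 2 * (1 - norm x)" if "norm x < 1" for x :: "complex^'n"
  proof -
    have "pw x = (1 + norm x) * (1 - norm x)" by (simp add: pw_def power2_eq_square algebra_simps)
    also have "\<dots> \<le> 2 * (1 - norm x)" using that by (intro mult_right_mono) auto
    finally show ?thesis .
  qed
  show "pw w \<le> 2 * norm (1 - hip z w)"
    using one_minus_hip_ge[of z w] pw2[OF assms(2)] assms by simp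
  show "pw z \<le> 2 * norm (1 - hip z w)"
    using one_minus_hip_ge[of w z] pw2[OF assms(1)] assms hip_eq_cnj_norm(2)[of z w] by simp
qed

text \<open>For the involutive automorphism \<open>\<phi>\<^sub>z\<close> of the ball exchanging 0
  and \<open>z\<close>, \<open>1 - |\<phi>\<^sub>z(w)|\<^sup>2\<close> equals
  \<open>pw z * pw w / (norm (1 - hip z w))\<^sup>2\<close>. For \<open>M > 0\<close> nearness thus
  says \<open>|\<phi>\<^sub>z(w)|\<^sup>2 < 1 - 1 / M\<close>, a ball of the Bergman metric. The
  explicit formula avoids constructing automorphisms.\<close>

definition near :: "real \<Rightarrow> complex^'n::finite \<Rightarrow> complex^'n \<Rightarrow> bool" where
  "near M z w \<longleftrightarrow> norm z < 1 \<and> norm w < 1 \<and> (norm (1 - hip z w))\<^sup>2 < M * pw z * pw w"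

lemma near_sym: "near M z w \<longleftrightarrow> near M w z"
  unfolding near_def hip_eq_cnj_norm(2)[of z w] by (auto simp: mult_ac)

lemma near_measurable [measurable (raw)]:
  assumes "f \<in> borel_measurable N" "g \<in> borel_measurable N"
  shows "Measurable.pred N (\<lambda>x. near M (f x) (g x :: complex^'n::finite))"
  using assms unfolding near_def by measurable

text \<open>By \<open>pw w \<le> 2 * norm (1 - hip z w)\<close> the square of \<open>pw w\<close> is
  at most \<open>4 * M * pw z * pw w\<close>, and one factor cancels.\<close>

lemma near_comparable:
  assumes "near M z w"
  shows "pw w \<le> 4 * M * pw z" "norm (1 - hip z w) < 2 * M * pw z" "0 < M"
proof -
  have z: "norm z < 1" "norm w < 1" and n: "(norm (1 - hip z w))\<^sup>2 < M * pw z * pw w"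
    using assms by (auto simp: near_def)
  have p: "0 < pw z" "0 < pw w" using z by (simp_all add: pw_pos_iff)
  have "(pw w)\<^sup>2 \<le> (2 * norm (1 - hip z w))\<^sup>2"
    using pw_le_one_minus_hip[OF z] p by (intro power_mono) auto
  also have "\<dots> \<le> 4 * (M * pw z * pw w)" using n by simp
  finally have "pw w * pw w \<le> (4 * M * pw z) * pw w" by (simp add: power2_eq_square mult_ac)
  then show 1: "pw w \<le> 4 * M * pw z" using p by simp
  have "0 < M * (pw z * pw w)" using n by (simp add: mult.assoc) (use zero_le_power2 le_less_trans in blast)
  then show M: "0 < M" by (rule zero_less_mult_pos2) (use p in simp)
  have "M * pw z * pw w \<le> M * pw z * (4 * M * pw z)" using 1 M p by (intro mult_left_mono) auto
  with n have "(norm (1 - hip z w))\<^sup>2 < (2 * M * pw z)\<^sup>2" by (simp add: power2_eq_square mult_ac)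
  then show "norm (1 - hip z w) < 2 * M * pw z" using M p by (simp add: power2_less_imp_less)
qed

text \<open>The constant arises as \<open>8 * (4 + 4)\<close>: squaring the quasi-triangle
  inequality costs 8, and replacing the middle weight \<open>pw w\<close> by \<open>pw v\<close> or
  by \<open>pw z\<close> costs \<open>4 * M'\<close> or \<open>4 * M\<close>.\<close>

lemma near_trans:
  assumes "near M z w" "near M' w v"
  shows "near (64 * M * M') z v"
proof -
  have n: "norm z < 1" "norm w < 1" "norm v < 1" using assms by (auto simp: near_def)
  have p: "0 < pw z" "0 < pw w" "0 < pw v" using n by (simp_all add: pw_pos_iff)
  note c1 = near_comparable[OF assms(1)] and c2 = near_comparable[OF assms(2)[unfolded near_sym[of M' w v]]]
  let ?a = "norm (1 - hip z w)" and ?b = "norm (1 - hip w v)"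
  have "(norm (1 - hip z v))\<^sup>2 \<le> (2 * (?a + ?b))\<^sup>2"
    using one_minus_hip_triangle[OF n] by (intro power_mono) auto
  also have "\<dots> \<le> 8 * (?a\<^sup>2 + ?b\<^sup>2)"
    using sum_squares_bound[of ?a ?b] by (simp add: power2_eq_square algebra_simps)
  also have "\<dots> < 8 * (M * pw z * pw w + M' * pw w * pw v)"
    using assms by (simp add: near_def)
  also have "\<dots> \<le> 8 * (M * pw z * (4 * M' * pw v) + M' * (4 * M * pw z) * pw v)"
    using c1 c2 p by (intro mult_left_mono add_mono mult_right_mono) auto
  also have "\<dots> = 64 * M * M' * pw z * pw v" by (simp add: algebra_simps)
  finally show ?thesis using n by (simp add: near_def)
qed

lemma holomorphic_Cn_on_hip:
  assumes G: "G holomorphic_on U" "open U" and sub: "\<And>w. w \<in> S \<Longrightarrow> hip w z \<in> U"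
  shows "(\<lambda>w. G (hip w z)) holomorphic_Cn_on S"
  unfolding holomorphic_Cn_on_def
proof
  fix w assume w: "w \<in> S"
  have "(G has_derivative (*) (deriv G (hip w z))) (at (hip w z))"
    using holomorphic_derivI[OF G sub[OF w]] by (simp add: has_field_derivative_def)
  moreover have "linear (\<lambda>w. hip w z)"
    by (intro linearI) (auto simp: hip_add_left scaleR_eq_scale_vec hip_scale_left scaleR_conv_of_real)
  then have "((\<lambda>w. hip w z) has_derivative (\<lambda>w. hip w z)) (at w)"
    by (intro bounded_linear_imp_has_derivative) (simp add: linear_conv_bounded_linear)
  ultimately have "((\<lambda>w. G (hip w z)) has_derivative (\<lambda>v. deriv G (hip w z) * hip v z)) (at w)"
    using has_derivative_compose by blast
  then show "\<exists>D. ((\<lambda>w. G (hip w z)) has_derivative D) (at w) \<and> (\<forall>c v. D (c *s v) = c * D v)"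
    by (auto simp: hip_scale_left)
qed

lemma bker_holomorphic:
  fixes z :: "complex^'n::finite"
  assumes "norm z < 1"
  shows "(\<lambda>w. bker w z) holomorphic_Cn_on ball 0 1"
proof -
  have "(\<lambda>x. 1 / (1 - x) ^ (CARD('n) + 1)) holomorphic_on ball 0 1"
    by (intro holomorphic_intros) auto
  then show ?thesis unfolding bker_def
    by (rule holomorphic_Cn_on_hip) (use norm_hip_ball assms in \<open>auto intro: le_less_trans\<close>)
qed

lemma bker_cnj: "bker z w = cnj (bker w z)"
  by (simp add: bker_def hip_commute[of z w])

lemma norm_bker: "norm (bker z (w::complex^'n::finite)) = 1 / norm (1 - hip z w) ^ (CARD('n) + 1)"
  by (simp add: bker_def norm_divide norm_mult norm_power)

lemma norm_bker_le:
  fixes z :: "complex^'n::finite"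
  assumes "norm z < 1" "norm w < 1"
  shows "norm (bker z w) \<le> 1 / (1 - norm z) ^ (CARD('n) + 1)"
  unfolding norm_bker using assms one_minus_hip_ge[of w z] hip_eq_cnj_norm(2)[of z w]
  by (intro divide_left_mono power_mono mult_pos_pos zero_less_power) (auto intro: less_le_trans)

text \<open>A Chebyshev estimate. By the reproducing formula the squared modulus of the kernel
  integrates to \<open>1 / pw z ^ (CARD('n) + 1)\<close>, and on the near region it is at least
  \<open>L\<close>, of the order of the square of this value.\<close>

lemma near_volume:
  fixes z :: "complex^'n::finite"
  assumes "norm z < 1"
  shows "measure dV {w. near M z w} \<le> (4 * M\<^sup>2) ^ (CARD('n) + 1) * pw z ^ (CARD('n) + 1)"
proof (cases "0 < M")
  case False
  then have "{w. near M z w} = {}" using near_comparable(3) by blast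
  then show ?thesis using assms by (simp add: pw_pos_iff less_imp_le)
next
  case True
  interpret finite_measure "dV :: (complex^'n) measure" by (rule finite_measure_dV)
  let ?m = "CARD('n) + 1"
  have p: "0 < pw z" using assms by (simp add: pw_pos_iff)
  define L where "L = (1 / (2 * M * pw z) ^ ?m)\<^sup>2"
  have L: "0 < L" using True p by (simp add: L_def)
  define B where "B = 1 / (1 - norm z) ^ ?m"
  have bd: "norm (bker w z) \<le> B" if "norm w < 1" for w
    using norm_bker_le[OF assms that] bker_cnj[of z w] by (simp add: B_def)
  have int: "integrable dV (\<lambda>w. bker w z)"
  proof (rule integrable_const_bound[where B = B])
    show "AE w in dV. norm (bker w z) \<le> B" using AE_dV_ball by eventually_elim (use bd in auto)
  qed measurable
  have "(\<integral>w. bker w z * bker z w \<partial>dV) = bker z z"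
    by (rule bergman_reproducing(2)[OF bker_holomorphic[OF assms] int assms])
  also have "bker z z = of_real (1 / pw z ^ ?m)"
    by (simp add: bker_def hip_self pw_def)
  also have "(\<integral>w. bker w z * bker z w \<partial>dV) = (\<integral>w. of_real ((norm (bker z w))\<^sup>2) \<partial>dV)"
    by (subst bker_cnj) (simp add: complex_norm_square[symmetric] mult.commute)
  finally have I: "(\<integral>w. (norm (bker z w))\<^sup>2 \<partial>dV) = 1 / pw z ^ ?m"
    unfolding integral_complex_of_real of_real_eq_iff .
  have "L * measure dV {w. near M z w} = (\<integral>w. L * indicator {w. near M z w} w \<partial>dV)"
    by simp
  also have "\<dots> \<le> (\<integral>w. (norm (bker z w))\<^sup>2 \<partial>dV)"
  proof (rule integral_mono_AE)
    show "integrable dV (\<lambda>w. L * indicator {w. near M z w} w)"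
      by (intro integrable_mult_right integrable_const_bound[where B = 1]) auto
    show "integrable dV (\<lambda>w. (norm (bker z w))\<^sup>2)"
    proof (rule integrable_const_bound[where B = "B\<^sup>2"])
      show "AE w in dV. norm ((norm (bker z w))\<^sup>2) \<le> B\<^sup>2"
        using AE_dV_ball by eventually_elim (use norm_bker_le[OF assms] in \<open>auto simp: B_def intro!: power_mono\<close>)
    qed measurable
    show "AE w in dV. L * indicator {w. near M z w} w \<le> (norm (bker z w))\<^sup>2"
    proof (rule AE_I2)
      fix w
      show "L * indicator {w. near M z w} w \<le> (norm (bker z w))\<^sup>2"
      proof (cases "near M z w")
        case True
        then have "norm (1 - hip z w) \<le> 2 * M * pw z" "norm z < 1" "norm w < 1"
          using near_comparable(2)[OF True] by (auto simp: near_def)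
        moreover have "0 < norm (1 - hip z w)"
          using one_minus_hip_nonzero[of z w] True by (simp add: near_def)
        ultimately have "1 / (2 * M * pw z) ^ ?m \<le> norm (bker z w)"
          unfolding norm_bker using \<open>0 < M\<close> p by (intro divide_left_mono power_mono mult_pos_pos zero_less_power) auto
        then have "L \<le> (norm (bker z w))\<^sup>2"
          unfolding L_def by (rule power_mono) (use \<open>0 < M\<close> p in simp)
        then show ?thesis using True by simp
      qed simp
    qed
  qed
  finally have "L * measure dV {w. near M z w} \<le> 1 / pw z ^ ?m"
    unfolding I .
  then have "measure dV {w. near M z w} \<le> (1 / pw z ^ ?m) / L"
    by (subst pos_le_divide_eq[OF L]) (simp only: mult.commute)
  also have "(1 / pw z ^ ?m) / L = ((2 * M) ^ ?m)\<^sup>2 * pw z ^ ?m"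
  proof -
    have "(1 / a) / (1 / (b * a))\<^sup>2 = b\<^sup>2 * a" if "0 < a" "0 < b" for a b :: real
      using that by (simp add: power2_eq_square)
    moreover have "0 < pw z ^ ?m" "0 < (2 * M) ^ ?m" using p True by simp_all
    ultimately show ?thesis
      unfolding L_def power_mult_distrib[of "2 * M" "pw z"] by blast
  qed
  also have "((2 * M) ^ ?m)\<^sup>2 = (4 * M\<^sup>2) ^ ?m"
  proof -
    have "((2 * M) ^ ?m)\<^sup>2 = ((2 * M)\<^sup>2) ^ ?m" by (simp only: power_mult[symmetric] mult.commute)
    then show ?thesis by (simp only: power_mult_distrib) simp
  qed
  finally show ?thesis .
qed

section \<open>The kernel away from the diagonal\<close>

definition far_kernel :: "real \<Rightarrow> complex^'n::finite \<Rightarrow> complex^'n \<Rightarrow> real" where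
  "far_kernel M z w = (if near M z w then 0 else norm (bker z w))"

lemma far_kernel_sym: "far_kernel M z w = far_kernel M w z"
proof -
  have "norm (bker z w) = norm (bker w z)" by (subst bker_cnj) (rule complex_mod_cnj)
  then show ?thesis by (simp add: far_kernel_def near_sym[of M z w])
qed

lemma far_kernel_nonneg: "0 \<le> far_kernel M z w"
  by (simp add: far_kernel_def)

lemma far_kernel_measurable [measurable (raw)]:
  assumes "f \<in> borel_measurable N" "g \<in> borel_measurable N"
  shows "(\<lambda>x. far_kernel M (f x) (g x :: complex^'n::finite)) \<in> borel_measurable N"
  unfolding far_kernel_def
  using near_measurable[OF assms, of M] bker_measurable[OF assms]
  by (intro measurable_If) (auto simp: pred_def)

text \<open>Off the near region \<open>1 \<le> (|1 - \<langle>z,w\<rangle>|\<^sup>2 / (M (1-|z|\<^sup>2) (1-|w|\<^sup>2)))\<^sup>1\<^sup>/\<^sup>4\<close>; inserting this factor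
  leads exactly to the integral estimated in \<open>Forelli_Rudin\<close> and gains \<open>M\<^sup>-\<^sup>1\<^sup>/\<^sup>4\<close>.\<close>

lemma far_kernel_schur:
  "\<exists>C>0. \<forall>(z :: complex^'n::finite) M. norm z < 1 \<longrightarrow> 0 < M \<longrightarrow>
    (\<integral>\<^sup>+w. ennreal (far_kernel M z w * pw w powr (- 1 / 2)) \<partial>dV) \<le> ennreal (C * M powr (- 1 / 4) * pw z powr (- 1 / 2))"
proof -
  define \<sigma> where "\<sigma> = (real CARD('n) + 1 / 2) / 2"
  obtain C where C: "0 < C" "\<forall>z :: complex^'n. z \<in> ball 0 1 \<longrightarrow>
    integrable dV (\<lambda>w. norm (1 - hip w z) powr (- 2 * \<sigma>) * pw w powr (- 3 / 4)) \<and>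
    (\<integral>w. norm (1 - hip w z) powr (- 2 * \<sigma>) * pw w powr (- 3 / 4) \<partial>dV) \<le> C * pw z powr (- 1 / 4)"
    using Forelli_Rudin[where 'n='n] unfolding \<sigma>_def by auto
  show ?thesis
  proof (intro exI[of _ C] conjI[OF C(1)] allI impI)
    fix z :: "complex^'n" and M :: real assume z: "norm z < 1" and M: "0 < M"
    have p: "0 < pw z" using z by (simp add: pw_pos_iff)
    define c where "c = M powr (- 1 / 4) * pw z powr (- 1 / 4)"
    let ?F = "\<lambda>w. norm (1 - hip w z) powr (- 2 * \<sigma>) * pw w powr (- 3 / 4)"
    have FR: "integrable dV ?F" "(\<integral>w. ?F w \<partial>dV) \<le> C * pw z powr (- 1 / 4)"
      using C(2) z by auto
    have "(\<integral>\<^sup>+w. ennreal (far_kernel M z w * pw w powr (- 1 / 2)) \<partial>dV) \<le> (\<integral>\<^sup>+w. ennreal (c * ?F w) \<partial>dV)"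
    proof (rule nn_integral_mono_AE)
      show "AE w in dV. ennreal (far_kernel M z w * pw w powr (- 1 / 2)) \<le> ennreal (c * ?F w)"
        using AE_dV_ball
      proof eventually_elim
        fix w :: "complex^'n" assume "w \<in> ball 0 1"
        then have w: "norm w < 1" and q: "0 < pw w" by (auto intro: pw_pos)
        show "ennreal (far_kernel M z w * pw w powr (- 1 / 2)) \<le> ennreal (c * ?F w)"
        proof (cases "near M z w")
          case True
          then show ?thesis by (simp add: far_kernel_def c_def)
        next
          case False
          let ?d = "norm (1 - hip z w)"
          have d: "0 < ?d" using one_minus_hip_nonzero[OF z w] by simp
          from False have "M * pw z * pw w \<le> ?d\<^sup>2" using z w by (simp add: near_def)
          then have "(M * pw z * pw w) powr (1/4) \<le> (?d\<^sup>2) powr (1/4)"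
            using M p q by (intro powr_mono2) auto
          also have "(?d\<^sup>2) powr (1/4) = ?d powr (1/2)"
            using d by (simp add: powr_powr flip: powr_numeral)
          also have "(M * pw z * pw w) powr (1/4) = M powr (1/4) * pw z powr (1/4) * pw w powr (1/4)"
            using M p q by (simp add: powr_mult)
          finally have "1 \<le> ?d powr (1/2) * (M powr (-1/4) * pw z powr (-1/4) * pw w powr (-1/4))"
            using M p q by (simp add: powr_minus field_simps)
          then have "norm (bker z w) * pw w powr (-1/2) * 1 \<le> norm (bker z w) * pw w powr (-1/2) *
              (?d powr (1/2) * (M powr (-1/4) * pw z powr (-1/4) * pw w powr (-1/4)))"
            by (intro mult_left_mono) auto
          also have "\<dots> = c * ((norm (bker z w) * ?d powr (1/2)) * (pw w powr (-1/2) * pw w powr (-1/4)))"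
            by (simp add: c_def)
          \<comment> \<open>The test function contributes the exponent -1/2 and the inserted factor
            -1/4; with the exponent of the kernel computed next this is the integrand of
            \<open>Forelli_Rudin\<close>.\<close>
          also have "pw w powr (-1/2) * pw w powr (-1/4) = pw w powr (-3/4)"
            by (simp flip: powr_add)
          also have "norm (bker z w) * ?d powr (1/2) = ?d powr (- 2 * \<sigma>)"
          proof -
            have "norm (bker z w) = ?d powr (- real (CARD('n) + 1))"
              unfolding norm_bker powr_minus using d by (subst powr_realpow) (auto simp: divide_inverse)
            then have "norm (bker z w) * ?d powr (1/2) = ?d powr (- real (CARD('n) + 1) + 1/2)"
              by (simp flip: powr_add)
            also have "- real (CARD('n) + 1) + 1/2 = - 2 * \<sigma>" by (simp add: \<sigma>_def)
            finally show ?thesis .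
          qed
          finally show ?thesis using False hip_eq_cnj_norm(2)[of z w]
            by (intro ennreal_leI) (simp add: far_kernel_def)
        qed
      qed
    qed
    also have "\<dots> = ennreal (c * (\<integral>w. ?F w \<partial>dV))"
    proof -
      have "(\<integral>\<^sup>+w. ennreal (c * ?F w) \<partial>dV) = ennreal (\<integral>w. c * ?F w \<partial>dV)"
        using FR(1) by (intro nn_integral_eq_integral integrable_mult_right) (auto simp: c_def)
      then show ?thesis by simp
    qed
    also have "\<dots> \<le> ennreal (c * (C * pw z powr (- 1 / 4)))"
      using FR(2) by (intro ennreal_leI mult_left_mono) (auto simp: c_def)
    also have "c * (C * pw z powr (- 1 / 4)) = C * M powr (- 1 / 4) * pw z powr (- 1 / 2)"
    proof -
      have "pw z powr (- 1 / 4) * pw z powr (- 1 / 4) = pw z powr (- 1 / 2)"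
        by (simp flip: powr_add)
      then show ?thesis unfolding c_def by (simp only: mult_ac)
    qed
    finally show "(\<integral>\<^sup>+w. ennreal (far_kernel M z w * pw w powr (- 1 / 2)) \<partial>dV) \<le>
      ennreal (C * M powr (- 1 / 4) * pw z powr (- 1 / 2))" .
  qed
qed

lemma far_kernel_L2_bound:
  "\<exists>C>0. \<forall>(f :: complex^'n::finite \<Rightarrow> real) M. 0 < M \<longrightarrow> f \<in> borel_measurable borel \<longrightarrow> (\<forall>x. 0 \<le> f x) \<longrightarrow>
    (\<integral>\<^sup>+z. (\<integral>\<^sup>+w. ennreal (far_kernel M z w * f w) \<partial>dV)\<^sup>2 \<partial>dV) \<le> ennreal ((C * M powr (- 1 / 4))\<^sup>2) * (\<integral>\<^sup>+w. ennreal ((f w)\<^sup>2) \<partial>dV)"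
proof -
  obtain C where C: "0 < C" "\<forall>(z :: complex^'n) M. norm z < 1 \<longrightarrow> 0 < M \<longrightarrow>
    (\<integral>\<^sup>+w. ennreal (far_kernel M z w * pw w powr (- 1 / 2)) \<partial>dV) \<le> ennreal (C * M powr (- 1 / 4) * pw z powr (- 1 / 2))"
    using far_kernel_schur[where 'n='n] by auto
  show ?thesis
  proof (intro exI[of _ C] conjI[OF C(1)] allI impI)
    fix f :: "complex^'n \<Rightarrow> real" and M :: real
    assume M: "0 < M" and [measurable]: "f \<in> borel_measurable borel" and f0: "\<forall>x. 0 \<le> f x"
    show "(\<integral>\<^sup>+z. (\<integral>\<^sup>+w. ennreal (far_kernel M z w * f w) \<partial>dV)\<^sup>2 \<partial>dV) \<le>
        ennreal ((C * M powr (- 1 / 4))\<^sup>2) * (\<integral>\<^sup>+w. ennreal ((f w)\<^sup>2) \<partial>dV)"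
    proof (rule schur_test[OF sigma_finite_dV, where h = "\<lambda>w. pw w powr (- 1 / 2)"])
      show "AE w in (dV :: (complex^'n) measure). 0 < pw w powr (- 1 / 2)"
        using AE_dV_ball by eventually_elim (drule pw_pos, simp)
      show "AE z in (dV :: (complex^'n) measure). (\<integral>\<^sup>+w. ennreal (far_kernel M z w * pw w powr (- 1 / 2)) \<partial>dV) \<le>
          ennreal (C * M powr (- 1 / 4) * pw z powr (- 1 / 2))"
        using AE_dV_ball
      proof eventually_elim
        fix z :: "complex^'n" assume "z \<in> ball 0 1"
        then show "(\<integral>\<^sup>+w. ennreal (far_kernel M z w * pw w powr (- 1 / 2)) \<partial>dV) \<le>
            ennreal (C * M powr (- 1 / 4) * pw z powr (- 1 / 2))"
          using C(2)[rule_format, of z M] M by simp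
      qed
    qed (use C(1) in \<open>auto simp: f0 far_kernel_nonneg intro: far_kernel_sym\<close>)
  qed
qed

section \<open>The Bergman projection and Toeplitz operators\<close>

lemma L2_measurable: "f \<in> L2 \<Longrightarrow> f \<in> borel_measurable borel"
  by (simp add: L2_def cong: measurable_cong_sets)

lemma L2_iff: "f \<in> L2 \<longleftrightarrow> f \<in> borel_measurable borel \<and> (\<integral>\<^sup>+z. ennreal ((norm (f z))\<^sup>2) \<partial>dV) < \<infinity>"
  unfolding L2_def integrable_iff_bounded by (auto cong: measurable_cong_sets)

lemma L2_nn_integral:
  assumes "f \<in> L2"
  shows "(\<integral>\<^sup>+z. ennreal ((norm (f z))\<^sup>2) \<partial>dV) = ennreal (\<integral>z. (norm (f z))\<^sup>2 \<partial>dV)"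
  using assms unfolding L2_def by (intro nn_integral_eq_integral) auto

lemma L2_imp_integrable:
  fixes f :: "complex^'n::finite \<Rightarrow> complex"
  assumes "f \<in> L2" shows "integrable dV f"
proof -
  interpret finite_measure "dV :: (complex^'n) measure" by (rule finite_measure_dV)
  have "integrable dV (\<lambda>z. 1 + (norm (f z))\<^sup>2)" using assms by (simp add: L2_def)
  then show ?thesis
  proof (rule Bochner_Integration.integrable_bound)
    show "f \<in> borel_measurable dV" using assms by (simp add: L2_def)
    have "x \<le> 1 + x\<^sup>2" if "0 \<le> x" for x :: real
      using sum_squares_bound[of x 1] that by simp
    then show "AE z in dV. norm (f z) \<le> norm (1 + (norm (f z))\<^sup>2)" by simp
  qed
qed

lemma Linf_measurable: "a \<in> Linf \<Longrightarrow> a \<in> borel_measurable borel"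
  by (simp add: Linf_def cong: measurable_cong_sets)

lemma Linf_boundE:
  assumes "a \<in> Linf" obtains A where "0 \<le> A" "AE z in dV. norm (a z) \<le> A"
proof -
  obtain C where C: "AE z in dV. norm (a z) \<le> C" using assms by (auto simp: Linf_def)
  have "AE z in dV. norm (a z) \<le> max C 0" using C by eventually_elim simp
  then show ?thesis by (intro that[of "max C 0"]) auto
qed

lemma Linf_mult_L2:
  assumes a: "a \<in> Linf" and f: "f \<in> L2" shows "(\<lambda>z. a z * f z) \<in> L2"
proof -
  obtain A where A: "0 \<le> A" "AE z in dV. norm (a z) \<le> A" using a by (rule Linf_boundE)
  have [measurable]: "a \<in> borel_measurable borel" "f \<in> borel_measurable borel"
    using a f by (auto intro: Linf_measurable L2_measurable)
  have "integrable dV (\<lambda>z. A\<^sup>2 * (norm (f z))\<^sup>2)" using f by (simp add: L2_def)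
  then have "integrable dV (\<lambda>z. (norm (a z * f z))\<^sup>2)"
  proof (rule Bochner_Integration.integrable_bound)
    show "AE z in dV. norm ((norm (a z * f z))\<^sup>2) \<le> norm (A\<^sup>2 * (norm (f z))\<^sup>2)"
      using A(2) by eventually_elim (auto simp: norm_mult power_mult_distrib intro!: mult_right_mono power_mono)
  qed measurable
  then show ?thesis by (simp add: L2_def cong: measurable_cong_sets)
qed

text \<open>Hence \<open>far_kernel (1/4)\<close> is the modulus of the whole Bergman kernel on the
  ball, and the estimates for the far part also give the boundedness of the Bergman
  projection.\<close>

lemma not_near_quarter:
  assumes "norm z < 1" "norm w < 1" shows "\<not> near (1/4) z w"
proof -
  have p: "0 < pw z" "0 < pw w" using assms by (simp_all add: pw_pos_iff)
  have "pw z * pw w \<le> (2 * norm (1 - hip z w)) * (2 * norm (1 - hip z w))"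
    using pw_le_one_minus_hip[OF assms] p by (intro mult_mono) auto
  then show ?thesis by (simp add: near_def power2_eq_square)
qed

lemma ennreal_mult_le_squares:
  fixes x y :: ennreal
  assumes "0 < l"
  shows "x * y \<le> ennreal (1 / l) * x\<^sup>2 + ennreal l * y\<^sup>2"
proof (cases "x = top \<or> y = top")
  case True
  then show ?thesis using assms by (auto simp: ennreal_mult_top power2_eq_square)
next
  case False
  then obtain a b where ab: "x = ennreal a" "y = ennreal b" "0 \<le> a" "0 \<le> b"
    by (metis ennreal_cases)
  have "0 \<le> (a / sqrt l - b * sqrt l)\<^sup>2" by simp
  also have "(a / sqrt l - b * sqrt l)\<^sup>2 = 1 / l * a\<^sup>2 + l * b\<^sup>2 - 2 * a * b"
    using assms by (simp add: power2_diff power_divide power_mult_distrib)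
  finally have "2 * (a * b) \<le> 1 / l * a\<^sup>2 + l * b\<^sup>2" by simp
  moreover have "0 \<le> a * b" using ab by simp
  ultimately have "a * b \<le> 1 / l * a\<^sup>2 + l * b\<^sup>2" by linarith
  moreover have "ennreal (1 / l) * (ennreal a)\<^sup>2 + ennreal l * (ennreal b)\<^sup>2 = ennreal (1 / l * a\<^sup>2 + l * b\<^sup>2)"
    using ab(3,4) assms by (simp add: ennreal_power ennreal_mult[symmetric] ennreal_plus[symmetric] del: ennreal_plus)
  ultimately show ?thesis using ab by (simp add: ennreal_mult[symmetric] ennreal_leI)
qed

text \<open>The inequality \<open>x * y \<le> x\<^sup>2 / l + l * y\<^sup>2\<close>, with the bound
  \<open>l = C * M powr (- 1 / 4)\<close> of the operator as weight, gives both terms the factor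
  \<open>l\<close>. Sums of squares in place of products of norms keep the later error estimates
  additive; \<open>blinfun_norm_le_cinner\<close> returns to the operator norm.\<close>

lemma far_kernel_bilinear:
  "\<exists>C>0. \<forall>(u :: complex^'n::finite \<Rightarrow> complex) v M. 0 < M \<longrightarrow> u \<in> L2 \<longrightarrow> v \<in> L2 \<longrightarrow>
    (\<integral>\<^sup>+z. \<integral>\<^sup>+w. ennreal (far_kernel M z w * norm (u w) * norm (v z)) \<partial>dV \<partial>dV) \<le>
      ennreal (C * M powr (- 1 / 4) * ((\<integral>w. (norm (u w))\<^sup>2 \<partial>dV) + (\<integral>z. (norm (v z))\<^sup>2 \<partial>dV)))"
proof -
  obtain C where C: "0 < C" "\<forall>(f :: complex^'n::finite \<Rightarrow> real) M. 0 < M \<longrightarrow> f \<in> borel_measurable borel \<longrightarrow> (\<forall>x. 0 \<le> f x) \<longrightarrow>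
    (\<integral>\<^sup>+z. (\<integral>\<^sup>+w. ennreal (far_kernel M z w * f w) \<partial>dV)\<^sup>2 \<partial>dV) \<le> ennreal ((C * M powr (- 1 / 4))\<^sup>2) * (\<integral>\<^sup>+w. ennreal ((f w)\<^sup>2) \<partial>dV)"
    using far_kernel_L2_bound[where 'n='n] by auto
  show ?thesis
  proof (intro exI[of _ C] conjI[OF C(1)] allI impI)
    fix u v :: "complex^'n \<Rightarrow> complex" and M :: real
    assume M: "0 < M" and u: "u \<in> L2" and v: "v \<in> L2"
    note [measurable] = L2_measurable[OF u] L2_measurable[OF v]
    interpret sigma_finite_measure "dV :: (complex^'n) measure" by (rule sigma_finite_dV)
    define l where "l = C * M powr (- 1 / 4)"
    have l: "0 < l" using C(1) M by (simp add: l_def)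
    define U where "U z = (\<integral>\<^sup>+w. ennreal (far_kernel M z w * norm (u w)) \<partial>dV)" for z
    have [measurable]: "U \<in> borel_measurable borel"
      unfolding U_def by measurable
    have U2: "(\<integral>\<^sup>+z. (U z)\<^sup>2 \<partial>dV) \<le> ennreal (l\<^sup>2) * ennreal (\<integral>w. (norm (u w))\<^sup>2 \<partial>dV)"
      using C(2)[rule_format, of M "\<lambda>w. norm (u w)"] M unfolding U_def l_def L2_nn_integral[OF u, symmetric] by simp
    have "(\<integral>\<^sup>+z. \<integral>\<^sup>+w. ennreal (far_kernel M z w * norm (u w) * norm (v z)) \<partial>dV \<partial>dV) =
        (\<integral>\<^sup>+z. U z * ennreal (norm (v z)) \<partial>dV)"
      unfolding U_def by (subst nn_integral_multc[symmetric])
        (auto simp: ennreal_mult far_kernel_nonneg intro!: nn_integral_cong)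
    also have "\<dots> \<le> (\<integral>\<^sup>+z. ennreal (1 / l) * (U z)\<^sup>2 + ennreal l * ennreal ((norm (v z))\<^sup>2) \<partial>dV)"
      using ennreal_mult_le_squares[OF l] by (intro nn_integral_mono) (simp add: ennreal_power[symmetric])
    also have "\<dots> = ennreal (1 / l) * (\<integral>\<^sup>+z. (U z)\<^sup>2 \<partial>dV) + ennreal l * (\<integral>\<^sup>+z. ennreal ((norm (v z))\<^sup>2) \<partial>dV)"
      by (subst nn_integral_add) (auto simp: nn_integral_cmult)
    also have "\<dots> \<le> ennreal (1 / l) * (ennreal (l\<^sup>2) * ennreal (\<integral>w. (norm (u w))\<^sup>2 \<partial>dV)) + ennreal l * ennreal (\<integral>z. (norm (v z))\<^sup>2 \<partial>dV)"
      unfolding L2_nn_integral[OF v] by (intro add_mono mult_left_mono U2) auto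
    also have "\<dots> = ennreal (l * ((\<integral>w. (norm (u w))\<^sup>2 \<partial>dV) + (\<integral>z. (norm (v z))\<^sup>2 \<partial>dV)))"
      using l by (simp flip: ennreal_mult ennreal_plus add: power2_eq_square distrib_left)
    finally show "(\<integral>\<^sup>+z. \<integral>\<^sup>+w. ennreal (far_kernel M z w * norm (u w) * norm (v z)) \<partial>dV \<partial>dV) \<le>
      ennreal (C * M powr (- 1 / 4) * ((\<integral>w. (norm (u w))\<^sup>2 \<partial>dV) + (\<integral>z. (norm (v z))\<^sup>2 \<partial>dV)))"
      by (simp add: l_def)
  qed
qed

lemma bker_sesquilinear_integrable:
  fixes u v :: "complex^'n::finite \<Rightarrow> complex"
  assumes u: "u \<in> L2" and v: "v \<in> L2"
  shows "integrable (dV \<Otimes>\<^sub>M dV) (\<lambda>(z, w). u w * bker z w * cnj (v z))"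
proof -
  interpret sigma_finite_measure "dV :: (complex^'n) measure" by (rule sigma_finite_dV)
  interpret pair_sigma_finite "dV :: (complex^'n) measure" "dV :: (complex^'n) measure" ..
  note [measurable] = L2_measurable[OF u] L2_measurable[OF v]
  obtain C where C: "0 < C" "\<forall>(u :: complex^'n::finite \<Rightarrow> complex) v M. 0 < M \<longrightarrow> u \<in> L2 \<longrightarrow> v \<in> L2 \<longrightarrow>
    (\<integral>\<^sup>+z. \<integral>\<^sup>+w. ennreal (far_kernel M z w * norm (u w) * norm (v z)) \<partial>dV \<partial>dV) \<le>
      ennreal (C * M powr (- 1 / 4) * ((\<integral>w. (norm (u w))\<^sup>2 \<partial>dV) + (\<integral>z. (norm (v z))\<^sup>2 \<partial>dV)))"
    using far_kernel_bilinear[where 'n='n] by auto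
  show ?thesis
  proof (rule integrableI_bounded)
    show "(\<lambda>(z, w). u w * bker z w * cnj (v z)) \<in> borel_measurable (dV \<Otimes>\<^sub>M dV)" by measurable
    have "(\<integral>\<^sup>+p. ennreal (norm (case p of (z, w) \<Rightarrow> u w * bker z w * cnj (v z))) \<partial>(dV \<Otimes>\<^sub>M dV)) =
        (\<integral>\<^sup>+z. \<integral>\<^sup>+w. ennreal (norm (u w * bker z w * cnj (v z))) \<partial>dV \<partial>dV)"
      by (subst sigma_finite_measure.nn_integral_fst[OF sigma_finite_dV, symmetric]) simp_all
    also have "\<dots> = (\<integral>\<^sup>+z. \<integral>\<^sup>+w. ennreal (far_kernel (1/4) z w * norm (u w) * norm (v z)) \<partial>dV \<partial>dV)"
    proof (rule nn_integral_cong_AE)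
      show "AE z in dV. (\<integral>\<^sup>+w. ennreal (norm (u w * bker z w * cnj (v z))) \<partial>dV) =
          (\<integral>\<^sup>+w. ennreal (far_kernel (1/4) z w * norm (u w) * norm (v z)) \<partial>dV)"
        using AE_dV_ball
      proof eventually_elim
        fix z :: "complex^'n" assume z: "z \<in> ball 0 1"
        show "(\<integral>\<^sup>+w. ennreal (norm (u w * bker z w * cnj (v z))) \<partial>dV) =
          (\<integral>\<^sup>+w. ennreal (far_kernel (1/4) z w * norm (u w) * norm (v z)) \<partial>dV)"
        proof (rule nn_integral_cong_AE)
          show "AE w in dV. ennreal (norm (u w * bker z w * cnj (v z))) = ennreal (far_kernel (1/4) z w * norm (u w) * norm (v z))"
            using AE_dV_ball by eventually_elim (use z not_near_quarter in \<open>auto simp: far_kernel_def norm_mult mult_ac\<close>)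
        qed
      qed
    qed
    also have "\<dots> < \<infinity>"
      using C(2)[rule_format, of "1/4" u v] u v by (auto intro: le_less_trans)
    finally show "(\<integral>\<^sup>+p. ennreal (norm (case p of (z, w) \<Rightarrow> u w * bker z w * cnj (v z))) \<partial>(dV \<Otimes>\<^sub>M dV)) < \<infinity>" .
  qed
qed

text \<open>The projection by its integral formula, zero off the ball as the members of
  \<open>bergman\<close> are; it is identified with \<open>bergman_proj\<close> in
  \<open>bergman_fun_proj\<close>.\<close>

definition proj_fun :: "(complex^'n::finite \<Rightarrow> complex) \<Rightarrow> complex^'n \<Rightarrow> complex" where
  "proj_fun g z = (if z \<in> ball 0 1 then (\<integral>w. g w * bker z w \<partial>dV) else 0)"

lemma proj_fun_measurable [measurable]:
  assumes [measurable]: "g \<in> borel_measurable borel"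
  shows "proj_fun g \<in> borel_measurable (borel :: (complex^'n::finite) measure)"
proof -
  interpret sigma_finite_measure "dV :: (complex^'n) measure" by (rule sigma_finite_dV)
  have "(\<lambda>z. \<integral>w. g w * bker z w \<partial>dV) \<in> borel_measurable (borel :: (complex^'n) measure)" by measurable
  then show ?thesis unfolding proj_fun_def by (intro measurable_If) auto
qed

lemma proj_fun_L2_bound:
  "\<exists>C>0. \<forall>g :: complex^'n::finite \<Rightarrow> complex. g \<in> L2 \<longrightarrow> proj_fun g \<in> L2 \<and>
    (\<integral>z. (norm (proj_fun g z))\<^sup>2 \<partial>dV) \<le> C\<^sup>2 * (\<integral>z. (norm (g z))\<^sup>2 \<partial>dV)"
proof -
  obtain C where C: "0 < C" "\<forall>(f :: complex^'n::finite \<Rightarrow> real) M. 0 < M \<longrightarrow> f \<in> borel_measurable borel \<longrightarrow> (\<forall>x. 0 \<le> f x) \<longrightarrow>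
    (\<integral>\<^sup>+z. (\<integral>\<^sup>+w. ennreal (far_kernel M z w * f w) \<partial>dV)\<^sup>2 \<partial>dV) \<le> ennreal ((C * M powr (- 1 / 4))\<^sup>2) * (\<integral>\<^sup>+w. ennreal ((f w)\<^sup>2) \<partial>dV)"
    using far_kernel_L2_bound[where 'n='n] by auto
  define D where "D = C * (1/4) powr (- 1 / 4)"
  have D: "0 < D" using C(1) by (simp add: D_def)
  show ?thesis
  proof (intro exI[of _ D] conjI[OF D] allI impI)
    fix g :: "complex^'n \<Rightarrow> complex" assume g: "g \<in> L2"
    note [measurable] = L2_measurable[OF g]
    have "(\<integral>\<^sup>+z. ennreal ((norm (proj_fun g z))\<^sup>2) \<partial>dV) \<le>
        (\<integral>\<^sup>+z. (\<integral>\<^sup>+w. ennreal (far_kernel (1/4) z w * norm (g w)) \<partial>dV)\<^sup>2 \<partial>dV)"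
    proof (rule nn_integral_mono_AE)
      show "AE z in dV. ennreal ((norm (proj_fun g z))\<^sup>2) \<le> (\<integral>\<^sup>+w. ennreal (far_kernel (1/4) z w * norm (g w)) \<partial>dV)\<^sup>2"
        using AE_dV_ball
      proof eventually_elim
        fix z :: "complex^'n" assume z: "z \<in> ball 0 1"
        have "ennreal (norm (proj_fun g z)) \<le> (\<integral>\<^sup>+w. ennreal (norm (g w * bker z w)) \<partial>dV)"
        proof (cases "integrable dV (\<lambda>w. g w * bker z w)")
          case True
          then show ?thesis using z integral_norm_bound_ennreal[OF True] by (simp add: proj_fun_def)
        next
          case False
          then show ?thesis using z by (simp add: proj_fun_def not_integrable_integral_eq)
        qed
        also have "\<dots> = (\<integral>\<^sup>+w. ennreal (far_kernel (1/4) z w * norm (g w)) \<partial>dV)"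
        proof (rule nn_integral_cong_AE)
          show "AE w in dV. ennreal (norm (g w * bker z w)) = ennreal (far_kernel (1/4) z w * norm (g w))"
            using AE_dV_ball by eventually_elim (use z not_near_quarter in \<open>auto simp: far_kernel_def norm_mult mult_ac\<close>)
        qed
        finally show "ennreal ((norm (proj_fun g z))\<^sup>2) \<le> (\<integral>\<^sup>+w. ennreal (far_kernel (1/4) z w * norm (g w)) \<partial>dV)\<^sup>2"
          unfolding ennreal_power[OF norm_ge_zero, symmetric] by (rule power_mono) simp
      qed
    qed
    also have "\<dots> \<le> ennreal (D\<^sup>2) * (\<integral>\<^sup>+w. ennreal ((norm (g w))\<^sup>2) \<partial>dV)"
      unfolding D_def by (rule C(2)[rule_format]) auto
    also have "\<dots> = ennreal (D\<^sup>2 * (\<integral>z. (norm (g z))\<^sup>2 \<partial>dV))"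
      unfolding L2_nn_integral[OF g] by (simp add: ennreal_mult)
    finally have *: "(\<integral>\<^sup>+z. ennreal ((norm (proj_fun g z))\<^sup>2) \<partial>dV) \<le> ennreal (D\<^sup>2 * (\<integral>z. (norm (g z))\<^sup>2 \<partial>dV))" .
    then have L: "proj_fun g \<in> L2" unfolding L2_iff by (auto intro: le_less_trans)
    have "(\<integral>z. (norm (proj_fun g z))\<^sup>2 \<partial>dV) \<le> D\<^sup>2 * (\<integral>z. (norm (g z))\<^sup>2 \<partial>dV)"
      using * unfolding L2_nn_integral[OF L] by (subst (asm) ennreal_le_iff) auto
    with L show "proj_fun g \<in> L2 \<and> (\<integral>z. (norm (proj_fun g z))\<^sup>2 \<partial>dV) \<le> D\<^sup>2 * (\<integral>z. (norm (g z))\<^sup>2 \<partial>dV)" by simp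
  qed
qed

text \<open>Differentiating the kernel integral requires a quadratic remainder uniform in the
  integration variable. On the disc of radius \<open>1 - r\<close> the second derivative is bounded
  because \<open>norm (1 - t) \<ge> r\<close> there.\<close>

lemma inverse_power_taylor:
  fixes x y :: complex
  assumes r: "0 < r" "r \<le> 1" and x: "norm x \<le> 1 - r" "norm y \<le> 1 - r"
  shows "norm (1 / (1 - y) ^ m - 1 / (1 - x) ^ m - of_nat m / (1 - x) ^ (m + 1) * (y - x)) \<le>
    (real m * real (m + 1) / r ^ (m + 2)) * norm (y - x) ^ 2"
proof -
  \<comment> \<open>\<open>f i\<close> is the \<open>i\<close>-th derivative of the power for
    \<open>i \<le> 2\<close>.\<close>
  define f :: "nat \<Rightarrow> complex \<Rightarrow> complex" where
    "f i t = (if i = 0 then 1 / (1 - t) ^ m else if i = 1 then of_nat m / (1 - t) ^ (m + 1)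
      else of_nat m * of_nat (m + 1) / (1 - t) ^ (m + 2))" for i t
  have ge: "r \<le> norm (1 - t)" if "t \<in> cball 0 (1 - r)" for t :: complex
    using norm_triangle_ineq2[of 1 t] that by simp
  then have ne: "1 - t \<noteq> 0" if "t \<in> cball 0 (1 - r)" for t :: complex
    using that r by fastforce
  have gen: "- (inverse (a ^ k) * (of_nat k * a ^ (k - 1) * (- 1)) * inverse (a ^ k)) = of_nat k / a ^ (k + 1)"
    if "a \<noteq> 0" for a :: complex and k
    by (cases k) (use that in \<open>simp_all add: field_simps\<close>)
  have d: "((\<lambda>t. 1 / (1 - t) ^ k) has_field_derivative of_nat k / (1 - t) ^ (k + 1)) (at t within S)"
    if "1 - t \<noteq> 0" for k :: nat and t :: complex and S
  proof -
    have "((\<lambda>t. inverse ((1 - t) ^ k)) has_field_derivative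
       - (inverse ((1 - t) ^ k) * (of_nat k * (1 - t) ^ (k - 1) * (- 1)) * inverse ((1 - t) ^ k))) (at t within S)"
      using that by (auto intro!: derivative_eq_intros)
    also have "- (inverse ((1 - t) ^ k) * (of_nat k * (1 - t) ^ (k - 1) * (- 1)) * inverse ((1 - t) ^ k)) =
        of_nat k / (1 - t) ^ (k + 1)"
      using gen[of "1 - t" k] that by simp
    finally show ?thesis by (simp add: inverse_eq_divide)
  qed
  have "norm (f 0 y - (\<Sum>i\<le>1. f i x * (y - x) ^ i / fact i)) \<le>
      (real m * real (m + 1) / r ^ (m + 2)) * norm (y - x) ^ Suc 1 / fact 1"
  proof (rule complex_Taylor)
    show "convex (cball (0::complex) (1 - r))" by simp
    show "x \<in> cball 0 (1 - r)" "y \<in> cball 0 (1 - r)" using x by simp_all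
    fix i t assume t: "t \<in> cball (0::complex) (1 - r)" and i: "i \<le> (1::nat)"
    consider "i = 0" | "i = 1" using i by linarith
    then show "(f i has_field_derivative f (Suc i) t) (at t within cball 0 (1 - r))"
    proof cases
      case 1
      then show ?thesis using d[OF ne[OF t], of m] by (simp add: f_def[abs_def])
    next
      case 2
      then show ?thesis using DERIV_cmult[OF d[OF ne[OF t], of "m + 1"], of "of_nat m"] by (simp add: f_def[abs_def])
    qed
  next
    fix t assume t: "t \<in> cball (0::complex) (1 - r)"
    have "norm (f (Suc 1) t) = real m * real (m + 1) / norm (1 - t) ^ (m + 2)"
      by (simp add: f_def norm_mult norm_divide norm_power del: of_nat_Suc power_Suc)
    also have "\<dots> \<le> real m * real (m + 1) / r ^ (m + 2)"
      using ge[OF t] r by (intro divide_left_mono power_mono mult_pos_pos zero_less_power) auto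
    finally show "norm (f (Suc 1) t) \<le> real m * real (m + 1) / r ^ (m + 2)" .
  qed
  then show ?thesis by (simp add: f_def power2_eq_square algebra_simps)
qed

text \<open>Differentiation under the integral: \<open>D\<close> integrates the derivative of the
  kernel, and the remainder from \<open>inverse_power_taylor\<close>, uniform in \<open>w\<close>,
  integrates to a multiple of \<open>norm (y - z) ^ 2\<close>.\<close>

lemma proj_fun_holomorphic:
  fixes g :: "complex^'n::finite \<Rightarrow> complex"
  assumes g: "integrable dV g"
  shows "proj_fun g holomorphic_Cn_on ball 0 1"
  unfolding holomorphic_Cn_on_def
proof
  fix z :: "complex^'n" assume "z \<in> ball 0 1"
  then have z: "norm z < 1" by simp
  define m where "m = CARD('n) + 1"
  \<comment> \<open>Half the distance to the sphere, so that points within \<open>r\<close> of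
    \<open>z\<close> still have norm at most \<open>1 - r\<close>.\<close>
  define r where "r = (1 - norm z) / 2"
  have r: "0 < r" "r \<le> 1" "norm z = 1 - 2 * r" using z norm_ge_zero[of z] by (auto simp: r_def field_simps)
  define G where "G = (\<integral>w. norm (g w) \<partial>dV)"
  have G: "0 \<le> G" by (simp add: G_def)
  define B where "B = real m * real (m + 1) / r ^ (m + 2)"
  have B: "0 \<le> B" using r by (simp add: B_def)
  note [measurable] = borel_measurable_integrable[OF g]
  have int: "integrable dV (\<lambda>w. g w * q w)" if [measurable]: "q \<in> borel_measurable borel"
    and bd: "\<And>w. norm w < 1 \<Longrightarrow> norm (q w) \<le> C" for q C
  proof (rule Bochner_Integration.integrable_bound[of _ "\<lambda>w. C * norm (g w)"])
    show "integrable dV (\<lambda>w. C * norm (g w))" using g by simp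
    show "AE w in dV. norm (g w * q w) \<le> norm (C * norm (g w))"
      using AE_dV_ball
    proof eventually_elim
      fix w :: "complex^'n" assume "w \<in> ball 0 1"
      then have "norm (q w) \<le> C" using bd by simp
      moreover from this have "0 \<le> C" using norm_ge_zero order_trans by blast
      ultimately show "norm (g w * q w) \<le> norm (C * norm (g w))"
        by (simp add: norm_mult abs_mult) (metis mult.commute mult_right_mono norm_ge_zero)
    qed
  qed measurable
  have ib: "norm (\<integral>w. g w * q w \<partial>dV) \<le> C * G" if [measurable]: "q \<in> borel_measurable borel"
    and bd: "\<And>w. norm w < 1 \<Longrightarrow> norm (q w) \<le> C" for q C
  proof -
    have "norm (\<integral>w. g w * q w \<partial>dV) \<le> (\<integral>w. norm (g w * q w) \<partial>dV)"
      by (rule integral_norm_bound)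
    also have "\<dots> \<le> (\<integral>w. C * norm (g w) \<partial>dV)"
    proof (rule integral_mono_AE)
      show "integrable dV (\<lambda>w. norm (g w * q w))" using int[OF that] by simp
      show "integrable dV (\<lambda>w. C * norm (g w))" using g by simp
      show "AE w in dV. norm (g w * q w) \<le> C * norm (g w)"
        using AE_dV_ball by eventually_elim
          (use bd in \<open>auto simp: norm_mult mult.commute[of C] intro!: mult_left_mono\<close>)
    qed
    finally show ?thesis by (simp add: G_def)
  qed
  define q1 where "q1 w = of_nat m / (1 - hip z w) ^ (m + 1)" for w
  have ball: "norm (hip x w) \<le> 1 - r" if "norm w < 1" "norm x \<le> 1 - r" for x w :: "complex^'n"
  proof -
    have "norm (hip x w) \<le> norm x * norm w" by (rule norm_hip_le)
    also have "\<dots> \<le> norm x" using that by (simp add: mult_right_le_one_le)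
    finally show ?thesis using that by simp
  qed
  have bker1: "norm (bker x w) \<le> 1 / r ^ m" if "norm w < 1" "norm x \<le> 1 - r" for x w :: "complex^'n"
    unfolding norm_bker m_def[symmetric] using norm_triangle_ineq2[of 1 "hip x w"] ball[OF that] r
    by (intro divide_left_mono power_mono mult_pos_pos zero_less_power) auto
  have q11: "norm (q1 w) \<le> real m / r ^ (m + 1)" if "norm w < 1" for w
  proof -
    have "r \<le> norm (1 - hip z w)"
      using norm_triangle_ineq2[of 1 "hip z w"] ball[OF that, of z] r by simp
    then show ?thesis unfolding q1_def norm_divide norm_power norm_of_nat using r
      by (intro divide_left_mono power_mono mult_pos_pos zero_less_power) auto
  qed
  have [measurable]: "q1 \<in> borel_measurable borel" unfolding q1_def by measurable
  define D where "D v = (\<integral>w. g w * (q1 w * hip v w) \<partial>dV)" for v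
  have Dbd: "norm (q1 w * hip v w) \<le> real m / r ^ (m + 1) * norm v" if "norm w < 1" for v w
  proof -
    have "norm (hip v w) \<le> norm v"
      using norm_hip_ball[OF that, of v] hip_eq_cnj_norm(1)[of v w] by simp
    then show ?thesis unfolding norm_mult using q11[OF that] r by (intro mult_mono) auto
  qed
  have Dint: "integrable dV (\<lambda>w. g w * (q1 w * hip v w))" for v
    by (rule int[OF _ Dbd]) measurable
  have Dc: "D (c *s v) = c * D v" for c v
    unfolding D_def integral_mult_right_zero[symmetric]
    by (intro Bochner_Integration.integral_cong refl) (simp add: hip_scale_left)
  have Dlin: "bounded_linear D"
  proof (rule bounded_linear_intro)
    fix x y :: "complex^'n" and c :: real
    show "D (x + y) = D x + D y"
      unfolding D_def by (subst Bochner_Integration.integral_add[symmetric, OF Dint Dint])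
        (simp add: hip_add_left distrib_left)
    show "D (c *\<^sub>R x) = c *\<^sub>R D x"
      unfolding scaleR_eq_scale_vec Dc by (simp add: scaleR_conv_of_real)
    show "norm (D x) \<le> norm x * (real m / r ^ (m + 1) * G)"
      unfolding D_def using ib[of "\<lambda>w. q1 w * hip x w", OF _ Dbd] by (simp add: mult_ac)
  qed
  have est: "norm (proj_fun g y - proj_fun g z - D (y - z)) \<le> B * norm (y - z) ^ 2 * G" if y: "norm (y - z) < r" for y
  proof -
    have yr: "norm y \<le> 1 - r" using norm_triangle_ineq[of "y - z" z] y r by simp
    have zr: "norm z \<le> 1 - r" using r by simp
    have yb: "y \<in> ball 0 1" "z \<in> ball 0 1" using yr zr r by auto
    have i: "integrable dV (\<lambda>w. g w * bker y w)" "integrable dV (\<lambda>w. g w * bker z w)"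
      using bker1[OF _ yr] bker1[OF _ zr] by (auto intro!: int)
    have "proj_fun g y - proj_fun g z - D (y - z) =
        (\<integral>w. g w * (bker y w - bker z w - q1 w * hip (y - z) w) \<partial>dV)"
      using yb unfolding proj_fun_def D_def
      by (simp add: right_diff_distrib Bochner_Integration.integral_diff i Dint Bochner_Integration.integrable_diff)
    also have "norm \<dots> \<le> (B * norm (y - z) ^ 2) * G"
    proof (rule ib)
      fix w :: "complex^'n" assume w: "norm w < 1"
      have "norm (bker y w - bker z w - q1 w * hip (y - z) w) \<le> B * norm (hip y w - hip z w) ^ 2"
        using inverse_power_taylor[OF r(1,2) ball[OF w zr] ball[OF w yr], of m]
        by (simp add: bker_def m_def q1_def B_def hip_diff_left)
      also have "\<dots> \<le> B * norm (y - z) ^ 2"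
        using norm_hip_ball[OF w, of "y - z"] hip_eq_cnj_norm(1)[of "y - z" w] B
        by (intro mult_left_mono power_mono) (auto simp: hip_diff_left)
      finally show "norm (bker y w - bker z w - q1 w * hip (y - z) w) \<le> B * norm (y - z) ^ 2" .
    qed measurable
    finally show ?thesis .
  qed
  have "(proj_fun g has_derivative D) (at z)"
    unfolding has_derivative_at_within
  proof (intro conjI Dlin)
    show "((\<lambda>y. (proj_fun g y - proj_fun g z - D (y - z)) /\<^sub>R norm (y - z)) \<longlongrightarrow> 0) (at z)"
    proof (rule Lim_null_comparison)
      show "\<forall>\<^sub>F y in at z. norm ((proj_fun g y - proj_fun g z - D (y - z)) /\<^sub>R norm (y - z)) \<le> B * G * norm (y - z)"
        unfolding eventually_at
      proof (intro exI[of _ r] conjI ballI impI r(1))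
        fix y assume "y \<noteq> z \<and> dist y z < r"
        then have y: "norm (y - z) < r" "0 < norm (y - z)" by (auto simp: dist_norm)
        have "norm (proj_fun g y - proj_fun g z - D (y - z)) \<le> (B * G * norm (y - z)) * norm (y - z)"
          using est[OF y(1)] by (simp add: power2_eq_square mult_ac)
        then show "norm ((proj_fun g y - proj_fun g z - D (y - z)) /\<^sub>R norm (y - z)) \<le> B * G * norm (y - z)"
          using y(2) by (simp add: divide_inverse[symmetric] pos_divide_le_eq mult.commute[of "inverse _"])
      qed
      have "((\<lambda>y. B * G * norm (y - z)) \<longlongrightarrow> B * G * norm (z - z)) (at z)"
        by (intro tendsto_intros)
      then show "((\<lambda>y. B * G * norm (y - z)) \<longlongrightarrow> 0) (at z)" by simp
    qed
  qed
  then show "\<exists>D. (proj_fun g has_derivative D) (at z) \<and> (\<forall>c v. D (c *s v) = c * D v)"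
    using Dc by blast
qed

section \<open>The complex inner product and operator norms\<close>

lemma bergman_fun_holomorphic: "bergman_fun f holomorphic_Cn_on ball 0 1"
  and bergman_fun_outside: "z \<notin> ball 0 1 \<Longrightarrow> bergman_fun f z = 0"
  using bergman_fun[of f] by auto

lemma bergman_fun_measurable [measurable]: "bergman_fun f \<in> borel_measurable borel"
  by (intro L2_measurable bergman_L2)

lemma bergman_fun_integrable: "integrable dV (bergman_fun f)"
  by (intro L2_imp_integrable bergman_L2)

lemma cinner_commute: "cinner f g = cnj (cinner g f)"
  unfolding cinner_def Bochner_Integration.integral_cnj[symmetric] by (simp add: mult.commute)

lemma cinner_add_left: "cinner (f + g) h = cinner f h + cinner g h"
  unfolding cinner_def plus_bergman.rep_eq distrib_right
  by (intro Bochner_Integration.integral_add bergman_integrable)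

lemma cinner_cscale_left: "cinner (cscale c f) g = c * cinner f g"
  unfolding cinner_def cscale.rep_eq mult.assoc by simp

lemma cscale_neg_one: "- f = cscale (-1) f"
  by transfer simp

lemma cinner_diff_left: "cinner (f - g) h = cinner f h - cinner g h"
  unfolding diff_conv_add_uminus cinner_add_left cscale_neg_one cinner_cscale_left by simp

lemma norm_bergman_sq: "(norm f)\<^sup>2 = (\<integral>z. (norm (bergman_fun f z))\<^sup>2 \<partial>dV)"
  by (simp add: norm_bergman_def inner_bergman_def cinner_self)

lemma cinner_eqI:
  assumes "\<And>h. cinner f h = cinner g h" shows "f = g"
proof -
  have "cinner (f - g) (f - g) = 0" using assms by (simp add: cinner_diff_left)
  then have "inner (f - g) (f - g) = 0" by (simp add: inner_bergman_def)
  then show ?thesis by simp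
qed

text \<open>A unimodular factor on \<open>f\<close> makes the complex product real and nonnegative,
  and the real Cauchy-Schwarz inequality applies.\<close>

lemma norm_cinner_le: "norm (cinner f g) \<le> norm f * norm g"
proof -
  obtain c :: complex where c: "norm c = 1" "c * cinner f g = of_real (norm (cinner f g))"
  proof (cases "cinner f g = 0")
    case True then show ?thesis by (intro that[of 1]) auto
  next
    case False
    then show ?thesis
      by (intro that[of "cnj (cinner f g) / of_real (norm (cinner f g))"])
        (auto simp: norm_divide mult.commute power2_eq_square simp flip: complex_norm_square)
  qed
  have "norm (cinner f g) = inner (cscale c f) g"
    by (simp add: inner_bergman_def cinner_cscale_left c)
  also have "\<dots> \<le> norm (cscale c f) * norm g" by (rule norm_cauchy_schwarz)
  finally show ?thesis by (simp add: norm_cscale c)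
qed

text \<open>Testing with the multiple of \<open>S f\<close> that has the norm of \<open>f\<close>
  turns the sum of squares into two equal terms, which account for the factor 2.\<close>

lemma blinfun_norm_le_cinner:
  fixes S :: "'n::finite bergman \<Rightarrow>\<^sub>L 'n bergman"
  assumes C: "0 \<le> C" and bd: "\<And>f g. norm (cinner (S f) g) \<le> C * ((norm f)\<^sup>2 + (norm g)\<^sup>2)"
  shows "norm S \<le> 2 * C"
proof (rule norm_blinfun_bound)
  show "0 \<le> 2 * C" using C by simp
  fix f
  show "norm (S f) \<le> 2 * C * norm f"
  proof (cases "f = 0 \<or> S f = 0")
    case True then show ?thesis using C by (auto simp: blinfun.zero_right)
  next
    case False
    define l where "l = norm f / norm (S f)"
    have l: "0 < l" using False by (simp add: l_def)
    have "l * (norm (S f))\<^sup>2 = inner (S f) (l *\<^sub>R S f)"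
      by (simp add: power2_norm_eq_inner)
    also have "\<dots> \<le> norm (cinner (S f) (l *\<^sub>R S f))"
      by (simp add: inner_bergman_def complex_Re_le_cmod)
    also have "\<dots> \<le> C * ((norm f)\<^sup>2 + (norm (l *\<^sub>R S f))\<^sup>2)" by (rule bd)
    also have "norm (l *\<^sub>R S f) = norm f" using False by (simp add: l_def)
    finally have "norm f * norm (S f) \<le> (2 * C * norm f) * norm f"
      using False by (simp add: l_def power2_eq_square)
    then show ?thesis using False by (simp add: mult.commute[of "norm f"])
  qed
qed

text \<open>By Fubini and the Hermitian symmetry of the kernel the projection moves to
  \<open>h\<close>, where it acts as the identity by \<open>bergman_reproducing\<close>.\<close>

lemma proj_fun_orth:
  fixes g :: "complex^'n::finite \<Rightarrow> complex"
  assumes g: "g \<in> L2"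
  shows "(\<integral>z. proj_fun g z * cnj (bergman_fun h z) \<partial>dV) = (\<integral>z. g z * cnj (bergman_fun h z) \<partial>dV)"
proof -
  interpret sigma_finite_measure "dV :: (complex^'n) measure" by (rule sigma_finite_dV)
  interpret pair_sigma_finite "dV :: (complex^'n) measure" "dV :: (complex^'n) measure" ..
  note [measurable] = L2_measurable[OF g]
  have "(\<integral>z. proj_fun g z * cnj (bergman_fun h z) \<partial>dV) =
      (\<integral>z. (\<integral>w. g w * bker z w * cnj (bergman_fun h z) \<partial>dV) \<partial>dV)"
    by (intro Bochner_Integration.integral_cong refl)
      (auto simp: proj_fun_def bergman_fun_outside)
  also have "\<dots> = (\<integral>w. (\<integral>z. g w * bker z w * cnj (bergman_fun h z) \<partial>dV) \<partial>dV)"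
    by (rule Fubini_integral[OF bker_sesquilinear_integrable[OF g bergman_L2], symmetric])
  also have "\<dots> = (\<integral>w. g w * cnj (bergman_fun h w) \<partial>dV)"
  proof (rule integral_cong_AE)
    show "AE w in dV. (\<integral>z. g w * bker z w * cnj (bergman_fun h z) \<partial>dV) = g w * cnj (bergman_fun h w)"
      using AE_dV_ball
    proof eventually_elim
      fix w :: "complex^'n" assume w: "w \<in> ball 0 1"
      have "(\<integral>z. g w * bker z w * cnj (bergman_fun h z) \<partial>dV) = (\<integral>z. g w * cnj (bergman_fun h z * bker w z) \<partial>dV)"
        by (intro Bochner_Integration.integral_cong refl) (simp add: bker_cnj[of _ w] mult_ac)
      also have "\<dots> = g w * cnj (\<integral>z. bergman_fun h z * bker w z \<partial>dV)"
        unfolding integral_mult_right_zero Bochner_Integration.integral_cnj ..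
      also have "(\<integral>z. bergman_fun h z * bker w z \<partial>dV) = bergman_fun h w"
        using w by (intro bergman_reproducing(2) bergman_fun_holomorphic bergman_fun_integrable) simp
      finally show "(\<integral>z. g w * bker z w * cnj (bergman_fun h z) \<partial>dV) = g w * cnj (bergman_fun h w)" .
    qed
  qed measurable
  finally show ?thesis .
qed

text \<open>\<open>proj_fun g\<close> satisfies the orthogonality, and an element of the Bergman
  space is determined by its inner products; so the description in \<open>bergman_proj\<close> has
  exactly this solution.\<close>

lemma bergman_fun_proj:
  fixes g :: "complex^'n::finite \<Rightarrow> complex"
  assumes g: "g \<in> L2"
  shows "bergman_fun (bergman_proj g) = proj_fun g"
proof -
  have PL: "proj_fun g \<in> L2" using proj_fun_L2_bound[where 'n='n] g by blast
  have "proj_fun g \<in> {f. f holomorphic_Cn_on ball 0 1 \<and> f \<in> L2 \<and> (\<forall>z. z \<notin> ball 0 1 \<longrightarrow> f z = 0)}"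
    using proj_fun_holomorphic[OF L2_imp_integrable[OF g]] PL by (auto simp: proj_fun_def)
  then have F: "bergman_fun (Bergman (proj_fun g)) = proj_fun g" by (rule Bergman_inverse)
  have diff: "(\<integral>z. (g z - bergman_fun f z) * cnj (bergman_fun h z) \<partial>dV) =
      (\<integral>z. g z * cnj (bergman_fun h z) \<partial>dV) - cinner f h" for f h
    unfolding cinner_def left_diff_distrib
    by (intro Bochner_Integration.integral_diff L2_integrable g bergman_L2)
  have "bergman_proj g = Bergman (proj_fun g)"
    unfolding bergman_proj_def
  proof (rule the_equality)
    show "\<forall>h. (\<integral>z. (g z - bergman_fun (Bergman (proj_fun g)) z) * cnj (bergman_fun h z) \<partial>dV) = 0"
      unfolding diff unfolding cinner_def F by (simp add: proj_fun_orth[OF g])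
    fix f assume "\<forall>h. (\<integral>z. (g z - bergman_fun f z) * cnj (bergman_fun h z) \<partial>dV) = 0"
    then have "cinner f h = cinner (Bergman (proj_fun g)) h" for h
      unfolding diff unfolding cinner_def F by (simp add: proj_fun_orth[OF g])
    then show "f = Bergman (proj_fun g)" by (rule cinner_eqI)
  qed
  then show ?thesis using F by simp
qed

lemma cinner_proj: "g \<in> L2 \<Longrightarrow> cinner (bergman_proj g) h = (\<integral>z. g z * cnj (bergman_fun h z) \<partial>dV)"
  unfolding cinner_def bergman_fun_proj by (rule proj_fun_orth)

lemma norm_bergman_proj_le:
  "\<exists>C>0. \<forall>g :: complex^'n::finite \<Rightarrow> complex. g \<in> L2 \<longrightarrow> (norm (bergman_proj g))\<^sup>2 \<le> C\<^sup>2 * (\<integral>z. (norm (g z))\<^sup>2 \<partial>dV)"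
  using proj_fun_L2_bound[where 'n='n] by (auto simp: norm_bergman_sq bergman_fun_proj)

text \<open>\<open>Blinfun\<close> has its intended meaning only on bounded linear maps. Linearity
  is verified weakly, by comparing inner products with all \<open>h\<close>; boundedness comes from
  that of the projection.\<close>

lemma toeplitz_apply:
  fixes a :: "complex^'n::finite \<Rightarrow> complex"
  assumes a: "a \<in> Linf"
  shows "blinfun_apply (toeplitz a) f = bergman_proj (\<lambda>z. a z * bergman_fun f z)"
proof -
  have L: "(\<lambda>z. a z * bergman_fun f z) \<in> L2" for f by (intro Linf_mult_L2 a bergman_L2)
  have ci: "cinner (bergman_proj (\<lambda>z. a z * bergman_fun f z)) h = (\<integral>z. a z * (bergman_fun f z * cnj (bergman_fun h z)) \<partial>dV)" for f h
    unfolding cinner_proj[OF L] by (simp add: mult.assoc)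
  have i: "integrable dV (\<lambda>z. a z * (bergman_fun f z * cnj (bergman_fun h z)))" for f h
    using L2_integrable[OF L bergman_L2, of f h] by (simp add: mult.assoc)
  obtain A where A: "0 \<le> A" "AE z in dV. norm (a z) \<le> A" using a by (rule Linf_boundE)
  obtain C where C: "0 < C" "\<forall>g :: complex^'n \<Rightarrow> complex. g \<in> L2 \<longrightarrow> (norm (bergman_proj g))\<^sup>2 \<le> C\<^sup>2 * (\<integral>z. (norm (g z))\<^sup>2 \<partial>dV)"
    using norm_bergman_proj_le[where 'n='n] by auto
  have "bounded_linear (\<lambda>f. bergman_proj (\<lambda>z. a z * bergman_fun f z))"
  proof (rule bounded_linear_intro)
    fix f g :: "'n bergman" and r :: real
    show "bergman_proj (\<lambda>z. a z * bergman_fun (f + g) z) =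
        bergman_proj (\<lambda>z. a z * bergman_fun f z) + bergman_proj (\<lambda>z. a z * bergman_fun g z)"
      by (rule cinner_eqI, simp only: ci cinner_add_left)
        (simp add: plus_bergman.rep_eq distrib_right distrib_left Bochner_Integration.integral_add i)
    have "bergman_proj (\<lambda>z. a z * bergman_fun (cscale (of_real r) f) z) =
        cscale (of_real r) (bergman_proj (\<lambda>z. a z * bergman_fun f z))"
      by (rule cinner_eqI, simp only: ci cinner_cscale_left)
        (simp add: cscale.rep_eq mult.left_commute[of _ "of_real r"] mult.assoc)
    then show "bergman_proj (\<lambda>z. a z * bergman_fun (r *\<^sub>R f) z) = r *\<^sub>R bergman_proj (\<lambda>z. a z * bergman_fun f z)"
      by (simp add: scaleR_bergman_def)
    have "(norm (bergman_proj (\<lambda>z. a z * bergman_fun f z)))\<^sup>2 \<le> C\<^sup>2 * (\<integral>z. (norm (a z * bergman_fun f z))\<^sup>2 \<partial>dV)"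
      using C(2) L by blast
    also have "(\<integral>z. (norm (a z * bergman_fun f z))\<^sup>2 \<partial>dV) \<le> (\<integral>z. A\<^sup>2 * (norm (bergman_fun f z))\<^sup>2 \<partial>dV)"
    proof (rule integral_mono_AE)
      show "integrable dV (\<lambda>z. (norm (a z * bergman_fun f z))\<^sup>2)" using L[of f] by (simp add: L2_def)
      show "integrable dV (\<lambda>z. A\<^sup>2 * (norm (bergman_fun f z))\<^sup>2)" using bergman_L2[of f] by (simp add: L2_def)
      show "AE z in dV. (norm (a z * bergman_fun f z))\<^sup>2 \<le> A\<^sup>2 * (norm (bergman_fun f z))\<^sup>2"
        using A(2) by eventually_elim (auto simp: norm_mult power_mult_distrib intro!: mult_right_mono power_mono)
    qed
    also have "C\<^sup>2 * (\<integral>z. A\<^sup>2 * (norm (bergman_fun f z))\<^sup>2 \<partial>dV) = (norm f * (C * A))\<^sup>2"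
      by (simp add: norm_bergman_sq[symmetric] power_mult_distrib)
    finally have "(norm (bergman_proj (\<lambda>z. a z * bergman_fun f z)))\<^sup>2 \<le> (norm f * (C * A))\<^sup>2"
      using C(1) by (simp add: mult_left_mono)
    then show "norm (bergman_proj (\<lambda>z. a z * bergman_fun f z)) \<le> norm f * (C * A)"
      by (rule power2_le_imp_le) (use C(1) A(1) in simp)
  qed
  then show ?thesis unfolding toeplitz_def by (simp add: bounded_linear_Blinfun_apply)
qed

lemma cinner_toeplitz:
  assumes "a \<in> Linf"
  shows "cinner (blinfun_apply (toeplitz a) f) g = (\<integral>z. a z * bergman_fun f z * cnj (bergman_fun g z) \<partial>dV)"
  unfolding toeplitz_apply[OF assms] by (rule cinner_proj) (intro Linf_mult_L2 assms bergman_L2)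

lemma toeplitz_integrable:
  assumes "a \<in> Linf"
  shows "integrable dV (\<lambda>z. a z * bergman_fun f z * cnj (bergman_fun g z))"
  by (intro L2_integrable Linf_mult_L2 assms bergman_L2)

lemma toeplitz_bounded_op: "a \<in> Linf \<Longrightarrow> toeplitz a \<in> bounded_ops"
  unfolding bounded_ops_def
  by (auto intro!: cinner_eqI simp: cinner_toeplitz cinner_cscale_left cscale.rep_eq mult.left_commute mult.assoc)

lemma cinner_toeplitz_mult:
  fixes a b :: "complex^'n::finite \<Rightarrow> complex"
  assumes a: "a \<in> Linf" and b: "b \<in> Linf"
  shows "cinner (blinfun_apply (toeplitz a o\<^sub>L toeplitz b) f) g =
    (\<integral>z. (\<integral>w. a z * b w * bker z w * bergman_fun f w * cnj (bergman_fun g z) \<partial>dV) \<partial>dV)"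
proof -
  have L: "(\<lambda>z. b z * bergman_fun f z) \<in> L2" by (intro Linf_mult_L2 b bergman_L2)
  have "cinner (blinfun_apply (toeplitz a o\<^sub>L toeplitz b) f) g =
      (\<integral>z. a z * proj_fun (\<lambda>w. b w * bergman_fun f w) z * cnj (bergman_fun g z) \<partial>dV)"
    by (simp add: cinner_toeplitz[OF a] toeplitz_apply[OF b] bergman_fun_proj[OF L])
  also have "\<dots> = (\<integral>z. (\<integral>w. a z * b w * bker z w * bergman_fun f w * cnj (bergman_fun g z) \<partial>dV) \<partial>dV)"
  proof (intro Bochner_Integration.integral_cong refl)
    fix z
    have "(\<integral>w. a z * b w * bker z w * bergman_fun f w * cnj (bergman_fun g z) \<partial>dV) =
        (\<integral>w. (a z * cnj (bergman_fun g z)) * (b w * bergman_fun f w * bker z w) \<partial>dV)"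
      by (simp add: mult_ac)
    also have "\<dots> = (a z * cnj (bergman_fun g z)) * (\<integral>w. b w * bergman_fun f w * bker z w \<partial>dV)"
      by (rule integral_mult_right_zero)
    finally show "a z * proj_fun (\<lambda>w. b w * bergman_fun f w) z * cnj (bergman_fun g z) =
        (\<integral>w. a z * b w * bker z w * bergman_fun f w * cnj (bergman_fun g z) \<partial>dV)"
      by (auto simp: proj_fun_def bergman_fun_outside)
  qed
  finally show ?thesis .
qed

section \<open>Recovering off-diagonal values\<close>

lemma taylor_coeff_bound:
  assumes F: "F holomorphic_on S" "cball 0 r \<subseteq> S" "0 < r"
    and bd: "\<And>\<zeta>. norm \<zeta> \<le> r \<Longrightarrow> norm (F \<zeta>) \<le> A"
  shows "norm (taylor_coeff F k) \<le> A / r ^ k"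
proof -
  have hol: "F holomorphic_on cball 0 r" by (rule holomorphic_on_subset[OF F(1,2)])
  have "norm ((deriv ^^ k) F 0) \<le> fact k * A / r ^ k"
    using F(3) bd
    by (intro Cauchy_inequality holomorphic_on_subset[OF hol] holomorphic_on_imp_continuous_on hol) auto
  then have "norm ((deriv ^^ k) F 0) / fact k \<le> fact k * A / r ^ k / fact k"
    by (rule divide_right_mono) simp
  then show ?thesis by (simp add: taylor_coeff_def norm_divide)
qed

text \<open>Cauchy's estimates bound all Taylor coefficients by \<open>A\<close>, so the increment
  is at most \<open>A * d / (1 - d)\<close>.\<close>

lemma holomorphic_diff_bound:
  assumes F: "F holomorphic_on S" "cball 0 1 \<subseteq> S" and bd: "\<And>\<zeta>. norm \<zeta> \<le> 1 \<Longrightarrow> norm (F \<zeta>) \<le> A"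
    and d: "0 \<le> d" "d \<le> 1 / 2"
  shows "norm (F (of_real d) - F 0) \<le> 2 * d * A"
proof -
  have A: "0 \<le> A" using order_trans[OF norm_ge_zero bd[of 0]] by simp
  have c: "norm (taylor_coeff F k) \<le> A" for k
    using taylor_coeff_bound[OF F _ bd, of k] by simp
  have hol: "F holomorphic_on ball 0 1"
    by (rule holomorphic_on_subset[OF F(1) order_trans[OF ball_subset_cball F(2)]])
  have "(\<lambda>k. taylor_coeff F k * of_real d ^ k) sums F (of_real d)"
    using d by (intro taylor_sums[OF hol]) simp
  from sums_split_initial_segment[OF this, of 1]
  have s: "(\<lambda>k. taylor_coeff F (k + 1) * of_real d ^ (k + 1)) sums (F (of_real d) - F 0)" by simp
  have g: "(\<lambda>k. A * d * d ^ k) sums (A * d * (1 / (1 - d)))"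
    using d by (intro sums_mult geometric_sums) auto
  have "norm (F (of_real d) - F 0) \<le> A * d * (1 / (1 - d))"
  proof (rule norm_sums_le[OF s g])
    fix k
    have "norm (taylor_coeff F (k + 1) * of_real d ^ (k + 1)) = norm (taylor_coeff F (k + 1)) * (d * d ^ k)"
      using d by (simp add: norm_mult norm_power)
    also have "\<dots> \<le> A * (d * d ^ k)" using c d by (intro mult_right_mono) auto
    finally show "norm (taylor_coeff F (k + 1) * of_real d ^ (k + 1)) \<le> A * d * d ^ k" by (simp add: mult_ac)
  qed
  also have "1 / (1 - d) \<le> 2" using d by (simp add: field_simps)
  then have "A * d * (1 / (1 - d)) \<le> A * d * 2" using A d by (intro mult_left_mono) auto
  finally show ?thesis by (simp add: mult_ac)
qed

text \<open>Integrating against this weight sums the Fourier coefficients of index 0 to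
  \<open>L\<close>, the \<open>m\<close>-th divided by \<open>\<rho> ^ m\<close>.\<close>

definition fourier_weight :: "nat \<Rightarrow> real \<Rightarrow> real \<Rightarrow> complex" where
  "fourier_weight L \<rho> x = (\<Sum>m\<le>L. of_real (1 / \<rho> ^ m) * cnj (unit_exp x) ^ m)"

lemma continuous_on_fourier_weight: "continuous_on S (fourier_weight L \<rho>)"
  unfolding fourier_weight_def by (intro continuous_intros)

lemma fourier_weight_measurable [measurable]: "fourier_weight L \<rho> \<in> borel_measurable borel"
  by (intro borel_measurable_continuous_onI continuous_on_fourier_weight)

lemma norm_fourier_weight_le:
  assumes "0 < \<rho>" shows "norm (fourier_weight L \<rho> x) \<le> (\<Sum>m\<le>L. 1 / \<rho> ^ m)"
  unfolding fourier_weight_def using assms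
  by (intro sum_norm_le) (simp add: norm_mult norm_power norm_divide)

text \<open>The polarisation step: an off-diagonal value \<open>F(1) cnj G(0)\<close> is recovered from the diagonal
  values \<open>F cnj G\<close> on one small circle. The \<open>m\<close>-th Fourier coefficient of \<open>F cnj G\<close> on the
  circle of radius \<open>\<rho>\<close> is \<open>\<Sum>l. F\<^sub>m\<^sub>+\<^sub>l cnj G\<^sub>l \<rho>\<^sup>m\<^sup>+\<^sup>2\<^sup>l\<close>, which after division by \<open>\<rho>\<^sup>m\<close> is
  \<open>F\<^sub>m cnj G\<^sub>0 + O(R\<^sup>-\<^sup>m \<rho>\<^sup>2)\<close>, uniformly in \<open>m\<close>.\<close>

lemma fourier_coefficient_product:
  assumes F: "F holomorphic_on S" and G: "G holomorphic_on S" and S: "cball 0 R \<subseteq> S" and R: "1 < R"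
    and A: "\<And>\<zeta>. norm \<zeta> \<le> R \<Longrightarrow> norm (F \<zeta>) \<le> A" and B: "\<And>\<zeta>. norm \<zeta> \<le> R \<Longrightarrow> norm (G \<zeta>) \<le> B"
    and \<rho>: "0 < \<rho>" "\<rho> < 1"
  shows "norm ((\<integral>x. F (of_real \<rho> * unit_exp x) * cnj (G (of_real \<rho> * unit_exp x)) * cnj (unit_exp x) ^ m \<partial>circle01)
      - taylor_coeff F m * cnj (G 0) * of_real \<rho> ^ m) \<le> A * B * (\<rho> / R) ^ m * (\<rho>\<^sup>2 / (1 - \<rho>\<^sup>2))"
proof -
  interpret C: finite_measure circle01 by (rule finite_measure_circle01)
  have AB: "0 \<le> A" "0 \<le> B"
    using order_trans[OF norm_ge_zero A[of 0]] order_trans[OF norm_ge_zero B[of 0]] R by simp_all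
  have Fk: "norm (taylor_coeff F k) \<le> A / R ^ k" and Gk: "norm (taylor_coeff G k) \<le> B / R ^ k" for k
    using taylor_coeff_bound[OF F S _ A] taylor_coeff_bound[OF G S _ B] R by auto
  have Gk': "norm (taylor_coeff G k) \<le> B" for k
  proof -
    have "B / R ^ k \<le> B / 1" using R AB by (intro divide_left_mono) auto
    then show ?thesis using Gk[of k] by simp
  qed
  have rS: "cball 0 \<rho> \<subseteq> S" using S R \<rho> by (auto simp: subset_iff)
  have holG: "G holomorphic_on ball 0 R"
    by (rule holomorphic_on_subset[OF G order_trans[OF ball_subset_cball S]])
  have cF: "continuous_on (cball 0 \<rho>) F" and cG: "continuous_on (cball 0 \<rho>) G"
    by (rule holomorphic_on_imp_continuous_on, rule holomorphic_on_subset[OF _ rS], fact)+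
  define e where "e x = of_real \<rho> * unit_exp x" for x
  have ne: "norm (e x) = \<rho>" for x using \<rho> by (simp add: e_def norm_mult)
  have "continuous_on UNIV (\<lambda>x. F (e x))" "continuous_on UNIV (\<lambda>x. G (e x))"
    using ne by (auto simp: e_def intro!: continuous_intros continuous_on_compose2[OF cF] continuous_on_compose2[OF cG])
  note [measurable] = this[THEN borel_measurable_continuous_onI]
  \<comment> \<open>Only \<open>cnj G\<close> is expanded. On the circle the conjugate of
    \<open>e x ^ l\<close> is \<open>\<rho> ^ l * cnj (unit_exp x) ^ l\<close>, which shifts the
    Fourier index of the unexpanded \<open>F\<close> from \<open>m\<close> to
    \<open>m + l\<close>.\<close>
  define t where "t l x = F (e x) * cnj (taylor_coeff G l * e x ^ l) * cnj (unit_exp x) ^ m" for l x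
  have [measurable]: "t l \<in> borel_measurable borel" for l
  proof -
    have [measurable]: "e \<in> borel_measurable borel" unfolding e_def by measurable
    show ?thesis unfolding t_def by measurable
  qed
  have tn: "norm (t l x) \<le> A * B * \<rho> ^ l" for l x
  proof -
    have "norm (t l x) = norm (F (e x)) * norm (taylor_coeff G l) * \<rho> ^ l"
      by (simp add: t_def norm_mult norm_power ne)
    also have "\<dots> \<le> A * B * \<rho> ^ l"
      using A[of "e x"] Gk'[of l] AB \<rho> R by (intro mult_right_mono mult_mono) (auto simp: ne)
    finally show ?thesis .
  qed
  have tsums: "(\<lambda>l. t l x) sums (F (e x) * cnj (G (e x)) * cnj (unit_exp x) ^ m)" for x
  proof -
    have "(\<lambda>l. taylor_coeff G l * e x ^ l) sums G (e x)"
      using \<rho> R by (intro taylor_sums[OF holG]) (simp add: ne)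
    then have "(\<lambda>l. cnj (taylor_coeff G l * e x ^ l)) sums cnj (G (e x))" by (simp only: sums_cnj)
    from sums_mult2[OF sums_mult[OF this, of "F (e x)"], of "cnj (unit_exp x) ^ m"]
    show ?thesis by (simp only: t_def)
  qed
  have ti: "integrable circle01 (t l)" for l
    by (rule C.integrable_const_bound[where B = "A * B * \<rho> ^ l"]) (auto simp: tn)
  have tI: "(\<integral>x. t l x \<partial>circle01) = taylor_coeff F (m + l) * cnj (taylor_coeff G l) * of_real (\<rho> ^ (m + 2 * l))" for l
  proof -
    have "t l x = (cnj (taylor_coeff G l) * of_real \<rho> ^ l) * (F (e x) * cnj (unit_exp x) ^ (m + l))" for x
      by (simp add: t_def e_def power_mult_distrib power_add mult_ac)
    then have "(\<integral>x. t l x \<partial>circle01) = (cnj (taylor_coeff G l) * of_real \<rho> ^ l) * (\<integral>x. F (e x) * cnj (unit_exp x) ^ (m + l) \<partial>circle01)"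
      by simp
    moreover have "complex_of_real (\<rho> ^ (m + 2 * l)) = of_real \<rho> ^ m * (of_real \<rho> ^ l * of_real \<rho> ^ l)"
      by (simp add: mult_2 power_add)
    ultimately show ?thesis
      unfolding e_def circle_integral_coeff[OF F rS \<rho>(1)] by (simp only: power_add mult_ac)
  qed
  have geo: "summable (\<lambda>l. A * B * \<rho> ^ l)" using \<rho> by (intro summable_mult summable_geometric) simp
  have L: "(\<lambda>l. \<integral>x. t l x \<partial>circle01) sums (\<integral>x. (\<Sum>l. t l x) \<partial>circle01)"
  proof (rule sums_integral[OF ti])
    show "AE x in circle01. summable (\<lambda>l. norm (t l x))"
      using tn by (intro AE_I2 summable_comparison_test'[OF geo]) auto
    show "summable (\<lambda>l. \<integral>x. norm (t l x) \<partial>circle01)"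
    proof (rule summable_comparison_test'[OF geo])
      fix l
      have "(\<integral>x. norm (t l x) \<partial>circle01) \<le> (\<integral>x. A * B * \<rho> ^ l \<partial>circle01)"
        using ti tn by (intro integral_mono) auto
      then show "norm (\<integral>x. norm (t l x) \<partial>circle01) \<le> A * B * \<rho> ^ l" by simp
    qed
  qed
  have "(\<Sum>l. t l x) = F (e x) * cnj (G (e x)) * cnj (unit_exp x) ^ m" for x
    using tsums sums_unique by metis
  then have "(\<lambda>l. taylor_coeff F (m + l) * cnj (taylor_coeff G l) * of_real (\<rho> ^ (m + 2 * l))) sums
      (\<integral>x. F (e x) * cnj (G (e x)) * cnj (unit_exp x) ^ m \<partial>circle01)"
    using L by (simp only: tI)
  \<comment> \<open>The term \<open>l = 0\<close> is the wanted one; every other term carries at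
    least two further powers of \<open>\<rho>\<close>.\<close>
  from sums_split_initial_segment[OF this, of 1]
  have s: "(\<lambda>l. taylor_coeff F (m + (l + 1)) * cnj (taylor_coeff G (l + 1)) * of_real (\<rho> ^ (m + 2 * (l + 1)))) sums
      ((\<integral>x. F (e x) * cnj (G (e x)) * cnj (unit_exp x) ^ m \<partial>circle01) - taylor_coeff F m * cnj (G 0) * of_real \<rho> ^ m)"
    by simp
  have \<rho>2: "\<rho>\<^sup>2 < 1" using \<rho> by (simp add: power_less_one_iff)
  have g: "(\<lambda>l. A * B * (\<rho> / R) ^ m * \<rho>\<^sup>2 * (\<rho>\<^sup>2) ^ l) sums (A * B * (\<rho> / R) ^ m * \<rho>\<^sup>2 * (1 / (1 - \<rho>\<^sup>2)))"
    using \<rho>2 by (intro sums_mult geometric_sums) auto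
  have "norm ((\<integral>x. F (e x) * cnj (G (e x)) * cnj (unit_exp x) ^ m \<partial>circle01) - taylor_coeff F m * cnj (G 0) * of_real \<rho> ^ m)
      \<le> A * B * (\<rho> / R) ^ m * \<rho>\<^sup>2 * (1 / (1 - \<rho>\<^sup>2))"
  proof (rule norm_sums_le[OF s g])
    fix l
    have "norm (taylor_coeff F (m + (l + 1))) \<le> A / R ^ m"
    proof -
      have "A / R ^ (m + (l + 1)) \<le> A / R ^ m"
        using R AB by (intro divide_left_mono power_increasing mult_pos_pos) auto
      then show ?thesis using Fk[of "m + (l + 1)"] by linarith
    qed
    then have "norm (taylor_coeff F (m + (l + 1)) * cnj (taylor_coeff G (l + 1)) * of_real (\<rho> ^ (m + 2 * (l + 1)))) \<le>
        A / R ^ m * B * \<rho> ^ (m + 2 * (l + 1))"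
    proof -
      assume F': "norm (taylor_coeff F (m + (l + 1))) \<le> A / R ^ m"
      have n: "norm (complex_of_real (\<rho> ^ (m + 2 * (l + 1)))) = \<rho> ^ (m + 2 * (l + 1))"
        unfolding norm_of_real using \<rho> by (intro abs_of_nonneg zero_le_power) simp
      show ?thesis unfolding norm_mult n complex_mod_cnj
        by (intro mult_mono F' Gk') (use AB R \<rho> in auto)
    qed
    also have "\<dots> = A * B * (\<rho> / R) ^ m * \<rho>\<^sup>2 * (\<rho>\<^sup>2) ^ l"
      by (simp add: power_divide power_add power_mult power2_eq_square)
    finally show "norm (taylor_coeff F (m + (l + 1)) * cnj (taylor_coeff G (l + 1)) * of_real (\<rho> ^ (m + 2 * (l + 1)))) \<le>
        A * B * (\<rho> / R) ^ m * \<rho>\<^sup>2 * (\<rho>\<^sup>2) ^ l" .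
  qed
  then show ?thesis by (simp add: e_def)
qed

text \<open>\<open>F 1\<close> is the sum of all Taylor coefficients of \<open>F\<close>. Truncation
  at \<open>L\<close> costs a geometric tail, and the errors of the Fourier coefficients, summable
  in \<open>m\<close>, are made small by \<open>\<rho>\<close>. Both choices depend on
  \<open>R\<close> and \<open>\<epsilon>\<close> alone, so one weight works for all pairs of
  functions.\<close>

lemma diagonal_approximation:
  assumes R: "1 < R" and \<epsilon>: "0 < \<epsilon>"
  shows "\<exists>L \<rho>. 0 < \<rho> \<and> \<rho> < 1 \<and> (\<forall>F G S A B. F holomorphic_on S \<longrightarrow> G holomorphic_on S \<longrightarrow> cball 0 R \<subseteq> S \<longrightarrow>
    (\<forall>\<zeta>. norm \<zeta> \<le> R \<longrightarrow> norm (F \<zeta>) \<le> A) \<longrightarrow> (\<forall>\<zeta>. norm \<zeta> \<le> R \<longrightarrow> norm (G \<zeta>) \<le> B) \<longrightarrow>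
    norm (F 1 * cnj (G 0) - (\<integral>x. fourier_weight L \<rho> x * (F (of_real \<rho> * unit_exp x) * cnj (G (of_real \<rho> * unit_exp x))) \<partial>circle01))
      \<le> \<epsilon> * A * B)"
proof -
  \<comment> \<open>The value of \<open>\<rho>\<^sup>2 / (1 - \<rho>\<^sup>2)\<close> for which the
    geometric sum of the errors, \<open>u * R / (R - 1)\<close>, is
    \<open>\<epsilon> / 2\<close>.\<close>
  define u where "u = \<epsilon> * (R - 1) / (2 * R)"
  have u: "0 < u" using R \<epsilon> by (simp add: u_def)
  define \<rho> where "\<rho> = sqrt (u / (1 + u))"
  have \<rho>: "0 < \<rho>" "\<rho> < 1" using u by (auto simp: \<rho>_def)
  have \<rho>2: "\<rho>\<^sup>2 / (1 - \<rho>\<^sup>2) = u" using u by (simp add: \<rho>_def field_simps)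
  \<comment> \<open>Up to the factor \<open>A\<close>, the tail of the Taylor series after index
    \<open>L\<close> is at most \<open>(1 / R) ^ L / (R - 1)\<close>.\<close>
  have "\<exists>L. (1 / R) ^ L < \<epsilon> * (R - 1) / 2"
    using R \<epsilon> by (intro real_arch_pow_inv) auto
  then obtain L where L: "(1 / R) ^ L < \<epsilon> * (R - 1) / 2" by blast
  show ?thesis
  proof (intro exI[of _ L] exI[of _ \<rho>] conjI \<rho> allI impI)
    fix F G S A B
    assume F: "F holomorphic_on S" and G: "G holomorphic_on S" and S: "cball 0 R \<subseteq> S"
      and A: "\<forall>\<zeta>. norm \<zeta> \<le> R \<longrightarrow> norm (F \<zeta>) \<le> A" and B: "\<forall>\<zeta>. norm \<zeta> \<le> R \<longrightarrow> norm (G \<zeta>) \<le> B"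
    have AB: "0 \<le> A" "0 \<le> B"
      using order_trans[OF norm_ge_zero A[rule_format, of 0]] order_trans[OF norm_ge_zero B[rule_format, of 0]] R by simp_all
    have G0: "norm (G 0) \<le> B" using B R by auto
    define q where "q x = F (of_real \<rho> * unit_exp x) * cnj (G (of_real \<rho> * unit_exp x))" for x
    have rS: "cball 0 \<rho> \<subseteq> S" using S R \<rho> by (auto simp: subset_iff)
    have cF: "continuous_on (cball 0 \<rho>) F" and cG: "continuous_on (cball 0 \<rho>) G"
      by (rule holomorphic_on_imp_continuous_on, rule holomorphic_on_subset[OF _ rS], fact)+
    have cq: "continuous_on UNIV q"
      unfolding q_def using \<rho>
      by (intro continuous_intros continuous_on_compose2[OF cF] continuous_on_compose2[OF cG]) (auto simp: norm_mult)
    have iq: "integrable circle01 (\<lambda>x. q x * cnj (unit_exp x) ^ m)" for m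
      by (intro integral_circle01 continuous_intros cq)
    define I where "I m = (\<integral>x. q x * cnj (unit_exp x) ^ m \<partial>circle01)" for m
    have "(\<integral>x. fourier_weight L \<rho> x * q x \<partial>circle01) = (\<integral>x. (\<Sum>m\<le>L. of_real (1 / \<rho> ^ m) * (q x * cnj (unit_exp x) ^ m)) \<partial>circle01)"
      unfolding fourier_weight_def sum_distrib_right
      by (intro Bochner_Integration.integral_cong sum.cong refl) (simp only: mult_ac)
    also have "\<dots> = (\<Sum>m\<le>L. of_real (1 / \<rho> ^ m) * I m)"
      unfolding I_def by (subst Bochner_Integration.integral_sum) (auto intro!: integrable_mult_right iq simp del: of_real_divide)
    finally have W: "(\<integral>x. fourier_weight L \<rho> x * q x \<partial>circle01) = (\<Sum>m\<le>L. of_real (1 / \<rho> ^ m) * I m)" .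
    have inv: "norm (1 / R) < 1" using R by simp
    have geo: "(\<lambda>m. (1 / R) ^ m) sums (R / (R - 1))"
      using geometric_sums[OF inv] R by (simp add: field_simps)
    have 1: "norm (of_real (1 / \<rho> ^ m) * I m - taylor_coeff F m * cnj (G 0)) \<le> A * B * u * (1 / R) ^ m" for m
    proof -
      have "of_real (1 / \<rho> ^ m) * I m - taylor_coeff F m * cnj (G 0) =
          of_real (1 / \<rho> ^ m) * (I m - taylor_coeff F m * cnj (G 0) * of_real \<rho> ^ m)"
        using \<rho> by (simp add: field_simps)
      then have "norm (of_real (1 / \<rho> ^ m) * I m - taylor_coeff F m * cnj (G 0)) =
          1 / \<rho> ^ m * norm (I m - taylor_coeff F m * cnj (G 0) * of_real \<rho> ^ m)"
        using \<rho> by (simp add: norm_mult norm_divide norm_power)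
      also have "\<dots> \<le> 1 / \<rho> ^ m * (A * B * (\<rho> / R) ^ m * (\<rho>\<^sup>2 / (1 - \<rho>\<^sup>2)))"
        using fourier_coefficient_product[OF F G S R _ _ \<rho>, of A B m] A B \<rho>
        by (intro mult_left_mono) (auto simp: I_def q_def)
      also have "\<dots> = A * B * u * (1 / R) ^ m"
        unfolding \<rho>2 using \<rho> by (simp add: power_divide)
      finally show ?thesis .
    qed
    have "norm ((\<Sum>m\<le>L. of_real (1 / \<rho> ^ m) * I m) - (\<Sum>m\<le>L. taylor_coeff F m * cnj (G 0))) \<le> (\<Sum>m\<le>L. A * B * u * (1 / R) ^ m)"
      unfolding sum_subtractf[symmetric] by (rule sum_norm_le) (rule 1)
    also have "\<dots> = A * B * u * (\<Sum>m\<le>L. (1 / R) ^ m)" by (simp add: sum_distrib_left)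
    also have "\<dots> \<le> A * B * u * (R / (R - 1))"
    proof (rule mult_left_mono)
      have "(\<Sum>m\<in>{..L}. (1 / R) ^ m) \<le> (\<Sum>m. (1 / R) ^ m)"
        using geo R by (intro sum_le_suminf) (auto simp: sums_iff)
      then show "(\<Sum>m\<le>L. (1 / R) ^ m) \<le> R / (R - 1)" using geo by (simp add: sums_iff)
    qed (use AB u in auto)
    also have "\<dots> = \<epsilon> / 2 * A * B" using R by (simp add: u_def field_simps)
    finally have e1: "norm ((\<Sum>m\<le>L. of_real (1 / \<rho> ^ m) * I m) - (\<Sum>m\<le>L. taylor_coeff F m * cnj (G 0))) \<le> \<epsilon> / 2 * A * B" .
    have holF: "F holomorphic_on ball 0 R"
      by (rule holomorphic_on_subset[OF F order_trans[OF ball_subset_cball S]])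
    have "(\<lambda>k. taylor_coeff F k * 1 ^ k) sums F 1" using R by (intro taylor_sums[OF holF]) simp
    from sums_split_initial_segment[OF this, of "Suc L"]
    have s: "(\<lambda>k. taylor_coeff F (k + Suc L)) sums (F 1 - (\<Sum>m\<le>L. taylor_coeff F m))"
      by (simp add: lessThan_Suc_atMost)
    have g: "(\<lambda>k. A * (1 / R) ^ Suc L * (1 / R) ^ k) sums (A * (1 / R) ^ Suc L * (R / (R - 1)))"
      by (intro sums_mult geo)
    have "norm (F 1 - (\<Sum>m\<le>L. taylor_coeff F m)) \<le> A * (1 / R) ^ Suc L * (R / (R - 1))"
    proof (rule norm_sums_le[OF s g])
      fix k show "norm (taylor_coeff F (k + Suc L)) \<le> A * (1 / R) ^ Suc L * (1 / R) ^ k"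
        using taylor_coeff_bound[OF F S, of A "k + Suc L"] A R by (simp add: power_divide power_add mult_ac)
    qed
    also have "\<dots> = A * ((1 / R) ^ L / (R - 1))" using R by simp
    also have "\<dots> \<le> A * (\<epsilon> / 2)"
      using L R AB by (intro mult_left_mono) (auto simp: field_simps)
    finally have "norm (F 1 - (\<Sum>m\<le>L. taylor_coeff F m)) * norm (cnj (G 0)) \<le> A * (\<epsilon> / 2) * B"
      using G0 AB \<epsilon> by (intro mult_mono) auto
    then have e2: "norm (F 1 * cnj (G 0) - (\<Sum>m\<le>L. taylor_coeff F m * cnj (G 0))) \<le> \<epsilon> / 2 * A * B"
      unfolding norm_mult[symmetric] left_diff_distrib sum_distrib_right by (simp add: mult_ac)
    have "norm (F 1 * cnj (G 0) - (\<Sum>m\<le>L. of_real (1 / \<rho> ^ m) * I m)) \<le>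
        norm (F 1 * cnj (G 0) - (\<Sum>m\<le>L. taylor_coeff F m * cnj (G 0))) +
        norm ((\<Sum>m\<le>L. of_real (1 / \<rho> ^ m) * I m) - (\<Sum>m\<le>L. taylor_coeff F m * cnj (G 0)))"
      using norm_triangle_ineq4[of "F 1 * cnj (G 0) - (\<Sum>m\<le>L. taylor_coeff F m * cnj (G 0))"
          "(\<Sum>m\<le>L. of_real (1 / \<rho> ^ m) * I m) - (\<Sum>m\<le>L. taylor_coeff F m * cnj (G 0))"] by simp
    also have "\<dots> \<le> \<epsilon> * A * B" using e1 e2 by simp
    finally show "norm (F 1 * cnj (G 0) - (\<integral>x. fourier_weight L \<rho> x *
        (F (of_real \<rho> * unit_exp x) * cnj (G (of_real \<rho> * unit_exp x))) \<partial>circle01)) \<le> \<epsilon> * A * B"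
      unfolding W[symmetric] q_def .
  qed
qed

text \<open>The first square is that of \<open>norm (1 - hip (z + \<beta> *s v) z)\<close>, and the
  coefficient of \<open>(norm \<beta>)\<^sup>2\<close> does not depend on \<open>\<beta>\<close>:
  along a complex line through \<open>z\<close>, nearness to \<open>z\<close> is governed by a
  single constant.\<close>

lemma pw_line: "pw z * pw (z + \<beta> *s v) =
  (norm (of_real (pw z) - \<beta> * hip v z))\<^sup>2 - (norm \<beta>)\<^sup>2 * ((norm (hip v z))\<^sup>2 + pw z * (norm v)\<^sup>2)"
proof -
  have "(norm (z + \<beta> *s v))\<^sup>2 = (norm (z - (- \<beta>) *s v))\<^sup>2" by (simp add: vec_eq_iff arg_cong[where f = norm])
  also have "\<dots> = (norm z)\<^sup>2 + 2 * Re (cnj \<beta> * hip z v) + (norm \<beta>)\<^sup>2 * (norm v)\<^sup>2"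
    unfolding norm_diff_scale_sq by simp
  also have "Re (cnj \<beta> * hip z v) = Re (\<beta> * hip v z)"
    using complex_cnj_mult[of \<beta> "hip v z"] hip_commute[of z v] by (metis complex_cnj_cnj cnj.sel(1))
  finally have 1: "pw (z + \<beta> *s v) = pw z - 2 * Re (\<beta> * hip v z) - (norm \<beta>)\<^sup>2 * (norm v)\<^sup>2"
    by (simp add: pw_def)
  have 2: "(norm (of_real p - x))\<^sup>2 = p\<^sup>2 - 2 * p * Re x + (norm x)\<^sup>2" for p :: real and x :: complex
    unfolding cmod_power2 by (simp add: power2_eq_square algebra_simps)
  show ?thesis unfolding 1 2 by (simp add: norm_mult power2_eq_square algebra_simps)
qed

text \<open>The complex geodesic through \<open>z\<close> and \<open>w\<close>, with \<open>z\<close> at parameter 0 and \<open>w\<close> at parameter 1;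
  it is \<open>\<zeta> \<mapsto> \<phi>\<^sub>z(\<zeta> \<phi>\<^sub>z(w))\<close> for the involutive automorphism \<open>\<phi>\<^sub>z\<close> of the ball exchanging 0 and \<open>z\<close>.\<close>

definition geod_coeff :: "complex^'n::finite \<Rightarrow> complex^'n \<Rightarrow> complex \<Rightarrow> complex" where
  "geod_coeff z w \<zeta> = \<zeta> * of_real (pw z) / (of_real (pw z) - (1 - \<zeta>) * hip (w - z) z)"

definition geodesic :: "complex^'n::finite \<Rightarrow> complex^'n \<Rightarrow> complex \<Rightarrow> complex^'n" where
  "geodesic z w \<zeta> = z + geod_coeff z w \<zeta> *s (w - z)"

lemma geodesic_measurable [measurable (raw)]:
  assumes "f \<in> borel_measurable M" "g \<in> borel_measurable M" "h \<in> borel_measurable M"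
  shows "(\<lambda>x. geodesic (f x) (g x) (h x)) \<in> borel_measurable M"
  using assms unfolding geodesic_def geod_coeff_def by measurable

text \<open>The geodesic multiplies \<open>\<phi>\<^sub>z(w)\<close> by \<open>\<zeta>\<close>, and
  the condition on \<open>\<zeta>\<close> turns
  \<open>|\<phi>\<^sub>z(w)|\<^sup>2 < 1 - 1 / M\<close> into the corresponding inequality for
  \<open>2 * M\<close>. The computation uses \<open>pw_line\<close> in place of the
  automorphism.\<close>

lemma geodesic_near:
  assumes n: "near M z w" and M: "1 \<le> M" and \<zeta>: "(norm \<zeta>)\<^sup>2 * (1 - 1 / M) \<le> 1 - 1 / (2 * M)"
  shows "of_real (pw z) - (1 - \<zeta>) * hip (w - z) z \<noteq> 0" "near (2 * M) z (geodesic z w \<zeta>)"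
proof -
  have z: "norm z < 1" and w: "norm w < 1" using n by (auto simp: near_def)
  define p where "p = pw z"
  have p: "0 < p" and q: "0 < pw w" using z w by (auto simp: p_def pw_pos_iff)
  define \<kappa> where "\<kappa> = hip (w - z) z"
  \<comment> \<open>With \<open>d\<close> defined below, \<open>E / d\<close> is
    \<open>|\<phi>\<^sub>z(w)|\<^sup>2\<close>, by the identity \<open>pq\<close>.\<close>
  define E where "E = (norm \<kappa>)\<^sup>2 + p * (norm (w - z))\<^sup>2"
  have one: "1 - hip (z + \<beta> *s (w - z)) z = of_real p - \<beta> * \<kappa>" for \<beta>
    unfolding hip_add_left hip_scale_left by (simp add: hip_self p_def pw_def \<kappa>_def)
  have onew: "1 - hip w z = of_real p - \<kappa>" using one[of 1] by simp
  have line: "p * pw (z + \<beta> *s (w - z)) = (norm (of_real p - \<beta> * \<kappa>))\<^sup>2 - (norm \<beta>)\<^sup>2 * E" for \<beta>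
    unfolding p_def E_def \<kappa>_def by (rule pw_line)
  define d where "d = (norm (of_real p - \<kappa>))\<^sup>2"
  have d: "0 < d" using one_minus_hip_nonzero[OF w z] by (simp add: d_def onew[symmetric])
  have pq: "p * pw w = d - E" using line[of 1] by (simp add: d_def)
  have "d < M * (p * pw w)" 
    using n unfolding near_def hip_eq_cnj_norm(2)[of z w] onew by (simp add: d_def p_def mult.assoc)
  then have E: "E < (1 - 1 / M) * d" using M unfolding pq by (simp add: field_simps)
  have E0: "0 \<le> E" using p by (simp add: E_def)
  have \<zeta>E: "(norm \<zeta>)\<^sup>2 * E \<le> (1 - 1 / (2 * M)) * d"
  proof -
    have "(norm \<zeta>)\<^sup>2 * E \<le> (norm \<zeta>)\<^sup>2 * ((1 - 1 / M) * d)" using E by (intro mult_left_mono) auto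
    also have "\<dots> = ((norm \<zeta>)\<^sup>2 * (1 - 1 / M)) * d" by simp
    also have "\<dots> \<le> (1 - 1 / (2 * M)) * d" using \<zeta> d by (intro mult_right_mono) auto
    finally show ?thesis .
  qed
  have lt: "(1 - 1 / (2 * M)) * d < d" using d M by (simp add: field_simps)
  have den: "of_real p - \<kappa> + \<zeta> * \<kappa> \<noteq> 0"
  proof
    assume "of_real p - \<kappa> + \<zeta> * \<kappa> = 0"
    then have "of_real p - \<kappa> = - (\<zeta> * \<kappa>)" by (simp add: eq_neg_iff_add_eq_0)
    then have "d = (norm \<zeta>)\<^sup>2 * (norm \<kappa>)\<^sup>2" by (simp add: d_def norm_mult power_mult_distrib)
    also have "\<dots> \<le> (norm \<zeta>)\<^sup>2 * E" using p by (intro mult_left_mono) (auto simp: E_def)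
    finally show False using \<zeta>E lt by linarith
  qed
  have dd: "of_real p - (1 - \<zeta>) * \<kappa> = of_real p - \<kappa> + \<zeta> * \<kappa>" by (simp add: algebra_simps)
  show "of_real (pw z) - (1 - \<zeta>) * hip (w - z) z \<noteq> 0" 
    unfolding p_def[symmetric] \<kappa>_def[symmetric] dd by (rule den)
  define \<beta> where "\<beta> = geod_coeff z w \<zeta>"
  have \<beta>: "\<beta> = \<zeta> * of_real p / (of_real p - \<kappa> + \<zeta> * \<kappa>)"
    by (simp add: \<beta>_def geod_coeff_def p_def[symmetric] \<kappa>_def[symmetric] dd)
  have nk: "of_real p - \<kappa> \<noteq> 0" using d by (auto simp: d_def)
  have pb: "of_real p - \<beta> * \<kappa> = of_real p * (of_real p - \<kappa>) / (of_real p - \<kappa> + \<zeta> * \<kappa>)"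
    unfolding \<beta> using den by (simp add: field_simps)
  have "\<zeta> * (of_real p - \<beta> * \<kappa>) / (of_real p - \<kappa>) = \<beta>"
    unfolding pb using nk by (simp add: \<beta>)
  note bb = this[symmetric]
  define X where "X = (norm (of_real p - \<beta> * \<kappa>))\<^sup>2"
  have X: "0 < X" unfolding X_def pb using nk den p by simp
  have "(norm \<beta>)\<^sup>2 = (norm \<zeta>)\<^sup>2 * X / d"
    by (subst bb) (simp add: norm_mult norm_divide power_mult_distrib power_divide X_def d_def)
  then have l: "p * pw (z + \<beta> *s (w - z)) = X - X * ((norm \<zeta>)\<^sup>2 * E / d)"
    unfolding line X_def[symmetric] by simp
  have "(norm \<zeta>)\<^sup>2 * E / d \<le> 1 - 1 / (2 * M)" using \<zeta>E d by (simp add: pos_divide_le_eq)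
  then have "X * ((norm \<zeta>)\<^sup>2 * E / d) \<le> X * (1 - 1 / (2 * M))"
    using X by (intro mult_left_mono) auto
  then have "X / (2 * M) \<le> p * pw (z + \<beta> *s (w - z))" unfolding l by (simp add: right_diff_distrib)
  then have le: "X \<le> 2 * M * (p * pw (z + \<beta> *s (w - z)))" using M by (simp add: field_simps)
  \<comment> \<open>For \<open>\<zeta> = 0\<close> the strictness of the bound on \<open>E\<close>
    is lost on multiplication by \<open>\<zeta>\<close>, but then the point is \<open>z\<close>
    itself and strictness comes from \<open>1 < 2 * M\<close>.\<close>
  have strict: "X < 2 * M * (p * pw (z + \<beta> *s (w - z)))"
  proof (cases "\<zeta> = 0")
    case True
    then have "\<beta> = 0" by (simp add: \<beta>)
    then show ?thesis using M p by (simp add: X_def p_def power2_eq_square)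
  next
    case False
    then have "(norm \<zeta>)\<^sup>2 * E < (norm \<zeta>)\<^sup>2 * ((1 - 1 / M) * d)" using E by (intro mult_strict_left_mono) auto
    also have "\<dots> = ((norm \<zeta>)\<^sup>2 * (1 - 1 / M)) * d" by simp
    also have "\<dots> \<le> (1 - 1 / (2 * M)) * d" using \<zeta> d by (intro mult_right_mono) auto
    finally have "(norm \<zeta>)\<^sup>2 * E / d < 1 - 1 / (2 * M)" using d by (simp add: pos_divide_less_eq)
    then have "X * ((norm \<zeta>)\<^sup>2 * E / d) < X * (1 - 1 / (2 * M))" using X by (intro mult_strict_left_mono)
    then have "X / (2 * M) < p * pw (z + \<beta> *s (w - z))" unfolding l by (simp add: right_diff_distrib)
    then show ?thesis using M by (simp add: field_simps)
  qed
  have "0 < 2 * M * (p * pw (z + \<beta> *s (w - z)))" using strict X by linarith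
  then have "0 < p * pw (z + \<beta> *s (w - z))" by (rule zero_less_mult_pos) (use M in simp)
  then have "0 < pw (z + \<beta> *s (w - z))" using p by (simp add: zero_less_mult_iff)
  then have "norm (z + \<beta> *s (w - z)) < 1" by (simp add: pw_pos_iff)
  then show "near (2 * M) z (geodesic z w \<zeta>)"
    using strict z unfolding near_def geodesic_def \<beta>_def[symmetric] hip_eq_cnj_norm(2)[of z "z + \<beta> *s (w - z)"] one X_def p_def
    by (simp add: mult.assoc)
qed

lemma geodesic_ends:
  assumes "near M z w"
  shows "geodesic z w 0 = z" "geodesic z w 1 = w"
  using assms pw_pos_iff[of z] by (simp_all add: geodesic_def geod_coeff_def near_def)

lemma near_mono: "near M z w \<Longrightarrow> M \<le> M' \<Longrightarrow> near M' z w"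
  unfolding near_def using pw_pos_iff[of z] pw_pos_iff[of w]
  by (auto elim!: less_le_trans intro!: mult_right_mono)

lemma geodesic_holomorphic:
  assumes n: "near M z w" and M: "1 \<le> M" and f: "f holomorphic_Cn_on ball 0 1"
    and R: "0 < R" "R\<^sup>2 * (1 - 1 / M) \<le> 1 - 1 / (2 * M)"
  shows "(\<lambda>\<zeta>. f (geodesic z w \<zeta>)) holomorphic_on cball 0 R"
proof -
  let ?U = "{\<zeta>. of_real (pw z) - (1 - \<zeta>) * hip (w - z) z \<noteq> 0}"
  have U: "open ?U"
  proof -
    have "open ((\<lambda>\<zeta>. of_real (pw z) - (1 - \<zeta>) * hip (w - z) z) -` (- {0}))"
      by (intro open_vimage continuous_intros)
    then show ?thesis by (simp add: vimage_def)
  qed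
  have b: "geod_coeff z w holomorphic_on ?U"
    unfolding geod_coeff_def[abs_def] by (intro holomorphic_intros) auto
  define T where "T = ?U \<inter> geodesic z w -` ball 0 1"
  have cont: "continuous_on ?U (geodesic z w)"
    unfolding geodesic_def[abs_def] by (intro continuous_intros holomorphic_on_imp_continuous_on b)
  have T: "open T" unfolding T_def by (rule continuous_open_preimage[OF cont U open_ball])
  have "(\<lambda>\<zeta>. f (z + geod_coeff z w \<zeta> *s (w - z))) holomorphic_on T"
  proof (rule holomorphic_Cn_on_compose_line[OF f _ T])
    show "geod_coeff z w holomorphic_on T" by (rule holomorphic_on_subset[OF b]) (auto simp: T_def)
  qed (auto simp: T_def geodesic_def)
  moreover have "cball 0 R \<subseteq> T"
  proof
    fix \<zeta> :: complex assume "\<zeta> \<in> cball 0 R"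
    then have "(norm \<zeta>)\<^sup>2 * (1 - 1 / M) \<le> R\<^sup>2 * (1 - 1 / M)" using M by (intro mult_right_mono power_mono) auto
    then have "(norm \<zeta>)\<^sup>2 * (1 - 1 / M) \<le> 1 - 1 / (2 * M)" using R by linarith
    from geodesic_near[OF n M this] show "\<zeta> \<in> T" by (auto simp: T_def near_def)
  qed
  ultimately show ?thesis unfolding geodesic_def[symmetric] by (rule holomorphic_on_subset)
qed

text \<open>Circled affine neighbourhoods, of the size of the invariant balls around \<open>v\<close>.\<close>

definition dset :: "real \<Rightarrow> complex^'n::finite \<Rightarrow> complex^'n \<Rightarrow> bool" where
  "dset \<delta> v y \<longleftrightarrow> (norm y)\<^sup>2 < \<delta>\<^sup>2 * pw v / 4 \<and> norm (hip y v) < \<delta> * pw v / 4"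

lemma dset_measurable [measurable (raw)]:
  assumes "f \<in> borel_measurable N" "g \<in> borel_measurable N"
  shows "Measurable.pred N (\<lambda>x. dset \<delta> (f x) (g x :: complex^'n::finite))"
  using assms unfolding dset_def by measurable

lemma dset_scale:
  assumes "dset \<delta> v y" "norm c \<le> 1" shows "dset \<delta> v (c *s y)"
proof -
  have "(norm (c *s y))\<^sup>2 \<le> (norm y)\<^sup>2" "norm (hip (c *s y) v) \<le> norm (hip y v)"
    using assms(2) unfolding norm_scale_vec hip_scale_left norm_mult
    by (intro power_mono mult_left_le_one_le; simp)+
  then show ?thesis using assms(1) unfolding dset_def by linarith
qed

lemma dset_divide:
  assumes "dset \<delta> v y" "0 < \<delta>" shows "dset 1 v ((1 / of_real \<delta>) *s y)"
  using assms by (auto simp: dset_def norm_scale_vec hip_scale_left norm_mult norm_divide power_divide power_mult_distrib field_simps)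

text \<open>Here \<open>norm (1 - hip v (v + y)) \<le> 5 / 4 * pw v\<close> and
  \<open>pw (v + y) > pw v / 4\<close>, so the quotient that defines nearness is below
  \<open>25 / 4\<close>, which 7 exceeds.\<close>

lemma dset_near:
  assumes d: "dset \<delta> v y" and v: "norm v < 1" and \<delta>: "0 < \<delta>" "\<delta> \<le> 1" shows "near 7 v (v + y)"
proof -
  have p: "0 < pw v" using v by (simp add: pw_pos_iff)
  have "\<delta>\<^sup>2 * pw v \<le> 1 * pw v" "\<delta> * pw v \<le> 1 * pw v"
    using p \<delta> by (auto intro!: mult_right_mono simp: power_le_one)
  then have y: "(norm y)\<^sup>2 < pw v / 4" "norm (hip y v) < pw v / 4" using d by (auto simp: dset_def)
  have vy: "norm (hip v y) < pw v / 4" using y hip_eq_cnj_norm(1)[of v y] by simp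
  have "(norm (v + y))\<^sup>2 = (norm (v - (- 1) *s y))\<^sup>2" by (simp add: vec_eq_iff arg_cong[where f = norm])
  also have "\<dots> = (norm v)\<^sup>2 + 2 * Re (hip v y) + (norm y)\<^sup>2" unfolding norm_diff_scale_sq by simp
  finally have "pw (v + y) = pw v - 2 * Re (hip v y) - (norm y)\<^sup>2" by (simp add: pw_def)
  then have q: "pw v / 4 < pw (v + y)" using complex_Re_le_cmod[of "hip v y"] vy y by linarith
  then have n: "norm (v + y) < 1" using p by (simp add: pw_pos_iff[symmetric])
  have "1 - hip v (v + y) = of_real (pw v) - hip v y" by (simp add: hip_add_right hip_self pw_def)
  then have "norm (1 - hip v (v + y)) \<le> pw v + norm (hip v y)"
    using norm_triangle_ineq4[of "of_real (pw v)" "hip v y"] p by simp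
  then have "norm (1 - hip v (v + y)) \<le> 5 / 4 * pw v" using vy by linarith
  then have "(norm (1 - hip v (v + y)))\<^sup>2 \<le> (5 / 4 * pw v)\<^sup>2" by (intro power_mono) auto
  also have "\<dots> < 7 * pw v * (pw v / 4)" using p by (simp add: power2_eq_square)
  also have "\<dots> \<le> 7 * pw v * pw (v + y)" using p q by (intro mult_left_mono) auto
  finally show ?thesis using n v by (simp add: near_def)
qed

section \<open>Volumes and mean values of the circled neighbourhoods\<close>

definition vol1 :: "'n::finite itself \<Rightarrow> real" where
  "vol1 _ = measure lborel (ball 0 1 :: (complex^'n) set)"

definition dset_vol :: "real \<Rightarrow> complex^'n::finite \<Rightarrow> real" where
  "dset_vol \<delta> v = measure dV {w. dset \<delta> v (w - v)}"

lemma dset_vol_measurable [measurable]: "dset_vol \<delta> \<in> borel_measurable (borel :: (complex^'n::finite) measure)"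
proof -
  interpret sigma_finite_measure "dV :: (complex^'n) measure" by (rule sigma_finite_dV)
  have "(\<lambda>v. \<integral>w. (if dset \<delta> v (w - v) then 1 else 0 :: real) \<partial>dV) \<in> borel_measurable (borel :: (complex^'n) measure)"
    by measurable
  also have "(\<lambda>v. \<integral>w. (if dset \<delta> v (w - v) then 1 else 0 :: real) \<partial>dV) = (dset_vol \<delta> :: complex^'n \<Rightarrow> real)"
  proof
    fix v :: "complex^'n"
    have "(\<integral>w. (if dset \<delta> v (w - v) then 1 else 0 :: real) \<partial>dV) = (\<integral>w. indicator {w. dset \<delta> v (w - v)} w \<partial>dV)"
      by (intro Bochner_Integration.integral_cong) (auto simp: indicator_def)
    then show "(\<integral>w. (if dset \<delta> v (w - v) then 1 else 0 :: real) \<partial>dV) = dset_vol \<delta> v"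
      by (simp add: dset_vol_def)
  qed
  finally show ?thesis .
qed

text \<open>After an isometry that aligns the \<open>i\<close>-th coordinate with \<open>v\<close>,
  the set contains a box with sides of order \<open>pw v\<close> in the two real directions of this
  coordinate and of order \<open>sqrt (pw v)\<close> in the other \<open>2 * CARD('n) - 2\<close>;
  its volume has the order \<open>pw v ^ (CARD('n) + 1)\<close>.\<close>

lemma dset_lborel_lower:
  fixes v :: "complex^'n::finite"
  assumes v: "norm v < 1" and \<delta>: "0 < \<delta>" "\<delta> \<le> 1"
  shows "ennreal ((\<delta> / (4 * real CARD('n))) ^ (2 * CARD('n)) * pw v ^ (CARD('n) + 1)) \<le> emeasure lborel {y. dset \<delta> v y}"
proof -
  let ?N = "CARD('n)"
  define i :: 'n where "i = (SOME i. True)"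
  have p: "0 < pw v" "pw v \<le> 1" using v pw_le_1 by (auto simp: pw_pos_iff)
  define s where "s = sqrt (pw v)"
  have s: "0 < s" "s\<^sup>2 = pw v" "pw v \<le> s"
    using p real_le_rsqrt[of "pw v" "pw v"] by (auto simp: s_def power2_eq_square mult_left_le)
  have N: "0 < real ?N" by simp
  obtain T c where T: "linear T" "\<And>x. norm (T x) = norm x" and c: "norm c = 1"
    "\<And>w. hip (T w) v = c * of_real (norm v) * w $ i"
    using isometry_to_axis[of v i] by metis
  have [measurable]: "T \<in> borel_measurable borel" by (rule isometry_measurable[OF T(1)])
  define Bi where "Bi = {axis i (1::complex), axis i \<i>}"
  \<comment> \<open>The divisions by \<open>CARD('n)\<close> pay for estimating
    \<open>norm y\<close> by the sum of the moduli of its coordinates.\<close>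
  define l where "l b = (if b \<in> Bi then \<delta> * pw v / (8 * real ?N) else \<delta> * s / (4 * real ?N))" for b :: "complex^'n"
  define L where "L = (\<Sum>b\<in>Basis. l b *\<^sub>R b)"
  have Lb: "L \<bullet> b = l b" if "b \<in> Basis" for b using that by (simp add: L_def inner_sum_left_Basis)
  have l0: "0 < l b" for b using \<delta> p s N by (simp add: l_def)
  have BiB: "Bi \<subseteq> Basis" by (auto simp: Bi_def axis_in_Basis_iff)
  have cBi: "card Bi = 2" by (simp add: Bi_def axis_eq_axis)
  have "emeasure lborel (box (- L) L) = ennreal (\<Prod>b\<in>Basis. (L - - L) \<bullet> b)"
  proof (rule emeasure_lborel_box)
    show "(- L) \<bullet> b \<le> L \<bullet> b" if "b \<in> Basis" for b using l0[of b] Lb[OF that] by simp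
  qed
  also have "(\<Prod>b\<in>Basis. (L - - L) \<bullet> b) = (\<Prod>b\<in>Basis. 2 * l b)"
  proof (rule prod.cong[OF refl])
    show "(L - - L) \<bullet> b = 2 * l b" if "b \<in> Basis" for b
      using Lb[OF that] unfolding inner_diff_left inner_minus_left by simp
  qed
  also have "(\<Prod>b\<in>Basis. 2 * l b) = (\<Prod>b\<in>Bi. 2 * l b) * (\<Prod>b\<in>Basis - Bi. 2 * l b)"
    using BiB by (simp add: prod.subset_diff[of Bi] mult.commute)
  also have "(\<Prod>b\<in>Bi. 2 * l b) = (\<delta> * pw v / (4 * real ?N)) ^ 2"
    using cBi by (simp add: l_def)
  also have "(\<Prod>b\<in>Basis - Bi. 2 * l b) = (\<delta> * s / (2 * real ?N)) ^ (2 * ?N - 2)"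
  proof -
    have "card (Basis - Bi) = 2 * ?N - 2"
      using BiB cBi by (simp add: card_Diff_subset Bi_def mult.commute)
    then show ?thesis by (simp add: l_def)
  qed
  finally have box: "emeasure lborel (box (- L) L) = ennreal ((\<delta> * pw v / (4 * real ?N)) ^ 2 * (\<delta> * s / (2 * real ?N)) ^ (2 * ?N - 2))" .
  have N1: "2 * ?N = 2 + (2 * ?N - 2)" using zero_less_card_finite[where 'a='n] by linarith
  have "(\<delta> / (4 * real ?N)) ^ (2 * ?N) * pw v ^ (?N + 1) = (\<delta> * pw v / (4 * real ?N)) ^ 2 * (\<delta> * s / (4 * real ?N)) ^ (2 * ?N - 2)"
  proof -
    have "pw v ^ (?N + 1) = pw v ^ 2 * pw v ^ (?N - 1)" using N by (simp flip: power_add)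
    also have "pw v ^ (?N - 1) = s ^ (2 * ?N - 2)" by (simp add: s(2)[symmetric] power_mult[symmetric] right_diff_distrib')
    finally have "(\<delta> / (4 * real ?N)) ^ (2 * ?N) * pw v ^ (?N + 1) =
        (\<delta> / (4 * real ?N)) ^ (2 + (2 * ?N - 2)) * (pw v ^ 2 * s ^ (2 * ?N - 2))" using N1 by simp
    moreover have e: "\<delta> * x / (4 * real ?N) = (\<delta> / (4 * real ?N)) * x" for x by simp
    ultimately show ?thesis unfolding e power_mult_distrib power_add by (simp only: mult_ac)
  qed
  also have "\<dots> \<le> (\<delta> * pw v / (4 * real ?N)) ^ 2 * (\<delta> * s / (2 * real ?N)) ^ (2 * ?N - 2)"
    using \<delta> s N by (intro mult_left_mono power_mono divide_left_mono) auto
  finally have "ennreal ((\<delta> / (4 * real ?N)) ^ (2 * ?N) * pw v ^ (?N + 1)) \<le> emeasure lborel (box (- L) L)"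
    unfolding box by (rule ennreal_leI)
  also have "\<dots> \<le> emeasure lborel (T -` {y. dset \<delta> v y})"
  proof (rule emeasure_mono)
    show "T -` {y. dset \<delta> v y} \<in> sets lborel" using measurable_sets[of T borel borel "{y. dset \<delta> v y}"] by simp
    show "box (- L) L \<subseteq> T -` {y. dset \<delta> v y}"
    proof
      fix y :: "complex^'n" assume "y \<in> box (- L) L"
      then have yb: "\<bar>y \<bullet> b\<bar> < l b" if "b \<in> Basis" for b using that Lb by (auto simp: mem_box abs_less_iff)
      have cj: "norm (y $ j) < l (axis j 1) + l (axis j \<i>)" for j
      proof -
        have "norm (y $ j) \<le> \<bar>Re (y $ j)\<bar> + \<bar>Im (y $ j)\<bar>" by (rule cmod_le)
        also have "\<dots> < l (axis j 1) + l (axis j \<i>)"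
          using yb[of "axis j 1"] yb[of "axis j \<i>"] by (simp add: axis_in_Basis_iff inner_axis inner_complex_def add_strict_mono)
        finally show ?thesis .
      qed
      have lle: "l b \<le> \<delta> * s / (4 * real ?N)" for b
      proof -
        have "\<delta> * pw v / (8 * real ?N) \<le> \<delta> * s / (4 * real ?N)"
          using s \<delta> N by (intro frac_le mult_left_mono) auto
        then show ?thesis by (simp add: l_def)
      qed
      have "norm y \<le> (\<Sum>j\<in>UNIV. norm (y $ j))" unfolding norm_vec_def by (rule L2_set_le_sum) simp
      also have "\<dots> < (\<Sum>j\<in>(UNIV::'n set). \<delta> * s / (2 * real ?N))"
      proof (rule sum_strict_mono)
        fix j show "norm (y $ j) < \<delta> * s / (2 * real ?N)"
          using cj[of j] lle[of "axis j 1"] lle[of "axis j \<i>"] by simp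
      qed auto
      also have "\<dots> = \<delta> * s / 2" using N by simp
      finally have "(norm y)\<^sup>2 < (\<delta> * s / 2)\<^sup>2" by (intro power_strict_mono) auto
      then have 1: "(norm (T y))\<^sup>2 < \<delta>\<^sup>2 * pw v / 4" by (simp add: T power_divide power_mult_distrib s(2))
      have "norm (hip (T y) v) = norm v * norm (y $ i)" by (simp add: c norm_mult)
      also have "\<dots> \<le> norm (y $ i)" using v by (simp add: mult_left_le_one_le)
      also have "\<dots> < \<delta> * pw v / (4 * real ?N)" using cj[of i] by (simp add: l_def Bi_def)
      also have "\<dots> \<le> \<delta> * pw v / 4" using \<delta> p N by (intro divide_left_mono) (auto simp: Suc_le_eq)
      finally show "y \<in> T -` {y. dset \<delta> v y}" using 1 by (simp add: dset_def)
    qed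
  qed
  also have "\<dots> = emeasure (distr lborel borel T) {y. dset \<delta> v y}" by (subst emeasure_distr) auto
  also have "\<dots> = emeasure lborel {y. dset \<delta> v y}" by (simp only: lborel_distr_linear_isometry[OF T])
  finally show ?thesis .
qed

text \<open>Centring at \<open>v\<close> gives an integral over a circled set in Lebesgue measure,
  which rotations of \<open>y\<close> preserve. By \<open>dset_near\<close> the set stays inside the
  ball, so only the normalisation distinguishes the two measures.\<close>

lemma integral_dV_dset:
  fixes q :: "complex^'n::finite \<Rightarrow> complex"
  assumes v: "norm v < 1" and \<delta>: "0 < \<delta>" "\<delta> \<le> 1" and q: "integrable dV q"
  shows "integrable lborel (\<lambda>y. indicator {y. dset \<delta> v y} y *\<^sub>R q (v + y))"
    "(\<integral>w. indicator {w. dset \<delta> v (w - v)} w *\<^sub>R q w \<partial>dV) =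
      (\<integral>y. indicator {y. dset \<delta> v y} y *\<^sub>R q (v + y) \<partial>lborel) /\<^sub>R vol1 TYPE('n)"
proof -
  have [measurable]: "q \<in> borel_measurable borel"
    using borel_measurable_integrable[OF q] by (simp cong: measurable_cong_sets)
  have vol: "0 < vol1 TYPE('n)" unfolding vol1_def by (rule content_ball_pos) simp
  have ev: "emeasure lborel (ball 0 1 :: (complex^'n) set) = ennreal (vol1 TYPE('n))"
    unfolding vol1_def using emeasure_unit_ball(2)[where 'n='n] by (simp add: emeasure_eq_ennreal_measure)
  have d: "dV = density lborel (\<lambda>x::complex^'n. ennreal (indicator (ball 0 1) x / vol1 TYPE('n)))"
    unfolding dV_def uniform_measure_def ev
    by (intro arg_cong2[where f = density] refl ext) (auto simp: indicator_def divide_ennreal[of 1, simplified] vol)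
  define Q where "Q w = indicator {w. dset \<delta> v (w - v)} w *\<^sub>R q w" for w
  have [measurable]: "Q \<in> borel_measurable borel" unfolding Q_def by measurable
  have iQ: "integrable dV Q"
    unfolding Q_def using q by (rule Bochner_Integration.integrable_bound) (auto simp: indicator_def)
  have ball: "norm w < 1" if "dset \<delta> v (w - v)" for w
    using dset_near[OF that v \<delta>] by (simp add: near_def)
  have wm: "(\<lambda>x::complex^'n. indicator (ball 0 1) x / vol1 TYPE('n)) \<in> borel_measurable borel"
    by (intro borel_measurable_divide borel_measurable_indicator borel_measurable_const) simp
  have Qb: "(indicator (ball 0 1) w / vol1 TYPE('n)) *\<^sub>R Q w = Q w /\<^sub>R vol1 TYPE('n)" for w
    using ball[of w] by (auto simp: Q_def indicator_def divide_inverse)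
  have "integrable lborel (\<lambda>w. Q w /\<^sub>R vol1 TYPE('n))"
    using iQ vol unfolding d by (subst (asm) integrable_density) (auto simp: Qb wm)
  then have "integrable lborel (\<lambda>w. vol1 TYPE('n) *\<^sub>R (Q w /\<^sub>R vol1 TYPE('n)))"
    by (rule integrable_scaleR_right)
  then have "integrable lborel Q" using vol by simp
  then have iQ': "integrable (distr lborel borel ((+) v)) Q" by (simp only: lborel_distr_plus)
  have Qv: "Q (v + y) = indicator {y. dset \<delta> v y} y *\<^sub>R q (v + y)" for y by (simp add: Q_def indicator_def)
  show "integrable lborel (\<lambda>y. indicator {y. dset \<delta> v y} y *\<^sub>R q (v + y))"
    using iQ' by (subst (asm) integrable_distr_eq) (auto simp: Qv)
  have "(\<integral>w. Q w \<partial>dV) = (\<integral>w. Q w /\<^sub>R vol1 TYPE('n) \<partial>lborel)"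
    unfolding d using vol by (subst integral_density) (auto simp: Qb wm)
  also have "\<dots> = (\<integral>w. Q w \<partial>lborel) /\<^sub>R vol1 TYPE('n)" by simp
  also have "(\<integral>w. Q w \<partial>lborel) = (\<integral>w. Q w \<partial>distr lborel borel ((+) v))" by (simp only: lborel_distr_plus)
  also have "\<dots> = (\<integral>y. Q (v + y) \<partial>lborel)" by (subst integral_distr) auto
  finally show "(\<integral>w. indicator {w. dset \<delta> v (w - v)} w *\<^sub>R q w \<partial>dV) =
      (\<integral>y. indicator {y. dset \<delta> v y} y *\<^sub>R q (v + y) \<partial>lborel) /\<^sub>R vol1 TYPE('n)"
    unfolding Q_def[symmetric] Qv .
qed

lemma dset_vol_eq:
  fixes v :: "complex^'n::finite"
  assumes v: "norm v < 1" and \<delta>: "0 < \<delta>" "\<delta> \<le> 1"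
  shows "dset_vol \<delta> v = measure lborel {y. dset \<delta> v y} / vol1 TYPE('n)"
    "emeasure lborel {y. dset \<delta> v y} < \<infinity>"
proof -
  interpret finite_measure "dV :: (complex^'n) measure" by (rule finite_measure_dV)
  note I = integral_dV_dset[OF v \<delta>, of "\<lambda>_. 1", OF integrable_const]
  show fin: "emeasure lborel {y. dset \<delta> v y} < \<infinity>"
    using I(1) by (simp add: scaleR_conv_of_real complex_of_real_integrable_eq integrable_indicator_iff)
  have "complex_of_real (dset_vol \<delta> v) = (\<integral>w. indicator {w. dset \<delta> v (w - v)} w *\<^sub>R 1 \<partial>dV)"
    by (simp add: dset_vol_def scaleR_conv_of_real)
  also have "\<dots> = of_real (measure lborel {y. dset \<delta> v y} / vol1 TYPE('n))"
    unfolding I(2) by (simp add: scaleR_conv_of_real divide_inverse mult.commute)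
  finally show "dset_vol \<delta> v = measure lborel {y. dset \<delta> v y} / vol1 TYPE('n)" by (simp only: of_real_eq_iff)
qed

lemma dset_vol_lower:
  assumes \<delta>: "0 < \<delta>" "\<delta> \<le> 1"
  shows "\<exists>c>0. \<forall>v :: complex^'n::finite. norm v < 1 \<longrightarrow> c * pw v ^ (CARD('n) + 1) \<le> dset_vol \<delta> v"
proof (intro exI[of _ "(\<delta> / (4 * real CARD('n))) ^ (2 * CARD('n)) / vol1 TYPE('n)"] conjI allI impI)
  have vol: "0 < vol1 TYPE('n)" unfolding vol1_def by (rule content_ball_pos) simp
  then show "0 < (\<delta> / (4 * real CARD('n))) ^ (2 * CARD('n)) / vol1 TYPE('n)" using \<delta> by simp
  fix v :: "complex^'n" assume v: "norm v < 1"
  note e = dset_vol_eq[OF v \<delta>]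
  have "(\<delta> / (4 * real CARD('n))) ^ (2 * CARD('n)) * pw v ^ (CARD('n) + 1) \<le> measure lborel {y. dset \<delta> v y}"
    using dset_lborel_lower[OF v \<delta>] e(2) by (simp add: emeasure_eq_ennreal_measure)
  then show "(\<delta> / (4 * real CARD('n))) ^ (2 * CARD('n)) / vol1 TYPE('n) * pw v ^ (CARD('n) + 1) \<le> dset_vol \<delta> v"
    unfolding e(1) using vol by (simp add: divide_right_mono)
qed

text \<open>The set is circled, so averaging over rotations of \<open>y\<close> replaces
  \<open>q (v + y)\<close> by its mean over a circle around \<open>v\<close> in a complex line,
  which is \<open>q v\<close>.\<close>

lemma dset_mean_value:
  fixes q :: "complex^'n::finite \<Rightarrow> complex"
  assumes v: "norm v < 1" and \<delta>: "0 < \<delta>" "\<delta> \<le> 1" and q: "integrable dV q"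
    and hol: "\<And>y. (\<lambda>\<zeta>. q (v + \<zeta> *s y)) holomorphic_on {\<zeta>. v + \<zeta> *s y \<in> ball 0 1}"
  shows "(\<integral>w. indicator {w. dset \<delta> v (w - v)} w *\<^sub>R q w \<partial>dV) = dset_vol \<delta> v *\<^sub>R q v"
proof -
  define G where "G y = indicator {y. dset \<delta> v y} y *\<^sub>R q (v + y)" for y
  note I = integral_dV_dset[OF v \<delta> q]
  have T: "(\<lambda>(x, w). unit_exp x *s w) \<in> measurable (circle01 \<Otimes>\<^sub>M lborel) (lborel :: (complex^'n) measure)"
    by measurable
  have inv: "distr lborel lborel (\<lambda>y. unit_exp x *s y) = (lborel :: (complex^'n) measure)" for x
  proof -
    have "distr lborel borel (\<lambda>y. unit_exp x *s y :: complex^'n) = lborel"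
      by (rule lborel_distr_linear_isometry[OF linear_scale_vec]) (simp add: norm_scale_vec)
    then show ?thesis by (simp cong: distr_cong)
  qed
  have inner: "(\<integral>x. G (unit_exp x *s y) \<partial>circle01) = indicator {y. dset \<delta> v y} y *\<^sub>R q v" for y
  proof (cases "dset \<delta> v y")
    case True
    have "cball 0 1 \<subseteq> {\<zeta>. v + \<zeta> *s y \<in> ball 0 1}"
    proof
      fix \<zeta> :: complex assume "\<zeta> \<in> cball 0 1"
      then have "dset \<delta> v (\<zeta> *s y)" by (intro dset_scale[OF True]) simp
      from dset_near[OF this v \<delta>] show "\<zeta> \<in> {\<zeta>. v + \<zeta> *s y \<in> ball 0 1}" by (simp add: near_def)
    qed
    from circle_integral_coeff[OF hol this, of 0]
    have "(\<integral>x. q (v + unit_exp x *s y) \<partial>circle01) = q v" by simp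
    moreover have "G (unit_exp x *s y) = q (v + unit_exp x *s y)" for x
      using dset_scale[OF True, of "unit_exp x"] by (simp add: G_def)
    ultimately show ?thesis using True by simp
  next
    case False
    have "\<not> dset \<delta> v (unit_exp x *s y)" for x
    proof
      assume "dset \<delta> v (unit_exp x *s y)"
      from dset_scale[OF this, of "1 / unit_exp x"] False show False
        by (simp add: norm_divide vector_smult_assoc)
    qed
    then show ?thesis using False by (simp add: G_def)
  qed
  have "(\<integral>y. G y \<partial>lborel) = (\<integral>y. indicator {y. dset \<delta> v y} y *\<^sub>R q v \<partial>lborel)"
    unfolding inner[symmetric]
    by (rule average_over_isometries(2)[OF lborel.sigma_finite_measure_axioms T inv, symmetric]) (use I(1) in \<open>simp add: G_def\<close>)
  also have "\<dots> = measure lborel {y. dset \<delta> v y} *\<^sub>R q v"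
  proof -
    have "integrable lborel (indicator {y. dset \<delta> v y} :: _ \<Rightarrow> real)"
      using dset_vol_eq(2)[OF v \<delta>] by (simp add: integrable_indicator_iff)
    then show ?thesis by (simp add: scaleR_conv_of_real)
  qed
  finally show ?thesis
    unfolding I(2) dset_vol_eq(1)[OF v \<delta>] G_def by (simp add: divide_inverse mult.commute)
qed

section \<open>Approximation of near-diagonal forms by Toeplitz operators\<close>

text \<open>A local mean of the squared modulus: the integral over a Bergman ball around
  \<open>z\<close>, divided by the order of its volume.\<close>

definition near_avg :: "real \<Rightarrow> 'n::finite bergman \<Rightarrow> complex^'n \<Rightarrow> real" where
  "near_avg M f z = (\<integral>w. (if near M z w then (norm (bergman_fun f w))\<^sup>2 else 0) \<partial>dV) / pw z ^ (CARD('n) + 1)"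

lemma near_avg_measurable [measurable]: "near_avg M f \<in> borel_measurable (borel :: (complex^'n::finite) measure)"
proof -
  interpret sigma_finite_measure "dV :: (complex^'n) measure" by (rule sigma_finite_dV)
  show ?thesis unfolding near_avg_def[abs_def] by measurable
qed

lemma bergman_norm_sq_integrable: "integrable dV (\<lambda>z. (norm (bergman_fun f z))\<^sup>2)"
  using bergman_L2[of f] by (simp add: L2_def)

lemma near_norm_sq_integrable: "integrable dV (\<lambda>w. if near M z w then (norm (bergman_fun f w))\<^sup>2 else 0)"
  using bergman_norm_sq_integrable[of f] by (rule Bochner_Integration.integrable_bound) (auto intro: measurable_If)

lemma near_avg_nonneg: "norm z < 1 \<Longrightarrow> 0 \<le> near_avg M f z"
  unfolding near_avg_def by (intro divide_nonneg_nonneg Bochner_Integration.integral_nonneg) (auto simp: pw_pos_iff[symmetric] less_imp_le)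

text \<open>The mean value property is applied to the square of \<open>f\<close>, which is again
  holomorphic, so that the quadratic estimate appears directly.\<close>

lemma bergman_submean:
  "\<exists>C>0. \<forall>(f :: 'n::finite bergman) v. norm v < 1 \<longrightarrow> (norm (bergman_fun f v))\<^sup>2 \<le> C * near_avg 7 f v"
proof -
  obtain c where c: "0 < c" "\<forall>v :: complex^'n. norm v < 1 \<longrightarrow> c * pw v ^ (CARD('n) + 1) \<le> dset_vol 1 v"
    using dset_vol_lower[of 1, where 'n='n] by auto
  show ?thesis
  proof (intro exI[of _ "1 / c"] conjI allI impI)
    show "0 < 1 / c" using c by simp
    fix f :: "'n bergman" and v :: "complex^'n" assume v: "norm v < 1"
    let ?f = "bergman_fun f" and ?D = "\<lambda>w. indicator {w. dset 1 v (w - v)} w :: real"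
    have p: "0 < pw v ^ (CARD('n) + 1)" using v by (simp add: pw_pos_iff)
    have q: "integrable dV (\<lambda>w. (?f w)\<^sup>2)"
      using bergman_norm_sq_integrable[of f] by (rule Bochner_Integration.integrable_bound) (auto simp: norm_power)
    have hol: "(\<lambda>\<zeta>. (?f (v + \<zeta> *s y))\<^sup>2) holomorphic_on {\<zeta>. v + \<zeta> *s y \<in> ball 0 1}" for y
      by (intro holomorphic_intros holomorphic_on_line bergman_fun_holomorphic)
    have "dset_vol 1 v * (norm (?f v))\<^sup>2 = norm (dset_vol 1 v *\<^sub>R (?f v)\<^sup>2)"
      by (simp add: norm_power dset_vol_def)
    also have "\<dots> = norm (\<integral>w. ?D w *\<^sub>R (?f w)\<^sup>2 \<partial>dV)"
      by (subst dset_mean_value[OF v _ _ q hol]) auto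
    also have "\<dots> \<le> (\<integral>w. norm (?D w *\<^sub>R (?f w)\<^sup>2) \<partial>dV)" by (rule integral_norm_bound)
    also have "\<dots> \<le> (\<integral>w. (if near 7 v w then (norm (?f w))\<^sup>2 else 0) \<partial>dV)"
    proof (rule integral_mono[OF _ near_norm_sq_integrable])
      show "integrable dV (\<lambda>w. norm (?D w *\<^sub>R (?f w)\<^sup>2))"
        by (intro integrable_norm Bochner_Integration.integrable_bound[OF q]) (auto simp: indicator_def)
      show "norm (?D w *\<^sub>R (?f w)\<^sup>2) \<le> (if near 7 v w then (norm (?f w))\<^sup>2 else 0)" for w
        using dset_near[of 1 v "w - v"] v by (auto simp: indicator_def norm_power)
    qed
    also have "\<dots> = pw v ^ (CARD('n) + 1) * near_avg 7 f v"
      using p unfolding near_avg_def by (simp only: nonzero_mult_div_cancel_left times_divide_eq_right)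
    finally have *: "dset_vol 1 v * (norm (?f v))\<^sup>2 \<le> pw v ^ (CARD('n) + 1) * near_avg 7 f v" .
    have "(c * pw v ^ (CARD('n) + 1)) * (norm (?f v))\<^sup>2 \<le> dset_vol 1 v * (norm (?f v))\<^sup>2"
      using c(2) v by (intro mult_right_mono) auto
    with * have "pw v ^ (CARD('n) + 1) * (c * (norm (?f v))\<^sup>2) \<le> pw v ^ (CARD('n) + 1) * near_avg 7 f v"
      by (simp add: mult_ac)
    then have "c * (norm (?f v))\<^sup>2 \<le> near_avg 7 f v" by (rule mult_left_le_imp_le) (rule p)
    then show "(norm (?f v))\<^sup>2 \<le> 1 / c * near_avg 7 f v" using c(1) by (simp add: field_simps)
  qed
qed

lemma near_inverse_pw_power:
  assumes "near M z v" shows "1 / pw v ^ k \<le> (4 * M) ^ k / pw z ^ k"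
proof -
  have p: "0 < pw z" "0 < pw v" using assms by (auto simp: near_def pw_pos_iff)
  have "pw z \<le> 4 * M * pw v" using near_comparable(1)[of M v z] assms near_sym by blast
  then have "pw z ^ k \<le> (4 * M) ^ k * pw v ^ k"
    using p unfolding power_mult_distrib[symmetric] by (intro power_mono) auto
  then show ?thesis using p by (simp add: field_simps)
qed

text \<open>By \<open>near_trans\<close> the region of parameter 7 around \<open>v\<close> lies in
  that of parameter \<open>64 * M * 7\<close> around \<open>z\<close>, and the weights at
  \<open>v\<close> and \<open>z\<close> are comparable.\<close>

lemma bergman_local_sup:
  assumes M: "0 < M"
  shows "\<exists>C>0. \<forall>(f :: 'n::finite bergman) z v. near M z v \<longrightarrow> (norm (bergman_fun f v))\<^sup>2 \<le> C * near_avg (64 * M * 7) f z"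
proof -
  obtain C where C: "0 < C" "\<forall>(f :: 'n bergman) v. norm v < 1 \<longrightarrow> (norm (bergman_fun f v))\<^sup>2 \<le> C * near_avg 7 f v"
    using bergman_submean[where 'n='n] by auto
  let ?m = "CARD('n) + 1"
  show ?thesis
  proof (intro exI[of _ "C * (4 * M) ^ ?m"] conjI allI impI)
    show "0 < C * (4 * M) ^ ?m" using C M by simp
    fix f :: "'n bergman" and z v :: "complex^'n" assume n: "near M z v"
    then have v: "norm v < 1" and z: "norm z < 1" by (auto simp: near_def)
    let ?I = "\<lambda>M z. \<integral>w. (if near M z w then (norm (bergman_fun f w))\<^sup>2 else 0) \<partial>dV"
    have "?I 7 v \<le> ?I (64 * M * 7) z"
    proof (intro integral_mono near_norm_sq_integrable)
      fix w show "(if near 7 v w then (norm (bergman_fun f w))\<^sup>2 else 0) \<le> (if near (64 * M * 7) z w then (norm (bergman_fun f w))\<^sup>2 else 0)"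
        using near_trans[OF n, of 7 w] by (cases "near (64 * M * 7) z w") (simp_all only: if_True if_False, auto)
    qed
    moreover have "0 \<le> ?I 7 v" by (intro Bochner_Integration.integral_nonneg) auto
    moreover have "0 \<le> (4 * M) ^ ?m / pw z ^ ?m" using M z by (simp add: pw_pos_iff[symmetric] less_imp_le)
    ultimately have "1 / pw v ^ ?m * ?I 7 v \<le> ((4 * M) ^ ?m / pw z ^ ?m) * ?I (64 * M * 7) z"
      using near_inverse_pw_power[OF n, of ?m] by (intro mult_mono) auto
    then have "near_avg 7 f v \<le> (4 * M) ^ ?m * near_avg (64 * M * 7) f z"
      by (simp add: near_avg_def)
    then have "C * near_avg 7 f v \<le> C * ((4 * M) ^ ?m * near_avg (64 * M * 7) f z)"
      using C(1) by (intro mult_left_mono) auto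
    then show "(norm (bergman_fun f v))\<^sup>2 \<le> C * (4 * M) ^ ?m * near_avg (64 * M * 7) f z"
      using C(2) v by (simp add: mult.assoc) (meson order_trans)
  qed
qed

lemma near_nn_volume:
  fixes z :: "complex^'n::finite"
  assumes "norm z < 1"
  shows "(\<integral>\<^sup>+w. (if near M z w then 1 else 0) \<partial>dV) \<le> ennreal ((4 * M\<^sup>2) ^ (CARD('n) + 1) * pw z ^ (CARD('n) + 1))"
proof -
  interpret finite_measure "dV :: (complex^'n) measure" by (rule finite_measure_dV)
  have "(\<integral>\<^sup>+w. (if near M z w then 1 else 0) \<partial>dV) = (\<integral>\<^sup>+w. indicator {w. near M z w} w \<partial>dV)"
    by (intro nn_integral_cong) (auto simp: indicator_def)
  also have "\<dots> = ennreal (measure dV {w. near M z w})" by (simp add: emeasure_eq_measure)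
  also have "\<dots> \<le> ennreal ((4 * M\<^sup>2) ^ (CARD('n) + 1) * pw z ^ (CARD('n) + 1))"
    by (intro ennreal_leI near_volume assms)
  finally show ?thesis .
qed

text \<open>Comparability of \<open>pw z\<close> with \<open>pw w\<close> contributes
  \<open>4 * M\<close> and the volume around \<open>w\<close> contributes
  \<open>4 * M\<^sup>2\<close>, both to the power \<open>CARD('n) + 1\<close>; the powers of
  \<open>pw w\<close> cancel.\<close>

lemma near_weight_integral:
  fixes w :: "complex^'n::finite"
  assumes w: "norm w < 1" and M: "0 < M"
  shows "(\<integral>\<^sup>+z. (if near M z w then ennreal (1 / pw z ^ (CARD('n) + 1)) else 0) \<partial>dV) \<le> ennreal ((16 * M ^ 3) ^ (CARD('n) + 1))"
proof -
  let ?m = "CARD('n) + 1"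
  have p: "0 < pw w" using w by (simp add: pw_pos_iff)
  have "(\<integral>\<^sup>+z. (if near M z w then ennreal (1 / pw z ^ ?m) else 0) \<partial>dV) \<le>
      (\<integral>\<^sup>+z. ennreal ((4 * M) ^ ?m / pw w ^ ?m) * (if near M w z then 1 else 0) \<partial>dV)"
    using near_inverse_pw_power[of M w _ ?m] near_sym[of M _ w] by (intro nn_integral_mono) (auto intro: ennreal_leI)
  also have "\<dots> = ennreal ((4 * M) ^ ?m / pw w ^ ?m) * (\<integral>\<^sup>+z. (if near M w z then 1 else 0) \<partial>dV)"
    by (rule nn_integral_cmult) measurable
  also have "\<dots> \<le> ennreal ((4 * M) ^ ?m / pw w ^ ?m) * ennreal ((4 * M\<^sup>2) ^ ?m * pw w ^ ?m)"
    by (intro mult_left_mono near_nn_volume w) auto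
  also have "\<dots> = ennreal ((4 * M) ^ ?m / pw w ^ ?m * ((4 * M\<^sup>2) ^ ?m * pw w ^ ?m))"
    using p M by (intro ennreal_mult[symmetric]) auto
  also have "(4 * M) ^ ?m / pw w ^ ?m * ((4 * M\<^sup>2) ^ ?m * pw w ^ ?m) = ((4 * M) * (4 * M\<^sup>2)) ^ ?m"
    unfolding power_mult_distrib[of "4 * M"] using p by simp
  also have "(4 * M) * (4 * M\<^sup>2) = 16 * M ^ 3" by (simp add: power2_eq_square power3_eq_cube)
  finally show ?thesis .
qed

text \<open>After Fubini, \<open>near_weight_integral\<close> bounds the total weight that each
  \<open>w\<close> receives.\<close>

lemma near_avg_integral:
  fixes f :: "'n::finite bergman"
  assumes M: "0 < M"
  shows "(\<integral>\<^sup>+z. ennreal (near_avg M f z) \<partial>dV) \<le> ennreal ((16 * M ^ 3) ^ (CARD('n) + 1) * (norm f)\<^sup>2)"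
proof -
  interpret sigma_finite_measure "dV :: (complex^'n) measure" by (rule sigma_finite_dV)
  interpret pair_sigma_finite "dV :: (complex^'n) measure" "dV :: (complex^'n) measure" ..
  let ?m = "CARD('n) + 1"
  let ?k = "\<lambda>z w. (if near M z w then ennreal (1 / pw z ^ ?m) else 0) * ennreal ((norm (bergman_fun f w))\<^sup>2)"
  have "(\<integral>\<^sup>+z. ennreal (near_avg M f z) \<partial>dV) = (\<integral>\<^sup>+z. \<integral>\<^sup>+w. ?k z w \<partial>dV \<partial>dV)"
  proof (rule nn_integral_cong_AE)
    show "AE z in dV. ennreal (near_avg M f z) = (\<integral>\<^sup>+w. ?k z w \<partial>dV)"
      using AE_dV_ball
    proof eventually_elim
      fix z :: "complex^'n" assume "z \<in> ball 0 1"
      then have p: "0 < pw z" by (rule pw_pos)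
      have "ennreal (near_avg M f z) = ennreal (1 / pw z ^ ?m) * ennreal (\<integral>w. (if near M z w then (norm (bergman_fun f w))\<^sup>2 else 0) \<partial>dV)"
        using p by (subst ennreal_mult[symmetric]) (auto simp: near_avg_def intro!: Bochner_Integration.integral_nonneg)
      also have "ennreal (\<integral>w. (if near M z w then (norm (bergman_fun f w))\<^sup>2 else 0) \<partial>dV) =
          (\<integral>\<^sup>+w. ennreal (if near M z w then (norm (bergman_fun f w))\<^sup>2 else 0) \<partial>dV)"
        by (rule nn_integral_eq_integral[symmetric, OF near_norm_sq_integrable]) auto
      also have "ennreal (1 / pw z ^ ?m) * \<dots> = (\<integral>\<^sup>+w. ?k z w \<partial>dV)"
        by (subst nn_integral_cmult[symmetric]) (auto intro!: nn_integral_cong measurable_If)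
      finally show "ennreal (near_avg M f z) = (\<integral>\<^sup>+w. ?k z w \<partial>dV)" .
    qed
  qed
  also have "\<dots> = (\<integral>\<^sup>+w. \<integral>\<^sup>+z. ?k z w \<partial>dV \<partial>dV)"
    by (rule Fubini'[symmetric]) measurable
  also have "\<dots> \<le> (\<integral>\<^sup>+w. ennreal ((16 * M ^ 3) ^ ?m) * ennreal ((norm (bergman_fun f w))\<^sup>2) \<partial>dV)"
  proof (rule nn_integral_mono_AE)
    show "AE w in dV. (\<integral>\<^sup>+z. ?k z w \<partial>dV) \<le> ennreal ((16 * M ^ 3) ^ ?m) * ennreal ((norm (bergman_fun f w))\<^sup>2)"
      using AE_dV_ball
    proof eventually_elim
      fix w :: "complex^'n" assume "w \<in> ball 0 1"
      then have "(\<integral>\<^sup>+z. (if near M z w then ennreal (1 / pw z ^ ?m) else 0) \<partial>dV) \<le> ennreal ((16 * M ^ 3) ^ ?m)"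
        using M by (intro near_weight_integral) auto
      then show "(\<integral>\<^sup>+z. ?k z w \<partial>dV) \<le> ennreal ((16 * M ^ 3) ^ ?m) * ennreal ((norm (bergman_fun f w))\<^sup>2)"
        by (subst nn_integral_multc) (auto intro: mult_right_mono)
    qed
  qed
  also have "\<dots> = ennreal ((16 * M ^ 3) ^ ?m) * ennreal ((norm f)\<^sup>2)"
    by (simp add: nn_integral_cmult L2_nn_integral[OF bergman_L2] norm_bergman_sq)
  also have "\<dots> = ennreal ((16 * M ^ 3) ^ ?m * (norm f)\<^sup>2)"
    using M by (intro ennreal_mult[symmetric]) auto
  finally show ?thesis .
qed

text \<open>Each \<open>k q\<close> is a symbol depending on a parameter. A uniform bound for the
  total mass over all parameters at each point of the ball makes the superposition a bounded symbol
  and permits Fubini.\<close>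

lemma integrated_symbol:
  fixes k :: "'a \<Rightarrow> complex^'n::finite \<Rightarrow> complex"
  assumes Q: "sigma_finite_measure Q" and k[measurable]: "(\<lambda>(q, v). k q v) \<in> borel_measurable (Q \<Otimes>\<^sub>M borel)"
    and bd: "\<And>v. norm v < 1 \<Longrightarrow> (\<integral>\<^sup>+q. ennreal (norm (k q v)) \<partial>Q) \<le> ennreal S" and S: "0 \<le> S"
  shows "(\<lambda>v. \<integral>q. k q v \<partial>Q) \<in> Linf"
    "integrable dV \<phi> \<Longrightarrow> integrable Q (\<lambda>q. \<integral>v. k q v * \<phi> v \<partial>dV)"
    "integrable dV \<phi> \<Longrightarrow> (\<integral>v. (\<integral>q. k q v \<partial>Q) * \<phi> v \<partial>dV) = (\<integral>q. (\<integral>v. k q v * \<phi> v \<partial>dV) \<partial>Q)"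
proof -
  interpret Q: sigma_finite_measure Q by fact
  interpret V: sigma_finite_measure "dV :: (complex^'n) measure" by (rule sigma_finite_dV)
  interpret pair_sigma_finite Q "dV :: (complex^'n) measure" ..
  have k2 [measurable]: "(\<lambda>(v, q). k q v) \<in> borel_measurable (borel \<Otimes>\<^sub>M Q)"
    using measurable_compose[OF measurable_pair_swap' k] by (simp add: case_prod_beta)
  have kq: "(\<lambda>q. k q v) \<in> borel_measurable Q" for v
    using measurable_compose[OF measurable_Pair2' k, of v] by simp
  have m: "(\<lambda>v. \<integral>q. k q v \<partial>Q) \<in> borel_measurable borel" by measurable
  have "norm (\<integral>q. k q v \<partial>Q) \<le> S" if "norm v < 1" for v
  proof (cases "integrable Q (\<lambda>q. k q v)")
    case True
    have "ennreal (norm (\<integral>q. k q v \<partial>Q)) \<le> ennreal S"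
      by (rule order_trans[OF integral_norm_bound_ennreal[OF True] bd[OF that]])
    then show ?thesis using S by (simp add: ennreal_le_iff)
  next
    case False then show ?thesis using S by (simp add: not_integrable_integral_eq)
  qed
  then have "AE v in dV. norm (\<integral>q. k q v \<partial>Q) \<le> S"
    using AE_dV_ball by (auto elim: eventually_mono)
  then show "(\<lambda>v. \<integral>q. k q v \<partial>Q) \<in> Linf" using m by (auto simp: Linf_def cong: measurable_cong_sets)
  assume \<phi>: "integrable dV \<phi>"
  then have [measurable]: "\<phi> \<in> borel_measurable borel"
    using borel_measurable_integrable by (simp cong: measurable_cong_sets)
  have "(\<lambda>(q, v). k q v * \<phi> v) \<in> borel_measurable (Q \<Otimes>\<^sub>M dV)"
    by measurable
  then have int: "integrable (Q \<Otimes>\<^sub>M dV) (\<lambda>(q, v). k q v * \<phi> v)"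
  proof (rule integrableI_bounded)
    have "(\<integral>\<^sup>+p. ennreal (norm (case p of (q, v) \<Rightarrow> k q v * \<phi> v)) \<partial>(Q \<Otimes>\<^sub>M dV)) =
        (\<integral>\<^sup>+v. \<integral>\<^sup>+q. ennreal (norm (k q v * \<phi> v)) \<partial>Q \<partial>dV)"
      by (subst nn_integral_snd[symmetric]) (auto simp: case_prod_beta)
    also have "\<dots> \<le> (\<integral>\<^sup>+v. ennreal S * ennreal (norm (\<phi> v)) \<partial>dV)"
    proof (rule nn_integral_mono_AE)
      show "AE v in dV. (\<integral>\<^sup>+q. ennreal (norm (k q v * \<phi> v)) \<partial>Q) \<le> ennreal S * ennreal (norm (\<phi> v))"
        using AE_dV_ball
      proof eventually_elim
        fix v :: "complex^'n" assume "v \<in> ball 0 1"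
        then have "(\<integral>\<^sup>+q. ennreal (norm (k q v)) \<partial>Q) * ennreal (norm (\<phi> v)) \<le> ennreal S * ennreal (norm (\<phi> v))"
          by (intro mult_right_mono bd) auto
        then show "(\<integral>\<^sup>+q. ennreal (norm (k q v * \<phi> v)) \<partial>Q) \<le> ennreal S * ennreal (norm (\<phi> v))"
          using kq[of v] by (simp add: norm_mult ennreal_mult nn_integral_multc)
      qed
    qed
    also have "\<dots> = ennreal S * (\<integral>\<^sup>+v. ennreal (norm (\<phi> v)) \<partial>dV)" by (rule nn_integral_cmult) measurable
    also have "\<dots> < \<infinity>" using \<phi> by (simp add: integrable_iff_bounded ennreal_mult_less_top)
    finally show "(\<integral>\<^sup>+p. ennreal (norm (case p of (q, v) \<Rightarrow> k q v * \<phi> v)) \<partial>(Q \<Otimes>\<^sub>M dV)) < \<infinity>" .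
  qed
  show "integrable Q (\<lambda>q. \<integral>v. k q v * \<phi> v \<partial>dV)" using integrable_fst[OF int] .
  have "(\<integral>v. (\<integral>q. k q v \<partial>Q) * \<phi> v \<partial>dV) = (\<integral>v. (\<integral>q. k q v * \<phi> v \<partial>Q) \<partial>dV)" by simp
  also have "\<dots> = (\<integral>q. (\<integral>v. k q v * \<phi> v \<partial>dV) \<partial>Q)" by (rule Fubini_integral[OF int])
  finally show "(\<integral>v. (\<integral>q. k q v \<partial>Q) * \<phi> v \<partial>dV) = (\<integral>q. (\<integral>v. k q v * \<phi> v \<partial>dV) \<partial>Q)" .
qed

text \<open>The mean of \<open>f\<close> times \<open>cnj g\<close> over a small neighbourhood of
  \<open>v\<close>. It replaces the value at \<open>v\<close>, which is no integral against a
  function: a superposition of point values over circles would only give a measure as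
  symbol.\<close>

definition dset_avg :: "real \<Rightarrow> 'n::finite bergman \<Rightarrow> 'n bergman \<Rightarrow> complex^'n \<Rightarrow> complex" where
  "dset_avg \<delta> f g v = (\<integral>w. (if dset \<delta> v (w - v) then of_real (1 / dset_vol \<delta> v) * (bergman_fun f w * cnj (bergman_fun g w)) else 0) \<partial>dV)"

lemma dset_avg_measurable [measurable]:
  "dset_avg \<delta> f g \<in> borel_measurable (borel :: (complex^'n::finite) measure)"
proof -
  interpret sigma_finite_measure "dV :: (complex^'n) measure" by (rule sigma_finite_dV)
  show ?thesis unfolding dset_avg_def[abs_def] by measurable
qed

text \<open>The neighbourhood with parameter \<open>\<delta>\<close> is that with parameter 1 scaled
  by \<open>\<delta>\<close>. By \<open>holomorphic_diff_bound\<close> along complex lines each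
  function deviates there from its value at \<open>v\<close> by at most \<open>2 * \<delta>\<close>
  times its bound, and the product by twice as much.\<close>

lemma dset_avg_diff:
  fixes f g :: "'n::finite bergman"
  assumes v: "norm v < 1" and \<delta>: "0 < \<delta>" "\<delta> \<le> 1 / 2"
    and A: "\<And>w. near 7 v w \<Longrightarrow> norm (bergman_fun f w) \<le> A" and B: "\<And>w. near 7 v w \<Longrightarrow> norm (bergman_fun g w) \<le> B"
  shows "norm (bergman_fun f v * cnj (bergman_fun g v) - dset_avg \<delta> f g v) \<le> 4 * \<delta> * A * B"
proof -
  interpret finite_measure "dV :: (complex^'n) measure" by (rule finite_measure_dV)
  let ?f = "bergman_fun f" and ?g = "bergman_fun g"
  have \<delta>1: "\<delta> \<le> 1" using \<delta> by simp
  have vv: "near 7 v v"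
    using dset_near[OF _ v, of 1 0] v by (simp add: dset_def pw_pos_iff hip_def)
  have A0: "0 \<le> A" and B0: "0 \<le> B" using A[OF vv] B[OF vv] norm_ge_zero order_trans by blast+
  have diff: "norm (bergman_fun h w - bergman_fun h v) \<le> 2 * \<delta> * H"
    if H: "\<And>w. near 7 v w \<Longrightarrow> norm (bergman_fun h w) \<le> H" and d: "dset \<delta> v (w - v)" for h :: "'n bergman" and w H
  proof -
    \<comment> \<open>The closed unit disc in direction \<open>y\<close> stays in the near region of
      \<open>v\<close>, and \<open>w\<close> sits at parameter \<open>\<delta>\<close>.\<close>
    define y where "y = (1 / of_real \<delta>) *s (w - v)"
    have y: "dset 1 v y" unfolding y_def by (rule dset_divide[OF d \<delta>(1)])
    have n: "near 7 v (v + \<zeta> *s y)" if "norm \<zeta> \<le> 1" for \<zeta>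
      by (rule dset_near[OF dset_scale[OF y that] v]) auto
    have sub: "cball 0 1 \<subseteq> {\<zeta>. v + \<zeta> *s y \<in> ball 0 1}" using n by (auto simp: near_def)
    have "norm (bergman_fun h (v + of_real \<delta> *s y) - bergman_fun h (v + 0 *s y)) \<le> 2 * \<delta> * H"
      by (rule holomorphic_diff_bound[OF holomorphic_on_line[OF bergman_fun_holomorphic] sub]) (use H n \<delta> in auto)
    moreover have "v + of_real \<delta> *s y = w" using \<delta>(1) by (simp add: y_def vec_eq_iff)
    ultimately show ?thesis by simp
  qed
  obtain c where c: "0 < c" "\<forall>v :: complex^'n. norm v < 1 \<longrightarrow> c * pw v ^ (CARD('n) + 1) \<le> dset_vol \<delta> v"
    using dset_vol_lower[OF \<delta>(1) \<delta>1, where 'n='n] by auto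
  have "0 < c * pw v ^ (CARD('n) + 1)" using c(1) v by (simp add: pw_pos_iff del: power_Suc)
  then have vol: "0 < dset_vol \<delta> v" using c(2) v by (meson less_le_trans)
  let ?r = "1 / dset_vol \<delta> v"
  have ifg: "integrable dV (\<lambda>w. ?f w * cnj (?g w))" by (intro L2_integrable bergman_L2)
  have i1: "integrable dV (\<lambda>w. if dset \<delta> v (w - v) then of_real ?r * (?f w * cnj (?g w)) else 0)"
    by (rule Bochner_Integration.integrable_bound[OF integrable_mult_right[OF ifg, of "of_real ?r"]]) (auto intro!: measurable_If)
  have i2: "integrable dV (\<lambda>w. if dset \<delta> v (w - v) then x else 0)" for x :: "'b::{banach, second_countable_topology}"
    by (rule integrable_const_bound[of _ "norm x"]) auto
  have vs: "(\<integral>w. (if dset \<delta> v (w - v) then x else 0) \<partial>dV) = dset_vol \<delta> v *\<^sub>R x" for x :: "'b::{banach, second_countable_topology}"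
  proof -
    have "(\<integral>w. (if dset \<delta> v (w - v) then x else 0) \<partial>dV) = (\<integral>w. indicator {w. dset \<delta> v (w - v)} w *\<^sub>R x \<partial>dV)"
      by (intro Bochner_Integration.integral_cong) (auto simp: indicator_def)
    also have "\<dots> = dset_vol \<delta> v *\<^sub>R x"
      unfolding dset_vol_def by (subst integral_scaleR_left) (auto simp: emeasure_eq_measure)
    finally show ?thesis .
  qed
  let ?x = "of_real ?r * (?f v * cnj (?g v))"
  have "?f v * cnj (?g v) = (\<integral>w. (if dset \<delta> v (w - v) then ?x else 0) \<partial>dV)"
    using vol by (simp add: vs scaleR_conv_of_real)
  then have "norm (?f v * cnj (?g v) - dset_avg \<delta> f g v) =
      norm (\<integral>w. (if dset \<delta> v (w - v) then ?x else 0) - (if dset \<delta> v (w - v) then of_real ?r * (?f w * cnj (?g w)) else 0) \<partial>dV)"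
    unfolding dset_avg_def Bochner_Integration.integral_diff[OF i2 i1]
    by (rule arg_cong2[where f = "\<lambda>s t. norm (s - t)"]) (rule refl)
  also have "\<dots> \<le> (\<integral>w. (if dset \<delta> v (w - v) then ?r * (4 * \<delta> * A * B) else 0) \<partial>dV)"
  proof (rule order_trans[OF integral_norm_bound], rule integral_mono)
    show "integrable dV (\<lambda>w. norm ((if dset \<delta> v (w - v) then ?x else 0) - (if dset \<delta> v (w - v) then of_real ?r * (?f w * cnj (?g w)) else 0)))"
      by (intro integrable_norm Bochner_Integration.integrable_diff i1 i2)
    show "integrable dV (\<lambda>w. if dset \<delta> v (w - v) then ?r * (4 * \<delta> * A * B) else 0)" by (rule i2)
    fix w
    show "norm ((if dset \<delta> v (w - v) then ?x else 0) - (if dset \<delta> v (w - v) then of_real ?r * (?f w * cnj (?g w)) else 0)) \<le>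
        (if dset \<delta> v (w - v) then ?r * (4 * \<delta> * A * B) else 0)"
    proof (cases "dset \<delta> v (w - v)")
      case True
      have w: "near 7 v w" using dset_near[OF True v \<delta>(1) \<delta>1] by simp
      have "?f v * cnj (?g v) - ?f w * cnj (?g w) = - ((?f w - ?f v) * cnj (?g w) + ?f v * cnj (?g w - ?g v))"
        by (simp add: algebra_simps)
      then have "norm (?f v * cnj (?g v) - ?f w * cnj (?g w)) \<le> norm (?f w - ?f v) * norm (?g w) + norm (?f v) * norm (?g w - ?g v)"
        by (metis norm_minus_cancel norm_triangle_ineq norm_mult complex_mod_cnj)
      also have "\<dots> \<le> (2 * \<delta> * A) * B + A * (2 * \<delta> * B)"
        using diff[OF A True] diff[OF B True] A[OF vv] B[OF w] A0 B0 \<delta>(1)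
        by (intro add_mono mult_mono) auto
      finally have *: "norm (?f v * cnj (?g v) - ?f w * cnj (?g w)) \<le> 4 * \<delta> * A * B" by (simp add: mult_ac)
      have "norm (?x - of_real ?r * (?f w * cnj (?g w))) = norm (of_real ?r * (?f v * cnj (?g v) - ?f w * cnj (?g w)))"
        by (simp only: right_diff_distrib)
      also have "\<dots> = ?r * norm (?f v * cnj (?g v) - ?f w * cnj (?g w))"
        using vol by (simp only: norm_mult norm_of_real) simp
      also have "\<dots> \<le> ?r * (4 * \<delta> * A * B)" using * vol by (intro mult_left_mono) auto
      finally show ?thesis using True by simp
    qed simp
  qed
  also have "\<dots> = 4 * \<delta> * A * B" using vol by (simp add: vs)
  finally show ?thesis .
qed

text \<open>Errors are measured by \<open>near_avg\<close> at \<open>z\<close>, since its integral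
  is controlled by the norm of the function. \<open>M'\<close> and \<open>C\<close> are chosen
  before \<open>\<epsilon>\<close>, so that the error integrates to \<open>\<epsilon>\<close> times
  a fixed constant.\<close>

lemma kernel_pointwise:
  assumes M: "1 \<le> M"
  shows "\<exists>M'>0. \<exists>C>0. (\<forall>(f :: 'n::finite bergman) g z w. near M z w \<longrightarrow>
      norm (bergman_fun f w * cnj (bergman_fun g z)) \<le> C * (sqrt (near_avg M' f z) * sqrt (near_avg M' g z))) \<and>
    (\<forall>\<epsilon>>0. \<exists>L \<rho> \<delta>. 0 < \<rho> \<and> 0 < \<delta> \<and> \<delta> \<le> 1 / 2 \<and> (\<forall>z w x. near M z w \<longrightarrow> near (2 * M) z (geodesic (z :: complex^'n) w (of_real \<rho> * unit_exp x))) \<and>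
      (\<forall>(f :: 'n::finite bergman) g z w. near M z w \<longrightarrow>
      norm (bergman_fun f w * cnj (bergman_fun g z) -
        (\<integral>x. fourier_weight L \<rho> x * dset_avg \<delta> f g (geodesic z w (of_real \<rho> * unit_exp x)) \<partial>circle01))
      \<le> \<epsilon> * (sqrt (near_avg M' f z) * sqrt (near_avg M' g z))))"
proof -
  \<comment> \<open>The region of parameter \<open>2 * M\<close> around \<open>z\<close> contains
    the relevant part of the geodesic. Points near one of its points with parameter 7 are near
    \<open>z\<close> with parameter \<open>X\<close>, by \<open>near_trans\<close>;
    \<open>M'\<close> is what \<open>bergman_local_sup\<close> then requires.\<close>
  define X where "X = 64 * (2 * M) * 7"
  define M' where "M' = 64 * X * 7"
  have X: "0 < X" "2 * M \<le> X" "M \<le> X" and M': "0 < M'" using M by (auto simp: X_def M'_def)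
  obtain C where C: "0 < C" "\<forall>(f :: 'n bergman) z v. near X z v \<longrightarrow> (norm (bergman_fun f v))\<^sup>2 \<le> C * near_avg M' f z"
    using bergman_local_sup[OF X(1), where 'n='n] unfolding M'_def by auto
  define N where "N f z = sqrt (C * near_avg M' f z)" for f :: "'n bergman" and z
  have N: "norm (bergman_fun f v) \<le> N f z" if "near X z v" for f :: "'n bergman" and z v
    unfolding N_def using C(2) that by (intro real_le_rsqrt) auto
  have NN: "N f z * N g z = C * (sqrt (near_avg M' f z) * sqrt (near_avg M' g z))" for f g :: "'n bergman" and z
    using C(1) by (simp add: N_def real_sqrt_mult)
  \<comment> \<open>A radius above 1 for which the geodesic up to parameter \<open>R\<close> stays
    in the region of parameter \<open>2 * M\<close>.\<close>
  define R where "R = sqrt (1 + 1 / (2 * M))"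
  have R: "1 < R" using M by (simp add: R_def)
  have R2: "R\<^sup>2 * (1 - 1 / M) \<le> 1 - 1 / (2 * M)"
  proof -
    have "R\<^sup>2 = 1 + 1 / (2 * M)" using M by (simp add: R_def)
    moreover have "(1 + 1 / (2 * M)) * (1 - 1 / M) = 1 - 1 / (2 * M) - 1 / (2 * M\<^sup>2)"
      using M by (simp add: field_simps power2_eq_square)
    ultimately show ?thesis by simp
  qed
  have geo: "near (2 * M) z (geodesic z w \<zeta>)" if "near M z w" "norm \<zeta> \<le> R" for z w :: "complex^'n" and \<zeta>
  proof (rule geodesic_near(2)[OF that(1) M])
    have "(norm \<zeta>)\<^sup>2 * (1 - 1 / M) \<le> R\<^sup>2 * (1 - 1 / M)"
      using that(2) M by (intro mult_right_mono power_mono) auto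
    then show "(norm \<zeta>)\<^sup>2 * (1 - 1 / M) \<le> 1 - 1 / (2 * M)" using R2 by linarith
  qed
  show ?thesis
  proof (rule exI[of _ M'], rule conjI[OF M'], rule exI[of _ C], intro conjI C(1) allI impI)
    fix f g :: "'n bergman" and z w :: "complex^'n" assume n: "near M z w"
    have zz: "near X z z" using near_mono[OF geo[OF n, of 0] X(2)] R geodesic_ends(1)[OF n] by simp
    have "norm (bergman_fun f w) * norm (bergman_fun g z) \<le> N f z * N g z"
      using N[OF zz, of g] N[OF near_mono[OF n X(3)], of f] by (intro mult_mono) (auto intro: order_trans[OF norm_ge_zero])
    then show "norm (bergman_fun f w * cnj (bergman_fun g z)) \<le> C * (sqrt (near_avg M' f z) * sqrt (near_avg M' g z))"
      by (simp add: norm_mult NN)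
  next
    fix \<epsilon> :: real assume \<epsilon>: "0 < \<epsilon>"
    then have e: "0 < \<epsilon> / (2 * C)" using C(1) by simp
    obtain L \<rho> where \<rho>: "0 < \<rho>" "\<rho> < 1" and diag0: "\<forall>F G S A B. F holomorphic_on S \<longrightarrow> G holomorphic_on S \<longrightarrow> cball 0 R \<subseteq> S \<longrightarrow>
      (\<forall>\<zeta>. norm \<zeta> \<le> R \<longrightarrow> norm (F \<zeta>) \<le> A) \<longrightarrow> (\<forall>\<zeta>. norm \<zeta> \<le> R \<longrightarrow> norm (G \<zeta>) \<le> B) \<longrightarrow>
      norm (F 1 * cnj (G 0) - (\<integral>x. fourier_weight L \<rho> x * (F (of_real \<rho> * unit_exp x) * cnj (G (of_real \<rho> * unit_exp x))) \<partial>circle01))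
      \<le> \<epsilon> / (2 * C) * A * B"
      using diagonal_approximation[OF R e] by (elim exE conjE) (rule that)
    note diag = diag0[rule_format]
    define H where "H = (\<Sum>m\<le>L. 1 / \<rho> ^ m)"
    have H: "0 < H" unfolding H_def using \<rho> by (intro sum_pos) auto
    \<comment> \<open>\<open>H\<close> bounds the weight, so averaging costs at most
      \<open>H * (4 * \<delta>)\<close>; this and the polarisation are each allowed
      \<open>\<epsilon> / (2 * C)\<close>.\<close>
    define \<delta> where "\<delta> = min (1 / 2) (\<epsilon> / (8 * C * H))"
    have \<delta>: "0 < \<delta>" "\<delta> \<le> 1 / 2" and \<delta>e: "\<delta> \<le> \<epsilon> / (8 * C * H)" using \<epsilon> C(1) H by (auto simp: \<delta>_def)
    have \<delta>e: "H * (4 * \<delta>) \<le> \<epsilon> / (2 * C)" using \<delta>e C(1) H by (simp add: field_simps)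
    have \<rho>R: "norm (of_real \<rho> * unit_exp x) \<le> R" for x using \<rho> R by (simp add: norm_mult)
    show "\<exists>L \<rho> \<delta>. 0 < \<rho> \<and> 0 < \<delta> \<and> \<delta> \<le> 1 / 2 \<and> (\<forall>z w x. near M z w \<longrightarrow> near (2 * M) z (geodesic (z :: complex^'n) w (of_real \<rho> * unit_exp x))) \<and>
      (\<forall>(f :: 'n::finite bergman) g z w. near M z w \<longrightarrow>
      norm (bergman_fun f w * cnj (bergman_fun g z) -
        (\<integral>x. fourier_weight L \<rho> x * dset_avg \<delta> f g (geodesic z w (of_real \<rho> * unit_exp x)) \<partial>circle01))
      \<le> \<epsilon> * (sqrt (near_avg M' f z) * sqrt (near_avg M' g z)))"
    proof (rule exI[of _ L], rule exI[of _ \<rho>], rule exI[of _ \<delta>], intro conjI \<rho>(1) \<delta> allI impI)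
      show "near (2 * M) z (geodesic z w (of_real \<rho> * unit_exp x))" if "near M z w" for z w :: "complex^'n" and x
        by (rule geo[OF that \<rho>R])
      fix f g :: "'n bergman" and z w :: "complex^'n" assume n: "near M z w"
      interpret circle: finite_measure circle01 by (rule finite_measure_circle01)
      let ?\<gamma> = "\<lambda>x. geodesic z w (of_real \<rho> * unit_exp x)" and ?h = "fourier_weight L \<rho>"
      let ?p = "\<lambda>v. bergman_fun f v * cnj (bergman_fun g v)"
      note geoX = near_mono[OF geo[OF n] X(2)]
      have "near X z z" using geoX[of 0] R geodesic_ends(1)[OF n] by simp
      then have N0: "0 \<le> N f z" "0 \<le> N g z" using N norm_ge_zero order_trans by blast+
      have d1: "norm (bergman_fun f w * cnj (bergman_fun g z) - (\<integral>x. ?h x * ?p (?\<gamma> x) \<partial>circle01)) \<le> \<epsilon> / (2 * C) * N f z * N g z"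
        using diag[of "\<lambda>\<zeta>. bergman_fun f (geodesic z w \<zeta>)" "cball 0 R" "\<lambda>\<zeta>. bergman_fun g (geodesic z w \<zeta>)" "N f z" "N g z"]
          geodesic_holomorphic[OF n M bergman_fun_holomorphic _ R2] R N[OF geoX] geodesic_ends[OF n] by simp
      have avg: "norm (?p (?\<gamma> x) - dset_avg \<delta> f g (?\<gamma> x)) \<le> 4 * \<delta> * N f z * N g z" for x
      proof (rule dset_avg_diff[OF _ \<delta>])
        have g: "near (2 * M) z (?\<gamma> x)" by (rule geo[OF n \<rho>R])
        then show "norm (?\<gamma> x) < 1" by (simp add: near_def)
        fix v assume "near 7 (?\<gamma> x) v"
        then have "near X z v" using near_trans[OF g] unfolding X_def by blast
        then show "norm (bergman_fun f v) \<le> N f z" "norm (bergman_fun g v) \<le> N g z" by (rule N)+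
      qed
      have hb: "norm (?h x) \<le> H" for x unfolding H_def by (rule norm_fourier_weight_le[OF \<rho>(1)])
      have pb: "norm (?p (?\<gamma> x)) \<le> N f z * N g z" for x
        unfolding norm_mult complex_mod_cnj using N[OF geoX[OF \<rho>R]] N0 by (intro mult_mono) auto
      have i1: "integrable circle01 (\<lambda>x. ?h x * ?p (?\<gamma> x))"
        by (rule circle.integrable_const_bound[of _ "H * (N f z * N g z)"])
          (use hb pb H in \<open>auto simp: norm_mult[of "fourier_weight _ _ _"] intro!: AE_I2 mult_mono\<close>)
      have hd: "norm (?h x * (?p (?\<gamma> x) - dset_avg \<delta> f g (?\<gamma> x))) \<le> H * (4 * \<delta> * N f z * N g z)" for x
        unfolding norm_mult[of "?h x"] using hb[of x] avg[of x] H by (intro mult_mono) auto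
      have i2: "integrable circle01 (\<lambda>x. ?h x * (?p (?\<gamma> x) - dset_avg \<delta> f g (?\<gamma> x)))"
        by (rule circle.integrable_const_bound[of _ "H * (4 * \<delta> * N f z * N g z)"]) (use hd in auto)
      have i3: "integrable circle01 (\<lambda>x. ?h x * dset_avg \<delta> f g (?\<gamma> x))"
        using Bochner_Integration.integrable_diff[OF i1 i2] by (simp add: algebra_simps)
      have "norm ((\<integral>x. ?h x * ?p (?\<gamma> x) \<partial>circle01) - (\<integral>x. ?h x * dset_avg \<delta> f g (?\<gamma> x) \<partial>circle01)) =
          norm (\<integral>x. ?h x * (?p (?\<gamma> x) - dset_avg \<delta> f g (?\<gamma> x)) \<partial>circle01)"
        using i1 i3 by (simp add: Bochner_Integration.integral_diff right_diff_distrib)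
      also have "\<dots> \<le> (\<integral>x. H * (4 * \<delta> * N f z * N g z) \<partial>circle01)"
        by (rule order_trans[OF integral_norm_bound integral_mono[OF integrable_norm[OF i2] circle.integrable_const hd]])
      also have "\<dots> = H * (4 * \<delta>) * (N f z * N g z)" by (simp add: mult.assoc)
      also have "\<dots> \<le> \<epsilon> / (2 * C) * (N f z * N g z)" using \<delta>e N0 by (intro mult_right_mono) auto
      finally have d2: "norm ((\<integral>x. ?h x * ?p (?\<gamma> x) \<partial>circle01) - (\<integral>x. ?h x * dset_avg \<delta> f g (?\<gamma> x) \<partial>circle01)) \<le> \<epsilon> / (2 * C) * (N f z * N g z)" .
      have "norm (bergman_fun f w * cnj (bergman_fun g z) - (\<integral>x. ?h x * dset_avg \<delta> f g (?\<gamma> x) \<partial>circle01)) \<le>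
          \<epsilon> / (2 * C) * (N f z * N g z) + \<epsilon> / (2 * C) * (N f z * N g z)"
        using norm_diff_triangle_le[OF d1 d2] by (simp add: mult.assoc)
      also have "\<dots> = \<epsilon> * (sqrt (near_avg M' f z) * sqrt (near_avg M' g z))" using C(1) by (simp add: NN)
      finally show "norm (bergman_fun f w * cnj (bergman_fun g z) - (\<integral>x. ?h x * dset_avg \<delta> f g (?\<gamma> x) \<partial>circle01)) \<le>
          \<epsilon> * (sqrt (near_avg M' f z) * sqrt (near_avg M' g z))" .
    qed
  qed
qed

text \<open>Integration over \<open>w\<close> cancels the power of \<open>pw z\<close> against the
  volume of the near region. The product of the two roots is at most the sum of the averages, to
  which \<open>near_avg_integral\<close> applies.\<close>

lemma near_kernel_total:
  fixes f g :: "'n::finite bergman"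
  assumes M': "0 < M'" and K: "0 \<le> K"
  shows "(\<integral>\<^sup>+z. \<integral>\<^sup>+w. ennreal ((if near M z w then K / pw z ^ (CARD('n) + 1) else 0) * (sqrt (near_avg M' f z) * sqrt (near_avg M' g z))) \<partial>dV \<partial>dV)
    \<le> ennreal (K * (4 * M\<^sup>2) ^ (CARD('n) + 1) * (16 * M' ^ 3) ^ (CARD('n) + 1) * ((norm f)\<^sup>2 + (norm g)\<^sup>2))"
proof -
  let ?m = "CARD('n) + 1"
  let ?V = "(4 * M\<^sup>2) ^ ?m" and ?W = "(16 * M' ^ 3) ^ ?m"
  have W: "0 \<le> ?W" using M' by simp
  have V: "0 \<le> ?V" by simp
  have "(\<integral>\<^sup>+z. \<integral>\<^sup>+w. ennreal ((if near M z w then K / pw z ^ ?m else 0) * (sqrt (near_avg M' f z) * sqrt (near_avg M' g z))) \<partial>dV \<partial>dV)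
      \<le> (\<integral>\<^sup>+z. ennreal (K * ?V) * (ennreal (near_avg M' f z) + ennreal (near_avg M' g z)) \<partial>dV)"
  proof (rule nn_integral_mono_AE)
    show "AE z in dV. (\<integral>\<^sup>+w. ennreal ((if near M z w then K / pw z ^ ?m else 0) * (sqrt (near_avg M' f z) * sqrt (near_avg M' g z))) \<partial>dV)
        \<le> ennreal (K * ?V) * (ennreal (near_avg M' f z) + ennreal (near_avg M' g z))"
      using AE_dV_ball
    proof eventually_elim
      fix z :: "complex^'n" assume "z \<in> ball 0 1"
      then have z: "norm z < 1" and p: "0 < pw z ^ ?m" and p0: "pw z \<noteq> 0" using pw_pos[of z] by auto
      let ?s = "sqrt (near_avg M' f z) * sqrt (near_avg M' g z)"
      note a = near_avg_nonneg[OF z, of M' f] near_avg_nonneg[OF z, of M' g]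
      have s: "0 \<le> ?s" using a by simp
      have s2: "?s \<le> near_avg M' f z + near_avg M' g z"
        using sum_squares_bound[of "sqrt (near_avg M' f z)" "sqrt (near_avg M' g z)"] a s by simp
      have "(\<integral>\<^sup>+w. ennreal ((if near M z w then K / pw z ^ ?m else 0) * ?s) \<partial>dV) =
          (\<integral>\<^sup>+w. ennreal (K / pw z ^ ?m * ?s) * (if near M z w then 1 else 0) \<partial>dV)"
        by (intro nn_integral_cong) auto
      also have "\<dots> = ennreal (K / pw z ^ ?m * ?s) * (\<integral>\<^sup>+w. (if near M z w then 1 else 0) \<partial>dV)"
        by (rule nn_integral_cmult) measurable
      also have "\<dots> \<le> ennreal (K / pw z ^ ?m * ?s) * ennreal (?V * pw z ^ ?m)"
        by (intro mult_left_mono near_nn_volume z) auto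
      also have "\<dots> = ennreal (K / pw z ^ ?m * ?s * (?V * pw z ^ ?m))"
        by (rule ennreal_mult[symmetric]) (use K p s V in \<open>auto simp del: power_Suc\<close>)
      also have "K / pw z ^ ?m * ?s * (?V * pw z ^ ?m) = K * ?V * ?s"
        using p0 by (simp del: power_Suc add: mult_ac)
      also have "ennreal (K * ?V * ?s) \<le> ennreal (K * ?V * (near_avg M' f z + near_avg M' g z))"
        using s2 K V by (intro ennreal_leI mult_left_mono) auto
      also have "\<dots> = ennreal (K * ?V) * (ennreal (near_avg M' f z) + ennreal (near_avg M' g z))"
        using a K V by (simp add: ennreal_mult)
      finally show "(\<integral>\<^sup>+w. ennreal ((if near M z w then K / pw z ^ ?m else 0) * ?s) \<partial>dV)
        \<le> ennreal (K * ?V) * (ennreal (near_avg M' f z) + ennreal (near_avg M' g z))" .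
    qed
  qed
  also have "\<dots> = ennreal (K * ?V) * ((\<integral>\<^sup>+z. ennreal (near_avg M' f z) \<partial>dV) + (\<integral>\<^sup>+z. ennreal (near_avg M' g z) \<partial>dV))"
    by (simp add: nn_integral_cmult nn_integral_add)
  also have "\<dots> \<le> ennreal (K * ?V) * (ennreal (?W * (norm f)\<^sup>2) + ennreal (?W * (norm g)\<^sup>2))"
    by (intro mult_left_mono add_mono near_avg_integral M') auto
  also have "\<dots> = ennreal (K * ?V * (?W * (norm f)\<^sup>2 + ?W * (norm g)\<^sup>2))"
    using K V W by (simp add: ennreal_mult)
  also have "K * ?V * (?W * (norm f)\<^sup>2 + ?W * (norm g)\<^sup>2) = K * ?V * ?W * ((norm f)\<^sup>2 + (norm g)\<^sup>2)"
    by (simp only: distrib_left mult.assoc)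
  finally show ?thesis .
qed

text \<open>For fixed \<open>v\<close> the integrand confines \<open>z\<close> to the near region of
  parameter \<open>X\<close> around \<open>v\<close>. Of its two inverse powers of
  \<open>pw z\<close>, one from the kernel and one from \<open>dset_vol\<close>, the first is
  cancelled by the volume available to \<open>w\<close>, and the second leaves the integral of
  \<open>near_weight_integral\<close>. The bound is uniform in \<open>\<gamma>\<close> so that it
  serves all points of the circle.\<close>

lemma symbol_kernel_bound:
  fixes M K H \<delta> \<rho> :: real
  assumes M: "1 \<le> M" and K: "0 \<le> K" and H: "0 \<le> H" and \<delta>: "0 < \<delta>" "\<delta> \<le> 1"
  shows "\<exists>S\<ge>0. \<forall>(\<gamma> :: complex^'n::finite \<Rightarrow> complex^'n \<Rightarrow> complex^'n) v.
    (\<forall>z w. near M z w \<longrightarrow> near (2 * M) z (\<gamma> z w)) \<longrightarrow> norm v < 1 \<longrightarrow>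
    (\<integral>\<^sup>+z. \<integral>\<^sup>+w. (if near M z w \<and> dset \<delta> (\<gamma> z w) (v - \<gamma> z w)
      then ennreal (K / pw z ^ (CARD('n) + 1) * H * (1 / dset_vol \<delta> (\<gamma> z w))) else 0) \<partial>dV \<partial>dV) \<le> ennreal S"
proof -
  let ?m = "CARD('n) + 1"
  define X where "X = 64 * (2 * M) * 7"
  have X: "0 < X" using M by (simp add: X_def)
  obtain c where c: "0 < c" "\<forall>v :: complex^'n. norm v < 1 \<longrightarrow> c * pw v ^ ?m \<le> dset_vol \<delta> v"
    using dset_vol_lower[OF \<delta>, where 'n='n] by auto
  let ?V = "(4 * M\<^sup>2) ^ ?m" and ?W = "(16 * X ^ 3) ^ ?m" and ?D = "K * H * ((4 * (2 * M)) ^ ?m / c)"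
  have D: "0 \<le> ?D" using K H M c(1) by simp
  have V: "0 \<le> ?V" by simp
  have W: "0 \<le> ?W" using X by simp
  show ?thesis
  proof (intro exI[of _ "?D * ?V * ?W"] conjI allI impI)
    show "0 \<le> ?D * ?V * ?W" by (rule mult_nonneg_nonneg[OF mult_nonneg_nonneg[OF D V] W])
    fix \<gamma> :: "complex^'n \<Rightarrow> complex^'n \<Rightarrow> complex^'n" and v :: "complex^'n"
    assume \<gamma>M: "\<forall>z w. near M z w \<longrightarrow> near (2 * M) z (\<gamma> z w)" and v: "norm v < 1"
    have pt: "(if near M z w \<and> dset \<delta> (\<gamma> z w) (v - \<gamma> z w) then ennreal (K / pw z ^ ?m * H * (1 / dset_vol \<delta> (\<gamma> z w))) else 0) \<le>
        (if near X z v then ennreal (?D / pw z ^ ?m / pw z ^ ?m) else 0) * (if near M z w then 1 else 0)" for z w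
    proof (cases "near M z w \<and> dset \<delta> (\<gamma> z w) (v - \<gamma> z w)")
      case True
      then have \<gamma>: "near (2 * M) z (\<gamma> z w)" "dset \<delta> (\<gamma> z w) (v - \<gamma> z w)" using \<gamma>M by auto
      have \<gamma>1: "norm (\<gamma> z w) < 1" "norm z < 1" using \<gamma>(1) by (auto simp: near_def)
      have "near 7 (\<gamma> z w) v" using dset_near[OF \<gamma>(2) \<gamma>1(1) \<delta>] by simp
      then have n: "near X z v" using near_trans[OF \<gamma>(1)] unfolding X_def by blast
      have p: "0 < pw z ^ ?m" "0 < pw (\<gamma> z w) ^ ?m" using \<gamma>1 by (auto simp: pw_pos_iff simp del: power_Suc)
      have "(1 / dset_vol \<delta> (\<gamma> z w)) \<le> 1 / (c * pw (\<gamma> z w) ^ ?m)"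
        using less_le_trans[OF mult_pos_pos[OF c(1) p(2)] c(2)[rule_format, OF \<gamma>1(1)]] c \<gamma>1(1) p
        by (intro divide_left_mono mult_pos_pos) auto
      also have "\<dots> = 1 / c * (1 / pw (\<gamma> z w) ^ ?m)" by simp
      also have "\<dots> \<le> 1 / c * ((4 * (2 * M)) ^ ?m / pw z ^ ?m)"
        using c(1) by (intro mult_left_mono near_inverse_pw_power[OF \<gamma>(1)]) auto
      finally have "K / pw z ^ ?m * H * (1 / dset_vol \<delta> (\<gamma> z w)) \<le> K / pw z ^ ?m * H * (1 / c * ((4 * (2 * M)) ^ ?m / pw z ^ ?m))"
        using K H p by (intro mult_left_mono mult_nonneg_nonneg) auto
      also have "\<dots> = ?D / pw z ^ ?m / pw z ^ ?m" by simp
      finally show ?thesis using True n by (simp add: ennreal_leI del: power_Suc)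
    qed auto
    have "(\<integral>\<^sup>+z. \<integral>\<^sup>+w. (if near M z w \<and> dset \<delta> (\<gamma> z w) (v - \<gamma> z w) then ennreal (K / pw z ^ ?m * H * (1 / dset_vol \<delta> (\<gamma> z w))) else 0) \<partial>dV \<partial>dV) \<le>
        (\<integral>\<^sup>+z. \<integral>\<^sup>+w. (if near X z v then ennreal (?D / pw z ^ ?m / pw z ^ ?m) else 0) * (if near M z w then 1 else 0) \<partial>dV \<partial>dV)"
      by (intro nn_integral_mono pt)
    also have "\<dots> \<le> (\<integral>\<^sup>+z. ennreal (?D * ?V) * (if near X z v then ennreal (1 / pw z ^ ?m) else 0) \<partial>dV)"
    proof (rule nn_integral_mono)
      fix z :: "complex^'n"
      have "(\<integral>\<^sup>+w. (if near X z v then ennreal (?D / pw z ^ ?m / pw z ^ ?m) else 0) * (if near M z w then 1 else 0) \<partial>dV) =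
          (if near X z v then ennreal (?D / pw z ^ ?m / pw z ^ ?m) else 0) * (\<integral>\<^sup>+w. (if near M z w then 1 else 0) \<partial>dV)"
        by (rule nn_integral_cmult) measurable
      also have "\<dots> \<le> ennreal (?D * ?V) * (if near X z v then ennreal (1 / pw z ^ ?m) else 0)"
      proof (cases "near X z v")
        case True
        then have z: "norm z < 1" by (simp add: near_def)
        then have p: "0 < pw z ^ ?m" by (simp add: pw_pos_iff del: power_Suc)
        have "ennreal (?D / pw z ^ ?m / pw z ^ ?m) * (\<integral>\<^sup>+w. (if near M z w then 1 else 0) \<partial>dV) \<le>
            ennreal (?D / pw z ^ ?m / pw z ^ ?m) * ennreal (?V * pw z ^ ?m)"
          by (intro mult_left_mono near_nn_volume z) auto
        also have "\<dots> = ennreal (?D / pw z ^ ?m / pw z ^ ?m * (?V * pw z ^ ?m))"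
          by (rule ennreal_mult[OF divide_nonneg_pos[OF divide_nonneg_pos[OF D p] p] mult_nonneg_nonneg[OF V less_imp_le[OF p]], symmetric])
        also have "?D / pw z ^ ?m / pw z ^ ?m * (?V * pw z ^ ?m) = ?D * ?V * (1 / pw z ^ ?m)"
          using p by (simp del: power_Suc add: less_imp_neq[THEN not_sym] mult_ac)
        also have "ennreal (?D * ?V * (1 / pw z ^ ?m)) = ennreal (?D * ?V) * ennreal (1 / pw z ^ ?m)"
          by (rule ennreal_mult[OF mult_nonneg_nonneg[OF D V]]) (use p in \<open>auto simp del: power_Suc\<close>)
        finally show ?thesis using True by simp
      qed simp
      finally show "(\<integral>\<^sup>+w. (if near X z v then ennreal (?D / pw z ^ ?m / pw z ^ ?m) else 0) * (if near M z w then 1 else 0) \<partial>dV) \<le>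
          ennreal (?D * ?V) * (if near X z v then ennreal (1 / pw z ^ ?m) else 0)" .
    qed
    also have "\<dots> = ennreal (?D * ?V) * (\<integral>\<^sup>+z. (if near X z v then ennreal (1 / pw z ^ ?m) else 0) \<partial>dV)"
      by (rule nn_integral_cmult) measurable
    also have "\<dots> \<le> ennreal (?D * ?V) * ennreal ?W"
      by (intro mult_left_mono near_weight_integral v X) auto
    also have "\<dots> = ennreal (?D * ?V * ?W)"
      by (rule ennreal_mult[OF mult_nonneg_nonneg[OF D V] W, symmetric])
    finally show "(\<integral>\<^sup>+z. \<integral>\<^sup>+w. (if near M z w \<and> dset \<delta> (\<gamma> z w) (v - \<gamma> z w) then ennreal (K / pw z ^ ?m * H * (1 / dset_vol \<delta> (\<gamma> z w))) else 0) \<partial>dV \<partial>dV) \<le> ennreal (?D * ?V * ?W)" .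
  qed
qed

text \<open>With the circle integral of local means in place of the product of values at
  \<open>w\<close> and \<open>z\<close>, the form becomes an integral over \<open>z\<close>,
  \<open>w\<close>, the circle and the averaging point \<open>v\<close>. Keeping \<open>v\<close>
  for last leaves a symbol, bounded by \<open>symbol_kernel_bound\<close>, while
  \<open>near_kernel_total\<close> integrates the pointwise error.\<close>

lemma kernel_approx:
  fixes c :: "complex^'n::finite \<Rightarrow> complex^'n \<Rightarrow> complex"
  assumes c [measurable]: "(\<lambda>(z, w). c z w) \<in> borel_measurable (borel \<Otimes>\<^sub>M borel)"
    and M: "1 \<le> M" and K: "0 \<le> K"
    and bd: "\<And>z w. near M z w \<Longrightarrow> norm (c z w) \<le> K / pw z ^ (CARD('n) + 1)"
    and zero: "\<And>z w. \<not> near M z w \<Longrightarrow> c z w = 0" and \<epsilon>: "0 < \<epsilon>"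
  shows "\<exists>s\<in>Linf. \<forall>f g. norm ((\<integral>z. (\<integral>w. c z w * (bergman_fun f w * cnj (bergman_fun g z)) \<partial>dV) \<partial>dV) -
    (\<integral>z. s z * (bergman_fun f z * cnj (bergman_fun g z)) \<partial>dV)) \<le> \<epsilon> * ((norm f)\<^sup>2 + (norm g)\<^sup>2)"
proof -
  let ?m = "CARD('n) + 1" and ?D = "dV :: (complex^'n) measure"
  interpret V: sigma_finite_measure ?D by (rule sigma_finite_dV)
  interpret circle: finite_measure circle01 by (rule finite_measure_circle01)
  interpret VV: pair_sigma_finite ?D ?D ..
  interpret VVs: sigma_finite_measure "?D \<Otimes>\<^sub>M ?D" by (rule VV.sigma_finite_measure_axioms)
  interpret Q: pair_sigma_finite "?D \<Otimes>\<^sub>M ?D" circle01 ..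
  have c2 [measurable]: "(\<lambda>p. c (fst p) (snd p)) \<in> borel_measurable (borel \<Otimes>\<^sub>M borel)"
    using c by (simp add: case_prod_beta')
  obtain M' C where M': "0 < M'" and C: "0 < C"
    and size0: "\<forall>(f :: 'n bergman) g z w. near M z w \<longrightarrow>
      norm (bergman_fun f w * cnj (bergman_fun g z)) \<le> C * (sqrt (near_avg M' f z) * sqrt (near_avg M' g z))"
    and ap: "\<forall>\<epsilon>>0. \<exists>L \<rho> \<delta>. 0 < \<rho> \<and> 0 < \<delta> \<and> \<delta> \<le> 1 / 2 \<and> (\<forall>z w x. near M z w \<longrightarrow> near (2 * M) z (geodesic (z :: complex^'n) w (of_real \<rho> * unit_exp x))) \<and>
      (\<forall>(f :: 'n::finite bergman) g z w. near M z w \<longrightarrow>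
      norm (bergman_fun f w * cnj (bergman_fun g z) -
        (\<integral>x. fourier_weight L \<rho> x * dset_avg \<delta> f g (geodesic z w (of_real \<rho> * unit_exp x)) \<partial>circle01))
      \<le> \<epsilon> * (sqrt (near_avg M' f z) * sqrt (near_avg M' g z)))"
    using kernel_pointwise[OF M, where 'n='n] by (elim exE conjE) (rule that)
  note size = size0[rule_format]
  define T where "T = K * (4 * M\<^sup>2) ^ ?m * (16 * M' ^ 3) ^ ?m"
  have T: "0 \<le> T" using K M' by (simp add: T_def)
  \<comment> \<open>\<open>T\<close> is what the majorant of the error costs after integration over
    \<open>z\<close> and \<open>w\<close>; adding 1 avoids a division by zero when
    \<open>K = 0\<close>.\<close>
  have "\<epsilon> / (T + 1) > 0" using \<epsilon> T by simp
  from ap[rule_format, OF this] obtain L \<rho> \<delta> where \<rho>: "0 < \<rho>" and \<delta>: "0 < \<delta>" "\<delta> \<le> 1 / 2"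
    and geo0: "\<forall>z w x. near M z w \<longrightarrow> near (2 * M) z (geodesic (z :: complex^'n) w (of_real \<rho> * unit_exp x))"
    and app0: "\<forall>(f :: 'n::finite bergman) g z w. near M z w \<longrightarrow>
      norm (bergman_fun f w * cnj (bergman_fun g z) -
        (\<integral>x. fourier_weight L \<rho> x * dset_avg \<delta> f g (geodesic z w (of_real \<rho> * unit_exp x)) \<partial>circle01))
      \<le> \<epsilon> / (T + 1) * (sqrt (near_avg M' f z) * sqrt (near_avg M' g z))"
    by (elim exE conjE) (rule that)
  note geo = geo0[rule_format] and app = app0[rule_format]
  define H where "H = (\<Sum>m\<le>L. 1 / \<rho> ^ m)"
  have \<delta>1: "\<delta> \<le> 1" using \<delta> by simp
  have H: "0 \<le> H" unfolding H_def using \<rho> by (intro sum_nonneg) auto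
  let ?h = "fourier_weight L \<rho>"
  define \<gamma> where "\<gamma> z w x = geodesic z w (of_real \<rho> * unit_exp x)" for z w :: "complex^'n" and x
  \<comment> \<open>A parameter is \<open>q = ((z, w), x)\<close>. It contributes a constant
    multiple of the indicator of the neighbourhood of \<open>\<gamma> z w x\<close>, so that the
    symbol is a superposition of such indicators.\<close>
  define k where "k q v = (if dset \<delta> (\<gamma> (fst (fst q)) (snd (fst q)) (snd q)) (v - \<gamma> (fst (fst q)) (snd (fst q)) (snd q))
    then c (fst (fst q)) (snd (fst q)) * ?h (snd q) * of_real (1 / dset_vol \<delta> (\<gamma> (fst (fst q)) (snd (fst q)) (snd q))) else 0)"
    for q :: "((complex^'n) \<times> (complex^'n)) \<times> real" and v
  have \<gamma>m [measurable (raw)]: "(\<lambda>x. \<gamma> (a x) (b x) (d x)) \<in> borel_measurable N"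
    if "a \<in> borel_measurable N" "b \<in> borel_measurable N" "d \<in> borel_measurable N" for a b d and N :: "'x measure"
    unfolding \<gamma>_def using that by measurable
  have km: "(\<lambda>(q, v). k q v) \<in> borel_measurable (((?D \<Otimes>\<^sub>M ?D) \<Otimes>\<^sub>M circle01) \<Otimes>\<^sub>M borel)"
    unfolding k_def by measurable
  obtain S where S: "0 \<le> S" and Sb: "\<forall>(\<gamma> :: complex^'n \<Rightarrow> complex^'n \<Rightarrow> complex^'n) v.
    (\<forall>z w. near M z w \<longrightarrow> near (2 * M) z (\<gamma> z w)) \<longrightarrow> norm v < 1 \<longrightarrow>
    (\<integral>\<^sup>+z. \<integral>\<^sup>+w. (if near M z w \<and> dset \<delta> (\<gamma> z w) (v - \<gamma> z w)
      then ennreal (K / pw z ^ ?m * H * (1 / dset_vol \<delta> (\<gamma> z w))) else 0) \<partial>dV \<partial>dV) \<le> ennreal S"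
    using symbol_kernel_bound[OF M K H \<delta>(1) \<delta>1, where 'n='n] by (elim exE conjE) (rule that)
  have kb: "(\<integral>\<^sup>+q. ennreal (norm (k q v)) \<partial>((?D \<Otimes>\<^sub>M ?D) \<Otimes>\<^sub>M circle01)) \<le> ennreal S" if v: "norm v < 1" for v
  proof -
    have k1: "(\<lambda>q. k q v) \<in> borel_measurable ((?D \<Otimes>\<^sub>M ?D) \<Otimes>\<^sub>M circle01)"
      unfolding k_def by measurable
    have "(\<integral>\<^sup>+q. ennreal (norm (k q v)) \<partial>((?D \<Otimes>\<^sub>M ?D) \<Otimes>\<^sub>M circle01)) =
        (\<integral>\<^sup>+x. \<integral>\<^sup>+p. ennreal (norm (k (p, x) v)) \<partial>(?D \<Otimes>\<^sub>M ?D) \<partial>circle01)"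
      using k1 by (intro Q.nn_integral_snd[symmetric]) simp
    also have "\<dots> \<le> (\<integral>\<^sup>+x. ennreal S \<partial>circle01)"
    proof (rule nn_integral_mono)
      fix x :: real
      have "(\<lambda>p. k (p, x) v) \<in> borel_measurable (?D \<Otimes>\<^sub>M ?D)"
        unfolding k_def fst_conv snd_conv by measurable
      then have "(\<integral>\<^sup>+p. ennreal (norm (k (p, x) v)) \<partial>(?D \<Otimes>\<^sub>M ?D)) = (\<integral>\<^sup>+z. \<integral>\<^sup>+w. ennreal (norm (k ((z, w), x) v)) \<partial>dV \<partial>dV)"
        by (intro V.nn_integral_fst[symmetric]) simp
      also have "\<dots> \<le> (\<integral>\<^sup>+z. \<integral>\<^sup>+w. (if near M z w \<and> dset \<delta> (\<gamma> z w x) (v - \<gamma> z w x)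
          then ennreal (K / pw z ^ ?m * H * (1 / dset_vol \<delta> (\<gamma> z w x))) else 0) \<partial>dV \<partial>dV)"
      proof (intro nn_integral_mono)
        fix z w :: "complex^'n"
        show "ennreal (norm (k ((z, w), x) v)) \<le> (if near M z w \<and> dset \<delta> (\<gamma> z w x) (v - \<gamma> z w x)
          then ennreal (K / pw z ^ ?m * H * (1 / dset_vol \<delta> (\<gamma> z w x))) else 0)"
        proof (cases "near M z w \<and> dset \<delta> (\<gamma> z w x) (v - \<gamma> z w x)")
          case True
          then have n: "near M z w" by simp
          have vol: "0 \<le> 1 / dset_vol \<delta> (\<gamma> z w x)" by (simp add: dset_vol_def)
          have p: "0 \<le> K / pw z ^ ?m" using order_trans[OF norm_ge_zero bd[OF n]] .
          have "norm (k ((z, w), x) v) = norm (c z w) * norm (?h x) * (1 / dset_vol \<delta> (\<gamma> z w x))"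
            using True vol by (simp add: k_def norm_mult norm_divide)
          also have "\<dots> \<le> K / pw z ^ ?m * H * (1 / dset_vol \<delta> (\<gamma> z w x))"
            using bd[OF n] norm_fourier_weight_le[OF \<rho>, of L x] vol p H unfolding H_def[symmetric]
            by (intro mult_right_mono mult_mono) auto
          finally show ?thesis using True by (simp add: ennreal_leI)
        next
          case False
          then show ?thesis using zero[of z w] by (auto simp: k_def)
        qed
      qed
      also have "\<dots> \<le> ennreal S"
        using geo v by (intro Sb[rule_format]) (auto simp: \<gamma>_def)
      finally show "(\<integral>\<^sup>+p. ennreal (norm (k (p, x) v)) \<partial>(?D \<Otimes>\<^sub>M ?D)) \<le> ennreal S" .
    qed
    also have "\<dots> = ennreal S" by (simp add: emeasure_circle01_UNIV)
    finally show ?thesis .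
  qed
  define s where "s v = (\<integral>q. k q v \<partial>((?D \<Otimes>\<^sub>M ?D) \<Otimes>\<^sub>M circle01))" for v
  note sy = integrated_symbol[OF Q.sigma_finite_measure_axioms km _ S, folded s_def]
  have sym1: "(\<lambda>v. s v) \<in> Linf" by (rule sy(1)) (rule kb)
  have sym2: "integrable ((?D \<Otimes>\<^sub>M ?D) \<Otimes>\<^sub>M circle01) (\<lambda>q. \<integral>v. k q v * \<phi> v \<partial>dV)" if "integrable dV \<phi>" for \<phi>
    by (rule sy(2)[OF _ that]) (rule kb)
  have sym3: "(\<integral>v. s v * \<phi> v \<partial>dV) = (\<integral>q. (\<integral>v. k q v * \<phi> v \<partial>dV) \<partial>((?D \<Otimes>\<^sub>M ?D) \<Otimes>\<^sub>M circle01))" if "integrable dV \<phi>" for \<phi>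
    by (rule sy(3)[OF _ that]) (rule kb)
  show ?thesis
  proof (intro bexI[of _ s] allI)
    show "s \<in> Linf" using sym1 .
    fix f g :: "'n bergman"
    let ?N = "\<lambda>z. sqrt (near_avg M' f z) * sqrt (near_avg M' g z)"
    let ?c = "\<lambda>p. c (fst p) (snd p)"
    define t where "t p = (\<integral>x. ?h x * dset_avg \<delta> f g (\<gamma> (fst p) (snd p) x) \<partial>circle01)" for p
    have ifg: "integrable dV (\<lambda>z. bergman_fun f z * cnj (bergman_fun g z))" by (intro L2_integrable bergman_L2)
    have inner: "(\<integral>v. k q v * (bergman_fun f v * cnj (bergman_fun g v)) \<partial>dV) =
        ?c (fst q) * (?h (snd q) * dset_avg \<delta> f g (\<gamma> (fst (fst q)) (snd (fst q)) (snd q)))" for q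
    proof -
      let ?g = "\<gamma> (fst (fst q)) (snd (fst q)) (snd q)"
      have "(\<integral>v. k q v * (bergman_fun f v * cnj (bergman_fun g v)) \<partial>dV) =
          (\<integral>v. ?c (fst q) * ?h (snd q) * (if dset \<delta> ?g (v - ?g) then of_real (1 / dset_vol \<delta> ?g) * (bergman_fun f v * cnj (bergman_fun g v)) else 0) \<partial>dV)"
        by (intro Bochner_Integration.integral_cong) (auto simp: k_def)
      also have "\<dots> = ?c (fst q) * ?h (snd q) * dset_avg \<delta> f g ?g"
        unfolding dset_avg_def by (rule integral_mult_right_zero)
      finally show ?thesis by (simp only: mult.assoc)
    qed
    have iQ: "integrable ((?D \<Otimes>\<^sub>M ?D) \<Otimes>\<^sub>M circle01) (\<lambda>q. ?c (fst q) * (?h (snd q) * dset_avg \<delta> f g (\<gamma> (fst (fst q)) (snd (fst q)) (snd q))))"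
      using sym2[OF ifg] unfolding inner .
    have "(\<integral>v. s v * (bergman_fun f v * cnj (bergman_fun g v)) \<partial>dV) =
        (\<integral>q. ?c (fst q) * (?h (snd q) * dset_avg \<delta> f g (\<gamma> (fst (fst q)) (snd (fst q)) (snd q))) \<partial>((?D \<Otimes>\<^sub>M ?D) \<Otimes>\<^sub>M circle01))"
      using sym3[OF ifg] unfolding inner .
    also have "\<dots> = (\<integral>p. (\<integral>x. ?c p * (?h x * dset_avg \<delta> f g (\<gamma> (fst p) (snd p) x)) \<partial>circle01) \<partial>(?D \<Otimes>\<^sub>M ?D))"
      using Q.integral_fst'[OF iQ] by simp
    also have "\<dots> = (\<integral>p. ?c p * t p \<partial>(?D \<Otimes>\<^sub>M ?D))" by (simp add: t_def)
    finally have eq1: "(\<integral>v. s v * (bergman_fun f v * cnj (bergman_fun g v)) \<partial>dV) = (\<integral>p. ?c p * t p \<partial>(?D \<Otimes>\<^sub>M ?D))" .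
    have it: "integrable (?D \<Otimes>\<^sub>M ?D) (\<lambda>p. ?c p * t p)"
      using Q.integrable_fst'[OF iQ] by (simp add: t_def)
    \<comment> \<open>A common majorant: \<open>C * b\<close> bounds the original integrand and
      \<open>\<epsilon> / (T + 1) * b\<close> the pointwise error.\<close>
    define b where "b p = (if near M (fst p) (snd p) then K / pw (fst p) ^ ?m else 0) * ?N (fst p)" for p :: "(complex^'n) \<times> (complex^'n)"
    have bm [measurable]: "b \<in> borel_measurable (?D \<Otimes>\<^sub>M ?D)" unfolding b_def by measurable
    have b0: "AE p in ?D \<Otimes>\<^sub>M ?D. 0 \<le> b p"
    proof (rule AE_I2)
      fix p :: "(complex^'n) \<times> (complex^'n)"
      show "0 \<le> b p"
        by (cases "near M (fst p) (snd p)") (use K near_avg_nonneg[of "fst p" M'] in \<open>auto simp: b_def near_def pw_pos_iff[symmetric] intro!: mult_nonneg_nonneg divide_nonneg_nonneg less_imp_le\<close>)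
    qed
    have "(\<integral>\<^sup>+p. ennreal (b p) \<partial>(?D \<Otimes>\<^sub>M ?D)) = (\<integral>\<^sup>+z. \<integral>\<^sup>+w. ennreal (b (z, w)) \<partial>dV \<partial>dV)"
      by (intro V.nn_integral_fst[symmetric]) simp
    also have "\<dots> \<le> ennreal (T * ((norm f)\<^sup>2 + (norm g)\<^sup>2))"
      using near_kernel_total[OF M' K, of M f g] unfolding b_def T_def fst_conv snd_conv .
    finally have bt: "(\<integral>\<^sup>+p. ennreal (b p) \<partial>(?D \<Otimes>\<^sub>M ?D)) \<le> ennreal (T * ((norm f)\<^sup>2 + (norm g)\<^sup>2))" .
    then have ib: "integrable (?D \<Otimes>\<^sub>M ?D) b"
      using b0 by (intro integrableI_nonneg) (auto intro: le_less_trans)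
    have bi: "(\<integral>p. b p \<partial>(?D \<Otimes>\<^sub>M ?D)) \<le> T * ((norm f)\<^sup>2 + (norm g)\<^sup>2)"
      using bt nn_integral_eq_integral[OF ib b0] T by (simp add: ennreal_le_iff)
    have n0: "near_avg M' f z \<ge> 0" "near_avg M' g z \<ge> 0" if "near M z w" for z w
      using that by (auto intro: near_avg_nonneg simp: near_def)
    have pt1: "norm (?c p * (bergman_fun f (snd p) * cnj (bergman_fun g (fst p)))) \<le> C * b p" for p
    proof (cases "near M (fst p) (snd p)")
      case True
      have "norm (?c p * (bergman_fun f (snd p) * cnj (bergman_fun g (fst p)))) \<le> K / pw (fst p) ^ ?m * (C * ?N (fst p))"
        unfolding norm_mult[of "?c p"] using True size[OF True] bd[OF True] order_trans[OF norm_ge_zero bd[OF True]]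
        by (intro mult_mono) auto
      then show ?thesis using True by (simp add: b_def mult_ac del: power_Suc)
    next
      case False then show ?thesis by (simp add: zero b_def)
    qed
    have pt2: "norm (?c p * (bergman_fun f (snd p) * cnj (bergman_fun g (fst p))) - ?c p * t p) \<le> \<epsilon> / (T + 1) * b p" for p
    proof (cases "near M (fst p) (snd p)")
      case True
      have "norm (?c p * (bergman_fun f (snd p) * cnj (bergman_fun g (fst p)) - t p)) \<le> K / pw (fst p) ^ ?m * (\<epsilon> / (T + 1) * ?N (fst p))"
        unfolding norm_mult[of "?c p"] using True app[OF True, of f g] bd[OF True] order_trans[OF norm_ge_zero bd[OF True]]
        by (intro mult_mono) (auto simp: t_def \<gamma>_def)
      then show ?thesis using True by (simp add: b_def mult_ac right_diff_distrib del: power_Suc)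
    next
      case False then show ?thesis by (simp add: zero b_def)
    qed
    have ic: "integrable (?D \<Otimes>\<^sub>M ?D) (\<lambda>p. ?c p * (bergman_fun f (snd p) * cnj (bergman_fun g (fst p))))"
    proof (rule Bochner_Integration.integrable_bound)
      show "integrable (?D \<Otimes>\<^sub>M ?D) (\<lambda>p. C * b p)" using ib by simp
      show "(\<lambda>p. ?c p * (bergman_fun f (snd p) * cnj (bergman_fun g (fst p)))) \<in> borel_measurable (?D \<Otimes>\<^sub>M ?D)" by measurable
      show "AE p in ?D \<Otimes>\<^sub>M ?D. norm (?c p * (bergman_fun f (snd p) * cnj (bergman_fun g (fst p)))) \<le> norm (C * b p)"
        using pt1 by (auto intro!: AE_I2 order_trans[OF _ abs_ge_self])
    qed
    have eq2: "(\<integral>z. (\<integral>w. c z w * (bergman_fun f w * cnj (bergman_fun g z)) \<partial>dV) \<partial>dV) =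
        (\<integral>p. ?c p * (bergman_fun f (snd p) * cnj (bergman_fun g (fst p))) \<partial>(?D \<Otimes>\<^sub>M ?D))"
      using VV.integral_fst'[OF ic] by simp
    have "norm ((\<integral>z. (\<integral>w. c z w * (bergman_fun f w * cnj (bergman_fun g z)) \<partial>dV) \<partial>dV) - (\<integral>z. s z * (bergman_fun f z * cnj (bergman_fun g z)) \<partial>dV)) =
        norm (\<integral>p. ?c p * (bergman_fun f (snd p) * cnj (bergman_fun g (fst p))) - ?c p * t p \<partial>(?D \<Otimes>\<^sub>M ?D))"
      unfolding eq1 eq2 by (simp only: Bochner_Integration.integral_diff[OF ic it])
    also have "\<dots> \<le> (\<integral>p. \<epsilon> / (T + 1) * b p \<partial>(?D \<Otimes>\<^sub>M ?D))"
      by (rule order_trans[OF integral_norm_bound integral_mono[OF integrable_norm[OF Bochner_Integration.integrable_diff[OF ic it]] integrable_mult_right[OF ib] pt2]])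
    also have "\<dots> \<le> \<epsilon> / (T + 1) * (T * ((norm f)\<^sup>2 + (norm g)\<^sup>2))"
      using bi \<epsilon> T by (simp only: integral_mult_right_zero) (intro mult_left_mono, auto)
    also have "\<dots> = \<epsilon> * (T / (T + 1)) * ((norm f)\<^sup>2 + (norm g)\<^sup>2)" by simp
    also have "\<dots> \<le> \<epsilon> * 1 * ((norm f)\<^sup>2 + (norm g)\<^sup>2)"
      using \<epsilon> T by (intro mult_right_mono mult_left_mono) auto
    finally show "norm ((\<integral>z. (\<integral>w. c z w * (bergman_fun f w * cnj (bergman_fun g z)) \<partial>dV) \<partial>dV) - (\<integral>z. s z * (bergman_fun f z * cnj (bergman_fun g z)) \<partial>dV))
        \<le> \<epsilon> * ((norm f)\<^sup>2 + (norm g)\<^sup>2)" by simp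
  qed
qed

section \<open>The closure of the Toeplitz operators is an algebra\<close>

lemma LinfI: "a \<in> borel_measurable borel \<Longrightarrow> (\<And>z. norm (a z) \<le> A) \<Longrightarrow> a \<in> Linf"
  by (auto simp: Linf_def cong: measurable_cong_sets)

lemma toeplitz_cong_AE:
  assumes "a \<in> Linf" "b \<in> Linf" "AE z in dV. a z = b z" shows "toeplitz a = toeplitz b"
proof (rule blinfun_eqI, rule cinner_eqI)
  fix f h
  have [measurable]: "a \<in> borel_measurable borel" "b \<in> borel_measurable borel"
    using assms by (auto intro: Linf_measurable)
  show "cinner (blinfun_apply (toeplitz a) f) h = cinner (blinfun_apply (toeplitz b) f) h"
    unfolding cinner_toeplitz[OF assms(1)] cinner_toeplitz[OF assms(2)]
    by (rule integral_cong_AE) (use assms(3) in \<open>auto\<close>)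
qed

lemma Linf_bounded_representative:
  assumes a: "a \<in> Linf"
  shows "\<exists>a'\<in>Linf. toeplitz a' = toeplitz a \<and> (\<exists>A\<ge>0. \<forall>z. norm (a' z) \<le> A)"
proof -
  obtain A where A: "0 \<le> A" "AE z in dV. norm (a z) \<le> A" using a by (rule Linf_boundE)
  have [measurable]: "a \<in> borel_measurable borel" using a by (rule Linf_measurable)
  let ?a = "\<lambda>z. if norm (a z) \<le> A then a z else 0"
  have "?a \<in> Linf" by (rule LinfI[of _ A]) (use A(1) in auto)
  moreover have "toeplitz ?a = toeplitz a"
    by (rule toeplitz_cong_AE[OF \<open>?a \<in> Linf\<close> a]) (use A(2) in eventually_elim, simp)
  ultimately show ?thesis using A(1) by (intro bexI[of _ ?a]) auto
qed

text \<open>The cut-off \<open>M\<close> is fixed first, so that the gain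
  \<open>M powr (- 1 / 4)\<close> makes the far part small. For the near part with this
  \<open>M\<close>, \<open>kernel_approx\<close> then reaches any accuracy, however its constants
  depend on \<open>M\<close>.\<close>

lemma toeplitz_mult_closure_bounded:
  fixes a b :: "complex^'n::finite \<Rightarrow> complex"
  assumes a: "a \<in> Linf" "\<And>z. norm (a z) \<le> A" and b: "b \<in> Linf" "\<And>z. norm (b z) \<le> B"
  shows "toeplitz a o\<^sub>L toeplitz b \<in> closure (toeplitz ` Linf)"
proof -
  let ?D = "dV :: (complex^'n) measure"
  interpret V: sigma_finite_measure ?D by (rule sigma_finite_dV)
  interpret VV: pair_sigma_finite ?D ?D ..
  have [measurable]: "a \<in> borel_measurable borel" "b \<in> borel_measurable borel"
    using a b by (auto intro: Linf_measurable)
  have A: "0 \<le> A" and B: "0 \<le> B" using order_trans[OF norm_ge_zero a(2)] order_trans[OF norm_ge_zero b(2)] by auto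
  obtain C where C: "0 < C" "\<forall>(u :: complex^'n \<Rightarrow> complex) v M. 0 < M \<longrightarrow> u \<in> L2 \<longrightarrow> v \<in> L2 \<longrightarrow>
    (\<integral>\<^sup>+z. \<integral>\<^sup>+w. ennreal (far_kernel M z w * norm (u w) * norm (v z)) \<partial>dV \<partial>dV) \<le>
      ennreal (C * M powr (- 1 / 4) * ((\<integral>w. (norm (u w))\<^sup>2 \<partial>dV) + (\<integral>z. (norm (v z))\<^sup>2 \<partial>dV)))"
    using far_kernel_bilinear[where 'n='n] by auto
  have "\<exists>T\<in>toeplitz ` Linf. dist T (toeplitz a o\<^sub>L toeplitz b) < e" if e: "0 < e" for e
  proof -
    \<comment> \<open>\<open>M = x powr 4\<close> turns the gain into \<open>1 / x\<close>, and
      \<open>x\<close> makes the far part cost at most \<open>e / 8\<close>; the summand 1 ensures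
      \<open>M \<ge> 1\<close>.\<close>
    define x where "x = 8 * (A * B * C) / e + 1"
    have x: "1 \<le> x" using A B C(1) e by (simp add: x_def)
    have xe: "A * B * C / x \<le> e / 8"
    proof -
      have "8 * (A * B * C) \<le> x * e" using e by (simp add: x_def field_simps)
      then show ?thesis using x by (simp add: field_simps)
    qed
    define M where "M = x powr 4"
    have M: "1 \<le> M" using x by (simp add: M_def ge_one_powr_ge_zero)
    have Mx: "M powr (- 1 / 4) = 1 / x" using x unfolding M_def powr_powr by (simp add: powr_minus_divide)
    let ?c = "\<lambda>z w. if near M z w then a z * b w * bker z w else 0"
    have e8: "0 < e / 8" using e by simp
    have "\<exists>s\<in>Linf. \<forall>f g. norm ((\<integral>z. (\<integral>w. ?c z w * (bergman_fun f w * cnj (bergman_fun g z)) \<partial>dV) \<partial>dV) -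
        (\<integral>z. s z * (bergman_fun f z * cnj (bergman_fun g z)) \<partial>dV)) \<le> e / 8 * ((norm f)\<^sup>2 + (norm g)\<^sup>2)"
    proof (rule kernel_approx[OF _ M _ _ _ e8])
      show "(\<lambda>(z, w). ?c z w) \<in> borel_measurable (borel \<Otimes>\<^sub>M borel)" by measurable
      show "0 \<le> A * B * 2 ^ (CARD('n) + 1)" using A B by simp
      fix z w :: "complex^'n" assume n: "near M z w"
      then have zw: "norm z < 1" "norm w < 1" by (auto simp: near_def)
      then have p: "0 < pw z" by (simp add: pw_pos_iff)
      have h: "pw z / 2 \<le> norm (1 - hip z w)" using pw_le_one_minus_hip(1)[OF zw] by simp
      have "1 / norm (1 - hip z w) ^ (CARD('n) + 1) \<le> 1 / (pw z / 2) ^ (CARD('n) + 1)"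
        using h p by (intro divide_left_mono power_mono mult_pos_pos zero_less_power) auto
      then have "norm (bker z w) \<le> 2 ^ (CARD('n) + 1) / pw z ^ (CARD('n) + 1)"
        by (simp add: norm_bker power_divide)
      then have "norm (a z) * norm (b w) * norm (bker z w) \<le> A * B * (2 ^ (CARD('n) + 1) / pw z ^ (CARD('n) + 1))"
        using a(2)[of z] b(2)[of w] A B by (intro mult_mono) auto
      then show "norm (?c z w) \<le> A * B * 2 ^ (CARD('n) + 1) / pw z ^ (CARD('n) + 1)"
        using n by (simp add: norm_mult)
    qed auto
    then obtain s where s: "s \<in> Linf" and se: "\<And>f g. norm ((\<integral>z. (\<integral>w. ?c z w * (bergman_fun f w * cnj (bergman_fun g z)) \<partial>dV) \<partial>dV) -
        (\<integral>z. s z * (bergman_fun f z * cnj (bergman_fun g z)) \<partial>dV)) \<le> e / 8 * ((norm f)\<^sup>2 + (norm g)\<^sup>2)"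
      by (elim bexE) (rule that, assumption, erule spec2)
    \<comment> \<open>The near and the far part each err by \<open>e / 8\<close>; passing from the
      form to the operator doubles the sum, leaving \<open>e / 2\<close>.\<close>
    have "norm ((toeplitz a o\<^sub>L toeplitz b) - toeplitz s) \<le> 2 * (e / 4)"
    proof (rule blinfun_norm_le_cinner)
      show "0 \<le> e / 4" using e by simp
      fix f g :: "'n bergman"
      let ?E = "\<lambda>p. a (fst p) * b (snd p) * bker (fst p) (snd p) * (bergman_fun f (snd p) * cnj (bergman_fun g (fst p)))"
      let ?F = "\<lambda>p. if near M (fst p) (snd p) then ?E p else 0"
      let ?R = "\<lambda>p. if near M (fst p) (snd p) then 0 else ?E p"
      have "(\<lambda>z. cnj (a z)) \<in> Linf" by (rule LinfI[of _ A]) (use a(2) in auto)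
      then have "integrable (?D \<Otimes>\<^sub>M ?D) (\<lambda>(z, w). (b w * bergman_fun f w) * bker z w * cnj (cnj (a z) * bergman_fun g z))"
        by (intro bker_sesquilinear_integrable Linf_mult_L2 b bergman_L2)
      then have iE: "integrable (?D \<Otimes>\<^sub>M ?D) ?E" by (simp add: case_prod_beta' mult_ac)
      have iF: "integrable (?D \<Otimes>\<^sub>M ?D) ?F"
        by (rule Bochner_Integration.integrable_bound[OF iE]) (auto intro!: AE_I2)
      have iR: "integrable (?D \<Otimes>\<^sub>M ?D) ?R"
        by (rule Bochner_Integration.integrable_bound[OF iE]) (auto intro!: AE_I2)
      have "cinner (blinfun_apply (toeplitz a o\<^sub>L toeplitz b) f) g = (\<integral>z. (\<integral>w. ?E (z, w) \<partial>dV) \<partial>dV)"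
        unfolding cinner_toeplitz_mult[OF a(1) b(1)] by (simp add: mult.assoc)
      also have "\<dots> = (\<integral>p. ?E p \<partial>(?D \<Otimes>\<^sub>M ?D))" by (rule VV.integral_fst'[OF iE])
      also have "\<dots> = (\<integral>p. ?F p + ?R p \<partial>(?D \<Otimes>\<^sub>M ?D))" by (intro Bochner_Integration.integral_cong) auto
      also have "\<dots> = (\<integral>p. ?F p \<partial>(?D \<Otimes>\<^sub>M ?D)) + (\<integral>p. ?R p \<partial>(?D \<Otimes>\<^sub>M ?D))"
        by (rule Bochner_Integration.integral_add[OF iF iR])
      also have "(\<integral>p. ?F p \<partial>(?D \<Otimes>\<^sub>M ?D)) = (\<integral>z. (\<integral>w. ?c z w * (bergman_fun f w * cnj (bergman_fun g z)) \<partial>dV) \<partial>dV)"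
        unfolding VV.integral_fst'[OF iF, symmetric] by (intro Bochner_Integration.integral_cong) auto
      finally have e1: "cinner (blinfun_apply (toeplitz a o\<^sub>L toeplitz b) f) g =
          (\<integral>z. (\<integral>w. ?c z w * (bergman_fun f w * cnj (bergman_fun g z)) \<partial>dV) \<partial>dV) + (\<integral>p. ?R p \<partial>(?D \<Otimes>\<^sub>M ?D))" .
      have e2: "cinner (blinfun_apply (toeplitz s) f) g = (\<integral>z. s z * (bergman_fun f z * cnj (bergman_fun g z)) \<partial>dV)"
        unfolding cinner_toeplitz[OF s] by (simp only: mult.assoc)
      have eq: "cinner (blinfun_apply ((toeplitz a o\<^sub>L toeplitz b) - toeplitz s) f) g =
          ((\<integral>z. (\<integral>w. ?c z w * (bergman_fun f w * cnj (bergman_fun g z)) \<partial>dV) \<partial>dV) -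
            (\<integral>z. s z * (bergman_fun f z * cnj (bergman_fun g z)) \<partial>dV)) + (\<integral>p. ?R p \<partial>(?D \<Otimes>\<^sub>M ?D))"
        unfolding blinfun.diff_left cinner_diff_left e1 e2 by simp
      have "ennreal (norm (\<integral>p. ?R p \<partial>(?D \<Otimes>\<^sub>M ?D))) \<le> (\<integral>\<^sup>+p. ennreal (norm (?R p)) \<partial>(?D \<Otimes>\<^sub>M ?D))"
        by (rule integral_norm_bound_ennreal[OF iR])
      also have "\<dots> = (\<integral>\<^sup>+z. \<integral>\<^sup>+w. ennreal (norm (?R (z, w))) \<partial>dV \<partial>dV)"
        using iR by (intro V.nn_integral_fst[symmetric]) auto
      also have "\<dots> \<le> (\<integral>\<^sup>+z. \<integral>\<^sup>+w. ennreal (A * B) * ennreal (far_kernel M z w * norm (bergman_fun f w) * norm (bergman_fun g z)) \<partial>dV \<partial>dV)"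
      proof (intro nn_integral_mono)
        fix z w :: "complex^'n"
        have "norm (a z) * norm (b w) * (norm (bker z w) * (norm (bergman_fun f w) * norm (bergman_fun g z))) \<le>
            A * B * (norm (bker z w) * (norm (bergman_fun f w) * norm (bergman_fun g z)))"
          using a(2)[of z] b(2)[of w] A by (intro mult_right_mono mult_mono) auto
        then show "ennreal (norm (?R (z, w))) \<le> ennreal (A * B) * ennreal (far_kernel M z w * norm (bergman_fun f w) * norm (bergman_fun g z))"
          using A B by (auto simp: far_kernel_def norm_mult mult.assoc simp flip: ennreal_mult intro!: ennreal_leI)
      qed
      also have "\<dots> = ennreal (A * B) * (\<integral>\<^sup>+z. \<integral>\<^sup>+w. ennreal (far_kernel M z w * norm (bergman_fun f w) * norm (bergman_fun g z)) \<partial>dV \<partial>dV)"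
        by (simp add: nn_integral_cmult)
      also have "\<dots> \<le> ennreal (A * B) * ennreal (C * M powr (- 1 / 4) * ((norm f)\<^sup>2 + (norm g)\<^sup>2))"
        using C(2)[rule_format, of M "bergman_fun f" "bergman_fun g"] M
        by (intro mult_left_mono) (auto simp: norm_bergman_sq bergman_L2)
      also have "\<dots> = ennreal (A * B * (C * M powr (- 1 / 4) * ((norm f)\<^sup>2 + (norm g)\<^sup>2)))"
        using A B C(1) by (intro ennreal_mult[symmetric]) auto
      also have "A * B * (C * M powr (- 1 / 4) * ((norm f)\<^sup>2 + (norm g)\<^sup>2)) = A * B * C / x * ((norm f)\<^sup>2 + (norm g)\<^sup>2)"
        unfolding Mx by simp
      also have "ennreal \<dots> \<le> ennreal (e / 8 * ((norm f)\<^sup>2 + (norm g)\<^sup>2))"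
        using xe by (intro ennreal_leI mult_right_mono) auto
      finally have R: "norm (\<integral>p. ?R p \<partial>(?D \<Otimes>\<^sub>M ?D)) \<le> e / 8 * ((norm f)\<^sup>2 + (norm g)\<^sup>2)"
        by (subst (asm) ennreal_le_iff) (use e in auto)
      have "e / 8 * ((norm f)\<^sup>2 + (norm g)\<^sup>2) + e / 8 * ((norm f)\<^sup>2 + (norm g)\<^sup>2) = e / 4 * ((norm f)\<^sup>2 + (norm g)\<^sup>2)"
        by simp
      then show "norm (cinner (blinfun_apply ((toeplitz a o\<^sub>L toeplitz b) - toeplitz s) f) g) \<le> e / 4 * ((norm f)\<^sup>2 + (norm g)\<^sup>2)"
        unfolding eq using norm_triangle_mono[OF se[of f g] R] by (simp only:)
    qed
    then have "dist (toeplitz s) (toeplitz a o\<^sub>L toeplitz b) < e"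
      using e by (simp add: dist_norm norm_minus_commute)
    then show ?thesis using s by blast
  qed
  then show ?thesis by (simp add: closure_approachable)
qed

text \<open>A theorem of Xia.\<close>

lemma toeplitz_mult_closure:
  assumes "a \<in> Linf" "b \<in> Linf"
  shows "toeplitz a o\<^sub>L toeplitz b \<in> closure (toeplitz ` Linf)"
proof -
  obtain a' A where a': "a' \<in> Linf" "toeplitz a' = toeplitz a" "\<And>z. norm (a' z) \<le> A"
    using Linf_bounded_representative[OF assms(1)] by auto
  obtain b' B where b': "b' \<in> Linf" "toeplitz b' = toeplitz b" "\<And>z. norm (b' z) \<le> B"
    using Linf_bounded_representative[OF assms(2)] by auto
  show ?thesis using toeplitz_mult_closure_bounded[OF a'(1,3) b'(1,3)] unfolding a'(2) b'(2) .
qed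

section \<open>Operations on symbols and the closed algebra\<close>

lemma Linf_add:
  assumes a: "a \<in> Linf" and b: "b \<in> Linf" shows "(\<lambda>z. a z + b z) \<in> Linf"
proof -
  obtain A where A: "AE z in dV. norm (a z) \<le> A" using a by (rule Linf_boundE)
  obtain B where B: "AE z in dV. norm (b z) \<le> B" using b by (rule Linf_boundE)
  note [measurable] = Linf_measurable[OF a] Linf_measurable[OF b]
  have "AE z in dV. norm (a z + b z) \<le> A + B" using A B by eventually_elim (rule norm_triangle_mono)
  then show ?thesis by (auto simp: Linf_def cong: measurable_cong_sets)
qed

lemma Linf_scale:
  assumes a: "a \<in> Linf" shows "(\<lambda>z. c * a z) \<in> Linf"
proof -
  obtain A where A: "AE z in dV. norm (a z) \<le> A" using a by (rule Linf_boundE)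
  note [measurable] = Linf_measurable[OF a]
  have "AE z in dV. norm (c * a z) \<le> norm c * A" using A by eventually_elim (simp add: norm_mult mult_left_mono)
  then show ?thesis by (auto simp: Linf_def cong: measurable_cong_sets)
qed

lemma toeplitz_add: 
  assumes "a \<in> Linf" "b \<in> Linf" shows "toeplitz (\<lambda>z. a z + b z) = toeplitz a + toeplitz b"
  by (rule blinfun_eqI, rule cinner_eqI)
    (simp add: blinfun.add_left cinner_add_left cinner_toeplitz assms Linf_add distrib_right Bochner_Integration.integral_add toeplitz_integrable)

lemma toeplitz_scale:
  assumes "a \<in> Linf" shows "toeplitz (\<lambda>z. c * a z) = cscale_op c (toeplitz a)"
  by (rule blinfun_eqI, rule cinner_eqI)
    (simp add: cscale_op_apply cinner_cscale_left cinner_toeplitz assms Linf_scale mult.assoc)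

lemma bounded_linear_cscale_op: "bounded_linear (cscale_op c :: _ \<Rightarrow> 'n::finite bergman \<Rightarrow>\<^sub>L 'n bergman)"
proof (rule bounded_linear_intro[where K = "norm c"])
  fix S T :: "'n bergman \<Rightarrow>\<^sub>L 'n bergman" and r :: real
  note l = bounded_linear.linear[OF bounded_linear_cscale[of c]]
  show "cscale_op c (S + T) = cscale_op c S + cscale_op c T"
    by (rule blinfun_eqI) (simp add: cscale_op_apply blinfun.add_left linear_add[OF l])
  show "cscale_op c (r *\<^sub>R S) = r *\<^sub>R cscale_op c S"
    by (rule blinfun_eqI) (simp add: cscale_op_apply blinfun.scaleR_left linear_scale[OF l])
  show "norm (cscale_op c S) \<le> norm S * norm c"
    by (rule norm_blinfun_bound) (auto simp: cscale_op_apply norm_cscale intro: order_trans[OF mult_left_mono[OF norm_blinfun]] simp: mult_ac)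
qed

lemma closed_bounded_ops: "closed (bounded_ops :: ('n::finite bergman \<Rightarrow>\<^sub>L 'n bergman) set)"
proof -
  have "closed {S :: 'n bergman \<Rightarrow>\<^sub>L 'n bergman. blinfun_apply S (cscale c f) = cscale c (blinfun_apply S f)}" for c and f :: "'n bergman"
    by (intro closed_Collect_eq bounded_linear.continuous_on[OF bounded_linear_cscale] continuous_intros)
  then have "closed (\<Inter>c. \<Inter>f. {S :: 'n bergman \<Rightarrow>\<^sub>L 'n bergman. blinfun_apply S (cscale c f) = cscale c (blinfun_apply S f)})"
    by (intro closed_INT ballI)
  also have "\<dots> = bounded_ops" by (auto simp: bounded_ops_def)
  finally show ?thesis .
qed

text \<open>Sums and scalar multiples of Toeplitz operators are Toeplitz operators by linearity in
  the symbol, and their products lie in the closure by \<open>toeplitz_mult_closure\<close>;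
  continuity of the operations extends this to the closure.\<close>

lemma closed_subalgebra_closure_toeplitz:
  "closed_subalgebra (closure (toeplitz ` Linf) :: ('n::finite bergman \<Rightarrow>\<^sub>L 'n bergman) set)"
  unfolding closed_subalgebra_def
proof (intro conjI ballI allI)
  let ?B = "closure (toeplitz ` Linf) :: ('n bergman \<Rightarrow>\<^sub>L 'n bergman) set"
  show "?B \<subseteq> bounded_ops"
    by (rule closure_minimal[OF _ closed_bounded_ops]) (auto intro: toeplitz_bounded_op)
  show "closed ?B" by simp
  have z: "(\<lambda>z. 0) \<in> Linf" by (rule LinfI[of _ 0]) auto
  have "toeplitz (\<lambda>z. 0) = cscale_op 0 (toeplitz (\<lambda>z. 0) :: 'n bergman \<Rightarrow>\<^sub>L 'n bergman)"
    using toeplitz_scale[OF z, of 0] by simp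
  also have "\<dots> = 0" by (rule blinfun_eqI, rule cinner_eqI) (simp add: cscale_op_apply cinner_cscale_left, simp add: cinner_def zero_bergman.rep_eq)
  finally have "0 = (toeplitz (\<lambda>z. 0) :: 'n bergman \<Rightarrow>\<^sub>L 'n bergman)" by simp
  then have "(0 :: 'n bergman \<Rightarrow>\<^sub>L 'n bergman) \<in> toeplitz ` Linf" using z by (rule image_eqI)
  then show "0 \<in> ?B" by (rule subsetD[OF closure_subset])
  fix S assume S: "S \<in> ?B"
  show "cscale_op c S \<in> ?B" for c
  proof -
    have "cscale_op c ` ?B \<subseteq> ?B"
    proof (rule image_closure_subset)
      show "continuous_on ?B (cscale_op c)" by (rule bounded_linear.continuous_on[OF bounded_linear_cscale_op]) (rule continuous_on_id)
      show "cscale_op c ` toeplitz ` Linf \<subseteq> ?B"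
        by (rule order_trans[OF _ closure_subset]) (auto simp: toeplitz_scale[symmetric] intro!: imageI Linf_scale)
    qed simp
    from subsetD[OF this imageI[OF S]] show ?thesis .
  qed
  fix T assume T: "T \<in> ?B"
  have ST: "(S, T) \<in> closure (toeplitz ` Linf \<times> toeplitz ` Linf)" using S T by (simp add: closure_Times)
  have "(\<lambda>(S, T). S + T) ` closure (toeplitz ` Linf \<times> toeplitz ` Linf) \<subseteq> ?B"
  proof (rule image_closure_subset)
    show "continuous_on (closure (toeplitz ` Linf \<times> toeplitz ` Linf)) (\<lambda>(S :: 'n bergman \<Rightarrow>\<^sub>L 'n bergman, T). S + T)"
      unfolding case_prod_beta by (intro continuous_intros)
    show "(\<lambda>(S, T). S + T) ` (toeplitz ` Linf \<times> toeplitz ` Linf) \<subseteq> ?B"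
      by (rule order_trans[OF _ closure_subset]) (auto simp: toeplitz_add[symmetric] intro!: imageI Linf_add)
  qed simp
  from subsetD[OF this imageI[OF ST]] show "S + T \<in> ?B" by simp
  have "(\<lambda>(S, T). S o\<^sub>L T) ` closure (toeplitz ` Linf \<times> toeplitz ` Linf) \<subseteq> ?B"
  proof (rule image_closure_subset)
    show "continuous_on (closure (toeplitz ` Linf \<times> toeplitz ` Linf)) (\<lambda>(S :: 'n bergman \<Rightarrow>\<^sub>L 'n bergman, T :: 'n bergman \<Rightarrow>\<^sub>L 'n bergman). S o\<^sub>L T)"
      unfolding case_prod_beta by (intro bounded_bilinear.continuous_on[OF bounded_bilinear_blinfun_compose] continuous_intros)
    show "(\<lambda>(S, T). S o\<^sub>L T) ` (toeplitz ` Linf \<times> toeplitz ` Linf) \<subseteq> ?B"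
      by (auto intro: toeplitz_mult_closure)
  qed simp
  from subsetD[OF this imageI[OF ST]] show "S o\<^sub>L T \<in> ?B" by simp
qed

lemma toeplitz_algebra_eq_closure: "toeplitz_algebra = closure (toeplitz ` Linf)"
proof
  show "toeplitz_algebra \<subseteq> closure (toeplitz ` Linf)"
    unfolding toeplitz_algebra_def
    by (rule hull_minimal) (rule closure_subset, rule closed_subalgebra_closure_toeplitz)
  show "closure (toeplitz ` Linf) \<subseteq> toeplitz_algebra"
    unfolding toeplitz_algebra_def hull_def
    by (rule Inter_greatest, rule closure_minimal) (auto simp: closed_subalgebra_def)
qed

section \<open>Invariant symbols\<close>

lemma dV_integral_unitary:
  fixes f :: "complex^'n::finite \<Rightarrow> 'b::{banach, second_countable_topology}"
  assumes "unitary B" "f \<in> borel_measurable borel"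
  shows "integrable dV (\<lambda>w. f (B *v w)) \<longleftrightarrow> integrable dV f" "(\<integral>w. f (B *v w) \<partial>dV) = (\<integral>w. f w \<partial>dV)"
  using dV_integral_isometry[OF linear_matrix_complex norm_unitary[OF assms(1)] assms(2)] by auto

lemma L2_unitary:
  assumes B: "unitary B" and f: "f \<in> L2" shows "(\<lambda>z. f (B *v z)) \<in> L2"
proof -
  note [measurable] = L2_measurable[OF f]
  have "integrable dV (\<lambda>z. (norm (f (B *v z)))\<^sup>2)"
    using dV_integral_unitary(1)[OF B, of "\<lambda>z. (norm (f z))\<^sup>2"] f by (simp add: L2_def)
  then show ?thesis by (simp add: L2_def cong: measurable_cong_sets)
qed

lemma Linf_unitary:
  assumes B: "unitary B" and a: "a \<in> Linf" shows "(\<lambda>z. a (B *v z)) \<in> Linf"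
proof -
  note [measurable] = Linf_measurable[OF a]
  obtain A where A: "AE z in dV. norm (a z) \<le> A" using a by (rule Linf_boundE)
  have "AE z in distr dV dV ((*v) B). norm (a z) \<le> A" unfolding dV_distr_unitary[OF B] by (rule A)
  then have "AE z in dV. norm (a (B *v z)) \<le> A"
    by (subst (asm) AE_distr_iff) (auto cong: measurable_cong_sets)
  then show ?thesis by (auto simp: Linf_def cong: measurable_cong_sets)
qed

lemma holomorphic_Cn_on_unitary:
  fixes B :: "complex^'n^'n::finite"
  assumes B: "unitary B" and f: "f holomorphic_Cn_on ball 0 1"
  shows "(\<lambda>z. f (B *v z)) holomorphic_Cn_on ball 0 1"
  unfolding holomorphic_Cn_on_def
proof
  fix z :: "complex^'n" assume "z \<in> ball 0 1"
  then have "B *v z \<in> ball 0 1" using norm_unitary[OF B] by simp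
  then obtain D where D: "(f has_derivative D) (at (B *v z))" "\<And>c v. D (c *s v) = c * D v"
    using f unfolding holomorphic_Cn_on_def by blast
  have "((\<lambda>z. B *v z) has_derivative (\<lambda>z. B *v z)) (at z)"
    using linear_matrix_complex[of B] by (intro bounded_linear_imp_has_derivative) (simp add: linear_conv_bounded_linear)
  from has_derivative_compose[OF this D(1)]
  have "((\<lambda>z. f (B *v z)) has_derivative (\<lambda>v. D (B *v v))) (at z)" .
  moreover have "D (B *v (c *s v)) = c * D (B *v v)" for c v
    by (simp add: vector_scalar_commute D(2))
  ultimately show "\<exists>D. ((\<lambda>z. f (B *v z)) has_derivative D) (at z) \<and> (\<forall>c v. D (c *s v) = c * D v)"
    by blast
qed

lemma rep_pi_apply:
  fixes A :: "complex^'n^'n::finite"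
  assumes A: "unitary A"
  shows "bergman_fun (blinfun_apply (rep_pi A) f) z = bergman_fun f (mstar A *v z)"
proof -
  note B = unitary_mstar[OF A]
  have fn: "bergman_fun (Bergman (\<lambda>z. bergman_fun f (matrix_inv A *v z))) = (\<lambda>z. bergman_fun f (mstar A *v z))" for f :: "'n bergman"
    unfolding unitary_inv[OF A]
    by (rule Bergman_inverse)
      (auto simp: norm_unitary[OF B] intro!: holomorphic_Cn_on_unitary[OF B] L2_unitary[OF B] bergman_fun_holomorphic bergman_L2 bergman_fun_outside)
  have "bounded_linear (\<lambda>f :: 'n bergman. Bergman (\<lambda>z. bergman_fun f (matrix_inv A *v z)))"
  proof (rule bounded_linear_intro[where K = 1])
    fix f g :: "'n bergman" and r :: real
    show "Bergman (\<lambda>z. bergman_fun (f + g) (matrix_inv A *v z)) =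
        Bergman (\<lambda>z. bergman_fun f (matrix_inv A *v z)) + Bergman (\<lambda>z. bergman_fun g (matrix_inv A *v z))"
      by (rule bergman_fun_inject[THEN iffD1], simp only: fn) (simp only: plus_bergman.rep_eq fn)
    show "Bergman (\<lambda>z. bergman_fun (r *\<^sub>R f) (matrix_inv A *v z)) = r *\<^sub>R Bergman (\<lambda>z. bergman_fun f (matrix_inv A *v z))"
      by (rule bergman_fun_inject[THEN iffD1], simp only: fn scaleR_bergman_def) (simp only: cscale.rep_eq fn)
    have "(norm (Bergman (\<lambda>z. bergman_fun f (matrix_inv A *v z))))\<^sup>2 = (norm f)\<^sup>2"
      unfolding norm_bergman_sq fn by (rule dV_integral_unitary(2)[OF B]) measurable
    then show "norm (Bergman (\<lambda>z. bergman_fun f (matrix_inv A *v z))) \<le> norm f * 1" by simp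
  qed
  then show ?thesis unfolding rep_pi_def by (simp add: bounded_linear_Blinfun_apply fn)
qed

lemma norm_rep_pi_le:
  assumes A: "unitary A" shows "norm (rep_pi A) \<le> 1"
proof (rule norm_blinfun_bound)
  fix f
  have "(norm (blinfun_apply (rep_pi A) f))\<^sup>2 = (norm f)\<^sup>2"
    unfolding norm_bergman_sq rep_pi_apply[OF A] by (rule dV_integral_unitary(2)[OF unitary_mstar[OF A]]) measurable
  then show "norm (blinfun_apply (rep_pi A) f) \<le> 1 * norm f" by simp
qed simp

lemma cinner_rep_pi:
  assumes A: "unitary A"
  shows "cinner (blinfun_apply (rep_pi A) f) g = cinner f (blinfun_apply (rep_pi (mstar A)) g)"
proof -
  have "cinner f (blinfun_apply (rep_pi (mstar A)) g) = (\<integral>z. bergman_fun f z * cnj (bergman_fun g (A *v z)) \<partial>dV)"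
    by (simp add: cinner_def rep_pi_apply[OF unitary_mstar[OF A]])
  also have "\<dots> = (\<integral>z. bergman_fun f (mstar A *v z) * cnj (bergman_fun g (A *v (mstar A *v z))) \<partial>dV)"
    by (rule dV_integral_unitary(2)[OF unitary_mstar[OF A], symmetric]) measurable
  also have "\<dots> = cinner (blinfun_apply (rep_pi A) f) g"
    by (simp add: cinner_def rep_pi_apply[OF A] unitary_apply[OF A])
  finally show ?thesis by simp
qed

lemma adj_rep_pi:
  assumes A: "unitary A" shows "adj (rep_pi A) = rep_pi (mstar A)"
  unfolding adj_def
proof (rule the_equality)
  show "\<forall>f g. cinner (blinfun_apply (rep_pi A) f) g = cinner f (blinfun_apply (rep_pi (mstar A)) g)"
    using cinner_rep_pi[OF A] by blast
  fix R assume R: "\<forall>f g. cinner (blinfun_apply (rep_pi A) f) g = cinner f (blinfun_apply R g)"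
  show "R = rep_pi (mstar A)"
  proof (rule blinfun_eqI, rule cinner_eqI)
    fix g h
    have "cinner h (blinfun_apply R g) = cinner h (blinfun_apply (rep_pi (mstar A)) g)"
      using R cinner_rep_pi[OF A, of h g] by simp
    then show "cinner (blinfun_apply R g) h = cinner (blinfun_apply (rep_pi (mstar A)) g) h"
      by (metis cinner_commute)
  qed
qed

lemma rep_pi_mstar_compose:
  assumes A: "unitary A" shows "rep_pi (mstar A) o\<^sub>L rep_pi A = id_blinfun"
  by (rule blinfun_eqI, rule bergman_fun_inject[THEN iffD1], rule ext)
    (simp add: rep_pi_apply[OF A] rep_pi_apply[OF unitary_mstar[OF A]] unitary_apply[OF A])

lemma rep_pi_bounded_op: "unitary A \<Longrightarrow> rep_pi A \<in> bounded_ops"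
  unfolding bounded_ops_def
  by (auto intro!: bergman_fun_inject[THEN iffD1] simp: rep_pi_apply cscale.rep_eq fun_eq_iff)

section \<open>Conjugation of operators by the group\<close>

definition conj_pi :: "complex^'n^'n \<Rightarrow> ('n::finite bergman \<Rightarrow>\<^sub>L 'n bergman) \<Rightarrow> ('n bergman \<Rightarrow>\<^sub>L 'n bergman)" where
  "conj_pi A S = rep_pi A o\<^sub>L S o\<^sub>L adj (rep_pi A)"

lemma bounded_linear_conj_pi: "bounded_linear (conj_pi A)"
  unfolding conj_pi_def[abs_def]
  by (rule bounded_linear_compose[OF bounded_bilinear.bounded_linear_left[OF bounded_bilinear_blinfun_compose]
    bounded_bilinear.bounded_linear_right[OF bounded_bilinear_blinfun_compose]])

lemma norm_conj_pi_le:
  assumes A: "unitary A" shows "norm (conj_pi A S) \<le> norm S"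
proof -
  have "norm (conj_pi A S) \<le> norm (rep_pi A o\<^sub>L S) * norm (rep_pi (mstar A))"
    unfolding conj_pi_def adj_rep_pi[OF A] by (rule norm_blinfun_compose)
  also have "\<dots> \<le> (norm (rep_pi A) * norm S) * norm (rep_pi (mstar A))"
    by (intro mult_right_mono norm_blinfun_compose) auto
  also have "\<dots> \<le> (1 * norm S) * 1"
    using norm_rep_pi_le[OF A] norm_rep_pi_le[OF unitary_mstar[OF A]] by (intro mult_mono) auto
  finally show ?thesis by simp
qed

lemma conj_pi_compose:
  assumes A: "unitary A" shows "conj_pi A (S o\<^sub>L T) = conj_pi A S o\<^sub>L conj_pi A T"
proof (rule blinfun_eqI)
  fix f
  have "blinfun_apply (rep_pi (mstar A)) (blinfun_apply (rep_pi A) g) = g" for g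
    using arg_cong[OF rep_pi_mstar_compose[OF A], of "\<lambda>R. blinfun_apply R g"] by simp
  then show "blinfun_apply (conj_pi A (S o\<^sub>L T)) f = blinfun_apply (conj_pi A S o\<^sub>L conj_pi A T) f"
    by (simp add: conj_pi_def adj_rep_pi[OF A])
qed

lemma conj_pi_cscale:
  assumes A: "unitary A" shows "conj_pi A (cscale_op c S) = cscale_op c (conj_pi A S)"
  using rep_pi_bounded_op[OF A] by (intro blinfun_eqI) (simp add: conj_pi_def cscale_op_apply bounded_ops_def)

text \<open>A change of variables in the form moves the matrix from the functions to the symbol, so
  that the group acts on symbols.\<close>

lemma conj_pi_toeplitz:
  assumes A: "unitary A" and a: "a \<in> Linf"
  shows "conj_pi A (toeplitz a) = toeplitz (\<lambda>z. a (mstar A *v z))"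
proof (rule blinfun_eqI, rule cinner_eqI)
  fix f g
  note [measurable] = Linf_measurable[OF a]
  note B = unitary_mstar[OF A]
  have "cinner (blinfun_apply (conj_pi A (toeplitz a)) f) g =
      cinner (blinfun_apply (toeplitz a) (blinfun_apply (rep_pi (mstar A)) f)) (blinfun_apply (rep_pi (mstar A)) g)"
    by (simp add: conj_pi_def adj_rep_pi[OF A] cinner_rep_pi[OF A])
  also have "\<dots> = (\<integral>z. a z * bergman_fun f (A *v z) * cnj (bergman_fun g (A *v z)) \<partial>dV)"
    by (simp add: cinner_toeplitz[OF a] rep_pi_apply[OF B])
  also have "\<dots> = (\<integral>z. a (mstar A *v z) * bergman_fun f (A *v (mstar A *v z)) * cnj (bergman_fun g (A *v (mstar A *v z))) \<partial>dV)"
    by (rule dV_integral_unitary(2)[OF B, symmetric]) measurable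
  also have "\<dots> = cinner (blinfun_apply (toeplitz (\<lambda>z. a (mstar A *v z))) f) g"
    by (simp add: cinner_toeplitz[OF Linf_unitary[OF B a]] unitary_apply[OF A])
  finally show "cinner (blinfun_apply (conj_pi A (toeplitz a)) f) g = cinner (blinfun_apply (toeplitz (\<lambda>z. a (mstar A *v z))) f) g" .
qed

section \<open>Symbols of least norm\<close>

lemma norm_diff_sq_parallelogram:
  "(norm (x - y))\<^sup>2 = 2 * (norm x)\<^sup>2 + 2 * (norm y)\<^sup>2 - 4 * (norm ((x + y) / 2))\<^sup>2" for x y :: complex
  by (simp add: norm_divide power_divide cmod_power2) (simp add: power2_eq_square algebra_simps)

text \<open>By \<open>t \<le> 2 ^ n * t\<^sup>2 + (1 / 2) ^ n\<close> the bound of order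
  \<open>(1 / 4) ^ n\<close> for the square integrals gives one of order \<open>(1 / 2) ^ n\<close>
  for the integrals of the increments, whose sum is then finite almost everywhere. This yields a
  pointwise limit, as wanted for symbols that are functions rather than classes.\<close>

lemma AE_convergent_of_geometric_L2:
  fixes a :: "nat \<Rightarrow> complex^'n::finite \<Rightarrow> complex"
  assumes [measurable]: "\<And>n. a n \<in> borel_measurable borel"
    and int: "\<And>n. integrable dV (\<lambda>z. (norm (a (Suc n) z - a n z))\<^sup>2)"
    and bd: "\<And>n. (\<integral>z. (norm (a (Suc n) z - a n z))\<^sup>2 \<partial>dV) \<le> C * (1 / 4) ^ n"
  shows "AE z in dV. convergent (\<lambda>n. a n z)"
proof -
  interpret finite_measure "dV :: (complex^'n) measure" by (rule finite_measure_dV)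
  let ?u = "\<lambda>n z. a (Suc n) z - a n z"
  have C: "0 \<le> C" using order_trans[OF _ bd[of 0]] by simp
  have one: "(\<integral>\<^sup>+z. ennreal (norm (?u n z)) \<partial>dV) \<le> ennreal ((C + 1) * (1 / 2) ^ n)" for n
  proof -
    have m: "measure (dV :: (complex^'n) measure) UNIV = 1" by (simp add: measure_def emeasure_dV_UNIV)
    have i: "integrable dV (\<lambda>z. 2 ^ n * (norm (?u n z))\<^sup>2 + (1 / 2) ^ n)" using int[of n] by simp
    have amgm: "t \<le> s * t\<^sup>2 + 1 / s" if "0 < s" for t s :: real
    proof -
      have "0 \<le> (s * t - 1 / 2)\<^sup>2" by simp
      then have "s * t \<le> s * (s * t\<^sup>2) + 1" by (simp add: power2_eq_square algebra_simps)
      then have "s * t \<le> s * (s * t\<^sup>2 + 1 / s)" using that by (simp add: distrib_left)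
      then show ?thesis using that by (simp only: mult_le_cancel_left_pos)
    qed
    have "(\<integral>\<^sup>+z. ennreal (norm (?u n z)) \<partial>dV) \<le> (\<integral>\<^sup>+z. ennreal (2 ^ n * (norm (?u n z))\<^sup>2 + (1 / 2) ^ n) \<partial>dV)"
      using amgm[of "2 ^ n"] by (intro nn_integral_mono ennreal_leI) (simp add: power_one_over)
    also have "\<dots> = ennreal (\<integral>z. 2 ^ n * (norm (?u n z))\<^sup>2 + (1 / 2) ^ n \<partial>dV)"
      by (rule nn_integral_eq_integral[OF i]) auto
    also have "(\<integral>z. 2 ^ n * (norm (?u n z))\<^sup>2 + (1 / 2) ^ n \<partial>dV) = 2 ^ n * (\<integral>z. (norm (?u n z))\<^sup>2 \<partial>dV) + (1 / 2) ^ n"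
      using int[of n] m by (subst Bochner_Integration.integral_add) auto
    also have "ennreal \<dots> \<le> ennreal (2 ^ n * (C * (1 / 4) ^ n) + (1 / 2) ^ n)"
      using bd[of n] by (intro ennreal_leI add_right_mono mult_left_mono) auto
    also have "2 ^ n * (C * (1 / 4) ^ n) + (1 / 2) ^ n = (C + 1) * (1 / 2 :: real) ^ n"
    proof -
      have "2 ^ n * (1 / 4 :: real) ^ n = (1 / 2) ^ n" by (simp only: power_mult_distrib[symmetric]) simp
      moreover have "2 ^ n * (C * (1 / 4) ^ n) = C * (2 ^ n * (1 / 4) ^ n)" by (rule mult.left_commute)
      ultimately show ?thesis by (simp only: distrib_right mult_1_left)
    qed
    finally show ?thesis .
  qed
  have "(\<integral>\<^sup>+z. (\<Sum>n. ennreal (norm (?u n z))) \<partial>dV) = (\<Sum>n. \<integral>\<^sup>+z. ennreal (norm (?u n z)) \<partial>dV)"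
    by (rule nn_integral_suminf) measurable
  also have "\<dots> \<le> (\<Sum>n. ennreal ((C + 1) * (1 / 2) ^ n))"
    by (intro suminf_le one) auto
  also have "\<dots> = ennreal (\<Sum>n. (C + 1) * (1 / 2) ^ n)"
    using C by (intro suminf_ennreal2) (auto intro!: summable_mult summable_geometric)
  finally have "(\<integral>\<^sup>+z. (\<Sum>n. ennreal (norm (?u n z))) \<partial>dV) \<noteq> \<infinity>" by (auto simp: top_unique)
  then have "AE z in dV. (\<Sum>n. ennreal (norm (?u n z))) \<noteq> \<infinity>"
    by (intro nn_integral_PInf_AE) measurable
  then show ?thesis
  proof eventually_elim
    fix z assume "(\<Sum>n. ennreal (norm (?u n z))) \<noteq> \<infinity>"
    then have "summable (\<lambda>n. norm (?u n z))" by (intro summable_suminf_not_top) auto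
    then have "convergent (\<lambda>n. \<Sum>i<n. ?u i z)"
      unfolding summable_iff_convergent[symmetric] by (rule summable_norm_cancel)
    then have "convergent (\<lambda>n. a n z - a 0 z)"
      unfolding sum_lessThan_telescope[of "\<lambda>n. a n z"] .
    then have "convergent (\<lambda>n. (a n z - a 0 z) + a 0 z)" by (intro convergent_add convergent_const)
    then show "convergent (\<lambda>n. a n z)" by simp
  qed
qed

lemma norm_le_cinner:
  fixes S :: "'n::finite bergman \<Rightarrow>\<^sub>L 'n bergman"
  assumes e: "0 \<le> e" and bd: "\<And>f g. norm (cinner (blinfun_apply S f) g) \<le> e * norm f * norm g"
  shows "norm S \<le> e"
proof (rule norm_blinfun_bound[OF e])
  fix f
  have "norm (blinfun_apply S f) * norm (blinfun_apply S f) = norm (cinner (blinfun_apply S f) (blinfun_apply S f))"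
    unfolding cinner_self norm_bergman_sq[symmetric] by (simp add: norm_mult power2_eq_square)
  also have "\<dots> \<le> (e * norm f) * norm (blinfun_apply S f)" by (rule bd)
  finally show "norm (blinfun_apply S f) \<le> e * norm f"
    using e by (cases "blinfun_apply S f = 0") auto
qed

lemma cinner_toeplitz_limit:
  fixes a :: "nat \<Rightarrow> complex^'n::finite \<Rightarrow> complex"
  assumes a: "\<And>n. a n \<in> Linf" "\<And>n z. norm (a n z) \<le> A" and b: "b \<in> Linf"
    and lim: "AE z in dV. (\<lambda>n. a n z) \<longlonglongrightarrow> b z"
  shows "(\<lambda>n. cinner (blinfun_apply (toeplitz (a n)) f) g) \<longlonglongrightarrow> cinner (blinfun_apply (toeplitz b) f) g"
    "(\<lambda>n. \<integral>z. (norm (a n z))\<^sup>2 \<partial>dV) \<longlonglongrightarrow> (\<integral>z. (norm (b z))\<^sup>2 \<partial>dV)"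
proof -
  interpret finite_measure "dV :: (complex^'n) measure" by (rule finite_measure_dV)
  have [measurable]: "a n \<in> borel_measurable borel" "b \<in> borel_measurable borel" for n
    using a(1) b by (auto intro: Linf_measurable)
  have i: "integrable dV (\<lambda>z. A * norm (bergman_fun f z * cnj (bergman_fun g z)))"
    by (intro integrable_mult_right integrable_norm L2_integrable bergman_L2)
  show "(\<lambda>n. cinner (blinfun_apply (toeplitz (a n)) f) g) \<longlonglongrightarrow> cinner (blinfun_apply (toeplitz b) f) g"
    unfolding cinner_toeplitz[OF a(1)] cinner_toeplitz[OF b]
  proof (rule integral_dominated_convergence[OF _ _ i])
    show "AE z in dV. (\<lambda>n. a n z * bergman_fun f z * cnj (bergman_fun g z)) \<longlonglongrightarrow> b z * bergman_fun f z * cnj (bergman_fun g z)"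
      using lim by eventually_elim (intro tendsto_intros)
    show "AE z in dV. norm (a n z * bergman_fun f z * cnj (bergman_fun g z)) \<le> A * norm (bergman_fun f z * cnj (bergman_fun g z))" for n
      using a(2)[of n] by (auto simp: norm_mult mult.assoc intro!: AE_I2 mult_right_mono)
  qed measurable
  show "(\<lambda>n. \<integral>z. (norm (a n z))\<^sup>2 \<partial>dV) \<longlonglongrightarrow> (\<integral>z. (norm (b z))\<^sup>2 \<partial>dV)"
  proof (rule integral_dominated_convergence[of _ _ _ "\<lambda>_. A\<^sup>2"])
    show "AE z in dV. (\<lambda>n. (norm (a n z))\<^sup>2) \<longlonglongrightarrow> (norm (b z))\<^sup>2"
      using lim by eventually_elim (intro tendsto_intros)
    show "AE z in dV. norm ((norm (a n z))\<^sup>2) \<le> A\<^sup>2" for n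
      using a(2)[of n] by (auto intro!: AE_I2 power_mono)
  qed (simp_all cong: measurable_cong_sets)
qed

text \<open>Instead of integrating over the group, one takes the symbol of least \<open>L\<^sup>2\<close> norm among the
  symbols of a given size whose Toeplitz operators are close to \<open>S\<close>: this convex set is
  invariant under the group, hence so is its unique element of least norm.\<close>

lemma invariant_symbol:
  fixes S :: "'n::finite bergman \<Rightarrow>\<^sub>L 'n bergman"
  assumes a0: "a0 \<in> Linf" and e: "norm (toeplitz a0 - S) \<le> e"
    and U: "\<And>A. A \<in> U \<Longrightarrow> unitary A" and inv: "\<And>A. A \<in> U \<Longrightarrow> conj_pi A S = S"
  shows "\<exists>b\<in>Linf. norm (toeplitz b - S) \<le> e \<and> (\<forall>A\<in>U. conj_pi A (toeplitz b) = toeplitz b)"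
proof -
  let ?D = "dV :: (complex^'n) measure"
  interpret finite_measure ?D by (rule finite_measure_dV)
  obtain a1 A where a1: "a1 \<in> Linf" "toeplitz a1 = toeplitz a0" and A: "0 \<le> A" "\<And>z. norm (a1 z) \<le> A"
    using Linf_bounded_representative[OF a0] by auto
  \<comment> \<open>The pointwise bound \<open>A\<close> provides the majorant for dominated
    convergence and passes to limits of symbols.\<close>
  define K where "K = {a \<in> Linf. (\<forall>z. norm (a z) \<le> A) \<and> norm (toeplitz a - S) \<le> e}"
  define q where "q a = (\<integral>z. (norm (a z))\<^sup>2 \<partial>?D)" for a :: "complex^'n \<Rightarrow> complex"
  have a1K: "a1 \<in> K" using a1 A(2) e by (simp add: K_def)
  have e0: "0 \<le> e" using order_trans[OF norm_ge_zero e] .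
  have Km: "a \<in> borel_measurable borel" if "a \<in> K" for a using that by (auto simp: K_def intro: Linf_measurable)
  have int: "integrable dV (\<lambda>z. (norm (a z))\<^sup>2)" if "a \<in> K" for a
  proof (rule integrable_const_bound[of _ "A\<^sup>2"])
    show "AE z in dV. norm ((norm (a z))\<^sup>2) \<le> A\<^sup>2" using that by (auto simp: K_def intro!: AE_I2 power_mono)
  qed (use Km[OF that] in measurable)
  have q0: "0 \<le> q a" for a by (simp add: q_def)
  define d where "d = Inf (q ` K)"
  have bdd: "bdd_below (q ` K)" by (rule bdd_belowI[of _ 0]) (auto simp: q0)
  have dle: "d \<le> q a" if "a \<in> K" for a unfolding d_def using that by (intro cInf_lower bdd) auto
  have mid: "(\<lambda>z. (a z + b z) / 2) \<in> K" if a: "a \<in> K" and b: "b \<in> K" for a b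
  proof -
    have ab: "a \<in> Linf" "b \<in> Linf" using a b by (auto simp: K_def)
    have L: "(\<lambda>z. (1 / 2) * (a z + b z)) \<in> Linf" by (intro Linf_scale Linf_add ab)
    have "norm ((a z + b z) / 2) \<le> A" for z
      using norm_triangle_ineq[of "a z" "b z"] a b unfolding K_def norm_divide by (auto dest!: spec[of _ z])
    moreover have "norm (toeplitz (\<lambda>z. (1 / 2) * (a z + b z)) - S) \<le> e"
    proof -
      have "toeplitz (\<lambda>z. (1 / 2) * (a z + b z)) = (1 / 2) *\<^sub>R (toeplitz a + toeplitz b)"
        unfolding toeplitz_scale[OF Linf_add[OF ab]] toeplitz_add[OF ab]
        by (rule blinfun_eqI) (simp add: cscale_op_apply blinfun.scaleR_left scaleR_bergman_def)
      then have "toeplitz (\<lambda>z. (1 / 2) * (a z + b z)) - S = (1 / 2) *\<^sub>R ((toeplitz a - S) + (toeplitz b - S))"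
        by (simp add: algebra_simps flip: scaleR_2)
      also have "norm \<dots> = (1 / 2) * norm ((toeplitz a - S) + (toeplitz b - S))" by simp
      also have "\<dots> \<le> (1 / 2) * (e + e)"
        using a b by (intro mult_left_mono norm_triangle_mono) (auto simp: K_def)
      finally show ?thesis by simp
    qed
    ultimately show ?thesis using L by (simp add: K_def)
  qed
  \<comment> \<open>The midpoint lies in \<open>K\<close>, so the parallelogram law bounds the
    distance of two symbols by their excess over the infimum. This makes the minimising sequence
    converge and the minimiser unique up to null sets.\<close>
  have idiff: "integrable dV (\<lambda>z. (norm (a z - b z))\<^sup>2)" and qdiff: "(\<integral>z. (norm (a z - b z))\<^sup>2 \<partial>dV) \<le> 2 * (q a - d) + 2 * (q b - d)"
    if a: "a \<in> K" and b: "b \<in> K" for a b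
  proof -
    note i = int[OF a] int[OF b] int[OF mid[OF a b]]
    show "integrable dV (\<lambda>z. (norm (a z - b z))\<^sup>2)" unfolding norm_diff_sq_parallelogram using i by simp
    have "(\<integral>z. (norm (a z - b z))\<^sup>2 \<partial>dV) = 2 * q a + 2 * q b - 4 * q (\<lambda>z. (a z + b z) / 2)"
      unfolding norm_diff_sq_parallelogram q_def using i by (simp del: norm_divide_numeral)
    also have "\<dots> \<le> 2 * (q a - d) + 2 * (q b - d)" using dle[OF mid[OF a b]] by simp
    finally show "(\<integral>z. (norm (a z - b z))\<^sup>2 \<partial>dV) \<le> 2 * (q a - d) + 2 * (q b - d)" .
  qed
  have "\<exists>a\<in>K. q a < d + (1 / 4) ^ n" for n :: nat
  proof -
    have "Inf (q ` K) < d + (1 / 4) ^ n" by (simp add: d_def)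
    then show ?thesis using a1K bdd by (subst (asm) cInf_less_iff) auto
  qed
  then obtain a where a: "\<And>n :: nat. a n \<in> K" and qa: "\<And>n. q (a n) < d + (1 / 4) ^ n" by metis
  note [measurable] = Km[OF a]
  have conv: "AE z in ?D. convergent (\<lambda>n. a n z)"
  proof (rule AE_convergent_of_geometric_L2[where C = 4])
    show "integrable dV (\<lambda>z. (norm (a (Suc n) z - a n z))\<^sup>2)" for n by (rule idiff[OF a a])
    show "(\<integral>z. (norm (a (Suc n) z - a n z))\<^sup>2 \<partial>dV) \<le> 4 * (1 / 4) ^ n" for n
    proof -
      have "(1 / 4 :: real) ^ Suc n \<le> (1 / 4) ^ n" by (rule power_decreasing) auto
      moreover have "I \<le> 2 * (u - d) + 2 * (v - d) \<Longrightarrow> u < d + x \<Longrightarrow> v < d + y \<Longrightarrow> x \<le> y \<Longrightarrow> I \<le> 4 * y" for I u v x y :: real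
        by argo
      ultimately show ?thesis using qdiff[OF a a, of "Suc n" n] qa[of "Suc n"] qa[of n] by blast
    qed
  qed measurable
  \<comment> \<open>Limits of modulus above \<open>A\<close> are replaced by 0, so that
    \<open>b\<close> is bounded everywhere; on the null set without convergence its value is
    arbitrary within this bound.\<close>
  define b where "b z = (if norm (lim (\<lambda>n. a n z)) \<le> A then lim (\<lambda>n. a n z) else 0)" for z
  have [measurable]: "b \<in> borel_measurable borel" unfolding b_def by measurable
  have bA: "norm (b z) \<le> A" for z using A(1) by (simp add: b_def)
  have bL: "b \<in> Linf" by (rule LinfI[OF _ bA]) measurable
  have aL: "a n \<in> Linf" and aA: "norm (a n z) \<le> A" and aS: "norm (toeplitz (a n) - S) \<le> e" for n z
    using a[of n] by (auto simp: K_def)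
  have lim: "AE z in dV. (\<lambda>n. a n z) \<longlonglongrightarrow> b z"
    using conv
  proof eventually_elim
    fix z assume "convergent (\<lambda>n. a n z)"
    then have l: "(\<lambda>n. a n z) \<longlonglongrightarrow> lim (\<lambda>n. a n z)" by (simp add: convergent_LIMSEQ_iff)
    moreover have "norm (lim (\<lambda>n. a n z)) \<le> A"
      by (rule LIMSEQ_le_const2[OF tendsto_norm[OF l]]) (use aA in auto)
    ultimately show "(\<lambda>n. a n z) \<longlonglongrightarrow> b z" by (simp add: b_def)
  qed
  note L = cinner_toeplitz_limit[OF aL aA bL lim]
  have bS: "norm (toeplitz b - S) \<le> e"
  proof (rule norm_le_cinner[OF e0])
    fix f g :: "'n bergman"
    have "(\<lambda>n. norm (cinner (blinfun_apply (toeplitz (a n)) f) g - cinner (blinfun_apply S f) g))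
        \<longlonglongrightarrow> norm (cinner (blinfun_apply (toeplitz b) f) g - cinner (blinfun_apply S f) g)"
      by (intro tendsto_intros L(1))
    moreover have "norm (cinner (blinfun_apply (toeplitz (a n)) f) g - cinner (blinfun_apply S f) g) \<le> e * norm f * norm g" for n
    proof -
      have "norm (cinner (blinfun_apply (toeplitz (a n) - S) f) g) \<le> norm (blinfun_apply (toeplitz (a n) - S) f) * norm g"
        by (rule norm_cinner_le)
      also have "\<dots> \<le> (norm (toeplitz (a n) - S) * norm f) * norm g"
        by (intro mult_right_mono norm_blinfun) auto
      also have "\<dots> \<le> e * norm f * norm g" using aS[of n] by (intro mult_right_mono) auto
      finally show ?thesis by (simp add: blinfun.diff_left cinner_diff_left)
    qed
    ultimately have "norm (cinner (blinfun_apply (toeplitz b) f) g - cinner (blinfun_apply S f) g) \<le> e * norm f * norm g"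
      by (intro LIMSEQ_le_const2) auto
    then show "norm (cinner (blinfun_apply (toeplitz b - S) f) g) \<le> e * norm f * norm g"
      by (simp add: blinfun.diff_left cinner_diff_left)
  qed
  have bK: "b \<in> K" using bL bA bS by (simp add: K_def)
  have qb: "q b = d"
  proof (rule antisym[OF _ dle[OF bK]])
    have "(\<lambda>n. d + (1 / 4) ^ n) \<longlonglongrightarrow> d + 0" by (intro tendsto_intros LIMSEQ_power_zero) simp
    then show "q b \<le> d"
      using L(2) qa unfolding q_def[symmetric] by (intro LIMSEQ_le[of "\<lambda>n. q (a n)" _ "\<lambda>n. d + (1 / 4) ^ n"]) (auto intro: less_imp_le)
  qed
  have "conj_pi C (toeplitz b) = toeplitz b" if C: "C \<in> U" for C
  proof -
    note u = U[OF C] and B = unitary_mstar[OF U[OF C]]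
    let ?b = "\<lambda>z. b (mstar C *v z)"
    have bL': "?b \<in> Linf" by (rule Linf_unitary[OF B bL])
    have t: "conj_pi C (toeplitz b) = toeplitz ?b" by (rule conj_pi_toeplitz[OF u bL])
    \<comment> \<open>Conjugation fixes \<open>S\<close> and does not increase norms, so the rotated
      symbol stays in \<open>K\<close>. Having the same L^2 norm, it is a second minimiser and
      agrees with \<open>b\<close> almost everywhere.\<close>
    have "toeplitz ?b - S = conj_pi C (toeplitz b - S)"
      using bounded_linear.linear[OF bounded_linear_conj_pi, of C] by (simp add: linear_diff t inv[OF C])
    then have "norm (toeplitz ?b - S) \<le> e" using order_trans[OF norm_conj_pi_le[OF u] bS] by simp
    then have b'K: "?b \<in> K" using bL' bA by (simp add: K_def)
    have "q ?b = q b" unfolding q_def by (rule dV_integral_unitary(2)[OF B]) measurable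
    then have "(\<integral>z. (norm (?b z - b z))\<^sup>2 \<partial>dV) \<le> 0" using qdiff[OF b'K bK] qb by simp
    moreover have "0 \<le> (\<integral>z. (norm (?b z - b z))\<^sup>2 \<partial>dV)" by simp
    ultimately have "(\<integral>z. (norm (?b z - b z))\<^sup>2 \<partial>dV) = 0" by linarith
    then have "AE z in dV. (norm (?b z - b z))\<^sup>2 = 0"
      using idiff[OF b'K bK] by (subst (asm) integral_nonneg_eq_0_iff_AE) auto
    then have "AE z in dV. ?b z = b z" by eventually_elim simp
    then show ?thesis unfolding t by (rule toeplitz_cong_AE[OF bL' bL])
  qed
  then show ?thesis using bL bS by blast
qed

lemma conj_pi_linear: "linear (conj_pi A)"
  by (rule bounded_linear.linear[OF bounded_linear_conj_pi])

lemma qrad_ops_alt: "qrad_ops e ns = {S \<in> bounded_ops. \<forall>A\<in>block_unitaries e ns. conj_pi A S = S}"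
  by (simp add: qrad_ops_def conj_pi_def)

lemma block_unitaries_unitary: "A \<in> block_unitaries e ns \<Longrightarrow> unitary A"
  by (simp add: block_unitaries_def)

text \<open>These are the common fixed points in \<open>bounded_ops\<close> of the maps
  \<open>conj_pi A\<close>, which are continuous and compatible with all algebra operations.\<close>

lemma closed_subalgebra_qrad_ops: "closed_subalgebra (qrad_ops e ns :: ('n::finite bergman \<Rightarrow>\<^sub>L 'n bergman) set)"
  unfolding closed_subalgebra_def
proof (intro conjI ballI allI)
  let ?Q = "qrad_ops e ns :: ('n bergman \<Rightarrow>\<^sub>L 'n bergman) set"
  note l = bounded_linear.linear[OF bounded_linear_cscale]
  note lin = linear_add[OF l] linear_0[OF l]
  show "?Q \<subseteq> bounded_ops" by (auto simp: qrad_ops_alt)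
  have "closed {S. conj_pi A S = S}" for A :: "complex^'n^'n"
    by (intro closed_Collect_eq bounded_linear.continuous_on[OF bounded_linear_conj_pi] continuous_on_id)
  then have "closed (bounded_ops \<inter> (\<Inter>A\<in>block_unitaries e ns. {S :: 'n bergman \<Rightarrow>\<^sub>L 'n bergman. conj_pi A S = S}))"
    by (intro closed_Int closed_bounded_ops closed_INT ballI)
  also have "\<dots> = ?Q" by (auto simp: qrad_ops_alt)
  finally show "closed ?Q" .
  show "0 \<in> ?Q" by (simp add: qrad_ops_alt bounded_ops_def lin linear_0[OF conj_pi_linear])
  fix S assume S: "S \<in> ?Q"
  show "cscale_op c S \<in> ?Q" for c
  proof -
    have "cscale c (cscale d f) = cscale d (cscale c f)" for d and f :: "'n bergman"
      by transfer (simp add: mult.left_commute)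
    then show ?thesis using S
      by (auto simp: qrad_ops_alt bounded_ops_def cscale_op_apply conj_pi_cscale block_unitaries_unitary)
  qed
  fix T assume T: "T \<in> ?Q"
  show "S + T \<in> ?Q"
    using S T by (auto simp: qrad_ops_alt bounded_ops_def lin blinfun.add_left linear_add[OF conj_pi_linear])
  show "S o\<^sub>L T \<in> ?Q"
    using S T by (auto simp: qrad_ops_alt bounded_ops_def conj_pi_compose block_unitaries_unitary)
qed

text \<open>The first two conjuncts together express density, as inclusion of the set in the algebra
  and of the algebra in its closure. The equalities come from a cycle of inclusions: the algebra in
  the intersection, the intersection in the closure of the invariant Toeplitz operators, and this
  closure in the algebra.\<close>

theorem theorem5p2:
  fixes e :: "'n::finite \<Rightarrow> nat" and ns :: "nat list" and n k :: nat
  assumes "length ns = k" and "\<forall>m\<in>set ns. 0 < m" and "n = sum_list ns"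
    and "bij_betw e UNIV {..<n}"
  shows "qrad_toeplitz_ops e ns \<subseteq> qrad_toeplitz_algebra e ns
       \<and> qrad_toeplitz_algebra e ns \<subseteq> closure (qrad_toeplitz_ops e ns)
       \<and> qrad_toeplitz_algebra e ns = toeplitz_algebra \<inter> qrad_ops e ns
       \<and> toeplitz_algebra \<inter> qrad_ops e ns =
           closure {toeplitz a | a. a \<in> Linf \<and> toeplitz a \<in> qrad_ops e ns}"
proof -
  let ?T = "toeplitz_algebra \<inter> qrad_ops e ns"
  have inc: "qrad_toeplitz_ops e ns \<subseteq> qrad_toeplitz_algebra e ns"
    unfolding qrad_toeplitz_algebra_def by (rule hull_subset)
  have "closed_subalgebra ?T"
    using closed_subalgebra_closure_toeplitz closed_subalgebra_qrad_ops[of e ns]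
    unfolding toeplitz_algebra_eq_closure closed_subalgebra_def by (auto intro: closed_Int)
  moreover have "qrad_toeplitz_ops e ns \<subseteq> ?T"
    unfolding toeplitz_algebra_eq_closure qrad_toeplitz_ops_def by (auto intro: subsetD[OF closure_subset])
  ultimately have upper: "qrad_toeplitz_algebra e ns \<subseteq> ?T"
    unfolding qrad_toeplitz_algebra_def by (intro hull_minimal)
  have dense: "?T \<subseteq> closure (qrad_toeplitz_ops e ns)"
  proof
    fix S assume S: "S \<in> ?T"
    have "\<exists>R\<in>qrad_toeplitz_ops e ns. dist R S < \<epsilon>" if "0 < \<epsilon>" for \<epsilon>
    proof -
      have "\<exists>a\<in>Linf. dist (toeplitz a) S < \<epsilon>"
        using S that unfolding toeplitz_algebra_eq_closure by (auto simp: closure_approachable)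
      then obtain a where a: "a \<in> Linf" "dist (toeplitz a) S < \<epsilon>" by blast
      \<comment> \<open>Making the symbol invariant does not worsen the approximation, because
        \<open>S\<close> itself is invariant.\<close>
      have "\<exists>b\<in>Linf. norm (toeplitz b - S) \<le> norm (toeplitz a - S) \<and> (\<forall>A\<in>block_unitaries e ns. conj_pi A (toeplitz b) = toeplitz b)"
        using S by (intro invariant_symbol[OF a(1)]) (auto simp: block_unitaries_unitary qrad_ops_alt)
      then obtain b where b: "b \<in> Linf" "norm (toeplitz b - S) \<le> norm (toeplitz a - S)"
        and "\<forall>A\<in>block_unitaries e ns. conj_pi A (toeplitz b) = toeplitz b" by blast
      then have "toeplitz b \<in> qrad_toeplitz_ops e ns"
        by (auto simp: qrad_toeplitz_ops_def qrad_ops_alt toeplitz_bounded_op)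
      moreover have "dist (toeplitz b) S < \<epsilon>" using b(2) a(2) by (simp add: dist_norm)
      ultimately show ?thesis by blast
    qed
    then show "S \<in> closure (qrad_toeplitz_ops e ns)" by (simp add: closure_approachable)
  qed
  have "closed (qrad_toeplitz_algebra e ns)"
    unfolding qrad_toeplitz_algebra_def hull_def by (auto simp: closed_subalgebra_def intro: closed_Inter)
  then have lower: "closure (qrad_toeplitz_ops e ns) \<subseteq> qrad_toeplitz_algebra e ns"
    by (rule closure_minimal[OF inc])
  show ?thesis using inc upper dense lower unfolding qrad_toeplitz_ops_def by blast
qed

end
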